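(* Let $\Omega\subset\mathbb R^2$ be a bounded polytope (polygon) with a conforming triangulation $\mathcal T_h$ into triangles. With the finite element spaces $W_h$ (Bell element), $\boldsymbol\Sigma_h$ and $\boldsymbol V_h$ defined in the context, the finite element elasticity complex $$\mathbb P_1(\Omega)\xrightarrow{\subset}W_h\xrightarrow{\operatorname{airy}}\boldsymbol\Sigma_h\xrightarrow{\operatorname{div}}\boldsymbol V_h\to0$$ is exact; that is, $\{v\in W_h:\operatorname{airy}v=0\}=\mathbb P_1(\Omega)$, $\operatorname{airy}W_h=\{\boldsymbol\tau\in\boldsymbol\Sigma_h:\operatorname{div}\boldsymbol\tau=0\}$, and $\operatorname{div}\boldsymbol\Sigma_h=\boldsymbol V_h$.
   Context: $\mathbb S$: symmetric $2\times2$ matrices. $\mathbb P_k(D;\mathbb X)$: $\mathbb X$-valued polynomials of total degree at most $k$ on $D$. $\operatorname{div}$ of a matrix field is row-wise. For a scalar $v$, $$\operatorname{airy}v=\begin{pmatrix}\partial_{22}v&-\partial_{12}v\\-\partial_{12}v&\partial_{11}v\end{pmatrix}.$$ Each edge $e$ of $\mathcal T_h$ has a fixed unit normal $\boldsymbol n$ and unit tangent $\boldsymbol t$; $\partial_n$ is the normal derivative. $(\cdot,\cdot)_D$ is the $L^2(D)$ inner product. For a triangle $K$: $\mathbb P_5^-(K):=\{q\in\mathbb P_5(K):\partial_nq|_e\in\mathbb P_3(e)\text{ for every edge }e\text{ of }K\}$ (the Bell element shape functions), and $\boldsymbol\Sigma(K):=\{\boldsymbol\tau\in\mathbb P_3(K;\mathbb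 S):\operatorname{div}\boldsymbol\tau\in\mathbb P_1(K;\mathbb R^2),\ (\boldsymbol t^{\intercal}\boldsymbol\tau\boldsymbol n)|_e\in\mathbb P_2(e)\text{ for every edge }e\text{ of }K\}$. Global spaces: - $W_h:=\{v_h\in H^2(\Omega):v_h|_K\in\mathbb P_5^-(K)\ \forall K\in\mathcal T_h\}$, the Bell element space; the degrees of freedom of the Bell element are $v(\mathtt v),\nabla v(\mathtt v),\nabla^2v(\mathtt v)$ at the vertices $\mathtt v$ of $K$. - $\boldsymbol\Sigma_h$: all $\boldsymbol\tau_h\in L^2(\Omega;\mathbb S)$ with $\boldsymbol\tau_h|_K\in\boldsymbol\Sigma(K)$ for all $K\in\mathcal T_h$ such that the following degrees of freedom are single-valued (values computed from all triangles sharing the vertex or edge agree): $\boldsymbol\tau(\mathtt v)$ at each vertex; $(\boldsymbol n^{\intercal}\boldsymbol\tau\boldsymbol n,q)_e$, $q\in\mathbb P_1(e)$, on each edge; $(\boldsymbol t^{\intercal}\boldsymbol\tau\boldsymbol n,q)_e$, $q\in\mathbb P_0(e)$, on each edge. (The remaining degrees of freedom $(\boldsymbol\tau,\boldsymbol q)_K$, $\boldsymbol q\in\mathbb P_0(K;\mathbb S)$, are interior to $K$.) - $\boldsymbol V_h:=\{\boldsymbol q_h\in L^2(\Omega;\mathbb R^2):\boldsymbol q_h|_K\in\mathbb P_1(K;\mathbb R^2)\ \forall K\in\mathcal T_h\}$.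
   Formalization: W_h also requires the vertex degrees of freedom v, ∇v, ∇²v to be single-valued, since with H² alone airy W_h is not contained in Σ_h; polygon means the interior of a simple closed polygonal curve, since exactness fails with holes. *)

theory Defs
  imports "HOL-Analysis.Analysis"
begin

section \<open>Polynomials and classical derivatives\<close>

text \<open>Polynomials on \<open>D\<close> of total degree at most \<open>k\<close>, with values in any real vector space. Members
  are unconstrained off \<open>D\<close>; \<open>polys k UNIV\<close> consists of the polynomial functions themselves. For a
  segment \<open>e\<close>, \<open>polys k e\<close> is the space of univariate polynomials of degree at most \<open>k\<close> on \<open>e\<close>.\<close>

definition polys :: "nat \<Rightarrow> (real^2) set \<Rightarrow> (real^2 \<Rightarrow> 'x::real_vector) set" where
  "polys k D = {f. \<exists>c :: nat \<Rightarrow> nat \<Rightarrow> 'x. \<forall>x\<in>D.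
     f x = (\<Sum>i\<le>k. \<Sum>j\<le>k - i. ((x $ 1) ^ i * (x $ 2) ^ j) *\<^sub>R c i j)}"

definition partial :: "2 \<Rightarrow> (real^2 \<Rightarrow> real) \<Rightarrow> real^2 \<Rightarrow> real" where
  "partial i f x = frechet_derivative f (at x) (axis i 1)"

definition dir_deriv :: "real^2 \<Rightarrow> (real^2 \<Rightarrow> real) \<Rightarrow> real^2 \<Rightarrow> real" where
  "dir_deriv n f x = frechet_derivative f (at x) n"

text \<open>\<open>partials [i\<^sub>1, \<dots>, i\<^sub>m] f\<close> is \<open>\<partial>\<^sub>i\<^sub>1 \<dots> \<partial>\<^sub>i\<^sub>m f\<close>.\<close>

definition partials :: "2 list \<Rightarrow> (real^2 \<Rightarrow> real) \<Rightarrow> real^2 \<Rightarrow> real" where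
  "partials is f = foldr partial is f"

definition classical_div :: "(real^2 \<Rightarrow> real^2^2) \<Rightarrow> real^2 \<Rightarrow> real^2" where
  "classical_div \<tau> x = (\<chi> i. \<Sum>j\<in>UNIV. partial j (\<lambda>y. \<tau> y $ i $ j) x)"

definition sym_mats :: "(real^2^2) set" where
  "sym_mats = {A. transpose A = A}"


section \<open>\<open>L\<^sup>2\<close>, weak derivatives, \<open>H\<^sup>k\<close>\<close>

text \<open>An element of \<open>L\<^sup>2(\<Omega>)\<close> is represented by any of its representatives. All function spaces below
  are closed under changes on null subsets of \<open>\<Omega>\<close> (and off \<open>\<Omega>\<close>), and the weak operators are relations
  with the same invariance. Equalities of such sets are therefore equalities of the corresponding
  sets of equivalence classes.\<close>

definition L2 :: "(real^2) set \<Rightarrow> (real^2 \<Rightarrow> 'x::euclidean_space) set" where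
  "L2 \<Omega> = {f. f \<in> borel_measurable (lebesgue_on \<Omega>) \<and>
              integrable (lebesgue_on \<Omega>) (\<lambda>x. (norm (f x))\<^sup>2)}"

text \<open>\<open>C\<^sup>\<infinity>\<close> functions: all iterated partial derivatives are (Frechet) differentiable everywhere.\<close>

definition smooth :: "(real^2 \<Rightarrow> real) \<Rightarrow> bool" where
  "smooth f \<longleftrightarrow> (\<forall>is. partials is f differentiable_on UNIV)"

definition test_functions :: "(real^2) set \<Rightarrow> (real^2 \<Rightarrow> real) set" where
  "test_functions \<Omega> = {\<phi>. smooth \<phi> \<and> compact (closure {x. \<phi> x \<noteq> 0}) \<and> closure {x. \<phi> x \<noteq> 0} \<subseteq> \<Omega>}"

definition has_weak_deriv ::
  "(real^2) set \<Rightarrow> 2 list \<Rightarrow> (real^2 \<Rightarrow> real) \<Rightarrow> (real^2 \<Rightarrow> real) \<Rightarrow> bool" where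
  "has_weak_deriv \<Omega> is v w \<longleftrightarrow> (\<forall>\<phi>\<in>test_functions \<Omega>.
     integral\<^sup>L (lebesgue_on \<Omega>) (\<lambda>x. v x * partials is \<phi> x) =
     (- 1) ^ length is * integral\<^sup>L (lebesgue_on \<Omega>) (\<lambda>x. w x * \<phi> x))"

definition sobolev_H :: "nat \<Rightarrow> (real^2) set \<Rightarrow> (real^2 \<Rightarrow> real) set" where
  "sobolev_H k \<Omega> = {v \<in> L2 \<Omega>. \<forall>is. length is \<le> k \<longrightarrow> (\<exists>w\<in>L2 \<Omega>. has_weak_deriv \<Omega> is v w)}"

definition airy_rel :: "(real^2) set \<Rightarrow> ((real^2 \<Rightarrow> real) \<times> (real^2 \<Rightarrow> real^2^2)) set" where
  "airy_rel \<Omega> = {(v, \<tau>). v \<in> L2 \<Omega> \<and> \<tau> \<in> L2 \<Omega> \<and>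
     has_weak_deriv \<Omega> [2, 2] v (\<lambda>x. \<tau> x $ 1 $ 1) \<and>
     has_weak_deriv \<Omega> [1, 2] v (\<lambda>x. - (\<tau> x $ 1 $ 2)) \<and>
     has_weak_deriv \<Omega> [1, 2] v (\<lambda>x. - (\<tau> x $ 2 $ 1)) \<and>
     has_weak_deriv \<Omega> [1, 1] v (\<lambda>x. \<tau> x $ 2 $ 2)}"

definition div_rel :: "(real^2) set \<Rightarrow> ((real^2 \<Rightarrow> real^2^2) \<times> (real^2 \<Rightarrow> real^2)) set" where
  "div_rel \<Omega> = {(\<tau>, q). \<tau> \<in> L2 \<Omega> \<and> q \<in> L2 \<Omega> \<and>
     (\<forall>i. \<forall>\<phi>\<in>test_functions \<Omega>.
        integral\<^sup>L (lebesgue_on \<Omega>) (\<lambda>x. \<Sum>j\<in>UNIV. \<tau> x $ i $ j * partial j \<phi> x) =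
        - integral\<^sup>L (lebesgue_on \<Omega>) (\<lambda>x. q x $ i * \<phi> x))}"

definition ae_polys :: "nat \<Rightarrow> (real^2) set \<Rightarrow> (real^2 \<Rightarrow> 'x::real_vector) set" where
  "ae_polys k D = {f. \<exists>p\<in>polys k D. AE x in lebesgue_on D. f x = p x}"


section \<open>Polygons and triangulations\<close>

text \<open>A polygon is the region enclosed by a simple closed curve consisting of finitely many segments.
  (Holes and boundary self-contacts are excluded: the complex is not exact in their presence.)\<close>

definition polygon :: "(real^2) set \<Rightarrow> bool" where
  "polygon \<Omega> \<longleftrightarrow> (\<exists>p S. simple_path p \<and> pathfinish p = pathstart p \<and>
     finite S \<and> path_image p = (\<Union>(a, b)\<in>S. closed_segment a b) \<and>
     \<Omega> = inside (path_image p))"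

text \<open>\<open>triangulation\<close> contains conformity: two members meet in a (possibly empty) common face.\<close>

definition conforming_triangulation :: "(real^2) set \<Rightarrow> (real^2) set set \<Rightarrow> bool" where
  "conforming_triangulation \<Omega> \<T> \<longleftrightarrow>
     triangulation \<T> \<and> (\<forall>K\<in>\<T>. 2 simplex K) \<and> \<Union>\<T> = closure \<Omega>"

text \<open>\<open>n e\<close> and \<open>t e\<close> are a unit normal and a unit tangent of the edge \<open>e\<close>; the signs are arbitrary.\<close>

definition edge_frames ::
  "(real^2) set set \<Rightarrow> ((real^2) set \<Rightarrow> real^2) \<Rightarrow> ((real^2) set \<Rightarrow> real^2) \<Rightarrow> bool" where
  "edge_frames \<T> n t \<longleftrightarrow> (\<forall>K\<in>\<T>. \<forall>e. e edge_of K \<longrightarrow>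
     norm (n e) = 1 \<and> norm (t e) = 1 \<and> n e \<bullet> t e = 0 \<and> (\<forall>x\<in>e. \<forall>y\<in>e. n e \<bullet> (x - y) = 0))"

text \<open>The \<open>L\<^sup>2\<close> inner product \<open>(f, g)\<^sub>e\<close> with respect to arc length on the segment \<open>e = [a, b]\<close>.\<close>

definition seg_inner ::
  "real^2 \<Rightarrow> real^2 \<Rightarrow> (real^2 \<Rightarrow> real) \<Rightarrow> (real^2 \<Rightarrow> real) \<Rightarrow> real" where
  "seg_inner a b f g = dist a b * integral {0..1} (\<lambda>s. f (linepath a b s) * g (linepath a b s))"


section \<open>Shape functions\<close>

text \<open>As a triangle has nonempty interior, a polynomial on \<open>K\<close> is identified with its unique polynomial
  extension to the plane; likewise symmetry of the values on \<open>K\<close> and on the plane are the same.\<close>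

definition bell_shape ::
  "((real^2) set \<Rightarrow> real^2) \<Rightarrow> (real^2) set \<Rightarrow> (real^2 \<Rightarrow> real) set" where
  "bell_shape n K = {q \<in> polys 5 UNIV. \<forall>e. e edge_of K \<longrightarrow> dir_deriv (n e) q \<in> polys 3 e}"

definition sigma_shape ::
  "((real^2) set \<Rightarrow> real^2) \<Rightarrow> ((real^2) set \<Rightarrow> real^2) \<Rightarrow> (real^2) set \<Rightarrow> (real^2 \<Rightarrow> real^2^2) set" where
  "sigma_shape n t K = {\<tau> \<in> polys 3 UNIV. range \<tau> \<subseteq> sym_mats \<and> classical_div \<tau> \<in> polys 1 K \<and>
     (\<forall>e. e edge_of K \<longrightarrow> (\<lambda>x. t e \<bullet> (\<tau> x *v n e)) \<in> polys 2 e)}"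


section \<open>Global finite element spaces\<close>

text \<open>The Bell element space: the vertex degrees of freedom \<open>v\<close>, \<open>\<nabla>v\<close>, \<open>\<nabla>\<^sup>2v\<close> are single-valued. For the
  second derivatives this does not follow from membership in \<open>H\<^sup>2(\<Omega>)\<close>.\<close>

definition bell_space :: "(real^2) set \<Rightarrow> (real^2) set set \<Rightarrow> ((real^2) set \<Rightarrow> real^2) \<Rightarrow>
    (real^2 \<Rightarrow> real) set" where
  "bell_space \<Omega> \<T> n = {v \<in> sobolev_H 2 \<Omega>. \<exists>p.
     (\<forall>K\<in>\<T>. p K \<in> bell_shape n K \<and> (AE x in lebesgue_on K. v x = p K x)) \<and>
     (\<forall>K\<in>\<T>. \<forall>K'\<in>\<T>. \<forall>z. z extreme_point_of K \<and> z extreme_point_of K' \<longrightarrow>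
        (\<forall>is. length is \<le> 2 \<longrightarrow> partials is (p K) z = partials is (p K') z))}"

definition sigma_space :: "(real^2) set \<Rightarrow> (real^2) set set \<Rightarrow> ((real^2) set \<Rightarrow> real^2) \<Rightarrow>
    ((real^2) set \<Rightarrow> real^2) \<Rightarrow> (real^2 \<Rightarrow> real^2^2) set" where
  "sigma_space \<Omega> \<T> n t = {\<tau> \<in> L2 \<Omega>. (AE x in lebesgue_on \<Omega>. \<tau> x \<in> sym_mats) \<and> (\<exists>\<rho>.
     (\<forall>K\<in>\<T>. \<rho> K \<in> sigma_shape n t K \<and> (AE x in lebesgue_on K. \<tau> x = \<rho> K x)) \<and>
     (\<forall>K\<in>\<T>. \<forall>K'\<in>\<T>. \<forall>z. z extreme_point_of K \<and> z extreme_point_of K' \<longrightarrow> \<rho> K z = \<rho> K' z) \<and>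
     (\<forall>K\<in>\<T>. \<forall>K'\<in>\<T>. \<forall>e a b. e edge_of K \<and> e edge_of K' \<and> e = closed_segment a b \<longrightarrow>
        (\<forall>q\<in>polys 1 e. seg_inner a b (\<lambda>x. n e \<bullet> (\<rho> K x *v n e)) q =
                        seg_inner a b (\<lambda>x. n e \<bullet> (\<rho> K' x *v n e)) q) \<and>
        (\<forall>q\<in>polys 0 e. seg_inner a b (\<lambda>x. t e \<bullet> (\<rho> K x *v n e)) q =
                        seg_inner a b (\<lambda>x. t e \<bullet> (\<rho> K' x *v n e)) q)))}"

definition V_space :: "(real^2) set \<Rightarrow> (real^2) set set \<Rightarrow> (real^2 \<Rightarrow> real^2) set" where
  "V_space \<Omega> \<T> = {q \<in> L2 \<Omega>. \<forall>K\<in>\<T>. q \<in> ae_polys 1 K}"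

end

theory Submission
  imports Defs "HOL-Complex_Analysis.Riemann_Mapping" "HOL-Computational_Algebra.Polynomial"
begin

text \<open>Single-valued degrees of freedom force the normal components of a piecewise polynomial tensor field to
  match across the edges. Such a field is the sum of a continuous one and of bubbles in the tangential
  directions of the edges, and for both kinds of summands translation invariance of the integral identifies
  the weak divergence with the piecewise one. Hermite interpolation on the edges shows that Bell functions
  are continuously differentiable, and airy maps the Bell shape functions exactly onto the divergence-free
  shape functions.

  Surjectivity of the divergence: on one triangle, bubbles and edge functions with prescribed fluxes
  through a single edge reach every linear vector field; for an interior triangle one transports the flux
  along a chain of adjacent triangles to an edge that is not shared.

  Exactness at the tensor fields: the polynomial Poincare lemma gives potentials on the triangles, unique
  up to affine functions, and their mismatches form a cocycle on the cover of the closed polygon by the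
  triangles. The closed polygon is a connected Euclidean neighbourhood retract with connected complement,
  hence contractible, so the cocycle is a coboundary and the potentials can be corrected to match.\<close>

section \<open>Contractibility of a closed polygon\<close>

text \<open>What shapes the argument is that members of the tensor space are discontinuous: across
  an edge only \<open>\<tau> *v n\<close> matches, while the tangential-tangential entry may jump
  away from the endpoints. A bubble \<open>f *\<^sub>R outer d d\<close> in the edge direction
  \<open>d\<close> absorbs the jump: its divergence is the derivative of \<open>f\<close> along
  \<open>d\<close>, times \<open>d\<close>, so only difference quotients along \<open>d\<close>
  enter, and \<open>f\<close> vanishes at both ends of every chord parallel to \<open>d\<close>. On
  a single triangle a field with vanishing normal components has a divergence orthogonal to the
  three rigid motions. This codimension 3 is why flux must leave through some edge and why an
  unshared edge has to be within reach of every triangle. The mismatches of the potentials are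
  affine functions. They become a function of pairs of points by choosing one triangle through each
  point; a contraction of the closed polygon then integrates it along discretised tracks, whatever
  the pattern of overlaps.\<close>

lemma compact_connected_superset:
  fixes U :: "'a::euclidean_space set"
  assumes "open U" "connected U" "compact Q" "Q \<subseteq> U"
  obtains L where "compact L" "connected L" "Q \<subseteq> L" "L \<subseteq> U"
proof (cases "Q = {}")
  case True
  then show ?thesis using that[of "{}"] by auto
next
  case False
  then obtain p where p: "p \<in> Q" by auto
  have "\<exists>r>0. cball x r \<subseteq> U" if "x \<in> Q" for x
    using that assms open_contains_cball by blast
  then obtain r where r: "\<And>x. x \<in> Q \<Longrightarrow> r x > 0 \<and> cball x (r x) \<subseteq> U" by metis
  have "Q \<subseteq> (\<Union>x\<in>Q. ball x (r x))" using r by force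
  then obtain F where F: "F \<subseteq> Q" "finite F" "Q \<subseteq> (\<Union>x\<in>F. ball x (r x))"
    using compactE_image[OF assms(3), of Q "\<lambda>x. ball x (r x)"] by blast
  have "path_connected U" using assms connected_open_path_connected by blast
  then have "\<exists>g. path g \<and> path_image g \<subseteq> U \<and> pathstart g = p \<and> pathfinish g = x" if "x \<in> Q" for x
    using that p assms(4) unfolding path_connected_def by blast
  then obtain g where g: "\<And>x. x \<in> Q \<Longrightarrow> path (g x) \<and> path_image (g x) \<subseteq> U \<and> pathstart (g x) = p \<and> pathfinish (g x) = x"
    by metis
  \<comment> \<open>A path from the base point to \<open>x\<close> together with a ball at
    \<open>x\<close>: all such pieces share \<open>p\<close>, so finitely many of them have a
    connected compact union.\<close>
  define C where "C x = path_image (g x) \<union> cball x (r x)" for x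
  have C1: "compact (C x) \<and> connected (C x) \<and> p \<in> C x \<and> C x \<subseteq> U \<and> ball x (r x) \<subseteq> C x" if "x \<in> Q" for x
  proof -
    have "x \<in> path_image (g x) \<inter> cball x (r x)"
      using g[OF that] r[OF that] pathfinish_in_path_image[of "g x"] by auto
    then have "connected (C x)" unfolding C_def
      using connected_Un[of "path_image (g x)" "cball x (r x)"] connected_path_image g[OF that] by blast
    then show ?thesis unfolding C_def
      using g[OF that] r[OF that] pathstart_in_path_image[of "g x"] compact_path_image
      by (auto intro!: compact_Un)
  qed
  show ?thesis
  proof (rule that[of "\<Union>x\<in>F. C x"])
    show "compact (\<Union>x\<in>F. C x)" using F C1 by (intro compact_UN) auto
    show "connected (\<Union>x\<in>F. C x)"
    proof (rule connected_Union)
      show "connected s" if "s \<in> C ` F" for s using that C1 F by blast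
      have "p \<in> \<Inter> (C ` F)" using C1 F by blast
      then show "\<Inter> (C ` F) \<noteq> {}" by blast
    qed
    show "Q \<subseteq> (\<Union>x\<in>F. C x)" using F C1 by blast
    show "(\<Union>x\<in>F. C x) \<subseteq> U" using F C1 by blast
  qed
qed

text \<open>A retract inherits contractibility, so it suffices to place an open simply connected set
  between \<open>S\<close> and the neighbourhood \<open>U\<close> that retracts onto it. In the
  plane a connected open set is simply connected once its complement is connected and unbounded;
  such a set arises as a component of the complement of a connected closed set \<open>M\<close> that
  swallows everything outside \<open>U\<close>.\<close>

lemma contractible_ENR_complex:
  fixes S :: "complex set"
  assumes "compact S" "connected S" "S \<noteq> {}" "connected (- S)" "ENR S"
  shows "contractible S"
proof -
  obtain U where U: "open U" "S retract_of U" using \<open>ENR S\<close> unfolding ENR_def by blast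
  have SU: "S \<subseteq> U" using U(2) retract_of_imp_subset by blast
  obtain R where R: "R > 0" "S \<subseteq> ball 0 R"
    using assms(1) compact_imp_bounded bounded_subset_ballD by blast
  \<comment> \<open>\<open>Q\<close> is what the simply connected set has to avoid inside the disc.
    The circle is included so that a connected set \<open>L\<close> containing \<open>Q\<close>
    meets the exterior of the disc and can be joined with it.\<close>
  define Q where "Q = (cball 0 R - U) \<union> sphere 0 R"
  have "compact Q" unfolding Q_def using U(1) by (intro compact_Un) (auto simp: compact_diff)
  moreover have "Q \<subseteq> - S" unfolding Q_def using SU R(2) by (auto simp: dist_norm)
  moreover have "open (- S)" using assms(1) compact_imp_closed by blast
  ultimately obtain L where L: "compact L" "connected L" "Q \<subseteq> L" "L \<subseteq> - S"
    using compact_connected_superset[of "- S" Q] assms(4) by blast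
  define M where "M = L \<union> (- ball 0 R)"
  have cb: "connected (- ball (0::complex) R)"
    by (rule connected_complement_bounded_convex) auto
  have "complex_of_real R \<in> L \<inter> (- ball 0 R)" using L(3) R(1) unfolding Q_def by auto
  then have cM: "connected M" unfolding M_def using connected_Un[OF L(2) cb] by blast
  have clM: "closed M" unfolding M_def using L(1) by (intro closed_Un) (auto simp: compact_imp_closed)
  have SM: "S \<subseteq> - M" unfolding M_def using L R by auto
  obtain s where s: "s \<in> S" using assms(3) by auto
  \<comment> \<open>The complement of a component of \<open>- M\<close> is connected because
    \<open>M\<close> is.\<close>
  define V where "V = connected_component_set (- M) s"
  have V1: "V \<in> components (- M)" unfolding V_def using SM s by (auto simp: components_def)
  have oV: "open V" unfolding V_def using clM by (simp add: open_Compl open_connected_component)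
  have cV: "connected V" unfolding V_def by simp
  have cnV: "connected (- V)" using component_complement_connected[OF cM V1] .
  have VM: "V \<subseteq> - M" using V1 in_components_subset by blast
  have ub: "\<not> bounded (- V)"
  proof
    assume "bounded (- V)"
    moreover have "- ball 0 R \<subseteq> - V" using VM unfolding M_def by auto
    ultimately have "bounded (- ball (0::complex) R)" using bounded_subset by blast
    then show False by (meson bounded_ball cobounded_imp_unbounded)
  qed
  then have ne: "- V \<noteq> {}" by auto
  have "components (- V) = {- V}"
    using cnV ne by (simp add: components_eq_sing_iff)
  then have "simply_connected V"
    using simply_connected_eq_unbounded_complement_components[OF oV] cV ub by simp
  then have conV: "contractible V" using contractible_eq_simply_connected_2d[OF oV] by blast
  have "V \<subseteq> U"
  proof
    fix x assume "x \<in> V"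
    then have "x \<notin> M" using VM by auto
    then have "x \<notin> L" "norm x < R" unfolding M_def by auto
    then have "x \<notin> Q" "x \<in> cball 0 R" using L(3) by auto
    then show "x \<in> U" unfolding Q_def by blast
  qed
  moreover have "S \<subseteq> V" unfolding V_def
    by (rule connected_component_maximal[OF s assms(2) SM])
  ultimately have "S retract_of V" using U(2) retract_of_subset by blast
  then show ?thesis using conV retract_of_contractible by blast
qed

lemma ENR_finite_Union_convex_compact:
  fixes \<T> :: "'a::euclidean_space set set"
  assumes "finite \<T>" "\<And>K. K \<in> \<T> \<Longrightarrow> convex K" "\<And>K. K \<in> \<T> \<Longrightarrow> compact K"
  shows "ENR (\<Union>\<T>)"
proof -
  have "ANR (\<Union>\<T>)" using assms by (intro ANR_finite_Union_convex_closed) (auto intro: compact_imp_closed)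
  moreover have "closed (\<Union>\<T>)" using assms by (auto intro: compact_imp_closed)
  ultimately show ?thesis using ENR_ANR closed_imp_locally_compact by blast
qed

section \<open>Transport of planar topology between vectors and complex numbers\<close>

definition to_complex :: "real^2 \<Rightarrow> complex" where "to_complex v = Complex (v $ 1) (v $ 2)"
definition of_complex :: "complex \<Rightarrow> real^2" where "of_complex z = vector [Re z, Im z]"

lemma to_of_complex [simp]: "to_complex (of_complex z) = z" "of_complex (to_complex v) = v"
  by (auto simp: to_complex_def of_complex_def vec_eq_iff forall_2)

lemma bounded_linear_to_complex: "bounded_linear to_complex"
  by (rule bounded_linear_intro[where K=2])
     (auto simp: to_complex_def complex_eq_iff norm_le_componentwise_cart cmod_def norm_vec_def L2_set_def sum_2)

lemma bounded_linear_of_complex: "bounded_linear of_complex"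
  by (rule bounded_linear_intro[where K=2])
     (auto simp: of_complex_def vec_eq_iff forall_2 cmod_def norm_vec_def L2_set_def sum_2)

lemma connected_of_complex: "connected A \<Longrightarrow> connected (of_complex ` A)"
  by (intro connected_continuous_image linear_continuous_on bounded_linear_of_complex)

lemma homeomorphism_complex: "homeomorphism S (to_complex ` S) to_complex of_complex"
  unfolding homeomorphism_def
  by (auto simp: image_image linear_continuous_on bounded_linear_to_complex bounded_linear_of_complex)

lemma connected_component_set_complex:
  "to_complex ` connected_component_set T x = connected_component_set (to_complex ` T) (to_complex x)"
proof (cases "x \<in> T")
  case False
  then have "to_complex x \<notin> to_complex ` T" by (metis imageE to_of_complex(2))
  then show ?thesis using False by (metis connected_component_eq_empty image_empty)
next
  case True
  have c1: "connected (to_complex ` connected_component_set T x)"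
    by (intro connected_continuous_image linear_continuous_on bounded_linear_to_complex connected_connected_component)
  have c2: "connected (of_complex ` connected_component_set (to_complex ` T) (to_complex x))"
    by (intro connected_continuous_image linear_continuous_on bounded_linear_of_complex connected_connected_component)
  have s2: "of_complex ` connected_component_set (to_complex ` T) (to_complex x) \<subseteq> connected_component_set T x"
  proof (rule connected_component_maximal[OF _ c2])
    show "x \<in> of_complex ` connected_component_set (to_complex ` T) (to_complex x)"
      by (rule image_eqI[where x="to_complex x"]) (use True in \<open>auto intro: connected_component_refl\<close>)
    show "of_complex ` connected_component_set (to_complex ` T) (to_complex x) \<subseteq> T"
      using connected_component_subset[of "to_complex ` T" "to_complex x"] by force
  qed
  have "to_complex ` connected_component_set T x \<subseteq> connected_component_set (to_complex ` T) (to_complex x)"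
    using True connected_component_subset[of T x]
    by (intro connected_component_maximal[OF _ c1]) auto
  moreover have "connected_component_set (to_complex ` T) (to_complex x) \<subseteq> to_complex ` connected_component_set T x"
  proof
    fix z assume "z \<in> connected_component_set (to_complex ` T) (to_complex x)"
    then have "of_complex z \<in> connected_component_set T x" using s2 by blast
    then show "z \<in> to_complex ` connected_component_set T x" by (metis imageI to_of_complex(1))
  qed
  ultimately show ?thesis by blast
qed

lemma bounded_to_complex: "bounded (to_complex ` S) \<longleftrightarrow> bounded S"
proof
  assume "bounded (to_complex ` S)"
  then have "bounded (of_complex ` to_complex ` S)"
    using bounded_linear_image bounded_linear_of_complex by blast
  then show "bounded S" by (simp add: image_image)
qed (use bounded_linear_image bounded_linear_to_complex in blast)

lemma bij_to_complex: "bij to_complex"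
  by (rule bijI', metis to_of_complex(2), metis to_of_complex(1))

lemma compl_to_complex: "to_complex ` (- S) = - to_complex ` S"
  using bij_to_complex by (rule bij_image_Compl_eq)

lemma inside_complex: "inside (to_complex ` S) = to_complex ` inside S"
proof -
  have "to_complex x \<in> inside (to_complex ` S) \<longleftrightarrow> x \<in> inside S" for x
    unfolding inside_def
    using connected_component_set_complex[of "-S" x] bounded_to_complex[of "connected_component_set (-S) x"]
      bij_to_complex by (auto simp: compl_to_complex bij_def inj_image_mem_iff)
  then show ?thesis
    using bij_is_surj[OF bij_to_complex] by (auto simp: image_iff) (metis surjD)
qed

lemma closure_to_complex: "closure (to_complex ` S) = to_complex ` closure S"
proof
  have "closed (to_complex ` closure S)"
  proof -
    have "to_complex ` closure S = of_complex -` closure S"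
      by (auto simp: image_iff) (metis to_of_complex)
    then show ?thesis
      using continuous_closed_vimage[of "closure S" of_complex]
        linear_continuous_at[OF bounded_linear_of_complex] by simp
  qed
  then show "closure (to_complex ` S) \<subseteq> to_complex ` closure S"
    by (intro closure_minimal image_mono closure_subset)
  show "to_complex ` closure S \<subseteq> closure (to_complex ` S)"
    by (rule closure_bounded_linear_image_subset[OF bounded_linear_to_complex])
qed

section \<open>Topology of polygons and their closures\<close>

context
  fixes \<Omega> :: "(real^2) set"
  assumes poly: "polygon \<Omega>"
begin

lemma polygon_complex:
  obtains c where "simple_path c" "pathfinish c = pathstart c" "to_complex ` \<Omega> = inside (path_image c)"
proof -
  obtain p where p: "simple_path p" "pathfinish p = pathstart p" "\<Omega> = inside (path_image p)"
    using poly unfolding polygon_def by blast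
  have "simple_path (to_complex \<circ> p)"
    using p(1) bij_to_complex bounded_linear_to_complex
    by (intro simple_path_continuous_image) (auto intro: linear_continuous_on simp: bij_def inj_on_def)
  moreover have "path_image (to_complex \<circ> p) = to_complex ` path_image p" by (simp add: path_image_def image_comp)
  ultimately show ?thesis
    using that[of "to_complex \<circ> p"] p by (simp add: pathfinish_def pathstart_def inside_complex)
qed

text \<open>The boundary of the region lies on the curve, and finitely many segments have measure
  zero. A general Jordan curve may have positive area, so the polygonal shape matters here.\<close>

lemma polygon_frontier_null: "negligible (closure \<Omega> - \<Omega>)"
proof -
  obtain p S where p: "simple_path p" "pathfinish p = pathstart p" "\<Omega> = inside (path_image p)"
    "finite S" "path_image p = (\<Union>(a, b)\<in>S. closed_segment a b)"
    using poly unfolding polygon_def by blast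
  have "closure \<Omega> - \<Omega> \<subseteq> frontier \<Omega>"
    unfolding frontier_def using interior_subset by blast
  also have "\<dots> \<subseteq> path_image p" using p(1,3) frontier_inside_subset closed_simple_path_image by blast
  finally have "closure \<Omega> - \<Omega> \<subseteq> path_image p" .
  moreover have "negligible (path_image p)"
    unfolding p(5) using p(4)
    by (intro negligible_Union) (auto intro!: negligible_convex_interior[THEN iffD2] simp: interior_closed_segment_ge2)
  ultimately show ?thesis using negligible_subset by blast
qed

lemma polygon_facts:
  shows "open \<Omega>" "bounded \<Omega>" "connected \<Omega>" "\<Omega> \<noteq> {}" "connected (- closure \<Omega>)"
proof -
  obtain p where p: "simple_path p" "pathfinish p = pathstart p" "\<Omega> = inside (path_image p)"
    using poly unfolding polygon_def by blast
  obtain c where c: "simple_path c" "pathfinish c = pathstart c" "to_complex ` \<Omega> = inside (path_image c)"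
    by (rule polygon_complex)
  note J = Jordan_inside_outside[OF c(1,2), folded c(3)]
  have O: "\<Omega> = of_complex ` to_complex ` \<Omega>" by (simp add: image_image)
  show "open \<Omega>" using p closed_simple_path_image open_inside by blast
  show "bounded \<Omega>" using J bounded_to_complex by blast
  have "connected (to_complex ` \<Omega>)" using J by blast
  then have "connected (of_complex ` to_complex ` \<Omega>)"
    by (rule connected_of_complex)
  then show "connected \<Omega>" using O by simp
  show "\<Omega> \<noteq> {}" using J by blast
  \<comment> \<open>By the Jordan curve theorem the frontier of the inside is the whole curve, so
    adding it leaves exactly the outside as complement.\<close>
  have "closure (to_complex ` \<Omega>) = to_complex ` \<Omega> \<union> path_image c"
    using closure_Un_frontier[of "to_complex ` \<Omega>"] J by simp
  then have "- closure (to_complex ` \<Omega>) = outside (path_image c)"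
    using outside_inside[of "path_image c"] c(3) by auto
  then have "to_complex ` (- closure \<Omega>) = outside (path_image c)" by (simp add: closure_to_complex compl_to_complex)
  then have "connected (to_complex ` (- closure \<Omega>))" using J by simp
  then have "connected (of_complex ` to_complex ` (- closure \<Omega>))"
    by (rule connected_of_complex)
  then show "connected (- closure \<Omega>)" by (simp add: image_image)
qed

text \<open>Absence of holes enters as connectedness of the complement of the closure; the
  triangulation supplies the neighbourhood retract property, a finite union of compact convex sets
  being an ENR.\<close>

lemma polygon_closure_contractible:
  assumes "finite \<T>" "\<And>K. K \<in> \<T> \<Longrightarrow> convex K" "\<And>K. K \<in> \<T> \<Longrightarrow> compact K" "\<Union>\<T> = closure \<Omega>"
  shows "contractible (closure \<Omega>)"
proof -
  have hom: "closure \<Omega> homeomorphic to_complex ` closure \<Omega>"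
    using homeomorphism_complex homeomorphic_def by blast
  have "ENR (closure \<Omega>)" using ENR_finite_Union_convex_compact[of \<T>] assms by auto
  then have E: "ENR (to_complex ` closure \<Omega>)" using hom homeomorphic_ENR_iff_ENR by blast
  have "contractible (to_complex ` closure \<Omega>)"
  proof (rule contractible_ENR_complex[OF _ _ _ _ E])
    show "compact (to_complex ` closure \<Omega>)"
      using polygon_facts bounded_linear_to_complex
      by (intro compact_continuous_image linear_continuous_on) auto
    show "connected (to_complex ` closure \<Omega>)"
      using polygon_facts bounded_linear_to_complex
      by (intro connected_continuous_image linear_continuous_on connected_imp_connected_closure) auto
    show "to_complex ` closure \<Omega> \<noteq> {}" using polygon_facts by simp
    show "connected (- to_complex ` closure \<Omega>)"
      using polygon_facts bounded_linear_to_complex unfolding compl_to_complex[symmetric]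
      by (intro connected_continuous_image linear_continuous_on) auto
  qed
  then show ?thesis using hom homeomorphic_contractible_eq by blast
qed

end

section \<open>Cocycles on contractible spaces\<close>

text \<open>Discrete form of homotopy invariance. For a point \<open>u\<close>, sum \<gamma> over
  the small steps of its track under the contraction. Two nearby points have nearby tracks, and the
  cocycle identity on the thin quadrilaterals between them makes the difference telescope from
  \<open>\<gamma> u v\<close> at the start to a trivial term at the common end
  \<open>a\<close>.\<close>

lemma Alexander_Spanier_contractible:
  fixes S :: "'a::metric_space set" and \<gamma> :: "'a \<Rightarrow> 'a \<Rightarrow> 'v::ab_group_add"
  assumes "compact S" "contractible S"
    and loc: "\<And>y. y \<in> S \<Longrightarrow> \<exists>e>0. \<forall>u\<in>ball y e \<inter> S. \<forall>v\<in>ball y e \<inter> S. \<forall>w\<in>ball y e \<inter> S. \<gamma> u v + \<gamma> v w = \<gamma> u w"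
  obtains h where "\<And>y. y \<in> S \<Longrightarrow> \<exists>e>0. \<forall>u\<in>ball y e \<inter> S. \<forall>v\<in>ball y e \<inter> S. h u - h v = \<gamma> u v"
proof (cases "S = {}")
  case True
  then show ?thesis using that[of "\<lambda>_. 0"] by simp
next
  case False
  obtain a H where H: "continuous_on ({0..1::real} \<times> S) H" "H ` ({0..1} \<times> S) \<subseteq> S"
    "\<And>x. x \<in> S \<Longrightarrow> H (0, x) = x" "\<And>x. x \<in> S \<Longrightarrow> H (1, x) = a"
  proof -
    obtain a where "homotopic_with_canon (\<lambda>x. True) S S id (\<lambda>x. a)"
      using \<open>contractible S\<close> unfolding contractible_def by blast
    then obtain H where H: "continuous_map (prod_topology (top_of_set {0..1::real}) (top_of_set S)) (top_of_set S) H"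
      "\<forall>x. H (0, x) = id x" "\<forall>x. H (1, x) = a"
      unfolding homotopic_with_def by blast
    have "continuous_on ({0..1} \<times> S) H" "H \<in> ({0..1} \<times> S) \<rightarrow> S"
      using H(1) unfolding prod_topology_subtopology_eu continuous_map_subtopology_eu by auto
    then have "continuous_on ({0..1} \<times> S) H" "H ` ({0..1} \<times> S) \<subseteq> S" "\<forall>x. H (0, x) = x" "\<forall>x. H (1, x) = a"
      using H by auto
    then show ?thesis by (intro that[of H a]) auto
  qed
  define X where "X = {0..1::real} \<times> S"
  have cX: "compact X" unfolding X_def using assms(1) by (intro compact_Times) auto
  obtain r where r: "\<And>y. y \<in> S \<Longrightarrow> r y > 0 \<and> (\<forall>u\<in>ball y (r y) \<inter> S. \<forall>v\<in>ball y (r y) \<inter> S. \<forall>w\<in>ball y (r y) \<inter> S. \<gamma> u v + \<gamma> v w = \<gamma> u w)"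
    using loc by metis
  have c1: "(\<lambda>y. ball y (r y)) ` S \<noteq> {}" using False by simp
  have c2: "S \<subseteq> \<Union>((\<lambda>y. ball y (r y)) ` S)" using r by force
  have c3: "open B" if "B \<in> (\<lambda>y. ball y (r y)) ` S" for B using that by auto
  obtain \<delta> where \<delta>: "\<delta> > 0" "\<And>T. \<lbrakk>T \<subseteq> S; diameter T < \<delta>\<rbrakk> \<Longrightarrow> \<exists>B \<in> (\<lambda>y. ball y (r y)) ` S. T \<subseteq> B"
    by (rule Lebesgue_number_lemma[OF assms(1) c1 c2 c3]) (assumption | rule that)+
  \<comment> \<open>With sides at most \<open>2 * \<eta>\<close> a triple has diameter below the
    Lebesgue number \<delta>, hence lies in one ball on which the cocycle identity is known.\<close>
  define \<eta> where "\<eta> = \<delta> / 4"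
  have \<eta>0: "\<eta> > 0" using \<delta>(1) unfolding \<eta>_def by simp
  have cocyc: "\<gamma> u v + \<gamma> v w = \<gamma> u w"
    if "u \<in> S" "v \<in> S" "w \<in> S" "dist u v \<le> \<eta>" "dist v w \<le> \<eta>" "dist u w \<le> 2 * \<eta>" for u v w
  proof -
    have "diameter {u, v, w} \<le> 2 * \<eta>"
      using that \<eta>0 unfolding diameter_def by (auto simp: dist_commute cSup_eq_Max)
    then have "diameter {u, v, w} < \<delta>" using \<delta>(1) unfolding \<eta>_def by simp
    then have "\<exists>B\<in>(\<lambda>y. ball y (r y)) ` S. {u, v, w} \<subseteq> B" using that by (intro \<delta>(2)) auto
    then obtain y where "y \<in> S" "{u, v, w} \<subseteq> ball y (r y)" by blast
    then show ?thesis using r[of y] that by auto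
  qed
  obtain d where d: "d > 0" "\<And>p q. p \<in> X \<Longrightarrow> q \<in> X \<Longrightarrow> dist p q < d \<Longrightarrow> dist (H p) (H q) < \<eta>"
    using compact_uniformly_continuous[OF H(1)[folded X_def] cX] \<eta>0
    unfolding uniformly_continuous_on_def by metis
  obtain N :: nat where N: "1 / real (Suc N) < d" using d(1) by (metis reals_Archimedean inverse_eq_divide)
  define M where "M = Suc N"
  have M: "M > 0" "1 / real M < d" unfolding M_def using N by auto
  define P where "P k u = H (real k / real M, u)" for k u
  have P_S: "P k u \<in> S" if "k \<le> M" "u \<in> S" for k u
    using H(2) that M unfolding P_def by (auto simp: image_subset_iff)
  have P_step: "dist (P (Suc k) u) (P k u) < \<eta>" if "Suc k \<le> M" "u \<in> S" for k u
  proof -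
    have "\<bar>real (Suc k) / real M - real k / real M\<bar> = 1 / real M"
      by (subst diff_divide_distrib[symmetric]) simp
    then have "dist (real (Suc k) / real M, u) (real k / real M, u) < d"
      using M by (simp add: dist_Pair_Pair dist_real_def)
    then show ?thesis unfolding P_def using that M by (intro d(2)) (auto simp: X_def)
  qed
  have P_close: "dist (P k u) (P k v) < \<eta>" if "k \<le> M" "u \<in> S" "v \<in> S" "dist u v < d" for k u v
    unfolding P_def using that M by (intro d(2)) (auto simp: X_def dist_Pair_Pair)
  have P0: "P 0 u = u" and PM: "P M u = a" if "u \<in> S" for u using that M H(3,4) by (auto simp: P_def)
  define h where "h u = (\<Sum>k<M. \<gamma> (P k u) (P (Suc k) u))" for u
  have key: "h u - h v = \<gamma> u v" if uv: "u \<in> S" "v \<in> S" "dist u v < d" for u v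
  proof -
    \<comment> \<open>The quadrilateral is cut by the diagonal from \<open>P k u\<close> to
      \<open>P (Suc k) v\<close>; both triangles satisfy the cocycle identity.\<close>
    have step: "\<gamma> (P k u) (P (Suc k) u) - \<gamma> (P k v) (P (Suc k) v) = \<gamma> (P k u) (P k v) - \<gamma> (P (Suc k) u) (P (Suc k) v)"
      if "k < M" for k
    proof -
      let ?u = "P k u" and ?u' = "P (Suc k) u" and ?v = "P k v" and ?v' = "P (Suc k) v"
      have mem: "?u \<in> S" "?u' \<in> S" "?v \<in> S" "?v' \<in> S" using P_S that uv by auto
      have ds: "dist ?u' ?u < \<eta>" "dist ?v' ?v < \<eta>" "dist ?u ?v < \<eta>" "dist ?u' ?v' < \<eta>"
        using P_step P_close that uv by auto
      have tri: "dist ?u ?v' \<le> 2 * \<eta>"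
        using ds dist_triangle[of ?u ?v' ?v] by (simp add: dist_commute)
      have "\<gamma> ?u ?u' + \<gamma> ?u' ?v' = \<gamma> ?u ?v'" using mem ds tri by (intro cocyc) (auto simp: dist_commute)
      moreover have "\<gamma> ?u ?v + \<gamma> ?v ?v' = \<gamma> ?u ?v'" using mem ds tri by (intro cocyc) (auto simp: dist_commute)
      ultimately show ?thesis by (simp add: algebra_simps)
    qed
    have "h u - h v = (\<Sum>k<M. \<gamma> (P k u) (P (Suc k) u) - \<gamma> (P k v) (P (Suc k) v))"
      unfolding h_def by (simp add: sum_subtractf)
    also have "\<dots> = (\<Sum>k<M. \<gamma> (P k u) (P k v) - \<gamma> (P (Suc k) u) (P (Suc k) v))"
      using step by (intro sum.cong) auto
    also have "\<dots> = \<gamma> (P 0 u) (P 0 v) - \<gamma> (P M u) (P M v)"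
      by (rule sum_lessThan_telescope')
    also have "\<dots> = \<gamma> u v - \<gamma> a a" using P0 PM uv by simp
    also have "\<gamma> a a = 0"
    proof -
      have "a \<in> S" using PM[OF uv(1)] P_S[of M u] uv by auto
      then have "\<gamma> a a + \<gamma> a a = \<gamma> a a" using \<eta>0 by (intro cocyc) auto
      then show ?thesis by simp
    qed
    finally show ?thesis by simp
  qed
  show ?thesis
  proof (rule that)
    fix y assume "y \<in> S"
    show "\<exists>e>0. \<forall>u\<in>ball y e \<inter> S. \<forall>v\<in>ball y e \<inter> S. h u - h v = \<gamma> u v"
    proof (intro exI[of _ "d/2"] conjI ballI)
      fix u v assume "u \<in> ball y (d/2) \<inter> S" "v \<in> ball y (d/2) \<inter> S"
      moreover from this have "dist u v < d" using dist_triangle_half_r[of y u d v] by auto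
      ultimately show "h u - h v = \<gamma> u v" using key by auto
    qed (use d in auto)
  qed
qed

text \<open>The members that miss \<open>x\<close> are finitely many closed sets. Hence members
  chosen at points near \<open>x\<close> all pass through \<open>x\<close> and have a common
  point.\<close>

lemma finite_closed_cover_ball:
  fixes x :: "'a::metric_space"
  assumes "finite \<T>" "\<And>K. K \<in> \<T> \<Longrightarrow> closed K"
  obtains e where "e > 0" "\<And>y K. K \<in> \<T> \<Longrightarrow> y \<in> ball x e \<Longrightarrow> y \<in> K \<Longrightarrow> x \<in> K"
proof -
  have "open (- \<Union>{K \<in> \<T>. x \<notin> K})" using assms by (intro open_Compl closed_Union) auto
  moreover have "x \<in> - \<Union>{K \<in> \<T>. x \<notin> K}" by auto
  ultimately obtain e where "e > 0" "ball x e \<subseteq> - \<Union>{K \<in> \<T>. x \<notin> K}"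
    using open_contains_ball by blast
  then show ?thesis using that[of e] by blast
qed

text \<open>Choosing a member \<open>\<kappa> x\<close> through every point converts the cocycle on
  members into one on pairs of points, to which \<open>Alexander_Spanier_contractible\<close>
  applies. The primitive \<open>h\<close> is then compared with \<open>g\<close> on each member:
  \<open>h x + g K (\<kappa> x)\<close> is locally constant on \<open>K\<close>, and connectedness
  of \<open>K\<close> turns it into the single value \<open>s K\<close>.\<close>

lemma Cech_cocycle_trivial:
  fixes \<T> :: "'a::metric_space set set" and g :: "'a set \<Rightarrow> 'a set \<Rightarrow> 'v::ab_group_add"
  assumes fin: "finite \<T>" and comp: "\<And>K. K \<in> \<T> \<Longrightarrow> compact K" and conn: "\<And>K. K \<in> \<T> \<Longrightarrow> connected K"
    and contr: "contractible (\<Union>\<T>)"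
    and cocycle: "\<And>K L M. K \<in> \<T> \<Longrightarrow> L \<in> \<T> \<Longrightarrow> M \<in> \<T> \<Longrightarrow> K \<inter> L \<inter> M \<noteq> {} \<Longrightarrow> g K L + g L M = g K M"
  obtains s where "\<And>K L. K \<in> \<T> \<Longrightarrow> L \<in> \<T> \<Longrightarrow> K \<inter> L \<noteq> {} \<Longrightarrow> g K L = s K - s L"
proof -
  define S where "S = \<Union>\<T>"
  have "\<forall>x\<in>S. \<exists>K. K \<in> \<T> \<and> x \<in> K" by (auto simp: S_def)
  then obtain \<kappa> where \<kappa>: "\<And>x. x \<in> S \<Longrightarrow> \<kappa> x \<in> \<T> \<and> x \<in> \<kappa> x" by metis
  have ball: "\<exists>e>0. \<forall>y K. K \<in> \<T> \<longrightarrow> y \<in> ball x e \<longrightarrow> y \<in> K \<longrightarrow> x \<in> K" for x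
    using finite_closed_cover_ball[of \<T> x] fin comp compact_imp_closed by metis
  have cS: "compact S" unfolding S_def using fin comp by blast
  have cS': "contractible S" using contr by (simp add: S_def)
  have loc: "\<exists>e>0. \<forall>u\<in>ball y e \<inter> S. \<forall>v\<in>ball y e \<inter> S. \<forall>w\<in>ball y e \<inter> S.
      g (\<kappa> u) (\<kappa> v) + g (\<kappa> v) (\<kappa> w) = g (\<kappa> u) (\<kappa> w)" if "y \<in> S" for y
  proof -
    obtain e where e: "e > 0" "\<forall>z K. K \<in> \<T> \<longrightarrow> z \<in> ball y e \<longrightarrow> z \<in> K \<longrightarrow> y \<in> K" using ball[of y] by blast
    have "g (\<kappa> u) (\<kappa> v) + g (\<kappa> v) (\<kappa> w) = g (\<kappa> u) (\<kappa> w)"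
      if uvw: "u \<in> ball y e \<inter> S" "v \<in> ball y e \<inter> S" "w \<in> ball y e \<inter> S" for u v w
    proof -
      have "y \<in> \<kappa> u" "y \<in> \<kappa> v" "y \<in> \<kappa> w"
        using uvw \<kappa>[of u] \<kappa>[of v] \<kappa>[of w] e(2) by blast+
      then show ?thesis using uvw \<kappa>[of u] \<kappa>[of v] \<kappa>[of w] by (intro cocycle) blast+
    qed
    then show ?thesis using e(1) by blast
  qed
  obtain h where h: "\<And>y. y \<in> S \<Longrightarrow> \<exists>e>0. \<forall>u\<in>ball y e \<inter> S. \<forall>v\<in>ball y e \<inter> S. h u - h v = g (\<kappa> u) (\<kappa> v)"
    by (rule Alexander_Spanier_contractible[OF cS cS' loc]) (assumption | rule that)+
  define \<sigma> where "\<sigma> K x = h x + g K (\<kappa> x)" for K x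
  have \<sigma>_loc: "\<exists>e>0. \<forall>x'\<in>K \<inter> ball x e. \<sigma> K x' = \<sigma> K x" if K: "K \<in> \<T>" "x \<in> K" for K x
  proof -
    have "x \<in> S" using K by (auto simp: S_def)
    obtain e where e: "e > 0" "\<forall>z K. K \<in> \<T> \<longrightarrow> z \<in> ball x e \<longrightarrow> z \<in> K \<longrightarrow> x \<in> K" using ball[of x] by blast
    obtain e' where e': "e' > 0" "\<forall>u\<in>ball x e' \<inter> S. \<forall>v\<in>ball x e' \<inter> S. h u - h v = g (\<kappa> u) (\<kappa> v)"
      using h[OF \<open>x \<in> S\<close>] by blast
    have "\<sigma> K x' = \<sigma> K x" if x': "x' \<in> K \<inter> ball x (min e e')" for x'
    proof -
      have "x' \<in> S" using x' K by (auto simp: S_def)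
      then have "x \<in> \<kappa> x'" using e(2) \<kappa>[of x'] x' by auto
      then have "g K (\<kappa> x') + g (\<kappa> x') (\<kappa> x) = g K (\<kappa> x)"
        using K \<kappa>[OF \<open>x \<in> S\<close>] \<kappa>[OF \<open>x' \<in> S\<close>] by (intro cocycle) auto
      moreover have "h x' - h x = g (\<kappa> x') (\<kappa> x)"
        using e' x' \<open>x \<in> S\<close> \<open>x' \<in> S\<close> by auto
      ultimately show ?thesis by (simp add: \<sigma>_def algebra_simps)
    qed
    then show ?thesis using e(1) e'(1) by (intro exI[of _ "min e e'"]) auto
  qed
  have const: "\<exists>c. \<forall>x\<in>K. \<sigma> K x = c" if K: "K \<in> \<T>" for K
  proof -
    have "openin (top_of_set K) {x \<in> K. \<sigma> K x = c}" for c
      unfolding openin_contains_ball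
    proof (intro conjI ballI)
      fix x assume x: "x \<in> {x \<in> K. \<sigma> K x = c}"
      then obtain e where "e > 0" "\<forall>x'\<in>K \<inter> ball x e. \<sigma> K x' = \<sigma> K x" using \<sigma>_loc K by blast
      then show "\<exists>e>0. ball x e \<inter> K \<subseteq> {x \<in> K. \<sigma> K x = c}" using x by (intro exI[of _ e]) auto
    qed auto
    then have o: "\<exists>T. openin (top_of_set K) T \<and> x \<in> T \<and> (\<forall>y\<in>T. \<sigma> K y = \<sigma> K x)" if "x \<in> K" for x
      using that by (intro exI[of _ "{y \<in> K. \<sigma> K y = \<sigma> K x}"]) auto
    have "\<sigma> K constant_on K"
      by (rule locally_constant_imp_constant[OF conn[OF K] o])
    then show ?thesis by (auto simp: constant_on_def)
  qed
  then obtain s where s: "\<And>K x. K \<in> \<T> \<Longrightarrow> x \<in> K \<Longrightarrow> \<sigma> K x = s K" by metis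
  show ?thesis
  proof (rule that[of s])
    fix K L assume KL: "K \<in> \<T>" "L \<in> \<T>" "K \<inter> L \<noteq> {}"
    then obtain x where x: "x \<in> K" "x \<in> L" by auto
    then have "x \<in> S" using KL by (auto simp: S_def)
    have "g K L + g L (\<kappa> x) = g K (\<kappa> x)" using KL x \<kappa>[OF \<open>x \<in> S\<close>] by (intro cocycle) auto
    moreover have "s K = h x + g K (\<kappa> x)" "s L = h x + g L (\<kappa> x)" using s KL x by (auto simp: \<sigma>_def)
    ultimately show "g K L = s K - s L" by (simp add: algebra_simps)
  qed
qed

section \<open>Polynomials in two variables with values in a vector space\<close>

abbreviation monom2 :: "nat \<Rightarrow> nat \<Rightarrow> real^2 \<Rightarrow> real" where
  "monom2 i j \<equiv> \<lambda>x. (x $ 1) ^ i * (x $ 2) ^ j"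

lemma polys_UNIV_iff: "f \<in> polys k UNIV \<longleftrightarrow> (\<exists>c. f = (\<lambda>x. \<Sum>i\<le>k. \<Sum>j\<le>k - i. monom2 i j x *\<^sub>R c i j))"
  by (auto simp: polys_def fun_eq_iff)

lemma polysE:
  assumes "f \<in> polys k D" obtains p where "p \<in> polys k UNIV" "\<And>x. x \<in> D \<Longrightarrow> f x = p x"
proof -
  obtain c where "\<forall>x\<in>D. f x = (\<Sum>i\<le>k. \<Sum>j\<le>k - i. monom2 i j x *\<^sub>R c i j)"
    using assms by (auto simp: polys_def)
  then show ?thesis
    by (intro that[of "\<lambda>x. \<Sum>i\<le>k. \<Sum>j\<le>k - i. monom2 i j x *\<^sub>R c i j"]) (auto simp: polys_def)
qed

lemma polys_UNIV_D: "f \<in> polys k UNIV \<Longrightarrow> f \<in> polys k D"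
  by (auto simp: polys_def)

lemma polys_cong: "p \<in> polys k UNIV \<Longrightarrow> (\<And>x. x \<in> D \<Longrightarrow> f x = p x) \<Longrightarrow> f \<in> polys k D"
  by (auto simp: polys_def)

lemma polys_zero: "(\<lambda>x. 0) \<in> polys k D"
  by (auto simp: polys_def intro!: exI[of _ "\<lambda>_ _. 0"])

lemma polys_add: "f \<in> polys k D \<Longrightarrow> g \<in> polys k D \<Longrightarrow> (\<lambda>x. f x + g x) \<in> polys k D"
proof -
  assume "f \<in> polys k D" "g \<in> polys k D"
  then obtain c d where "\<forall>x\<in>D. f x = (\<Sum>i\<le>k. \<Sum>j\<le>k - i. monom2 i j x *\<^sub>R c i j)"
    "\<forall>x\<in>D. g x = (\<Sum>i\<le>k. \<Sum>j\<le>k - i. monom2 i j x *\<^sub>R d i j)" by (auto simp: polys_def)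
  then show ?thesis unfolding polys_def
    by (intro CollectI exI[of _ "\<lambda>i j. c i j + d i j"]) (auto simp: scaleR_add_right sum.distrib)
qed

lemma polys_linear:
  assumes "linear h" "f \<in> polys k D" shows "(\<lambda>x. h (f x)) \<in> polys k D"
proof -
  obtain c where "\<forall>x\<in>D. f x = (\<Sum>i\<le>k. \<Sum>j\<le>k - i. monom2 i j x *\<^sub>R c i j)"
    using assms(2) by (auto simp: polys_def)
  then show ?thesis unfolding polys_def using assms(1)
    by (intro CollectI exI[of _ "\<lambda>i j. h (c i j)"]) (auto simp: linear_sum linear_scale)
qed

lemma polys_scaleR: "f \<in> polys k D \<Longrightarrow> (\<lambda>x. r *\<^sub>R f x) \<in> polys k D"
  by (rule polys_linear) (auto intro: linearI simp: scaleR_add_right)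

lemma polys_cmult: "f \<in> polys k D \<Longrightarrow> (\<lambda>x. (r::real) * f x) \<in> polys k D"
  using polys_scaleR[of f k D r] by simp

lemma polys_uminus: "f \<in> polys k D \<Longrightarrow> (\<lambda>x. - f x) \<in> polys k D"
  using polys_scaleR[of f k D "-1"] by simp

lemma polys_diff: "f \<in> polys k D \<Longrightarrow> g \<in> polys k D \<Longrightarrow> (\<lambda>x. f x - g x) \<in> polys k D"
  using polys_add[OF _ polys_uminus, of f k D g] by simp

lemma polys_sum: "(\<And>i. i \<in> I \<Longrightarrow> f i \<in> polys k D) \<Longrightarrow> (\<lambda>x. \<Sum>i\<in>I. f i x) \<in> polys k D"
  by (induction I rule: infinite_finite_induct) (auto simp: polys_zero intro: polys_add)

lemma polys_monom:
  assumes "i + j \<le> k" shows "(\<lambda>x. monom2 i j x *\<^sub>R c) \<in> polys k D"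
proof -
  have "(\<Sum>i'\<le>k. \<Sum>j'\<le>k - i'. monom2 i' j' x *\<^sub>R (if i' = i \<and> j' = j then c else 0)) = monom2 i j x *\<^sub>R c" for x
  proof -
    have "(\<Sum>j'\<le>k - i'. monom2 i' j' x *\<^sub>R (if i' = i \<and> j' = j then c else 0)) = (if i' = i then monom2 i j x *\<^sub>R c else 0)" for i'
      using assms by (cases "i' = i") (auto simp: if_distrib[of "\<lambda>z. _ *\<^sub>R z"] sum.delta cong: if_cong)
    then show ?thesis using assms by (simp add: sum.delta)
  qed
  then show ?thesis by (auto simp: polys_def intro!: exI[of _ "\<lambda>i' j'. if i' = i \<and> j' = j then c else 0"])
qed

text \<open>A property stable under sums only has to be checked on monomials; many of the rules
  below are obtained in this way.\<close>

lemma polys_induct [consumes 1, case_names monom zero add]: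
  assumes "f \<in> polys k UNIV"
    and "\<And>i j c. i + j \<le> k \<Longrightarrow> Q (\<lambda>x. monom2 i j x *\<^sub>R c)"
    and "Q (\<lambda>x. 0)" and "\<And>f g. Q f \<Longrightarrow> Q g \<Longrightarrow> Q (\<lambda>x. f x + g x)"
  shows "Q f"
proof -
  have S: "(\<And>i. i \<in> I \<Longrightarrow> Q (f i)) \<Longrightarrow> finite I \<Longrightarrow> Q (\<lambda>x. \<Sum>i\<in>I. f i x)" for I :: "nat set" and f
  proof (induction I rule: infinite_finite_induct)
    case (insert x F)
    then show ?case using assms(4)[of "f x" "\<lambda>y. \<Sum>i\<in>F. f i y"] by simp
  qed (use assms(3) in auto)
  obtain c where f: "f = (\<lambda>x. \<Sum>i\<le>k. \<Sum>j\<le>k - i. monom2 i j x *\<^sub>R c i j)"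
    using assms(1) by (auto simp: polys_UNIV_iff)
  show ?thesis unfolding f by (intro S assms(2)) auto
qed

lemma polys_mono: "k \<le> l \<Longrightarrow> f \<in> polys k D \<Longrightarrow> f \<in> polys l D"
proof -
  assume kl: "k \<le> l" and f: "f \<in> polys k D"
  obtain p where p: "p \<in> polys k UNIV" "\<And>x. x \<in> D \<Longrightarrow> f x = p x" using polysE[OF f] by metis
  from p(1) have "p \<in> polys l UNIV"
    by (induction rule: polys_induct) (use kl in \<open>auto intro: polys_monom polys_zero polys_add\<close>)
  then show ?thesis using p(2) polys_cong by metis
qed

lemma polys_const: "(\<lambda>x. c) \<in> polys k D"
  using polys_monom[of 0 0 k c] by simp

lemma polys_coord: "1 \<le> k \<Longrightarrow> (\<lambda>x. x $ i :: real) \<in> polys k D"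
  using polys_monom[of 1 0 k "1::real" D] polys_monom[of 0 1 k "1::real" D] exhaust_2[of i] by auto

lemma polys_cvec: "1 \<le> k \<Longrightarrow> (\<lambda>x. x \<bullet> w) \<in> polys k D"
  unfolding inner_vec_def sum_2
  by (auto intro!: polys_add polys_cmult polys_coord simp: mult.commute[of _ "w $ _"])

lemma polys_scaleR_mult:
  fixes f :: "real^2 \<Rightarrow> real"
  assumes "f \<in> polys k D" "g \<in> polys l D"
  shows "(\<lambda>x. f x *\<^sub>R g x) \<in> polys (k + l) D"
proof -
  obtain p where p: "p \<in> polys k UNIV" "\<And>x. x \<in> D \<Longrightarrow> f x = p x" using polysE[OF assms(1)] by metis
  obtain q where q: "q \<in> polys l UNIV" "\<And>x. x \<in> D \<Longrightarrow> g x = q x" using polysE[OF assms(2)] by metis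
  from p(1) have "(\<lambda>x. p x *\<^sub>R q x) \<in> polys (k + l) UNIV"
  proof (induction rule: polys_induct)
    case (monom i j c)
    from q(1) show ?case
    proof (induction rule: polys_induct)
      case (monom i' j' c')
      have "(\<lambda>x. monom2 (i + i') (j + j') x *\<^sub>R (c *\<^sub>R c')) \<in> polys (k + l) UNIV"
        using monom \<open>i + j \<le> k\<close> by (intro polys_monom) simp
      then show ?case by (simp add: power_add mult_ac)
    next
      case (add f g)
      then show ?case using polys_add[OF add] by (simp add: scaleR_add_right)
    qed (simp add: polys_zero)
  next
    case (add f g)
    then show ?case using polys_add[OF add] by (simp add: scaleR_add_left)
  qed (simp add: polys_zero)
  then show ?thesis using p(2) q(2) by (auto intro: polys_cong)
qed

text \<open>The bound \<open>m\<close> is a separate variable tied by an equation, so that numeral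
  degrees such as 3 are reached by instantiating \<open>k\<close> and \<open>l\<close>.\<close>

lemma polys_mult:
  fixes f g :: "real^2 \<Rightarrow> real"
  shows "f \<in> polys k D \<Longrightarrow> g \<in> polys l D \<Longrightarrow> k + l = m \<Longrightarrow> (\<lambda>x. f x * g x) \<in> polys m D"
  using polys_scaleR_mult[of f k D g l] by simp

lemma polys_power:
  fixes f :: "real^2 \<Rightarrow> real"
  shows "f \<in> polys k D \<Longrightarrow> (\<lambda>x. f x ^ i) \<in> polys (i * k) D"
  by (induction i) (auto simp: polys_const intro!: polys_mult)

lemma polys_vec_iff:
  fixes f :: "real^2 \<Rightarrow> 'x::real_vector ^ 'n"
  shows "f \<in> polys k D \<longleftrightarrow> (\<forall>i. (\<lambda>x. f x $ i) \<in> polys k D)"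
proof
  assume "f \<in> polys k D"
  then show "\<forall>i. (\<lambda>x. f x $ i) \<in> polys k D"
    by (auto intro!: polys_linear[of "\<lambda>v. v $ _"] linearI)
next
  assume "\<forall>i. (\<lambda>x. f x $ i) \<in> polys k D"
  then have "\<forall>i. \<exists>c. \<forall>x\<in>D. f x $ i = (\<Sum>i\<le>k. \<Sum>j\<le>k - i. monom2 i j x *\<^sub>R c i j)"
    by (auto simp: polys_def)
  from choice[OF this] obtain c where "\<forall>l. \<forall>x\<in>D. f x $ l = (\<Sum>i\<le>k. \<Sum>j\<le>k - i. monom2 i j x *\<^sub>R c l i j)" by blast
  then show "f \<in> polys k D" unfolding polys_def
    by (intro CollectI exI[of _ "\<lambda>i j. \<chi> l. c l i j"]) (auto simp: vec_eq_iff)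
qed

section \<open>Derivatives\<close>

lemma vec2_expand: "(h :: real^2) = (h $ 1) *\<^sub>R axis 1 1 + (h $ 2) *\<^sub>R axis 2 1"
  by (simp add: vec_eq_iff forall_2 axis_def)

lemma frechet_partial:
  assumes "f differentiable at x"
  shows "frechet_derivative f (at x) h = h $ 1 * partial 1 f x + h $ 2 * partial 2 f x"
proof -
  have "linear (frechet_derivative f (at x))" using assms by (rule linear_frechet_derivative)
  then show ?thesis unfolding partial_def by (subst vec2_expand) (simp add: linear_add linear_scale)
qed

lemma has_derivative_partial:
  assumes "f differentiable at x"
  shows "(f has_derivative (\<lambda>h. h $ 1 * partial 1 f x + h $ 2 * partial 2 f x)) (at x)"
proof -
  have "frechet_derivative f (at x) = (\<lambda>h. h $ 1 * partial 1 f x + h $ 2 * partial 2 f x)"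
    using frechet_partial[OF assms] by (intro ext)
  then show ?thesis using assms frechet_derivative_works[of f "at x"] by simp
qed

lemma partial_eqI: "(f has_derivative f') (at x) \<Longrightarrow> partial i f x = f' (axis i 1)"
  unfolding partial_def using frechet_derivative_at by metis

lemma dir_deriv_eqI: "(f has_derivative f') (at x) \<Longrightarrow> dir_deriv n f x = f' n"
  unfolding dir_deriv_def using frechet_derivative_at by metis

lemma dir_deriv_partial: "f differentiable at x \<Longrightarrow> dir_deriv n f x = n $ 1 * partial 1 f x + n $ 2 * partial 2 f x"
  unfolding dir_deriv_def by (rule frechet_partial)

lemma frechet_D: "f differentiable at x \<Longrightarrow> (f has_derivative frechet_derivative f (at x)) (at x)"
  by (simp add: frechet_derivative_works)

lemma partial_add: "f differentiable at x \<Longrightarrow> g differentiable at x \<Longrightarrow> partial i (\<lambda>x. f x + g x) x = partial i f x + partial i g x"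
  by (subst partial_eqI[OF has_derivative_add[OF frechet_D frechet_D]]) (auto simp: partial_def)

lemma partial_diff: "f differentiable at x \<Longrightarrow> g differentiable at x \<Longrightarrow> partial i (\<lambda>x. f x - g x) x = partial i f x - partial i g x"
  by (subst partial_eqI[OF has_derivative_diff[OF frechet_D frechet_D]]) (auto simp: partial_def)

lemma partial_minus: "f differentiable at x \<Longrightarrow> partial i (\<lambda>x. - f x) x = - partial i f x"
  by (subst partial_eqI[OF has_derivative_minus[OF frechet_D]]) (auto simp: partial_def)

lemma partial_mult: "f differentiable at x \<Longrightarrow> g differentiable at x \<Longrightarrow> partial i (\<lambda>x. f x * g x) x = f x * partial i g x + partial i f x * g x"
  by (subst partial_eqI[OF has_derivative_mult[OF frechet_D frechet_D]]) (auto simp: partial_def)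

lemma partial_const [simp]: "partial i (\<lambda>x. c) x = 0"
  by (subst partial_eqI[OF has_derivative_const]) auto

lemma partial_cmult: "f differentiable at x \<Longrightarrow> partial i (\<lambda>x. c * f x) x = c * partial i f x"
  using partial_mult[of "\<lambda>_. c" x f i] by simp

lemma partial_cong_open:
  assumes "open U" "x \<in> U" "\<And>y. y \<in> U \<Longrightarrow> f y = g y" shows "partial i f x = partial i g x"
proof -
  have "(f has_derivative D) (at x) \<longleftrightarrow> (g has_derivative D) (at x)" for D
    using assms has_derivative_transform_within_open[of f D x UNIV U g] has_derivative_transform_within_open[of g D x UNIV U f] by auto
  then show ?thesis unfolding partial_def frechet_derivative_def by simp
qed

lemma one_neq_two2: "(2::2) = 1 \<longleftrightarrow> False" "(1::2) = 2 \<longleftrightarrow> False"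
  by simp_all

text \<open>For exponent 0 the truncated \<open>i - 1\<close> does no harm, its factor
  \<open>of_nat i\<close> being 0.\<close>

lemma monom2_has_derivative:
  "((\<lambda>x. monom2 i j x *\<^sub>R c) has_derivative (\<lambda>h. (h $ 1 * (of_nat i * monom2 (i - 1) j x) + h $ 2 * (of_nat j * monom2 i (j - 1) x)) * c)) (at (x::real^2))"
  by (auto intro!: derivative_eq_intros bounded_linear.has_derivative[OF bounded_linear_vec_nth] ext simp: algebra_simps)

lemma polys_differentiable: "(f::real^2 \<Rightarrow> real) \<in> polys k UNIV \<Longrightarrow> f differentiable at x"
proof (induction rule: polys_induct)
  case (monom i j c)
  then show ?case using monom2_has_derivative differentiable_def by blast
qed (auto intro!: derivative_intros)

lemma polys_continuous: "(f::real^2 \<Rightarrow> real) \<in> polys k UNIV \<Longrightarrow> continuous_on S f"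
  by (intro differentiable_imp_continuous_on differentiable_at_imp_differentiable_on polys_differentiable)

lemma partial_monom2:
  "partial l (\<lambda>x. monom2 i j x *\<^sub>R c) = (\<lambda>x. if l = 1 then monom2 (i - 1) j x *\<^sub>R (of_nat i * c) else monom2 i (j - 1) x *\<^sub>R (of_nat j * c))"
proof
  fix x show "partial l (\<lambda>x. monom2 i j x *\<^sub>R c) x = (if l = 1 then monom2 (i - 1) j x *\<^sub>R (of_nat i * c) else monom2 i (j - 1) x *\<^sub>R (of_nat j * c))"
    unfolding partial_eqI[OF monom2_has_derivative] using exhaust_2[of l] by (auto simp: axis_def)
qed

lemma polys_partial_add:
  "f \<in> polys k UNIV \<Longrightarrow> g \<in> polys l UNIV \<Longrightarrow> partial i (\<lambda>x. f x + g x) = (\<lambda>x. partial i f x + partial i g x)"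
  by (rule ext) (auto intro!: partial_add polys_differentiable)

lemma polys_partial:
  assumes "f \<in> polys k UNIV" shows "partial i f \<in> polys (k - 1) UNIV"
proof -
  from assms have "f \<in> polys k UNIV \<and> partial i f \<in> polys (k - 1) UNIV"
  proof (induction rule: polys_induct)
    case (monom i' j c)
    have "(\<lambda>x. monom2 (i' - 1) j x *\<^sub>R (of_nat i' * c)) \<in> polys (k - 1) UNIV"
    proof (cases i')
      case (Suc m)
      then show ?thesis using monom by (intro polys_monom) simp
    qed (simp add: polys_zero)
    moreover have "(\<lambda>x. monom2 i' (j - 1) x *\<^sub>R (of_nat j * c)) \<in> polys (k - 1) UNIV"
    proof (cases j)
      case (Suc m)
      then show ?thesis using monom by (intro polys_monom) simp
    qed (simp add: polys_zero)
    ultimately show ?case unfolding partial_monom2 using polys_monom[OF monom, of c UNIV] by (cases "i = 1") (simp_all only: if_True if_False refl simp_thms)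
  next
    case zero then show ?case by (auto simp: polys_zero partial_const[abs_def])
  next
    case (add f g) then show ?case by (auto simp: polys_partial_add polys_add)
  qed
  then show ?thesis ..
qed

lemma polys_partial_commute:
  assumes "f \<in> polys k UNIV" shows "partial i (partial j f) = partial j (partial i f)"
proof -
  from assms have "f \<in> polys k UNIV \<and> partial 1 (partial 2 f) = partial 2 (partial 1 f)"
  proof (induction rule: polys_induct)
    case (monom i' j c)
    have "partial 1 (partial 2 (\<lambda>x. monom2 i' j x *\<^sub>R c)) = partial 2 (partial 1 (\<lambda>x. monom2 i' j x *\<^sub>R c))"
      by (simp only: partial_monom2 if_True if_False one_neq_two2 refl) (simp add: mult_ac)
    then show ?case using polys_monom[OF monom, of c UNIV] by blast
  next
    case zero then show ?case by (auto simp: polys_zero partial_const[abs_def])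
  next
    case (add f g)
    then show ?case
      by (auto simp: polys_add polys_partial_add[of f k g k] polys_partial_add[OF polys_partial polys_partial, of f k g k])
  qed
  then show ?thesis using exhaust_2[of i] exhaust_2[of j] by auto
qed

section \<open>Restrictions to lines\<close>

lemma polys_line:
  fixes f :: "real^2 \<Rightarrow> real"
  assumes "f \<in> polys k UNIV"
  obtains q where "degree q \<le> k" "\<And>s. f (a + s *\<^sub>R d) = poly q s"
proof -
  have "\<exists>q. degree q \<le> k \<and> (\<forall>s. f (a + s *\<^sub>R d) = poly q s)"
    using assms
  proof (induction rule: polys_induct)
    case (monom i j c)
    have "degree (smult c ([:a $ 1, d $ 1:] ^ i * [:a $ 2, d $ 2:] ^ j)) \<le> degree ([:a $ 1, d $ 1:] ^ i) + degree ([:a $ 2, d $ 2:] ^ j)"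
      using degree_mult_le degree_smult_le order_trans by blast
    also have "\<dots> \<le> i * 1 + j * 1"
      by (intro add_mono order_trans[OF degree_power_le]) (auto simp: mult.commute)
    also have "\<dots> \<le> k" using monom by simp
    finally show ?case
      by (intro exI[of _ "smult c ([:a $ 1, d $ 1:] ^ i * [:a $ 2, d $ 2:] ^ j)"]) (auto simp: algebra_simps)
  next
    case zero show ?case by (intro exI[of _ 0]) auto
  next
    case (add f g)
    then obtain p q where "degree p \<le> k" "degree q \<le> k" "\<forall>s. f (a + s *\<^sub>R d) = poly p s" "\<forall>s. g (a + s *\<^sub>R d) = poly q s" by blast
    then show ?case by (intro exI[of _ "p + q"]) (auto intro: degree_add_le)
  qed
  then show ?thesis using that by blast
qed

lemma poly_upto: "degree (q::real poly) \<le> n \<Longrightarrow> poly q x = (\<Sum>i\<le>n. coeff q i * x ^ i)"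
  unfolding poly_altdef by (rule sum.mono_neutral_left) (auto simp: coeff_eq_0)

lemma linepath_alt: "linepath a b s = a + s *\<^sub>R (b - a)"
  by (simp add: linepath_def algebra_simps)

lemma polys_segment_E:
  fixes f :: "real^2 \<Rightarrow> real"
  assumes "f \<in> polys k (closed_segment a b)"
  obtains q where "degree q \<le> k" "\<And>s. s \<in> {0..1} \<Longrightarrow> f (linepath a b s) = poly q s"
proof -
  obtain p where p: "p \<in> polys k UNIV" "\<And>x. x \<in> closed_segment a b \<Longrightarrow> f x = p x" using polysE[OF assms] by metis
  obtain q where "degree q \<le> k" "\<And>s. p (a + s *\<^sub>R (b - a)) = poly q s" using polys_line[OF p(1)] by metis
  then show ?thesis using that[of q] p(2) linepath_in_path[of _ a b] by (metis linepath_alt)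
qed

lemma polys_segment_I:
  fixes f :: "real^2 \<Rightarrow> real"
  assumes "a \<noteq> b" "degree q \<le> k" "\<And>s. s \<in> {0..1} \<Longrightarrow> f (linepath a b s) = poly q s"
  shows "f \<in> polys k (closed_segment a b)"
proof -
  \<comment> \<open>Orthogonal projection onto the line recovers the parameter as a polynomial of
    degree 1; substituting it into \<open>q\<close> extends \<open>f\<close> from the segment to the
    plane.\<close>
  define \<sigma> where "\<sigma> x = (x \<bullet> (b - a)) * (1 / ((b - a) \<bullet> (b - a))) + - ((a \<bullet> (b - a)) / ((b - a) \<bullet> (b - a)))" for x
  have nz: "(b - a) \<bullet> (b - a) \<noteq> 0" using assms(1) by simp
  have \<sigma>: "\<sigma> (linepath a b s) = s" for s
  proof -
    have "(a + s *\<^sub>R (b - a)) \<bullet> (b - a) = a \<bullet> (b - a) + s * ((b - a) \<bullet> (b - a))" by (simp add: inner_add_left)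
    then show ?thesis using nz by (simp add: \<sigma>_def linepath_alt add_divide_distrib)
  qed
  have \<sigma>1: "\<sigma> \<in> polys 1 UNIV" unfolding \<sigma>_def
    by (intro polys_add polys_const polys_mult[where k=1 and l=0] polys_cvec) auto
  have "(\<lambda>x. \<Sum>i\<le>k. coeff q i * \<sigma> x ^ i) \<in> polys k UNIV"
  proof (intro polys_sum polys_cmult)
    fix i assume "i \<in> {..k}"
    then show "(\<lambda>x. \<sigma> x ^ i) \<in> polys k UNIV" using polys_power[OF \<sigma>1, of i] polys_mono[of i k] by simp
  qed
  then show ?thesis
  proof (rule polys_cong)
    fix x assume "x \<in> closed_segment a b"
    then obtain s where "s \<in> {0..1}" "x = linepath a b s"
      by (metis imageE linepath_image_01)
    then show "f x = (\<Sum>i\<le>k. coeff q i * \<sigma> x ^ i)" using \<sigma> assms poly_upto by auto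
  qed
qed

lemma polys_zero_on_open:
  fixes f :: "real^2 \<Rightarrow> real"
  assumes "f \<in> polys k UNIV" "open U" "x0 \<in> U" "\<And>x. x \<in> U \<Longrightarrow> f x = 0"
  shows "f x = 0"
proof -
  obtain q where q: "degree q \<le> k" "\<And>s. f (x0 + s *\<^sub>R (x - x0)) = poly q s" using polys_line[OF assms(1)] by metis
  obtain e where e: "e > 0" "ball x0 e \<subseteq> U" using assms(2,3) open_contains_ball by blast
  \<comment> \<open>For parameters below \<open>r\<close> the point of the line stays in the ball;
    the summand 1 covers \<open>x = x0\<close>.\<close>
  define r where "r = e / (norm (x - x0) + 1)"
  have r: "r > 0" using e by (simp add: r_def add_nonneg_pos)
  have "poly q s = 0" if "s \<in> {0<..<r}" for s
  proof -
    have "norm (s *\<^sub>R (x - x0)) \<le> s * (norm (x - x0) + 1)" using that by (simp add: mult_left_mono)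
    also have "\<dots> < r * (norm (x - x0) + 1)" using that by (intro mult_strict_right_mono) (auto simp: add_nonneg_pos)
    also have "\<dots> = e" unfolding r_def using norm_ge_zero[of "x - x0"] by (simp add: add_nonneg_eq_0_iff)
    finally have "x0 + s *\<^sub>R (x - x0) \<in> U" using e by (intro subsetD[OF e(2)]) (simp add: dist_norm)
    then show ?thesis using q(2) assms(4) by metis
  qed
  then have "{0<..<r} \<subseteq> {s. poly q s = 0}" by auto
  then have "infinite {s. poly q s = 0}" using infinite_Ioo[OF r] finite_subset by blast
  then have "q = 0" using poly_roots_finite by blast
  then show ?thesis using q(2)[of 1] by simp
qed

lemma has_derivative_line:
  fixes f :: "real^2 \<Rightarrow> real"
  assumes "f differentiable at (a + s *\<^sub>R d)"
  shows "((\<lambda>s. f (a + s *\<^sub>R d)) has_real_derivative dir_deriv d f (a + s *\<^sub>R d)) (at s)"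
proof -
  have "((\<lambda>s. a + s *\<^sub>R d) has_derivative (\<lambda>h. h *\<^sub>R d)) (at s)"
    by (auto intro!: derivative_eq_intros)
  from has_derivative_compose[OF this frechet_D[OF assms]]
  have "((\<lambda>s. f (a + s *\<^sub>R d)) has_derivative (\<lambda>h. frechet_derivative f (at (a + s *\<^sub>R d)) (h *\<^sub>R d))) (at s)" .
  moreover have "linear (frechet_derivative f (at (a + s *\<^sub>R d)))" using assms by (rule linear_frechet_derivative)
  ultimately show ?thesis
    unfolding has_field_derivative_def dir_deriv_def by (simp add: linear_scale mult.commute[of _ "frechet_derivative _ _ _"])
qed

lemma poly_line_deriv:
  fixes f :: "real^2 \<Rightarrow> real"
  assumes "\<And>x. f differentiable at x" "\<And>s. f (a + s *\<^sub>R d) = poly q s"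
  shows "dir_deriv d f (a + s *\<^sub>R d) = poly (pderiv q) s"
proof -
  have "((\<lambda>s. poly q s) has_real_derivative dir_deriv d f (a + s *\<^sub>R d)) (at s)"
    using has_derivative_line[where f=f and a=a and s=s and d=d] assms by simp
  then show ?thesis using DERIV_unique poly_DERIV by blast
qed

section \<open>Univariate interpolation\<close>

lemma sum_le5: "(\<Sum>i\<le>(5::nat). f i) = f 0 + f 1 + f 2 + f 3 + f 4 + (f 5::real)"
  by (simp add: eval_nat_numeral)
lemma sum_le3: "(\<Sum>i\<le>(3::nat). f i) = f 0 + f 1 + f 2 + (f 3::real)"
  by (simp add: eval_nat_numeral)
lemma sum_le2: "(\<Sum>i\<le>(2::nat). f i) = f 0 + f 1 + (f 2::real)"
  by (simp add: eval_nat_numeral)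

lemma poly_eq_0_upto:
  assumes "degree (q::real poly) \<le> n" "\<And>i. i \<le> n \<Longrightarrow> coeff q i = 0" shows "q = 0"
  by (rule poly_eqI) (metis assms coeff_0 coeff_eq_0 le_less_trans not_le)

lemma Hermite3_unique:
  fixes q :: "real poly"
  assumes "degree q \<le> 3" "poly q 0 = 0" "poly (pderiv q) 0 = 0" "poly q 1 = 0" "poly (pderiv q) 1 = 0"
  shows "q = 0"
proof (rule poly_eq_0_upto[OF assms(1)])
  fix i :: nat assume "i \<le> 3"
  have d: "degree (pderiv q) \<le> 2" using assms(1) by (simp add: degree_pderiv)
  have "coeff q 0 = 0" "coeff q 1 = 0" "coeff q 2 = 0" "coeff q 3 = 0"
    using assms(2-) by (auto simp: poly_upto[OF assms(1)] poly_upto[OF d] sum_le3 sum_le2 coeff_pderiv eval_nat_numeral)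
  moreover have "i = 0 \<or> i = 1 \<or> i = 2 \<or> i = 3" using \<open>i \<le> 3\<close> by linarith
  ultimately show "coeff q i = 0" by auto
qed

lemma Hermite5_unique:
  fixes q :: "real poly"
  assumes "degree q \<le> 5" "poly q 0 = 0" "poly (pderiv q) 0 = 0" "poly (pderiv (pderiv q)) 0 = 0"
    "poly q 1 = 0" "poly (pderiv q) 1 = 0" "poly (pderiv (pderiv q)) 1 = 0"
  shows "q = 0"
proof (rule poly_eq_0_upto[OF assms(1)])
  fix i :: nat assume "i \<le> 5"
  have d: "degree (pderiv q) \<le> 5" "degree (pderiv (pderiv q)) \<le> 5"
    using assms(1) by (simp_all add: degree_pderiv)
  \<comment> \<open>Evaluating both derivatives with the bound 5 reaches two coefficients beyond the
    degree, which are zero.\<close>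
  have z: "coeff q 6 = 0" "coeff q 7 = 0" using assms(1) by (auto intro: coeff_eq_0)
  have "coeff q 0 = 0" "coeff q 1 = 0" "coeff q 2 = 0" "coeff q 3 = 0" "coeff q 4 = 0" "coeff q 5 = 0"
    using assms(2-) z by (auto simp: poly_upto[OF assms(1)] poly_upto[OF d(1)] poly_upto[OF d(2)] sum_le5 coeff_pderiv eval_nat_numeral)
  moreover have "i = 0 \<or> i = 1 \<or> i = 2 \<or> i = 3 \<or> i = 4 \<or> i = 5" using \<open>i \<le> 5\<close> by linarith
  ultimately show "coeff q i = 0" by auto
qed

lemma poly_has_integral:
  assumes "degree (q::real poly) \<le> n"
  shows "((\<lambda>s. poly q s) has_integral (\<Sum>i\<le>n. coeff q i / real (Suc i))) {0..1}"
proof -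
  have "((\<lambda>s. poly q s) has_integral (\<Sum>i\<le>n. coeff q i * 1 ^ Suc i / real (Suc i)) - (\<Sum>i\<le>n. coeff q i * 0 ^ Suc i / real (Suc i))) {0..1}"
  proof (rule fundamental_theorem_of_calculus)
    fix x :: real
    show "((\<lambda>x. \<Sum>i\<le>n. coeff q i * x ^ Suc i / real (Suc i)) has_vector_derivative poly q x) (at x within {0..1})"
      unfolding poly_upto[OF assms] has_real_derivative_iff_has_vector_derivative[symmetric]
    proof (rule DERIV_sum)
      fix i
      have "((\<lambda>x. x ^ Suc i) has_real_derivative real (Suc i) * x ^ i) (at x within {0..1})"
        using DERIV_power[OF DERIV_ident, of "Suc i"] by (simp add: has_field_derivative_at_within)
      from DERIV_cmult[OF this, of "coeff q i / real (Suc i)"]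
      show "((\<lambda>x. coeff q i * x ^ Suc i / real (Suc i)) has_real_derivative coeff q i * x ^ i) (at x within {0..1})"
        by (simp del: of_nat_Suc power_Suc)
    qed
  qed simp
  then show ?thesis by simp
qed

text \<open>Two endpoint values and two moments are the data available for the normal-normal
  component, a cubic on each edge; the quadratic version below serves the tangential-normal
  component.\<close>

lemma moments3_unique:
  fixes q :: "real poly"
  assumes "degree q \<le> 3" "poly q 0 = 0" "poly q 1 = 0"
    "integral {0..1} (\<lambda>s. poly q s) = 0" "integral {0..1} (\<lambda>s. poly q s * s) = 0"
  shows "q = 0"
proof (rule poly_eq_0_upto[OF assms(1)])
  fix i :: nat assume "i \<le> 3"
  have d: "degree (pCons 0 q) \<le> 4" using assms(1) by (simp add: degree_pCons_le[THEN order_trans])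
  \<comment> \<open>Multiplication by the variable is \<open>pCons 0\<close>, so the first moment is
    again the integral of a polynomial.\<close>
  have "(\<lambda>s. poly q s * s) = poly (pCons 0 q)" by (auto simp: mult.commute)
  then have "integral {0..1} (poly (pCons 0 q)) = 0" using assms(5) by simp
  then have e2: "(\<Sum>i\<le>4. coeff (pCons 0 q) i / real (Suc i)) = 0"
    using integral_unique[OF poly_has_integral[OF d]] by simp
  have e1: "(\<Sum>i\<le>3. coeff q i / real (Suc i)) = 0"
    using integral_unique[OF poly_has_integral[OF assms(1)]] assms(4) by simp
  have "coeff q 0 = 0" "coeff q 1 = 0" "coeff q 2 = 0" "coeff q 3 = 0"
    using assms(2,3) e1 e2 by (auto simp: poly_upto[OF assms(1)] eval_nat_numeral field_simps)
  moreover have "i = 0 \<or> i = 1 \<or> i = 2 \<or> i = 3" using \<open>i \<le> 3\<close> by linarith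
  ultimately show "coeff q i = 0" by auto
qed

lemma moments2_unique:
  fixes q :: "real poly"
  assumes "degree q \<le> 2" "poly q 0 = 0" "poly q 1 = 0" "integral {0..1} (\<lambda>s. poly q s) = 0"
  shows "q = 0"
proof (rule poly_eq_0_upto[OF assms(1)])
  fix i :: nat assume "i \<le> 2"
  have e1: "(\<Sum>i\<le>2. coeff q i / real (Suc i)) = 0"
    using integral_unique[OF poly_has_integral[OF assms(1)]] assms(4) by simp
  have "coeff q 0 = 0" "coeff q 1 = 0" "coeff q 2 = 0"
    using assms(2,3) e1 by (auto simp: poly_upto[OF assms(1)] eval_nat_numeral field_simps)
  moreover have "i = 0 \<or> i = 1 \<or> i = 2" using \<open>i \<le> 2\<close> by linarith
  ultimately show "coeff q i = 0" by auto
qed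

section \<open>Polynomial potentials\<close>

lemma polys_antiderivative:
  assumes "f \<in> polys k UNIV"
  obtains F where "F \<in> polys (Suc k) UNIV" "partial l F = f"
proof -
  have "\<exists>F\<in>polys (Suc k) UNIV. partial l F = f" using assms
  proof (induction rule: polys_induct)
    case (monom i j c)
    have "(\<lambda>x. monom2 (Suc i) j x *\<^sub>R (c / real (Suc i))) \<in> polys (Suc k) UNIV"
      "(\<lambda>x. monom2 i (Suc j) x *\<^sub>R (c / real (Suc j))) \<in> polys (Suc k) UNIV"
      using monom by (intro polys_monom; simp)+
    moreover have "partial 1 (\<lambda>x. monom2 (Suc i) j x *\<^sub>R (c / real (Suc i))) = (\<lambda>x. monom2 i j x *\<^sub>R c)"
      unfolding partial_monom2 by (simp del: of_nat_Suc)
    moreover have "partial 2 (\<lambda>x. monom2 i (Suc j) x *\<^sub>R (c / real (Suc j))) = (\<lambda>x. monom2 i j x *\<^sub>R c)"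
      unfolding partial_monom2 by (simp del: of_nat_Suc)
    ultimately show ?case using exhaust_2[of l] by auto
  next
    case zero show ?case by (intro bexI[of _ "\<lambda>_. 0"]) (auto simp: polys_zero)
  next
    case (add f g)
    then obtain F G where "F \<in> polys (Suc k) UNIV" "G \<in> polys (Suc k) UNIV" "partial l F = f" "partial l G = g" by blast
    then show ?case by (intro bexI[of _ "\<lambda>x. F x + G x"]) (auto simp: polys_partial_add polys_add)
  qed
  then show ?thesis using that by blast
qed

lemma polys_partial_zero_const:
  assumes "f \<in> polys k UNIV" "partial i f = (\<lambda>_. 0)" shows "f (x + s *\<^sub>R axis i 1) = f x"
proof -
  obtain q where q: "\<And>s. f (x + s *\<^sub>R axis i 1) = poly q s" using polys_line[OF assms(1)] by metis
  have "poly (pderiv q) s = 0" for s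
    using poly_line_deriv[OF polys_differentiable[OF assms(1)] q, of s] assms(2) by (simp add: partial_def dir_deriv_def fun_eq_iff)
  then have "pderiv q = 0" using poly_all_0_iff_0 by blast
  then obtain c where "q = [:c:]" using pderiv_iszero by blast
  then show ?thesis using q[of s] q[of 0] by simp
qed

lemma polys_project2: "(f :: real^2 \<Rightarrow> real) \<in> polys k UNIV \<Longrightarrow> (\<lambda>x. f ((x $ 2) *\<^sub>R axis 2 1)) \<in> polys k UNIV"
proof (induction rule: polys_induct)
  case (monom i j c)
  have "(\<lambda>x. monom2 i j ((x $ 2) *\<^sub>R axis 2 1 :: real^2) *\<^sub>R c) = (\<lambda>x. monom2 0 j x *\<^sub>R (if i = 0 then c else 0))"
    by (auto simp: axis_def)
  moreover have "(\<lambda>x. monom2 0 j x *\<^sub>R (if i = 0 then c else 0)) \<in> polys k UNIV" using monom by (intro polys_monom) simp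
  ultimately show ?case by simp
qed (auto simp: polys_zero polys_add)

lemma polys_Poincare:
  assumes f: "f \<in> polys k UNIV" and g: "g \<in> polys k UNIV" and eq: "partial 2 f = partial 1 g"
  obtains p where "p \<in> polys (Suc k) UNIV" "partial 1 p = f" "partial 2 p = g"
proof -
  obtain F where F: "F \<in> polys (Suc k) UNIV" "partial 1 F = f" using polys_antiderivative[OF f] by metis
  have pF: "partial 2 F \<in> polys k UNIV" using polys_partial[OF F(1)] by simp
  \<comment> \<open>What \<open>F\<close> does not yet explain of \<open>g\<close>; by the
    integrability condition it depends on the second coordinate only.\<close>
  define g' where "g' = (\<lambda>x. g x - partial 2 F x)"
  have g': "g' \<in> polys k UNIV" unfolding g'_def using g pF by (rule polys_diff)
  have "partial 1 g' x = partial 1 g x - partial 1 (partial 2 F) x" for x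
    unfolding g'_def using g pF by (intro partial_diff polys_differentiable)
  then have p1: "partial 1 g' = (\<lambda>_. 0)"
    using eq polys_partial_commute[OF F(1), of 1 2] F(2) by auto
  obtain G where G: "G \<in> polys (Suc k) UNIV" "partial 2 G = g'" using polys_antiderivative[OF g'] by metis
  \<comment> \<open>\<open>G\<close> may contain the first coordinate; evaluating it on the axis
    removes this dependence. As \<open>g'\<close> does not depend on the first coordinate, the
    derivative along the second one is still \<open>g'\<close>.\<close>
  define H where "H = (\<lambda>x::real^2. G ((x $ 2) *\<^sub>R axis 2 1))"
  have H: "H \<in> polys (Suc k) UNIV" unfolding H_def using G(1) by (rule polys_project2)
  have HD: "(H has_derivative (\<lambda>h. frechet_derivative G (at ((x $ 2) *\<^sub>R axis 2 1)) ((h $ 2) *\<^sub>R axis 2 1))) (at x)" for x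
    unfolding H_def
    by (rule has_derivative_compose[OF _ frechet_D[OF polys_differentiable[OF G(1)]]]) (auto intro!: derivative_eq_intros bounded_linear.has_derivative[OF bounded_linear_vec_nth])
  have lin: "linear (frechet_derivative G (at x))" for x
    using polys_differentiable[OF G(1)] by (rule linear_frechet_derivative)
  have H1: "partial 1 H x = 0" for x
    unfolding partial_eqI[OF HD] using linear_0[OF lin] by (simp add: axis_def)
  have H2: "partial 2 H x = g' x" for x
  proof -
    have "partial 2 H x = partial 2 G ((x $ 2) *\<^sub>R axis 2 1)"
      unfolding partial_eqI[OF HD] by (simp add: partial_def axis_def)
    also have "\<dots> = g' ((x $ 2) *\<^sub>R axis 2 1)" using G(2) by simp
    also have "\<dots> = g' ((x $ 2) *\<^sub>R axis 2 1 + (x $ 1) *\<^sub>R axis 1 1)" using polys_partial_zero_const[OF g' p1] by simp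
    also have "\<dots> = g' x" using vec2_expand[of x] by (simp add: add.commute)
    finally show ?thesis .
  qed
  show ?thesis
  proof (rule that[of "\<lambda>x. F x + H x"])
    show "(\<lambda>x. F x + H x) \<in> polys (Suc k) UNIV" using F(1) H by (rule polys_add)
    show "partial 1 (\<lambda>x. F x + H x) = f" using polys_partial_add[OF F(1) H] F(2) H1 by auto
    show "partial 2 (\<lambda>x. F x + H x) = g" using polys_partial_add[OF F(1) H] H2 by (auto simp: g'_def)
  qed
qed

section \<open>Bump functions\<close>

text \<open>The terms that occur in derivatives of the flat function
  \<open>exp (- inverse s)\<close>. The span of the family is closed under differentiation, see
  \<open>theta_deriv\<close>, and every member tends to 0 at 0.\<close>

definition theta :: "nat \<Rightarrow> real \<Rightarrow> real" where
  "theta k s = (if s > 0 then exp (- inverse s) * inverse s ^ k else 0)"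

lemma theta_tendsto_0: "(theta k \<longlongrightarrow> 0) (at 0)"
proof (rule filterlim_split_at)
  have "((\<lambda>x. x ^ k / exp x) \<longlongrightarrow> (0::real)) at_top" by (rule tendsto_power_div_exp_0)
  then have "((\<lambda>s. inverse s ^ k / exp (inverse s)) \<longlongrightarrow> (0::real)) (at_right 0)"
    by (rule filterlim_compose) (rule filterlim_inverse_at_top_right)
  then show "(theta k \<longlongrightarrow> 0) (at_right 0)"
    by (rule Lim_transform_eventually) (auto simp: eventually_at_right_less theta_def exp_minus field_simps intro: eventually_mono[OF eventually_at_right_less])
  have "eventually (\<lambda>s. theta k s = 0) (at_left 0)"
    by (auto simp: theta_def eventually_at_filter)
  then show "(theta k \<longlongrightarrow> 0) (at_left 0)" by (rule tendsto_eventually)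
qed

lemma theta_deriv: "(theta k has_real_derivative (theta (k + 2) s - real k * theta (k + 1) s)) (at s)"
proof -
  consider "s > 0" | "s < 0" | "s = 0" by linarith
  then show ?thesis
  proof cases
    case 1
    have "((\<lambda>s. exp (- inverse s) * inverse s ^ k) has_real_derivative (theta (k + 2) s - real k * theta (k + 1) s)) (at s)"
    proof -
      have "k * inverse s ^ (k - 1) * inverse s ^ 2 = k * inverse s ^ (k + 1)"
        by (cases k) (auto simp: power2_eq_square)
      then show ?thesis
        using 1 by (auto intro!: derivative_eq_intros simp: theta_def power2_eq_square algebra_simps)
    qed
    then show ?thesis
      by (rule has_field_derivative_transform_within_open[of _ _ _ "{0<..}"]) (use 1 in \<open>auto simp: theta_def\<close>)
  next
    case 2
    have "((\<lambda>_. 0) has_real_derivative (theta (k + 2) s - real k * theta (k + 1) s)) (at s)"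
      using 2 by (simp add: theta_def)
    then show ?thesis
      by (rule has_field_derivative_transform_within_open[of _ _ _ "{..<0}"]) (use 2 in \<open>auto simp: theta_def\<close>)
  next
    case 3
    \<comment> \<open>The difference quotient at 0 is the next member of the family, whose limit is
      already known.\<close>
    have "(\<lambda>h. (theta k (0 + h) - theta k 0) / h) = theta (Suc k)"
      by (auto simp: theta_def field_simps)
    then show ?thesis using theta_tendsto_0[of "Suc k"] unfolding 3 DERIV_def by (simp add: theta_def)
  qed
qed

text \<open>An algebra of differentiable functions stable under partial derivatives: smoothness of
  its members follows from a single differentiation step.\<close>

inductive_set theta_alg :: "(real^2 \<Rightarrow> real) set" where
  const: "(\<lambda>_. c) \<in> theta_alg"
| theta: "(\<lambda>x. theta k (\<alpha> * x $ i + \<beta>)) \<in> theta_alg"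
| add: "f \<in> theta_alg \<Longrightarrow> g \<in> theta_alg \<Longrightarrow> (\<lambda>x. f x + g x) \<in> theta_alg"
| mult: "f \<in> theta_alg \<Longrightarrow> g \<in> theta_alg \<Longrightarrow> (\<lambda>x. f x * g x) \<in> theta_alg"

lemma theta_alg_has_derivative:
  "((\<lambda>x. theta k (\<alpha> * x $ i + \<beta>)) has_derivative (\<lambda>h. (theta (k + 2) (\<alpha> * x $ i + \<beta>) - real k * theta (k + 1) (\<alpha> * x $ i + \<beta>)) * (\<alpha> * h $ i))) (at (x::real^2))"
proof -
  have "((\<lambda>x. \<alpha> * x $ i + \<beta>) has_derivative (\<lambda>h. \<alpha> * h $ i)) (at x)"
    by (auto intro!: derivative_eq_intros bounded_linear.has_derivative[OF bounded_linear_vec_nth])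
  from has_derivative_compose[OF this theta_deriv[unfolded has_field_derivative_def]]
  show ?thesis .
qed

lemma theta_alg_differentiable: "f \<in> theta_alg \<Longrightarrow> f differentiable at x"
proof (induction rule: theta_alg.induct)
  case theta then show ?case using theta_alg_has_derivative differentiable_def by blast
qed auto

lemma theta_alg_partial: "f \<in> theta_alg \<Longrightarrow> partial i f \<in> theta_alg"
proof (induction rule: theta_alg.induct)
  case (const c)
  have "partial i (\<lambda>_. c) = (\<lambda>_. 0)" by (auto simp: partial_const)
  then show ?case using theta_alg.const[of 0] by simp
next
  case (theta k \<alpha> j \<beta>)
  have "partial i (\<lambda>x. theta k (\<alpha> * x $ j + \<beta>)) = (\<lambda>x. (theta (k + 2) (\<alpha> * x $ j + \<beta>) + (- real k) * theta (k + 1) (\<alpha> * x $ j + \<beta>)) * (\<alpha> * axis i 1 $ j))"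
    by (rule ext) (simp only: partial_eqI[OF theta_alg_has_derivative], simp)
  moreover have "\<dots> \<in> theta_alg" by (intro theta_alg.intros)
  ultimately show ?case by (simp only:)
next
  case (add f g)
  have "partial i (\<lambda>x. f x + g x) = (\<lambda>x. partial i f x + partial i g x)"
    using add by (auto intro!: ext partial_add theta_alg_differentiable)
  then show ?case using add by (auto intro: theta_alg.intros)
next
  case (mult f g)
  have "partial i (\<lambda>x. f x * g x) = (\<lambda>x. f x * partial i g x + partial i f x * g x)"
    using mult by (auto intro!: ext partial_mult theta_alg_differentiable)
  then show ?case using mult by (auto intro: theta_alg.intros)
qed

lemma theta_alg_smooth: "f \<in> theta_alg \<Longrightarrow> smooth f"
proof -
  assume f: "f \<in> theta_alg"
  have "partials is f \<in> theta_alg" for "is"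
    by (induction "is") (use f theta_alg_partial in \<open>auto simp: partials_def\<close>)
  then show ?thesis unfolding smooth_def
    using theta_alg_differentiable differentiable_at_imp_differentiable_on by blast
qed

text \<open>The arguments are written as \<open>\<alpha> * x $ i + \<beta>\<close> to fit
  \<open>theta_alg\<close>. Scaling by \<open>m\<close> steepens the flanks: the bumps vanish off
  the open box, are bounded by 1 and tend pointwise to its indicator.\<close>

definition box_bump :: "real^2 \<Rightarrow> real^2 \<Rightarrow> nat \<Rightarrow> real^2 \<Rightarrow> real" where
  "box_bump a b m x = theta 0 (real m * x $ 1 + - (real m * a $ 1)) * theta 0 (- real m * x $ 1 + real m * b $ 1)
     * (theta 0 (real m * x $ 2 + - (real m * a $ 2)) * theta 0 (- real m * x $ 2 + real m * b $ 2))"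

lemma box_bump_smooth: "smooth (box_bump a b m)"
  unfolding box_bump_def[abs_def] by (intro theta_alg_smooth theta_alg.intros)

lemma theta0_bounds: "0 \<le> theta 0 s" "theta 0 s \<le> 1"
  by (auto simp: theta_def)

lemma box_bump_bounds: "\<bar>box_bump a b m x\<bar> \<le> 1"
  unfolding box_bump_def abs_mult using theta0_bounds by (intro mult_le_one) auto

lemma mem_box2: "(x::real^2) \<in> box a b \<longleftrightarrow> a $ 1 < x $ 1 \<and> x $ 1 < b $ 1 \<and> a $ 2 < x $ 2 \<and> x $ 2 < b $ 2"
  by (auto simp: mem_box_cart forall_2)

lemma box_bump_zero: "x \<notin> box a b \<Longrightarrow> box_bump a b m x = 0"
proof -
  assume "x \<notin> box a b"
  then consider "x $ 1 \<le> a $ 1" | "b $ 1 \<le> x $ 1" | "x $ 2 \<le> a $ 2" | "b $ 2 \<le> x $ 2"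
    unfolding mem_box2 by linarith
  then show ?thesis
  proof cases
    case 1 then have "real m * x $ 1 \<le> real m * a $ 1" by (intro mult_left_mono) auto
    then show ?thesis by (simp add: box_bump_def theta_def)
  next
    case 2 then have "real m * b $ 1 \<le> real m * x $ 1" by (intro mult_left_mono) auto
    then show ?thesis by (simp add: box_bump_def theta_def)
  next
    case 3 then have "real m * x $ 2 \<le> real m * a $ 2" by (intro mult_left_mono) auto
    then show ?thesis by (simp add: box_bump_def theta_def)
  next
    case 4 then have "real m * b $ 2 \<le> real m * x $ 2" by (intro mult_left_mono) auto
    then show ?thesis by (simp add: box_bump_def theta_def)
  qed
qed

lemma theta0_limit: "c > 0 \<Longrightarrow> (\<lambda>m. theta 0 (real m * c)) \<longlonglongrightarrow> 1"
proof -
  assume c: "c > 0"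
  have "filterlim (\<lambda>m. real m * c) at_top sequentially"
    using c filterlim_tendsto_pos_mult_at_top[OF tendsto_const[of c] c filterlim_real_sequentially] by (simp add: mult.commute)
  then have "(\<lambda>m. exp (- inverse (real m * c))) \<longlonglongrightarrow> exp (- 0)"
    by (intro tendsto_intros filterlim_compose[OF tendsto_inverse_0_at_top]) (rule filterlim_ident)
  moreover have "eventually (\<lambda>m. exp (- inverse (real m * c)) = theta 0 (real m * c)) sequentially"
    using eventually_gt_at_top[of 0] by eventually_elim (use c in \<open>auto simp: theta_def\<close>)
  ultimately show ?thesis by (simp add: Lim_transform_eventually)
qed

lemma box_bump_limit: "(\<lambda>m. box_bump a b m x) \<longlonglongrightarrow> indicator (box a b) x"
proof (cases "x \<in> box a b")
  case True
  then have "(\<lambda>m. theta 0 (real m * (x $ 1 - a $ 1)) * theta 0 (real m * (b $ 1 - x $ 1))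
     * (theta 0 (real m * (x $ 2 - a $ 2)) * theta 0 (real m * (b $ 2 - x $ 2)))) \<longlonglongrightarrow> 1 * 1 * (1 * 1)"
    unfolding mem_box2 by (intro tendsto_intros theta0_limit) auto
  then show ?thesis using True by (simp add: box_bump_def[abs_def] algebra_simps)
qed (simp add: box_bump_zero)

lemma box_bump_test_function:
  assumes "cbox a b \<subseteq> U" shows "box_bump a b m \<in> test_functions U"
proof -
  have "closure {x. box_bump a b m x \<noteq> 0} \<subseteq> closure (box a b)"
    using box_bump_zero by (intro closure_mono) blast
  also have "\<dots> \<subseteq> cbox a b" by (intro closure_minimal box_subset_cbox closed_cbox)
  finally have *: "closure {x. box_bump a b m x \<noteq> 0} \<subseteq> cbox a b" .
  then have "compact (closure {x. box_bump a b m x \<noteq> 0})"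
    using bounded_cbox bounded_subset compact_eq_bounded_closed by blast
  then show ?thesis using * assms box_bump_smooth by (auto simp: test_functions_def)
qed

section \<open>Test functions\<close>

lemma test_function_smooth_differentiable: "smooth \<phi> \<Longrightarrow> \<phi> differentiable at x"
  unfolding smooth_def by (metis UNIV_I differentiable_on_eq_differentiable_at foldr.simps(1) id_apply open_UNIV partials_def)

lemma test_function_differentiable: "\<phi> \<in> test_functions U \<Longrightarrow> \<phi> differentiable at x"
  using test_function_smooth_differentiable by (auto simp: test_functions_def)

lemma test_function_outside: "\<phi> \<in> test_functions U \<Longrightarrow> x \<notin> U \<Longrightarrow> \<phi> x = 0"
  using closure_subset[of "{x. \<phi> x \<noteq> 0}"] unfolding test_functions_def by blast

lemma smooth_partial: "smooth \<phi> \<Longrightarrow> smooth (partial i \<phi>)"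
  unfolding smooth_def
proof
  fix "is" assume "\<forall>is. partials is \<phi> differentiable_on UNIV"
  then have "partials (is @ [i]) \<phi> differentiable_on UNIV" by blast
  then show "partials is (partial i \<phi>) differentiable_on UNIV" by (simp add: partials_def)
qed

lemma test_function_partial: "\<phi> \<in> test_functions U \<Longrightarrow> partial i \<phi> \<in> test_functions U"
proof -
  assume \<phi>: "\<phi> \<in> test_functions U"
  let ?S = "closure {x. \<phi> x \<noteq> 0}"
  have "partial i \<phi> x = 0" if "x \<notin> ?S" for x
  proof -
    have "partial i \<phi> x = partial i (\<lambda>_. 0) x"
    proof (rule partial_cong_open[of "- ?S"])
      fix y assume "y \<in> - ?S"
      then show "\<phi> y = 0" using closure_subset[of "{x. \<phi> x \<noteq> 0}"] by blast
    qed (use that in auto)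
    then show ?thesis by simp
  qed
  then have "closure {x. partial i \<phi> x \<noteq> 0} \<subseteq> ?S" by (intro closure_minimal) auto
  moreover from this have "compact (closure {x. partial i \<phi> x \<noteq> 0})"
    using \<phi> compact_eq_bounded_closed bounded_subset closed_closure unfolding test_functions_def by (metis (no_types, lifting) mem_Collect_eq)
  ultimately show ?thesis using \<phi> smooth_partial by (auto simp: test_functions_def)
qed

lemma test_function_continuous: "\<phi> \<in> test_functions U \<Longrightarrow> continuous_on S \<phi>"
  by (intro differentiable_imp_continuous_on differentiable_at_imp_differentiable_on test_function_differentiable)

lemma test_function_support: "\<phi> \<in> test_functions U \<Longrightarrow> \<exists>R>0. \<forall>x. \<phi> x \<noteq> 0 \<longrightarrow> norm x \<le> R"
proof -
  assume "\<phi> \<in> test_functions U"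
  then have "bounded {x. \<phi> x \<noteq> 0}"
    using compact_imp_bounded bounded_subset closure_subset unfolding test_functions_def by blast
  then obtain R where "R > 0" "\<forall>x\<in>{x. \<phi> x \<noteq> 0}. norm x \<le> R" unfolding bounded_pos by blast
  then show ?thesis by auto
qed

lemma test_function_bounded: "\<phi> \<in> test_functions U \<Longrightarrow> \<exists>B>0. \<forall>x. \<bar>\<phi> x\<bar> \<le> B"
proof -
  assume \<phi>: "\<phi> \<in> test_functions U"
  obtain R where R: "R > 0" "\<forall>x. \<phi> x \<noteq> 0 \<longrightarrow> norm x \<le> R" using test_function_support[OF \<phi>] by blast
  have "bounded (\<phi> ` cball 0 R)"
    using test_function_continuous[OF \<phi>] by (intro compact_imp_bounded compact_continuous_image) auto
  then obtain B where "B > 0" "\<forall>x\<in>cball 0 R. \<bar>\<phi> x\<bar> \<le> B" unfolding bounded_pos by auto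
  then show ?thesis using R by (intro exI[of _ B]) (metis abs_zero less_imp_le mem_cball_0)
qed

text \<open>The factor 2 comes from estimating the derivative by its two components.\<close>

lemma Lipschitz_partial_bound:
  fixes f :: "real^2 \<Rightarrow> real"
  assumes "convex S" "\<And>x. x \<in> S \<Longrightarrow> f differentiable at x" "\<And>x i. x \<in> S \<Longrightarrow> \<bar>partial i f x\<bar> \<le> B"
    "x \<in> S" "y \<in> S"
  shows "\<bar>f x - f y\<bar> \<le> 2 * B * norm (x - y)"
proof -
  have "norm (f x - f y) \<le> (2 * B) * norm (x - y)"
  proof (rule differentiable_bound[OF assms(1) _ _ assms(4,5)])
    fix z assume z: "z \<in> S"
    show "(f has_derivative frechet_derivative f (at z)) (at z within S)"
      using frechet_D[OF assms(2)[OF z]] has_derivative_at_withinI by blast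
    show "onorm (frechet_derivative f (at z)) \<le> 2 * B"
    proof (rule onorm_le)
      fix h :: "real^2"
      have "\<bar>h $ 1 * partial 1 f z + h $ 2 * partial 2 f z\<bar> \<le> \<bar>h $ 1 * partial 1 f z\<bar> + \<bar>h $ 2 * partial 2 f z\<bar>" by linarith
      also have "\<dots> \<le> norm h * B + norm h * B"
        unfolding abs_mult using assms(3)[OF z] component_le_norm_cart[of h]
        by (intro add_mono mult_mono) auto
      finally show "norm (frechet_derivative f (at z) h) \<le> 2 * B * norm h"
        unfolding frechet_partial[OF assms(2)[OF z]] by simp
    qed
  qed
  then show ?thesis by simp
qed

lemma test_function_Lipschitz: "\<phi> \<in> test_functions U \<Longrightarrow> \<exists>L>0. \<forall>x y. \<bar>\<phi> x - \<phi> y\<bar> \<le> L * norm (x - y)"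
proof -
  assume \<phi>: "\<phi> \<in> test_functions U"
  obtain B1 where B1: "B1 > 0" "\<forall>x. \<bar>partial 1 \<phi> x\<bar> \<le> B1" using test_function_bounded[OF test_function_partial[OF \<phi>]] by blast
  obtain B2 where B2: "B2 > 0" "\<forall>x. \<bar>partial 2 \<phi> x\<bar> \<le> B2" using test_function_bounded[OF test_function_partial[OF \<phi>]] by blast
  have "\<bar>partial i \<phi> x\<bar> \<le> max B1 B2" for i x using exhaust_2[of i] B1(2) B2(2) by (metis max.coboundedI1 max.coboundedI2)
  then have "\<bar>\<phi> x - \<phi> y\<bar> \<le> 2 * max B1 B2 * norm (x - y)" for x y
    using test_function_differentiable[OF \<phi>] by (intro Lipschitz_partial_bound[of UNIV]) auto
  then show ?thesis using B1(1) by (intro exI[of _ "2 * max B1 B2"]) auto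
qed

lemma polys_bounded:
  assumes "(p::real^2 \<Rightarrow> real) \<in> polys k UNIV" "bounded S" shows "\<exists>B>0. \<forall>x\<in>S. \<bar>p x\<bar> \<le> B"
proof -
  have "bounded (p ` closure S)"
    using assms polys_continuous by (intro compact_imp_bounded compact_continuous_image) auto
  then obtain B where "B > 0" "\<forall>x\<in>closure S. \<bar>p x\<bar> \<le> B" unfolding bounded_pos by auto
  then show ?thesis using closure_subset by blast
qed

lemma polys_Lipschitz:
  assumes p: "(p::real^2 \<Rightarrow> real) \<in> polys k UNIV" and "bounded S" "convex S"
  shows "\<exists>L>0. \<forall>x\<in>S. \<forall>y\<in>S. \<bar>p x - p y\<bar> \<le> L * norm (x - y)"
proof -
  obtain B1 where B1: "B1 > 0" "\<forall>x\<in>S. \<bar>partial 1 p x\<bar> \<le> B1" using polys_bounded[OF polys_partial[OF p] assms(2)] by blast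
  obtain B2 where B2: "B2 > 0" "\<forall>x\<in>S. \<bar>partial 2 p x\<bar> \<le> B2" using polys_bounded[OF polys_partial[OF p] assms(2)] by blast
  have "\<bar>partial i p x\<bar> \<le> max B1 B2" if "x \<in> S" for i x using exhaust_2[of i] B1(2) B2(2) that by (metis max.coboundedI1 max.coboundedI2)
  then have "\<bar>p x - p y\<bar> \<le> 2 * max B1 B2 * norm (x - y)" if "x \<in> S" "y \<in> S" for x y
    using that polys_differentiable[OF p] by (intro Lipschitz_partial_bound[OF assms(3)]) auto
  then show ?thesis using B1(1) by (intro exI[of _ "2 * max B1 B2"]) auto
qed

section \<open>The fundamental lemma of the calculus of variations\<close>

text \<open>Dominated convergence, with \<open>\<bar>f x\<bar>\<close> as majorant of the products
  with the bumps.\<close>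

lemma integral_bump_zero_imp_box_zero:
  fixes f :: "real^2 \<Rightarrow> real"
  assumes f: "integrable lebesgue f"
    and 0: "\<And>m. integral\<^sup>L lebesgue (\<lambda>x. f x * box_bump a b m x) = 0"
  shows "integral\<^sup>L lebesgue (\<lambda>x. f x * indicator (box a b) x) = 0"
proof -
  have [measurable]: "box_bump a b m \<in> borel_measurable lebesgue" for m
  proof -
    have "continuous_on UNIV (box_bump a b m)"
      using box_bump_smooth test_function_smooth_differentiable
      by (intro differentiable_imp_continuous_on differentiable_at_imp_differentiable_on) blast
    then show ?thesis using borel_measurable_continuous_onI by (intro measurable_completion) auto
  qed
  have "(\<lambda>m. integral\<^sup>L lebesgue (\<lambda>x. f x * box_bump a b m x)) \<longlonglongrightarrow> integral\<^sup>L lebesgue (\<lambda>x. f x * indicator (box a b) x)"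
  proof (rule integral_dominated_convergence[where w = "\<lambda>x. \<bar>f x\<bar>"])
    show "(\<lambda>x. f x * indicator (box a b) x) \<in> borel_measurable lebesgue"
      using f by (intro borel_measurable_times borel_measurable_indicator) auto
    show "(\<lambda>x. f x * box_bump a b m x) \<in> borel_measurable lebesgue" for m using f by measurable
    show "AE x in lebesgue. (\<lambda>m. f x * box_bump a b m x) \<longlonglongrightarrow> f x * indicator (box a b) x"
      by (intro AE_I2 tendsto_intros box_bump_limit)
    show "AE x in lebesgue. norm (f x * box_bump a b m x) \<le> \<bar>f x\<bar>" for m
      using box_bump_bounds[of a b m] by (intro AE_I2) (auto simp: abs_mult intro: mult_left_le)
  qed (use f in auto)
  then show ?thesis using 0 LIMSEQ_unique[OF _ tendsto_const] by simp
qed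

text \<open>Boxes are stable under intersection and generate the Borel sets, so the integral of
  \<open>h\<close> vanishes over every Borel set; the total integral enters for complements. The
  sets where \<open>h\<close> or \<open>- h\<close> is positive are then tested.\<close>

lemma set_integral_boxes_zero_imp_AE_zero:
  fixes h :: "'a::euclidean_space \<Rightarrow> real"
  assumes h: "integrable lborel h" and box0: "\<And>a b. (LINT x:box a b|lborel. h x) = 0" and tot: "(LINT x|lborel. h x) = 0"
  shows "AE x in lborel. h x = 0"
proof -
  have si: "set_integrable lborel A h" if "A \<in> sets borel" for A
    using h that unfolding set_integrable_def by (intro integrable_mult_indicator) auto
  have Z: "(LINT x:A|lborel. h x) = 0" if A: "A \<in> sets borel" for A
  proof -
    let ?G = "range (\<lambda>(a, b). box a b :: 'a set)"
    have "Int_stable ?G" by (auto simp: Int_stable_def box_Int_box)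
    moreover have "?G \<subseteq> Pow UNIV" by simp
    moreover have "A \<in> sigma_sets UNIV ?G" using A by (simp add: borel_eq_box)
    ultimately show ?thesis
    proof (induction rule: sigma_sets_induct_disjoint)
      case (basic A) then show ?case using box0 by auto
    next
      case empty then show ?case by (simp add: set_lebesgue_integral_def)
    next
      case (compl A)
      then have "A \<in> sets borel" by (simp add: borel_eq_box)
      have "(LINT x:A \<union> (UNIV - A)|lborel. h x) = (LINT x:A|lborel. h x) + (LINT x:UNIV - A|lborel. h x)"
        using \<open>A \<in> sets borel\<close> by (intro set_integral_Un si) auto
      then show ?case using compl.IH tot by (simp add: set_lebesgue_integral_def)
    next
      case (union A)
      then have "A i \<in> sets borel" for i by (auto simp: borel_eq_box)
      then have "(LINT x:(\<Union>i. A i)|lborel. h x) = (\<Sum>i. (LINT x:(A i)|lborel. h x))"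
        using union(1) by (intro lebesgue_integral_countable_add si) (auto simp: disjoint_family_on_def)
      then show ?case using union by simp
    qed
  qed
  have [measurable]: "h \<in> borel_measurable borel" using h by auto
  have pos: "AE x in lborel. f x \<le> 0" if f: "f = h \<or> f = (\<lambda>x. - h x)" for f
  proof -
    have [measurable]: "f \<in> borel_measurable borel" using f by auto
    have "{x. f x > 0} \<in> sets borel" by measurable
    then have "(LINT x:{x. f x > 0}|lborel. h x) = 0" by (rule Z)
    then have "(LINT x:{x. f x > 0}|lborel. f x) = 0" using f by (auto simp: set_lebesgue_integral_def)
    moreover have "integrable lborel (\<lambda>x. indicator {x. f x > 0} x *\<^sub>R f x)"
      using h f \<open>{x. f x > 0} \<in> sets borel\<close> by (intro integrable_mult_indicator) auto
    ultimately have "AE x in lborel. indicator {x. f x > 0} x *\<^sub>R f x = 0"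
      unfolding set_lebesgue_integral_def
      by (subst (asm) integral_nonneg_eq_0_iff_AE) (auto simp: indicator_def)
    then show ?thesis by (rule AE_mp) (auto simp: indicator_def)
  qed
  have "AE x in lborel. h x \<le> 0" "AE x in lborel. - h x \<le> 0"
    using pos[of h] pos[of "\<lambda>x. - h x"] by simp_all
  then show ?thesis by eventually_elim auto
qed

lemma du_Bois_Reymond:
  fixes g :: "real^2 \<Rightarrow> real"
  assumes U: "open U" "U \<subseteq> \<Omega>" and \<Omega>: "\<Omega> \<in> sets lebesgue" and g: "integrable (lebesgue_on \<Omega>) g"
    and 0: "\<And>\<phi>. \<phi> \<in> test_functions U \<Longrightarrow> integral\<^sup>L (lebesgue_on \<Omega>) (\<lambda>x. g x * \<phi> x) = 0"
  shows "AE x in lebesgue. x \<in> U \<longrightarrow> g x = 0"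
proof -
  define f where "f x = indicator \<Omega> x * g x" for x
  have f: "integrable lebesgue f"
    using g \<Omega> unfolding f_def by (simp add: integrable_restrict_space)
  have f0: "integral\<^sup>L lebesgue (\<lambda>x. f x * indicator (box a b) x) = 0" if "cbox a b \<subseteq> U" for a b
  proof (rule integral_bump_zero_imp_box_zero[OF f])
    fix m
    have "integral\<^sup>L (lebesgue_on \<Omega>) (\<lambda>x. g x * box_bump a b m x) = 0"
      by (rule 0[OF box_bump_test_function[OF that]])
    then show "integral\<^sup>L lebesgue (\<lambda>x. f x * box_bump a b m x) = 0"
      using \<Omega> by (simp add: integral_restrict_space f_def mult.assoc)
  qed
  \<comment> \<open>The box argument lives on Borel sets, so a Borel representative replaces the
    Lebesgue measurable \<open>f\<close>.\<close>
  obtain f' where f': "f' \<in> borel_measurable lborel" "AE x in lborel. f x = f' x"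
    using completion_ex_borel_measurable_real[of f lborel] f by auto
  have ff': "AE x in lebesgue. f x = f' x" using f'(2) by (rule AE_completion)
  have m': "f' \<in> borel_measurable lebesgue" using f'(1) by (rule measurable_completion)
  have f'i: "integrable lborel f'"
    using f integrable_cong_AE[OF _ m' ff'] f'(1) by (auto simp: integrable_completion)
  have f'0: "integral\<^sup>L lborel (\<lambda>x. indicator (box a b) x * f' x) = 0" if "cbox a b \<subseteq> U" for a b
  proof -
    have [measurable]: "box a b \<in> sets lebesgue" by simp
    have "integral\<^sup>L lborel (\<lambda>x. indicator (box a b) x * f' x) = integral\<^sup>L lebesgue (\<lambda>x. indicator (box a b) x * f' x)"
      using f'(1) by (intro integral_completion[symmetric]) auto
    also have "\<dots> = integral\<^sup>L lebesgue (\<lambda>x. f x * indicator (box a b) x)"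
    proof (rule integral_cong_AE)
      show "(\<lambda>x. indicator (box a b) x * f' x) \<in> borel_measurable lebesgue" using m' by measurable
      show "(\<lambda>x. f x * indicator (box a b) x) \<in> borel_measurable lebesgue" using f by measurable
      show "AE x in lebesgue. indicator (box a b) x * f' x = f x * indicator (box a b) x"
        using ff' by eventually_elim simp
    qed
    finally show ?thesis using f0[OF that] by simp
  qed
  have onbox: "AE x in lebesgue. x \<in> cbox c d \<longrightarrow> g x = 0" if cd: "cbox c d \<subseteq> U" for c d
  proof -
    \<comment> \<open>Vanishing integrals are known only for boxes whose closure lies in
      \<open>U\<close>; cutting off at a fixed box inside \<open>U\<close> extends this to all
      boxes.\<close>
    define h where "h x = indicator (box c d) x * f' x" for x
    have hi: "integrable lborel h" unfolding h_def using f'i integrable_mult_indicator[of "box c d" lborel f'] by simp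
    have "AE x in lborel. h x = 0"
    proof (rule set_integral_boxes_zero_imp_AE_zero[OF hi])
      fix a b :: "real^2"
      obtain p q where pq: "box a b \<inter> box c d = box p q"
        using box_Int_box[of a b c d] by blast
      show "(LINT x:box a b|lborel. h x) = 0"
      proof (cases "box p q = {}")
        case True
        then have "(\<lambda>x. indicator (box a b) x *\<^sub>R h x) = (\<lambda>_. 0)" using pq by (auto simp: h_def indicator_def fun_eq_iff)
        then show ?thesis unfolding set_lebesgue_integral_def by (simp only: integral_zero)
      next
        case False
        then have "cbox p q = closure (box p q)" by (simp add: closure_box)
        also have "\<dots> \<subseteq> closure (box c d)" using pq by (intro closure_mono) auto
        also have "\<dots> \<subseteq> cbox c d" by (intro closure_minimal box_subset_cbox closed_cbox)
        finally have "cbox p q \<subseteq> U" using cd by auto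
        moreover have "(\<lambda>x. indicator (box a b) x *\<^sub>R h x) = (\<lambda>x. indicator (box p q) x * f' x)"
          unfolding h_def pq[symmetric] by (auto simp: indicator_def fun_eq_iff)
        ultimately show ?thesis using f'0 unfolding set_lebesgue_integral_def by (simp only:)
      qed
    next
      show "(LINT x|lborel. h x) = 0" unfolding h_def using f'0[OF cd] .
    qed
    then have h0: "AE x in lebesgue. h x = 0" by (rule AE_completion)
    have "cbox c d - box c d \<in> null_sets lebesgue"
      using negligible_frontier_interval negligible_iff_null_sets by blast
    then have "AE x in lebesgue. x \<notin> cbox c d - box c d" by (rule AE_not_in)
    with h0 ff' show ?thesis
      by eventually_elim (use cd U(2) box_subset_cbox[of c d] in \<open>auto simp: h_def f_def indicator_def split: if_splits\<close>)
  qed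
  obtain \<D> where \<D>: "countable \<D>" "\<And>X. X \<in> \<D> \<Longrightarrow> \<exists>a b. X = cbox a b" "\<Union>\<D> = U"
    using open_countable_Union_open_cbox[OF U(1)] by metis
  have "AE x in lebesgue. \<forall>X\<in>\<D>. x \<in> X \<longrightarrow> g x = 0"
  proof (subst AE_ball_countable[OF \<D>(1)], intro ballI)
    fix X assume X: "X \<in> \<D>"
    then obtain a b where "X = cbox a b" using \<D>(2) by blast
    then show "AE x in lebesgue. x \<in> X \<longrightarrow> g x = 0" using onbox[of a b] X \<D>(3) by blast
  qed
  then show ?thesis by eventually_elim (use \<D>(3) in auto)
qed

section \<open>Integration by parts by translation invariance\<close>

text \<open>Translation invariance makes the integral of each difference quotient zero; the
  increment bound and the bounded support dominate them, so the limit passes under the integral. For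
  products with test functions this is integration by parts. Increments are controlled in the single
  direction \<open>d\<close> only, which is all that an edge bubble offers.\<close>

lemma integral_difference_quotient_limit:
  fixes F G :: "real^2 \<Rightarrow> real"
  assumes F: "integrable lborel F" and G: "G \<in> borel_measurable lebesgue"
    and L: "\<And>x h. 0 < h \<Longrightarrow> h \<le> 1 \<Longrightarrow> \<bar>F (x + h *\<^sub>R d) - F x\<bar> \<le> L * h"
    and R: "\<And>x. F x \<noteq> 0 \<Longrightarrow> norm x \<le> R"
    and der: "AE x in lebesgue. ((\<lambda>h. F (x + h *\<^sub>R d)) has_real_derivative G x) (at 0)"
  shows "integral\<^sup>L lebesgue G = 0"
proof -
  define e where "e n = inverse (real (Suc n))" for n
  have e: "0 < e n" "e n \<le> 1" for n by (auto simp: e_def inverse_le_1_iff)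
  define f where "f n x = (F (x + e n *\<^sub>R d) - F x) / e n" for n x
  have [measurable]: "F \<in> borel_measurable borel" using F by auto
  have fm: "f n \<in> borel_measurable borel" for n unfolding f_def[abs_def] by measurable
  have L0: "L \<ge> 0" using L[of 1 0] by simp
  have trans: "integrable lborel (\<lambda>x. F (x + c)) \<and> integral\<^sup>L lborel (\<lambda>x. F (x + c)) = integral\<^sup>L lborel F" for c
  proof -
    have D: "distr lborel lborel (\<lambda>x. x + c) = (lborel :: (real^2) measure)"
      using lborel_distr_plus[of c] distr_cong[OF refl, of lborel borel lborel "\<lambda>x. x + c" "(+) c"] by (simp add: add.commute)
    then show ?thesis
      using F integrable_distr_eq[of "\<lambda>x. x + c" lborel lborel F] integral_distr[of "\<lambda>x. x + c" lborel lborel F] by simp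
  qed
  have int0: "integral\<^sup>L lebesgue (f n) = 0" for n
  proof -
    have "integral\<^sup>L lebesgue (f n) = integral\<^sup>L lborel (f n)" using fm by (intro integral_completion) auto
    also have "\<dots> = (integral\<^sup>L lborel (\<lambda>x. F (x + e n *\<^sub>R d)) - integral\<^sup>L lborel F) / e n"
      unfolding f_def using trans F by simp
    finally show ?thesis using trans by simp
  qed
  \<comment> \<open>A step of length at most 1 enlarges the support radius by at most
    \<open>norm d\<close>, which explains the ball in the majorant.\<close>
  have "(\<lambda>n. integral\<^sup>L lebesgue (f n)) \<longlonglongrightarrow> integral\<^sup>L lebesgue G"
  proof (rule integral_dominated_convergence[where w = "\<lambda>x. L * indicator (cball 0 (R + norm d)) x"])
    show "G \<in> borel_measurable lebesgue" by fact
    show "f n \<in> borel_measurable lebesgue" for n using fm by (intro measurable_completion) auto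
    have "cball 0 (R + norm d) \<in> lmeasurable" by (rule lmeasurable_cball)
    then show "integrable lebesgue (\<lambda>x::real^2. L * indicator (cball 0 (R + norm d)) x)"
      by (intro integrable_mult_right integrable_real_indicator) (auto simp: fmeasurable_def)
    show "AE x in lebesgue. (\<lambda>n. f n x) \<longlonglongrightarrow> G x"
      using der
    proof eventually_elim
      fix x assume "((\<lambda>h. F (x + h *\<^sub>R d)) has_real_derivative G x) (at 0)"
      then have "((\<lambda>h. (F (x + h *\<^sub>R d) - F x) / h) \<longlongrightarrow> G x) (at 0)" by (simp add: DERIV_def)
      moreover have "filterlim e (at 0) sequentially"
        unfolding filterlim_at using e LIMSEQ_inverse_real_of_nat by (auto simp: e_def[abs_def] less_imp_neq[symmetric])
      ultimately show "(\<lambda>n. f n x) \<longlonglongrightarrow> G x" unfolding f_def by (rule filterlim_compose)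
    qed
    show "AE x in lebesgue. norm (f n x) \<le> L * indicator (cball 0 (R + norm d)) x" for n
    proof (intro AE_I2)
      fix x :: "real^2"
      have b: "\<bar>f n x\<bar> \<le> L" using L[OF e, of x n] e(1)[of n] by (simp add: f_def field_simps abs_divide)
      show "norm (f n x) \<le> L * indicator (cball 0 (R + norm d)) x"
      proof (cases "f n x = 0")
        case True then show ?thesis using L0 by (simp add: indicator_def)
      next
        case False
        then have "F x \<noteq> 0 \<or> F (x + e n *\<^sub>R d) \<noteq> 0" by (auto simp: f_def)
        then have "norm x \<le> R \<or> norm (x + e n *\<^sub>R d) \<le> R" using R by blast
        moreover have "norm (e n *\<^sub>R d) \<le> norm d" using e[of n] by (simp add: mult_left_le_one_le)
        moreover have "norm x \<le> norm (x + e n *\<^sub>R d) + norm (e n *\<^sub>R d)"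
          using norm_triangle_ineq4[of "x + e n *\<^sub>R d" "e n *\<^sub>R d"] by simp
        ultimately have "norm x \<le> R + norm d" using norm_ge_zero[of d] by linarith
        then show ?thesis using b by simp
      qed
    qed
  qed
  then show ?thesis using int0 LIMSEQ_unique[OF _ tendsto_const] by simp
qed

section \<open>Piecewise polynomial functions\<close>

text \<open>The interiors of the pieces will be disjoint, so at most one summand is nonzero; the
  values on the skeleton concern a null set.\<close>

definition glue :: "(real^2) set set \<Rightarrow> ((real^2) set \<Rightarrow> real^2 \<Rightarrow> 'x) \<Rightarrow> real^2 \<Rightarrow> 'x::real_vector" where
  "glue \<T> q x = (\<Sum>K\<in>\<T>. indicator (interior K) x *\<^sub>R q K x)"

lemma AE_lebesgue_on_iff: "A \<in> sets lebesgue \<Longrightarrow> (AE x in lebesgue_on A. P x) \<longleftrightarrow> (AE x in lebesgue. x \<in> A \<longrightarrow> P x)"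
  by (rule AE_restrict_space_iff) simp

lemma L2_integrable:
  fixes f :: "real^2 \<Rightarrow> 'x::euclidean_space"
  assumes "\<Omega> \<in> lmeasurable" "f \<in> L2 \<Omega>" shows "integrable (lebesgue_on \<Omega>) f"
proof -
  have [measurable]: "f \<in> borel_measurable (lebesgue_on \<Omega>)" and i: "integrable (lebesgue_on \<Omega>) (\<lambda>x. (norm (f x))\<^sup>2)"
    using assms(2) by (auto simp: L2_def)
  have "finite_measure (lebesgue_on \<Omega>)" using assms(1) by (rule finite_measure_lebesgue_on)
  then have "integrable (lebesgue_on \<Omega>) (\<lambda>x. 1 + (norm (f x))\<^sup>2)"
    using i by (intro Bochner_Integration.integrable_add finite_measure.integrable_const)
  then show ?thesis
  proof (rule Bochner_Integration.integrable_bound)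
    have "norm (f x) \<le> 1 + (norm (f x))\<^sup>2" for x
    proof -
      have "0 \<le> (norm (f x) - 1/2)\<^sup>2" by simp
      then show ?thesis by (simp add: power2_eq_square algebra_simps)
    qed
    then show "AE x in lebesgue_on \<Omega>. norm (f x) \<le> norm (1 + (norm (f x))\<^sup>2)" by (auto intro: order_trans[OF _ abs_ge_self])
  qed simp
qed

text \<open>Completeness of Lebesgue measure carries measurability over to a function that agrees
  almost everywhere.\<close>

lemma L2_cong_AE:
  assumes "g \<in> L2 \<Omega>" "AE x in lebesgue_on \<Omega>. f x = g x" "\<Omega> \<in> sets lebesgue" shows "f \<in> L2 \<Omega>"
proof -
  have g: "g \<in> borel_measurable (lebesgue_on \<Omega>)" "integrable (lebesgue_on \<Omega>) (\<lambda>x. (norm (g x))\<^sup>2)"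
    using assms(1) by (auto simp: L2_def)
  have f: "f \<in> borel_measurable (lebesgue_on \<Omega>)"
  proof -
    have "AE x in lebesgue. x \<in> \<Omega> \<longrightarrow> f x = g x" using assms(2,3) by (simp add: AE_lebesgue_on_iff)
    then have ae: "AE x in lebesgue. indicator \<Omega> x *\<^sub>R g x = indicator \<Omega> x *\<^sub>R f x"
      by eventually_elim (auto simp: indicator_def)
    have "(\<lambda>x. indicator \<Omega> x *\<^sub>R g x) \<in> borel_measurable lebesgue"
      using g(1) assms(3) by (simp add: borel_measurable_restrict_space_iff)
    then have "(\<lambda>x. indicator \<Omega> x *\<^sub>R f x) \<in> borel_measurable lebesgue" by (rule borel_measurable_AE[OF _ ae])
    then show ?thesis using assms(3) by (simp add: borel_measurable_restrict_space_iff)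
  qed
  have "integrable (lebesgue_on \<Omega>) (\<lambda>x. (norm (f x))\<^sup>2)"
  proof (subst integrable_cong_AE)
    show "AE x in lebesgue_on \<Omega>. (norm (f x))\<^sup>2 = (norm (g x))\<^sup>2" using assms(2) by eventually_elim simp
  qed (use f g in auto)
  with f show ?thesis by (simp add: L2_def)
qed

lemma L2_bounded:
  fixes f :: "real^2 \<Rightarrow> 'x::euclidean_space"
  assumes "\<Omega> \<in> lmeasurable" "f \<in> borel_measurable borel" "\<And>x. norm (f x) \<le> B"
  shows "f \<in> L2 \<Omega>"
proof -
  have f: "f \<in> borel_measurable (lebesgue_on \<Omega>)"
    using assms(2) by (intro measurable_restrict_space1 measurable_completion) simp
  have fin: "finite_measure (lebesgue_on \<Omega>)" using assms(1) by (rule finite_measure_lebesgue_on)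
  have "integrable (lebesgue_on \<Omega>) (\<lambda>x. (norm (f x))\<^sup>2)"
  proof (rule finite_measure.integrable_const_bound[OF fin, where B = "B\<^sup>2"])
    show "AE x in lebesgue_on \<Omega>. norm ((norm (f x))\<^sup>2) \<le> B\<^sup>2"
      using assms(3) by (auto intro!: power_mono)
  qed (use f in auto)
  with f show ?thesis by (simp add: L2_def)
qed

lemma integrable_test_mult:
  fixes g :: "real^2 \<Rightarrow> real"
  assumes "integrable (lebesgue_on \<Omega>) g" "\<phi> \<in> test_functions U"
  shows "integrable (lebesgue_on \<Omega>) (\<lambda>x. g x * \<phi> x)"
proof -
  obtain B where B: "B > 0" "\<forall>x. \<bar>\<phi> x\<bar> \<le> B" using test_function_bounded[OF assms(2)] by blast
  have [measurable]: "\<phi> \<in> borel_measurable (lebesgue_on \<Omega>)"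
    using borel_measurable_continuous_onI[OF test_function_continuous[OF assms(2)]]
    by (intro measurable_restrict_space1 measurable_completion) simp
  have [measurable]: "g \<in> borel_measurable (lebesgue_on \<Omega>)" using assms(1) by auto
  have "integrable (lebesgue_on \<Omega>) (\<lambda>x. B * g x)" using assms(1) by simp
  then show ?thesis
    by (rule Bochner_Integration.integrable_bound) (use B in \<open>auto simp: abs_mult mult.commute intro!: mult_right_mono\<close>)
qed

lemma linear_continuous_borel: "linear h \<Longrightarrow> h \<in> borel_measurable borel" for h :: "'a::euclidean_space \<Rightarrow> 'b::euclidean_space"
  by (intro borel_measurable_continuous_onI linear_continuous_on linear_conv_bounded_linear[THEN iffD1])

lemma L2_linear_image:
  fixes f :: "real^2 \<Rightarrow> 'x::euclidean_space" and h :: "'x \<Rightarrow> 'y::euclidean_space"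
  assumes "f \<in> L2 \<Omega>" "linear h" shows "(\<lambda>x. h (f x)) \<in> L2 \<Omega>"
proof -
  obtain B where B: "\<And>x. norm (h x) \<le> norm x * B" "B > 0"
    using assms(2) linear_conv_bounded_linear bounded_linear.pos_bounded by metis
  have [measurable]: "f \<in> borel_measurable (lebesgue_on \<Omega>)" and i: "integrable (lebesgue_on \<Omega>) (\<lambda>x. (norm (f x))\<^sup>2)"
    using assms(1) by (auto simp: L2_def)
  have [measurable]: "h \<in> borel_measurable borel" using assms(2) by (rule linear_continuous_borel)
  have "integrable (lebesgue_on \<Omega>) (\<lambda>x. B\<^sup>2 * (norm (f x))\<^sup>2)" using i by simp
  then have "integrable (lebesgue_on \<Omega>) (\<lambda>x. (norm (h (f x)))\<^sup>2)"
  proof (rule Bochner_Integration.integrable_bound)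
    have "(norm (h (f x)))\<^sup>2 \<le> B\<^sup>2 * (norm (f x))\<^sup>2" for x
      using power_mono[OF B(1), of "f x" 2] by (simp add: power_mult_distrib mult.commute)
    then show "AE x in lebesgue_on \<Omega>. norm ((norm (h (f x)))\<^sup>2) \<le> norm (B\<^sup>2 * (norm (f x))\<^sup>2)" by auto
  qed measurable
  then show ?thesis by (simp add: L2_def)
qed

text \<open>The part of the setting that integration uses: convex compact pieces with disjoint
  interiors and a null boundary. How the pieces meet is the business of
  \<open>triangulated\<close>.\<close>

locale mesh =
  fixes \<Omega> :: "(real^2) set" and \<T> :: "(real^2) set set"
  assumes open_\<Omega>: "open \<Omega>" and bounded_\<Omega>: "bounded \<Omega>" and null_bdry: "negligible (closure \<Omega> - \<Omega>)"
    and fin: "finite \<T>" and conv: "K \<in> \<T> \<Longrightarrow> convex K" and comp: "K \<in> \<T> \<Longrightarrow> compact K"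
    and int_disjoint: "K \<in> \<T> \<Longrightarrow> L \<in> \<T> \<Longrightarrow> K \<noteq> L \<Longrightarrow> interior K \<inter> interior L = {}"
    and cover: "\<Union>\<T> = closure \<Omega>"
begin

lemma lmeasurable_\<Omega>: "\<Omega> \<in> lmeasurable"
  using open_\<Omega> bounded_\<Omega> by (simp add: lmeasurable_open)

lemma sets_\<Omega> [simp]: "\<Omega> \<in> sets lebesgue"
  using lmeasurable_\<Omega> by (simp add: fmeasurable_def)

lemma sets_K [simp]: "K \<in> \<T> \<Longrightarrow> K \<in> sets lebesgue"
  using comp lmeasurable_compact by (blast dest: fmeasurableD)

lemma AE_\<Omega>_closure: "AE x in lebesgue. x \<in> closure \<Omega> \<longrightarrow> x \<in> \<Omega>"
proof -
  have "AE x in lebesgue. x \<notin> closure \<Omega> - \<Omega>"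
    using null_bdry negligible_iff_null_sets by (intro AE_not_in) blast
  then show ?thesis by eventually_elim blast
qed

lemma AE_skeleton: "AE x in lebesgue. \<forall>K\<in>\<T>. x \<in> K \<longrightarrow> x \<in> interior K"
proof (subst AE_ball_countable, intro countable_finite fin, intro ballI)
  fix K assume K: "K \<in> \<T>"
  have "AE x in lebesgue. x \<notin> frontier K"
    using negligible_convex_frontier[OF conv[OF K]] negligible_iff_null_sets by (intro AE_not_in) blast
  then show "AE x in lebesgue. x \<in> K \<longrightarrow> x \<in> interior K"
    by eventually_elim (use closure_subset in \<open>auto simp: frontier_def\<close>)
qed

text \<open>The boundary of \<Omega> is null, so statements almost everywhere on \<Omega> and on its
  closure, the union of the pieces, are the same.\<close>

lemma AE_pieces_iff: "(AE x in lebesgue_on \<Omega>. P x) \<longleftrightarrow> (\<forall>K\<in>\<T>. AE x in lebesgue_on K. P x)"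
proof -
  have "(AE x in lebesgue_on \<Omega>. P x) \<longleftrightarrow> (AE x in lebesgue. \<forall>K\<in>\<T>. x \<in> K \<longrightarrow> P x)"
    unfolding AE_lebesgue_on_iff[OF sets_\<Omega>]
  proof
    assume "AE x in lebesgue. x \<in> \<Omega> \<longrightarrow> P x"
    then show "AE x in lebesgue. \<forall>K\<in>\<T>. x \<in> K \<longrightarrow> P x" using AE_\<Omega>_closure by eventually_elim (use cover in blast)
  next
    assume "AE x in lebesgue. \<forall>K\<in>\<T>. x \<in> K \<longrightarrow> P x"
    then show "AE x in lebesgue. x \<in> \<Omega> \<longrightarrow> P x" by eventually_elim (use cover closure_subset in blast)
  qed
  also have "\<dots> \<longleftrightarrow> (\<forall>K\<in>\<T>. AE x in lebesgue. x \<in> K \<longrightarrow> P x)"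
    by (rule AE_ball_countable[OF countable_finite[OF fin]])
  also have "\<dots> \<longleftrightarrow> (\<forall>K\<in>\<T>. AE x in lebesgue_on K. P x)"
    by (intro ball_cong refl AE_lebesgue_on_iff[symmetric] sets_K)
  finally show ?thesis .
qed

lemma AE_piece_interior_iff: "K \<in> \<T> \<Longrightarrow> (AE x in lebesgue_on K. P x) \<longleftrightarrow> (AE x in lebesgue. x \<in> interior K \<inter> \<Omega> \<longrightarrow> P x)"
proof (subst AE_lebesgue_on_iff, simp, rule iffI)
  assume "AE x in lebesgue. x \<in> K \<longrightarrow> P x"
  then show "AE x in lebesgue. x \<in> interior K \<inter> \<Omega> \<longrightarrow> P x" by eventually_elim (use interior_subset in blast)
next
  assume "K \<in> \<T>" "AE x in lebesgue. x \<in> interior K \<inter> \<Omega> \<longrightarrow> P x"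
  then show "AE x in lebesgue. x \<in> K \<longrightarrow> P x"
    using AE_skeleton AE_\<Omega>_closure by (eventually_elim) (use cover \<open>K \<in> \<T>\<close> in blast)
qed

lemma glue_interior: "K \<in> \<T> \<Longrightarrow> x \<in> interior K \<Longrightarrow> glue \<T> q x = q K x"
proof -
  assume K: "K \<in> \<T>" "x \<in> interior K"
  have "glue \<T> q x = (\<Sum>L\<in>\<T>. if L = K then q K x else 0)"
    unfolding glue_def
  proof (intro sum.cong refl)
    fix L assume "L \<in> \<T>"
    then show "indicator (interior L) x *\<^sub>R q L x = (if L = K then q K x else 0)"
      using int_disjoint[of K L] K by (auto simp: indicator_def)
  qed
  then show ?thesis using fin K by simp
qed

lemma glue_outside: "x \<notin> \<Union>\<T> \<Longrightarrow> glue \<T> q x = 0"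
  unfolding glue_def using interior_subset by (intro sum.neutral) (auto simp: indicator_def)

lemma AE_glue: "K \<in> \<T> \<Longrightarrow> AE x in lebesgue_on K. glue \<T> q x = q K x"
  by (subst AE_piece_interior_iff) (auto simp: glue_interior)

lemma AE_glue_eq: "(\<And>K. K \<in> \<T> \<Longrightarrow> AE x in lebesgue_on K. f x = q K x) \<Longrightarrow> AE x in lebesgue_on \<Omega>. f x = glue \<T> q x"
  unfolding AE_pieces_iff
proof
  fix K assume K: "K \<in> \<T>" and "\<And>K. K \<in> \<T> \<Longrightarrow> AE x in lebesgue_on K. f x = q K x"
  then have "AE x in lebesgue_on K. f x = q K x" by blast
  then show "AE x in lebesgue_on K. f x = glue \<T> q x" using AE_glue[OF K, of q] by eventually_elim simp
qed

lemma glue_borel: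
  fixes q :: "(real^2) set \<Rightarrow> real^2 \<Rightarrow> 'x::euclidean_space"
  assumes "\<And>K. K \<in> \<T> \<Longrightarrow> continuous_on UNIV (q K)" shows "glue \<T> q \<in> borel_measurable borel"
  unfolding glue_def[abs_def] using assms
  by (intro borel_measurable_sum borel_measurable_scaleR borel_measurable_indicator borel_measurable_continuous_onI) auto

lemma glue_L2:
  fixes q :: "(real^2) set \<Rightarrow> real^2 \<Rightarrow> 'x::euclidean_space"
  assumes "\<And>K. K \<in> \<T> \<Longrightarrow> continuous_on UNIV (q K)" shows "glue \<T> q \<in> L2 \<Omega>"
proof -
  have "\<exists>B. \<forall>x\<in>K. norm (q K x) \<le> B" if "K \<in> \<T>" for K
  proof -
    have "bounded (q K ` K)"
      using assms[OF that] comp[OF that] continuous_on_subset by (intro compact_imp_bounded compact_continuous_image) blast+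
    then show ?thesis unfolding bounded_iff by blast
  qed
  then obtain B where B: "\<And>K x. K \<in> \<T> \<Longrightarrow> x \<in> K \<Longrightarrow> norm (q K x) \<le> B K" by metis
  have "norm (glue \<T> q x) \<le> (\<Sum>K\<in>\<T>. \<bar>B K\<bar>)" for x
    unfolding glue_def
  proof (rule sum_norm_le)
    fix K assume "K \<in> \<T>"
    then show "norm (indicator (interior K) x *\<^sub>R q K x) \<le> \<bar>B K\<bar>"
      using B[of K x] interior_subset[of K] by (auto simp: indicator_def)
  qed
  then show ?thesis using glue_borel[OF assms] lmeasurable_\<Omega> by (intro L2_bounded) auto
qed

lemma L2_piecewise:
  fixes q :: "(real^2) set \<Rightarrow> real^2 \<Rightarrow> 'x::euclidean_space"
  assumes "\<And>K. K \<in> \<T> \<Longrightarrow> continuous_on UNIV (q K)" "\<And>K. K \<in> \<T> \<Longrightarrow> AE x in lebesgue_on K. f x = q K x"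
  shows "f \<in> L2 \<Omega>"
  by (rule L2_cong_AE[OF glue_L2[OF assms(1)] AE_glue_eq[OF assms(2)]]) auto

text \<open>Along a segment the closed pieces induce a finite closed cover of the parameter
  interval, and a function that is Lipschitz on every member of such a cover is Lipschitz on the
  interval with the same constant.\<close>

lemma piecewise_Lipschitz:
  fixes F :: "real^2 \<Rightarrow> real"
  assumes L: "\<And>K. K \<in> \<T> \<Longrightarrow> \<exists>M. \<forall>x\<in>K. \<forall>y\<in>K. \<bar>F x - F y\<bar> \<le> M * norm (x - y)"
    and 0: "\<And>x. x \<notin> \<Omega> \<Longrightarrow> F x = 0"
  obtains M where "M \<ge> 0" "\<And>x y. \<bar>F x - F y\<bar> \<le> M * norm (x - y)"
proof -
  obtain M where M: "\<And>K x y. K \<in> \<T> \<Longrightarrow> x \<in> K \<Longrightarrow> y \<in> K \<Longrightarrow> \<bar>F x - F y\<bar> \<le> M K * norm (x - y)"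
    using L by metis
  define m where "m = (\<Sum>K\<in>\<T>. \<bar>M K\<bar>)"
  have m0: "m \<ge> 0" unfolding m_def by (simp add: sum_nonneg)
  have Mm: "M K \<le> m" if "K \<in> \<T>" for K
    using member_le_sum[OF that, of "\<lambda>K. \<bar>M K\<bar>"] fin unfolding m_def by auto
  \<comment> \<open>The complement of \<Omega>, where \<open>F\<close> is 0, is one more closed
    piece; now every segment is covered.\<close>
  define \<U> where "\<U> = insert (- \<Omega>) \<T>"
  have \<U>: "finite \<U>" "\<And>A. A \<in> \<U> \<Longrightarrow> closed A" "\<Union>\<U> = UNIV"
    unfolding \<U>_def using fin comp compact_imp_closed open_\<Omega> cover closure_subset[of \<Omega>] by auto
  have \<U>L: "\<bar>F x - F y\<bar> \<le> m * norm (x - y)" if "A \<in> \<U>" "x \<in> A" "y \<in> A" for A x y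
  proof (cases "A \<in> \<T>")
    case True
    have "M A * norm (x - y) \<le> m * norm (x - y)" using Mm[OF True] by (intro mult_right_mono) auto
    then show ?thesis using M[OF True that(2,3)] by linarith
  next
    case False
    then show ?thesis using that 0 m0 unfolding \<U>_def by auto
  qed
  have "\<bar>F x - F y\<bar> \<le> m * norm (x - y)" for x y
  proof -
    define g where "g s = x + s *\<^sub>R (y - x)" for s
    have "(m * norm (y - x))-lipschitz_on {0..1} (F \<circ> g)"
    proof (rule lipschitz_on_closed_Union[where I = \<U> and U = "\<lambda>A. g -` A"])
      fix A assume A: "A \<in> \<U>"
      show "closed (g -` A)" unfolding g_def by (intro continuous_closed_vimage \<U>(2)[OF A]) (auto intro!: continuous_intros)
      show "(m * norm (y - x))-lipschitz_on (g -` A) (F \<circ> g)"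
      proof (rule lipschitz_onI)
        fix s t assume "s \<in> g -` A" "t \<in> g -` A"
        then have "\<bar>F (g s) - F (g t)\<bar> \<le> m * norm (g s - g t)" using \<U>L[OF A] by auto
        also have "g s - g t = (s - t) *\<^sub>R (y - x)" unfolding g_def by (simp add: algebra_simps)
        finally show "dist ((F \<circ> g) s) ((F \<circ> g) t) \<le> m * norm (y - x) * dist s t"
          by (simp add: dist_real_def mult_ac)
      qed (use m0 in auto)
    next
      have "\<exists>A\<in>\<U>. g s \<in> A" for s using \<U>(3) by (metis UNIV_I UnionE)
      then show "{0..1} \<subseteq> (\<Union>A\<in>\<U>. g -` A)" by blast
    qed (use \<U> m0 in auto)
    from lipschitz_onD[OF this, of 0 1] show ?thesis by (simp add: g_def dist_real_def norm_minus_commute)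
  qed
  then show ?thesis using that m0 by blast
qed

text \<open>Multiplied by a test function, a continuous piecewise polynomial extends by zero to a
  Lipschitz function on the plane, so \<open>integral_difference_quotient_limit\<close> applies in a
  coordinate direction. Off the null skeleton the limit of the difference quotients is given by the
  product rule.\<close>

lemma continuous_piecewise_weak_partial:
  assumes p: "\<And>K. K \<in> \<T> \<Longrightarrow> p K \<in> polys k UNIV"
    and match: "\<And>K L x. K \<in> \<T> \<Longrightarrow> L \<in> \<T> \<Longrightarrow> x \<in> K \<inter> L \<Longrightarrow> p K x = p L x"
    and \<phi>: "\<phi> \<in> test_functions \<Omega>"
  shows "integral\<^sup>L (lebesgue_on \<Omega>) (\<lambda>x. glue \<T> p x * partial i \<phi> x) = - integral\<^sup>L (lebesgue_on \<Omega>) (\<lambda>x. glue \<T> (\<lambda>K. partial i (p K)) x * \<phi> x)"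
proof -
  \<comment> \<open>Any triangle through \<open>x\<close> may be chosen, since the matching
    condition makes the value independent of it; on the skeleton \<open>glue\<close> need not give
    this continuous value.\<close>
  define \<kappa> where "\<kappa> x = (SOME K. K \<in> \<T> \<and> x \<in> K)" for x
  have \<kappa>: "\<kappa> x \<in> \<T> \<and> x \<in> \<kappa> x" if "x \<in> K" "K \<in> \<T>" for x K
    unfolding \<kappa>_def by (rule someI[of _ K]) (use that in blast)
  define F where "F x = p (\<kappa> x) x * \<phi> x" for x
  have FK: "F x = p K x * \<phi> x" if "x \<in> K" "K \<in> \<T>" for x K
    unfolding F_def using match[of "\<kappa> x" K x] \<kappa>[OF that] that by auto
  have F0: "F x = 0" if "x \<notin> \<Omega>" for x
    unfolding F_def using test_function_outside[OF \<phi> that] by simp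
  obtain B where B: "B > 0" "\<forall>x. \<bar>\<phi> x\<bar> \<le> B" using test_function_bounded[OF \<phi>] by blast
  obtain M\<phi> where M\<phi>: "M\<phi> > 0" "\<forall>x y. \<bar>\<phi> x - \<phi> y\<bar> \<le> M\<phi> * norm (x - y)" using test_function_Lipschitz[OF \<phi>] by blast
  obtain M where M: "M \<ge> 0" "\<And>x y. \<bar>F x - F y\<bar> \<le> M * norm (x - y)"
  proof (rule piecewise_Lipschitz[of F])
    fix K assume K: "K \<in> \<T>"
    obtain Bp where Bp: "Bp > 0" "\<forall>x\<in>K. \<bar>p K x\<bar> \<le> Bp"
      using polys_bounded[OF p[OF K]] comp[OF K] compact_imp_bounded by blast
    obtain Mp where Mp: "Mp > 0" "\<forall>x\<in>K. \<forall>y\<in>K. \<bar>p K x - p K y\<bar> \<le> Mp * norm (x - y)"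
      using polys_Lipschitz[OF p[OF K]] comp[OF K] conv[OF K] compact_imp_bounded by blast
    show "\<exists>M. \<forall>x\<in>K. \<forall>y\<in>K. \<bar>F x - F y\<bar> \<le> M * norm (x - y)"
    proof (intro exI ballI)
      fix x y assume xy: "x \<in> K" "y \<in> K"
      have "F x - F y = p K x * (\<phi> x - \<phi> y) + (p K x - p K y) * \<phi> y"
        using FK xy K by (simp add: algebra_simps)
      then have "\<bar>F x - F y\<bar> \<le> \<bar>p K x\<bar> * \<bar>\<phi> x - \<phi> y\<bar> + \<bar>p K x - p K y\<bar> * \<bar>\<phi> y\<bar>"
        using abs_triangle_ineq[of "p K x * (\<phi> x - \<phi> y)" "(p K x - p K y) * \<phi> y"] by (simp add: abs_mult)
      also have "\<dots> \<le> Bp * (M\<phi> * norm (x - y)) + (Mp * norm (x - y)) * B"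
        using Bp Mp M\<phi> B xy by (intro add_mono mult_mono) auto
      finally show "\<bar>F x - F y\<bar> \<le> (Bp * M\<phi> + Mp * B) * norm (x - y)" by (simp add: algebra_simps)
    qed
  qed (use F0 in auto)
  have contF: "continuous_on UNIV F"
    by (rule lipschitz_on_continuous_on[of M], rule lipschitz_onI) (use M in \<open>auto simp: dist_real_def dist_norm\<close>)
  obtain R where R: "R > 0" "\<forall>x. \<phi> x \<noteq> 0 \<longrightarrow> norm x \<le> R" using test_function_support[OF \<phi>] by blast
  have FR: "norm x \<le> R" if "F x \<noteq> 0" for x using that R by (auto simp: F_def)
  have Fint: "integrable lborel F"
  proof -
    have "integrable lborel (\<lambda>x. indicator (cball 0 R) x *\<^sub>R F x)"
      using contF by (intro borel_integrable_compact) (auto intro: continuous_on_subset)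
    moreover have "(\<lambda>x. indicator (cball 0 R) x *\<^sub>R F x) = F" using FR by (auto simp: indicator_def fun_eq_iff)
    ultimately show ?thesis by simp
  qed
  define G where "G x = glue \<T> p x * partial i \<phi> x + glue \<T> (\<lambda>K. partial i (p K)) x * \<phi> x" for x
  have cp: "continuous_on UNIV (p K)" "continuous_on UNIV (partial i (p K))" if "K \<in> \<T>" for K
    using p[OF that] polys_continuous polys_partial by blast+
  have c\<phi>: "continuous_on UNIV \<phi>" "continuous_on UNIV (partial i \<phi>)"
    using \<phi> test_function_continuous test_function_partial by blast+
  have G_meas: "G \<in> borel_measurable borel"
    unfolding G_def[abs_def]
    using cp c\<phi> by (intro borel_measurable_add borel_measurable_times glue_borel borel_measurable_continuous_onI) auto
  have "integral\<^sup>L lebesgue G = 0"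
  proof (rule integral_difference_quotient_limit[OF Fint, where d = "axis i 1" and L = M and R = R])
    show "G \<in> borel_measurable lebesgue" using G_meas by (intro measurable_completion) simp
    show "\<bar>F (x + h *\<^sub>R axis i 1) - F x\<bar> \<le> M * h" if "0 < h" "h \<le> 1" for x h
      using M(2)[of "x + h *\<^sub>R axis i 1" x] that by simp
    show "AE x in lebesgue. ((\<lambda>h. F (x + h *\<^sub>R axis i 1)) has_real_derivative G x) (at 0)"
      using AE_skeleton
    proof eventually_elim
      fix x assume x: "\<forall>K\<in>\<T>. x \<in> K \<longrightarrow> x \<in> interior K"
      \<comment> \<open>Off the skeleton \<open>F\<close> coincides near \<open>x\<close> with a
        differentiable function: the product on one triangle, or 0 outside the closed
        domain.\<close>
      obtain f U where f: "open U" "x \<in> U" "\<And>y. y \<in> U \<Longrightarrow> F y = f y" "f differentiable at x" "partial i f x = G x"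
      proof (cases "x \<in> \<Union>\<T>")
        case True
        then obtain K where K: "K \<in> \<T>" "x \<in> K" by blast
        then have xi: "x \<in> interior K" using x by blast
        show ?thesis
        proof (rule that[of "interior K" "\<lambda>y. p K y * \<phi> y"])
          show "F y = p K y * \<phi> y" if "y \<in> interior K" for y using FK that K interior_subset by blast
          show "partial i (\<lambda>y. p K y * \<phi> y) x = G x"
            unfolding G_def glue_interior[OF K(1) xi]
            using p[OF K(1)] \<phi> by (intro partial_mult polys_differentiable test_function_differentiable)
          show "(\<lambda>y. p K y * \<phi> y) differentiable at x"
            using p[OF K(1)] \<phi> by (intro differentiable_mult polys_differentiable test_function_differentiable)
        qed (use xi in auto)
      next
        case False
        show ?thesis
        proof (rule that[of "- closure \<Omega>" "\<lambda>_. 0"])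
          show "F y = 0" if "y \<in> - closure \<Omega>" for y using F0 that closure_subset by blast
          show "partial i (\<lambda>_. 0) x = G x" unfolding G_def using False by (simp add: glue_outside)
        qed (use False cover in auto)
      qed
      have Fd: "(F has_derivative frechet_derivative f (at x)) (at x)"
        using has_derivative_transform_within_open[OF frechet_D[OF f(4)] f(1,2)] f(3) by simp
      then have Fdiff: "F differentiable at (x + 0 *\<^sub>R axis i 1)" by (auto simp: differentiable_def)
      have "dir_deriv (axis i 1) F x = G x" unfolding dir_deriv_eqI[OF Fd] using f(5) by (simp add: partial_def)
      then show "((\<lambda>h. F (x + h *\<^sub>R axis i 1)) has_real_derivative G x) (at 0)"
        using has_derivative_line[OF Fdiff] by simp
    qed
  qed (use FR in auto)
  moreover have G0: "G x = 0" if "x \<notin> \<Omega>" for x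
    using test_function_outside[OF \<phi> that] test_function_outside[OF test_function_partial[OF \<phi>] that] by (simp add: G_def)
  ultimately have "integral\<^sup>L (lebesgue_on \<Omega>) G = 0"
  proof -
    have "integral\<^sup>L (lebesgue_on \<Omega>) G = integral\<^sup>L lebesgue (\<lambda>x. indicator \<Omega> x *\<^sub>R G x)"
      by (simp add: integral_restrict_space)
    also have "(\<lambda>x. indicator \<Omega> x *\<^sub>R G x) = G" using G0 by (auto simp: indicator_def fun_eq_iff)
    finally show ?thesis using \<open>integral\<^sup>L lebesgue G = 0\<close> by simp
  qed
  moreover have "integrable (lebesgue_on \<Omega>) (\<lambda>x. glue \<T> p x * partial i \<phi> x)"
    "integrable (lebesgue_on \<Omega>) (\<lambda>x. glue \<T> (\<lambda>K. partial i (p K)) x * \<phi> x)"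
    by (rule integrable_test_mult[OF L2_integrable[OF lmeasurable_\<Omega> glue_L2[OF cp(1)]] test_function_partial[OF \<phi>]],
        simp, rule integrable_test_mult[OF L2_integrable[OF lmeasurable_\<Omega> glue_L2[OF cp(2)]] \<phi>])
  ultimately show ?thesis unfolding G_def by simp
qed

end

section \<open>Triangles\<close>

text \<open>The planar cross product; \<open>cr (v - u) (w - u)\<close> is twice the signed area of
  the triangle.\<close>

definition cr :: "real^2 \<Rightarrow> real^2 \<Rightarrow> real" where "cr a b = a $ 1 * b $ 2 - a $ 2 * b $ 1"

text \<open>The order of the vertices singles out the edge from \<open>v\<close> to
  \<open>w\<close>, opposite \<open>u\<close>; statements are proved for this edge and reach the
  others through \<open>tri_rotate\<close>.\<close>

definition tri :: "real^2 \<Rightarrow> real^2 \<Rightarrow> real^2 \<Rightarrow> (real^2) set \<Rightarrow> bool" where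
  "tri u v w K \<longleftrightarrow> \<not> affine_dependent {u, v, w} \<and> distinct [u, v, w] \<and> cr (v - u) (w - u) \<noteq> 0 \<and> K = convex hull {u, v, w}"

text \<open>\<open>bary u v w\<close> is the barycentric coordinate of \<open>u\<close> in the triangle \<open>u v w\<close>.\<close>

definition bary :: "real^2 \<Rightarrow> real^2 \<Rightarrow> real^2 \<Rightarrow> real^2 \<Rightarrow> real" where
  "bary u v w x = cr (w - v) (x - v) / cr (w - v) (u - v)"

lemma affine_independent_cr:
  assumes "\<not> affine_dependent {u, v, w}" "distinct [u, v, w]"
  shows "cr (v - u) (w - u) \<noteq> 0"
proof
  assume c: "cr (v - u) (w - u) = 0"
  define a b where "a = v - u" and "b = w - u"
  have ab: "(a \<bullet> b) *\<^sub>R a = (a \<bullet> a) *\<^sub>R b"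
  proof -
    have "a $ 1 * b $ 2 = a $ 2 * b $ 1" using c by (simp add: cr_def a_def b_def)
    then have "(a $ 1 * b $ 1 + a $ 2 * b $ 2) * a $ 1 = (a $ 1 * a $ 1 + a $ 2 * a $ 2) * b $ 1"
      "(a $ 1 * b $ 1 + a $ 2 * b $ 2) * a $ 2 = (a $ 1 * a $ 1 + a $ 2 * a $ 2) * b $ 2" by algebra+
    then show ?thesis by (simp add: vec_eq_iff forall_2 inner_vec_def sum_2)
  qed
  \<comment> \<open>The relation \<open>ab\<close> between \<open>v - u\<close> and
    \<open>w - u\<close>, written as coefficients on the vertices; the one at \<open>u\<close> makes
    their sum zero.\<close>
  define U where "U z = (if z = v then a \<bullet> b else if z = w then - (a \<bullet> a) else a \<bullet> a - a \<bullet> b)" for z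
  have "sum U {u, v, w} = 0" using assms(2) by (auto simp: U_def)
  moreover have "U w \<noteq> 0" using assms(2) by (auto simp: U_def a_def)
  moreover have "(\<Sum>z\<in>{u, v, w}. U z *\<^sub>R z) = 0"
  proof -
    have "(\<Sum>z\<in>{u, v, w}. U z *\<^sub>R z) = (a \<bullet> b) *\<^sub>R a - (a \<bullet> a) *\<^sub>R b"
      using assms(2) by (auto simp: U_def a_def b_def algebra_simps)
    then show ?thesis using ab by simp
  qed
  ultimately have "affine_dependent {u, v, w}"
    by (subst affine_dependent_explicit_finite) (auto intro!: exI[of _ U])
  then show False using assms(1) by simp
qed

lemma triI: "\<not> affine_dependent {u, v, w} \<Longrightarrow> distinct [u, v, w] \<Longrightarrow> K = convex hull {u, v, w} \<Longrightarrow> tri u v w K"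
  using affine_independent_cr by (auto simp: tri_def)

lemma simplex_tri:
  assumes "2 simplex K" obtains u v w where "tri u v w K"
proof -
  obtain C where C: "\<not> affine_dependent C" "int (card C) = 3" "K = convex hull C"
    using assms by (auto simp: simplex_def)
  then have "card C = 3" by linarith
  then obtain u v w where "C = {u, v, w}" "distinct [u, v, w]" by (auto simp: card_3_iff)
  then show ?thesis using C that[of u v w] triI[of u v w K] by auto
qed

lemma tri_rotate: "tri u v w K \<Longrightarrow> tri v w u K"
  by (rule triI) (auto simp: tri_def insert_commute)

lemma tri_swap: "tri u v w K \<Longrightarrow> tri u w v K"
  by (rule triI) (auto simp: tri_def insert_commute)

lemma cr_tri_rotate: "cr (w - v) (u - v) = cr (v - u) (w - u)"
  by (simp add: cr_def algebra_simps)

lemma tri_cr: "tri u v w K \<Longrightarrow> cr (w - v) (u - v) \<noteq> 0"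
  using cr_tri_rotate by (auto simp: tri_def)

lemma bary_polys: "bary u v w \<in> polys 1 UNIV"
proof -
  have "(\<lambda>x. cr (w - v) (x - v)) = (\<lambda>x. (w - v) $ 1 * (x $ 2 - v $ 2) - (w - v) $ 2 * (x $ 1 - v $ 1))"
    by (simp add: cr_def fun_eq_iff)
  moreover have "\<dots> \<in> polys 1 UNIV" by (intro polys_diff polys_cmult polys_coord polys_const) auto
  ultimately have "(\<lambda>x. 1 / cr (w - v) (u - v) * cr (w - v) (x - v)) \<in> polys 1 UNIV" by (intro polys_cmult) simp
  then show ?thesis by (simp add: bary_def[abs_def])
qed

lemma bary_continuous: "continuous_on S (bary u v w)"
  using bary_polys by (rule polys_continuous)

lemma bary_shift: "bary u v w (x + y) = bary u v w x + cr (w - v) y / cr (w - v) (u - v)"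
  by (simp add: bary_def cr_def add_divide_distrib[symmetric] algebra_simps)

lemma bary_has_derivative: "(bary u v w has_derivative (\<lambda>h. cr (w - v) h / cr (w - v) (u - v))) (at x)"
proof -
  have "((\<lambda>x. (w - v) $ 1 * (x $ 2 - v $ 2) - (w - v) $ 2 * (x $ 1 - v $ 1)) has_derivative (\<lambda>h. cr (w - v) h)) (at x)"
    unfolding cr_def by (auto intro!: derivative_eq_intros bounded_linear.has_derivative[OF bounded_linear_vec_nth])
  from bounded_linear.has_derivative[OF bounded_linear_divide this] show ?thesis
    unfolding bary_def[abs_def] cr_def[of _ "_ - v"] by simp
qed

lemma bary_self:
  assumes "tri u v w K" shows "bary u v w u = 1" "bary u v w v = 0" "bary u v w w = 0"
  using tri_cr[OF assms] by (auto simp: bary_def cr_def)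

lemma bary_sum:
  assumes "tri u v w K" shows "bary u v w x + bary v w u x + bary w u v x = 1"
proof -
  have "bary v w u x = cr (u - w) (x - w) / cr (w - v) (u - v)" "bary w u v x = cr (v - u) (x - u) / cr (w - v) (u - v)"
    using cr_tri_rotate[of u w v] cr_tri_rotate[of w v u] by (simp_all add: bary_def)
  then have "bary u v w x + bary v w u x + bary w u v x = (cr (w - v) (x - v) + cr (u - w) (x - w) + cr (v - u) (x - u)) / cr (w - v) (u - v)"
    unfolding bary_def[of u] by (simp only: add_divide_distrib)
  also have "cr (w - v) (x - v) + cr (u - w) (x - w) + cr (v - u) (x - u) = cr (w - v) (u - v)"
    by (simp add: cr_def algebra_simps)
  finally show ?thesis using tri_cr[OF assms] by simp
qed

lemma bary_expand:
  assumes "tri u v w K" shows "x = bary u v w x *\<^sub>R u + bary v w u x *\<^sub>R v + bary w u v x *\<^sub>R w"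
proof -
  let ?D = "cr (w - v) (u - v)"
  have e: "bary v w u x = cr (u - w) (x - w) / ?D" "bary w u v x = cr (v - u) (x - u) / ?D"
    using cr_tri_rotate[of u w v] cr_tri_rotate[of w v u] by (simp_all add: bary_def)
  have "?D *\<^sub>R x = cr (w - v) (x - v) *\<^sub>R u + cr (u - w) (x - w) *\<^sub>R v + cr (v - u) (x - u) *\<^sub>R w"
    by (simp add: vec_eq_iff forall_2 cr_def algebra_simps)
  then have "(1 / ?D) *\<^sub>R (?D *\<^sub>R x) = (1 / ?D) *\<^sub>R (cr (w - v) (x - v) *\<^sub>R u + cr (u - w) (x - w) *\<^sub>R v + cr (v - u) (x - u) *\<^sub>R w)"
    by simp
  then show ?thesis using tri_cr[OF assms] unfolding e bary_def[of u] by (simp add: scaleR_add_right)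
qed

lemma bary_affine: "a + b + c = 1 \<Longrightarrow> bary u v w (a *\<^sub>R p + b *\<^sub>R q + c *\<^sub>R r) = a * bary u v w p + b * bary u v w q + c * bary u v w r"
proof -
  assume "a + b + c = 1"
  then have c: "c = 1 - a - b" by simp
  have "cr (w - v) (a *\<^sub>R p + b *\<^sub>R q + c *\<^sub>R r - v) = a * cr (w - v) (p - v) + b * cr (w - v) (q - v) + c * cr (w - v) (r - v)"
    unfolding c by (simp add: cr_def algebra_simps)
  then show ?thesis by (simp add: bary_def add_divide_distrib)
qed

lemma tri_mem_iff:
  assumes "tri u v w K" shows "x \<in> K \<longleftrightarrow> 0 \<le> bary u v w x \<and> 0 \<le> bary v w u x \<and> 0 \<le> bary w u v x"
proof
  assume "x \<in> K"
  then obtain a b c where abc: "a \<ge> 0" "b \<ge> 0" "c \<ge> 0" "a + b + c = 1" "x = a *\<^sub>R u + b *\<^sub>R v + c *\<^sub>R w"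
    using assms unfolding tri_def convex_hull_3 by auto
  then show "0 \<le> bary u v w x \<and> 0 \<le> bary v w u x \<and> 0 \<le> bary w u v x"
    using bary_self[OF assms] bary_self[OF tri_rotate[OF assms]] bary_self[OF tri_rotate[OF tri_rotate[OF assms]]]
    by (simp add: bary_affine)
next
  assume "0 \<le> bary u v w x \<and> 0 \<le> bary v w u x \<and> 0 \<le> bary w u v x"
  then have "x \<in> convex hull {u, v, w}"
    unfolding convex_hull_3 using bary_expand[OF assms, of x] bary_sum[OF assms, of x] by blast
  then show "x \<in> K" using assms by (simp add: tri_def)
qed

lemma open_bary: "open {x. 0 < bary u v w x}"
  using bary_continuous by (intro open_Collect_less) auto

lemma tri_interior:
  assumes "tri u v w K" "0 < bary u v w x" "0 < bary v w u x" "0 < bary w u v x" shows "x \<in> interior K"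
proof (rule interiorI)
  show "open ({x. 0 < bary u v w x} \<inter> {x. 0 < bary v w u x} \<inter> {x. 0 < bary w u v x})"
    by (intro open_Int open_bary)
  show "x \<in> {x. 0 < bary u v w x} \<inter> {x. 0 < bary v w u x} \<inter> {x. 0 < bary w u v x}" using assms(2-4) by simp
  show "{x. 0 < bary u v w x} \<inter> {x. 0 < bary v w u x} \<inter> {x. 0 < bary w u v x} \<subseteq> K"
  proof
    fix y assume "y \<in> {x. 0 < bary u v w x} \<inter> {x. 0 < bary v w u x} \<inter> {x. 0 < bary w u v x}"
    then show "y \<in> K" using tri_mem_iff[OF assms(1), of y] by simp
  qed
qed

lemma tri_interior_nonempty:
  assumes "tri u v w K" obtains x where "x \<in> interior K"
proof -
  let ?x = "(1/3) *\<^sub>R u + (1/3) *\<^sub>R v + (1/3) *\<^sub>R w"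
  have "?x \<in> interior K" using bary_self[OF assms] bary_self[OF tri_rotate[OF assms]] bary_self[OF tri_rotate[OF tri_rotate[OF assms]]]
    by (intro tri_interior[OF assms]) (simp_all add: bary_affine)
  then show ?thesis using that by blast
qed

lemma tri_extreme: "tri u v w K \<Longrightarrow> x extreme_point_of K \<longleftrightarrow> x \<in> {u, v, w}"
  unfolding tri_def using extreme_point_of_convex_hull_affine_independent by metis

lemma tri_convex_compact: "tri u v w K \<Longrightarrow> convex K \<and> compact K"
  unfolding tri_def by (auto intro!: finite_imp_compact_convex_hull)

lemma tri_edge: "tri u v w K \<Longrightarrow> closed_segment v w edge_of K"
proof -
  assume t: "tri u v w K"
  have "convex hull {v, w} face_of K"
    using t face_of_convex_hull_affine_independent[of "{u, v, w}" "convex hull {v, w}"] unfolding tri_def by blast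
  moreover have "aff_dim (convex hull {v, w}) = 1" using t by (simp add: tri_def aff_dim_convex_hull aff_dim_2)
  ultimately show ?thesis by (simp add: edge_of_def segment_convex_hull)
qed

lemma tri_face_cases:
  assumes t: "tri u v w K" and F: "F face_of K"
  shows "F = {} \<or> (\<exists>z. F = {z} \<and> z extreme_point_of K) \<or> (\<exists>u' v' w'. tri u' v' w' K \<and> F = closed_segment v' w') \<or> F = K"
proof -
  obtain c where c: "c \<subseteq> {u, v, w}" "F = convex hull c"
    using t F face_of_convex_hull_affine_independent[of "{u, v, w}" F] unfolding tri_def by blast
  have "c = {} \<or> c = {u} \<or> c = {v} \<or> c = {w} \<or> c = {v, w} \<or> c = {w, u} \<or> c = {u, v} \<or> c = {u, v, w}"
    using c(1) by (cases "u \<in> c"; cases "v \<in> c"; cases "w \<in> c") blast+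
  then consider "c = {}" | z where "c = {z}" "z \<in> {u, v, w}" | u' v' w' where "c = {v', w'}" "tri u' v' w' K" | "c = {u, v, w}"
    using t tri_rotate[OF t] tri_rotate[OF tri_rotate[OF t]] by blast
  then show ?thesis
  proof cases
    case 1 then show ?thesis using c by simp
  next
    case (2 z) then show ?thesis using c tri_extreme[OF t] by auto
  next
    case (3 u' v' w')
    then have "F = closed_segment v' w'" using c segment_convex_hull[of v' w'] by simp
    then show ?thesis using 3(2) by blast
  next
    case 4 then show ?thesis using c t by (simp add: tri_def)
  qed
qed

lemma edge_tri:
  assumes t: "tri u v w K" and e: "e edge_of K"
  obtains u' v' w' where "tri u' v' w' K" "e = closed_segment v' w'"
proof -
  have ad: "aff_dim e = 1" "e face_of K" using e by (auto simp: edge_of_def)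
  obtain x where "x \<in> interior K" using tri_interior_nonempty[OF t] .
  then have "aff_dim K = 2" using aff_dim_nonempty_interior[of K] by auto
  then have "e \<noteq> {}" "e \<noteq> {z}" "e \<noteq> K" for z using ad by auto
  then show thesis using tri_face_cases[OF t ad(2)] that by blast
qed

lemma edge_tri_endpoints:
  assumes t: "tri u v w K" and e: "closed_segment a b edge_of K" and "a \<noteq> b"
  obtains c where "tri c a b K"
proof -
  obtain u' v' w' where t': "tri u' v' w' K" "closed_segment a b = closed_segment v' w'" using edge_tri[OF t e] .
  have "{a, b} = {v', w'}" using closed_segment_eq t'(2) by blast
  then show thesis using that t'(1) tri_swap[OF t'(1)] by (metis doubleton_eq_iff)
qed

lemma bary_linepath:
  assumes t: "tri u v w K"
  shows "bary u v w (linepath v w s) = 0" "bary v w u (linepath v w s) = 1 - s" "bary w u v (linepath v w s) = s"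
  using bary_affine[of "1 - s" s 0 _ _ _ v w 0] bary_self[OF t] bary_self[OF tri_rotate[OF t]] bary_self[OF tri_rotate[OF tri_rotate[OF t]]]
  by (simp_all add: linepath_def)

lemma on_edge_iff:
  assumes t: "tri u v w K" shows "x \<in> closed_segment v w \<longleftrightarrow> x \<in> K \<and> bary u v w x = 0"
proof
  assume "x \<in> closed_segment v w"
  then obtain s where s: "s \<in> {0..1}" "x = linepath v w s" by (metis imageE linepath_image_01)
  then show "x \<in> K \<and> bary u v w x = 0" using bary_linepath[OF t] tri_mem_iff[OF t] by auto
next
  assume x: "x \<in> K \<and> bary u v w x = 0"
  then have "x = (1 - bary w u v x) *\<^sub>R v + bary w u v x *\<^sub>R w" "0 \<le> bary w u v x" "bary w u v x \<le> 1"
    using bary_expand[OF t, of x] bary_sum[OF t, of x] tri_mem_iff[OF t, of x] by (auto simp: eq_diff_eq[symmetric])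
  then show "x \<in> closed_segment v w" unfolding closed_segment_def by blast
qed

section \<open>Triangulations\<close>

locale triangulated =
  fixes \<T> :: "(real^2) set set"
  assumes finT: "finite \<T>" and triT: "K \<in> \<T> \<Longrightarrow> \<exists>u v w. tri u v w K"
    and faceT: "K \<in> \<T> \<Longrightarrow> L \<in> \<T> \<Longrightarrow> K \<inter> L face_of K"
begin

lemma full_face: "K \<in> \<T> \<Longrightarrow> F face_of K \<Longrightarrow> interior F \<noteq> {} \<Longrightarrow> F = K"
proof (rule ccontr)
  assume K: "K \<in> \<T>" "F face_of K" "interior F \<noteq> {}" "F \<noteq> K"
  have "convex K" using triT[OF K(1)] tri_convex_compact by blast
  then have "aff_dim F < aff_dim K" using K face_of_aff_dim_lt by blast
  moreover have "aff_dim F = DIM(real^2)" using K(3) aff_dim_nonempty_interior by blast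
  ultimately show False using aff_dim_le_DIM[of K] by simp
qed

lemma interiors_disjoint:
  assumes "K \<in> \<T>" "L \<in> \<T>" "K \<noteq> L" shows "interior K \<inter> interior L = {}"
proof (rule ccontr)
  assume "interior K \<inter> interior L \<noteq> {}"
  then have "interior (K \<inter> L) \<noteq> {}" by simp
  then have "K \<inter> L = K" "L \<inter> K = L" using full_face faceT assms by (metis inf_commute)+
  then show False using assms by blast
qed

text \<open>Full overlap is excluded because a face with interior points is the whole triangle,
  which would make the two members equal.\<close>

lemma intersection_cases:
  assumes K: "K \<in> \<T>" and L: "L \<in> \<T>" and "K \<noteq> L" "K \<inter> L \<noteq> {}"
  obtains z where "K \<inter> L = {z}" "z extreme_point_of K" "z extreme_point_of L"
  | u v w u' where "tri u v w K" "tri u' v w L" "K \<inter> L = closed_segment v w"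
proof -
  obtain u v w where t: "tri u v w K" using triT[OF K] by blast
  obtain p q r where t': "tri p q r L" using triT[OF L] by blast
  have fK: "K \<inter> L face_of K" and fL: "K \<inter> L face_of L" using faceT[OF K L] faceT[OF L K] by (simp_all add: inf_commute)
  have "K \<inter> L \<noteq> K"
  proof
    assume eq: "K \<inter> L = K"
    obtain x where "x \<in> interior K" using tri_interior_nonempty[OF t] .
    then have "K \<inter> L = L" using full_face[OF L fL] eq by auto
    then show False using eq assms by blast
  qed
  then consider z where "K \<inter> L = {z}" "z extreme_point_of K" | u' v' w' where "tri u' v' w' K" "K \<inter> L = closed_segment v' w'"
    using tri_face_cases[OF t fK] assms(4) by blast
  then show thesis
  proof cases
    case (1 z)
    then show thesis using fL that(1) by (metis face_of_singleton)
  next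
    case e: (2 u' v' w')
    then have "closed_segment v' w' edge_of L" using fL tri_edge[OF e(1)] by (simp add: edge_of_def)
    moreover have "v' \<noteq> w'" using e(1) by (simp add: tri_def)
    ultimately obtain c where "tri c v' w' L" using edge_tri_endpoints[OF t'] by blast
    then show thesis using that(2) e by blast
  qed
qed

text \<open>If both third vertices were on the same side of the common edge, a small shift of its
  midpoint towards that side would be interior to both triangles.\<close>

lemma opposite_sides:
  assumes K: "K \<in> \<T>" and L: "L \<in> \<T>" and ne: "K \<noteq> L" and t: "tri u v w K" and t': "tri u' v w L"
  shows "cr (w - v) (u - v) * cr (w - v) (u' - v) < 0"
proof (rule ccontr)
  assume "\<not> ?thesis"
  moreover have nz: "cr (w - v) (u - v) \<noteq> 0" "cr (w - v) (u' - v) \<noteq> 0" using tri_cr t t' by auto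
  ultimately have pos: "cr (w - v) (u - v) / cr (w - v) (u' - v) > 0"
    by (simp add: zero_less_divide_iff mult_less_0_iff not_less) linarith
  define m where "m = linepath v w (1/2)"
  let ?U = "{x. 0 < bary v w u x} \<inter> {x. 0 < bary w u v x} \<inter> {x. 0 < bary v w u' x} \<inter> {x. 0 < bary w u' v x}"
  have "open ?U" by (intro open_Int open_bary)
  moreover have "m \<in> ?U" unfolding m_def using bary_linepath[OF t] bary_linepath[OF t'] by auto
  ultimately obtain e where e: "e > 0" "ball m e \<subseteq> ?U" using open_contains_ball by blast
  define N where "N = norm (u - v) + 1"
  have N: "N > 0" by (simp add: N_def add_nonneg_pos)
  \<comment> \<open>Small enough for the shifted midpoint to stay in the ball; the 1 in
    \<open>N\<close> keeps the denominator positive.\<close>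
  define \<delta> where "\<delta> = e / 2 / N"
  have \<delta>: "\<delta> > 0" using e N by (simp add: \<delta>_def)
  have "norm (\<delta> *\<^sub>R (u - v)) \<le> \<delta> * N" using \<delta> by (simp add: N_def)
  also have "\<dots> = e / 2" unfolding \<delta>_def using N by simp
  finally have "m + \<delta> *\<^sub>R (u - v) \<in> ?U" using e by (intro subsetD[OF e(2)]) (simp add: dist_norm)
  moreover have cs: "cr (w - v) (\<delta> *\<^sub>R (u - v)) = \<delta> * cr (w - v) (u - v)" by (simp add: cr_def algebra_simps)
  then have "bary u v w (m + \<delta> *\<^sub>R (u - v)) > 0" "bary u' v w (m + \<delta> *\<^sub>R (u - v)) > 0"
    unfolding bary_shift m_def bary_linepath[OF t] bary_linepath[OF t'] cs using \<delta> mult_pos_pos[OF \<delta> pos] nz by auto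
  ultimately have "m + \<delta> *\<^sub>R (u - v) \<in> interior K \<inter> interior L"
    using tri_interior[OF t] tri_interior[OF t'] by auto
  then show False using interiors_disjoint[OF K L ne] by blast
qed

text \<open>Of three third vertices two would lie on the same side of the edge, contradicting
  \<open>opposite_sides\<close>.\<close>

lemma at_most_two:
  assumes "K \<in> \<T>" "L \<in> \<T>" "M \<in> \<T>" "e edge_of K" "e edge_of L" "e edge_of M" "K \<noteq> L" "M \<noteq> K"
  shows "M = L"
proof (rule ccontr)
  assume "M \<noteq> L"
  obtain u v w where t: "tri u v w K" "e = closed_segment v w" using triT[OF assms(1)] edge_tri assms(4) by metis
  have vw: "v \<noteq> w" using t(1) by (simp add: tri_def)
  obtain p where p: "tri p v w L" using triT[OF assms(2)] edge_tri_endpoints assms(5) t(2) vw by metis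
  obtain q where q: "tri q v w M" using triT[OF assms(3)] edge_tri_endpoints assms(6) t(2) vw by metis
  have "cr (w - v) (u - v) * cr (w - v) (p - v) < 0" "cr (w - v) (p - v) * cr (w - v) (q - v) < 0"
    "cr (w - v) (u - v) * cr (w - v) (q - v) < 0"
    using opposite_sides assms t p q \<open>M \<noteq> L\<close> by metis+
  then show False by (auto simp: mult_less_0_iff)
qed

text \<open>Near such a point the coordinates of \<open>v\<close> and \<open>w\<close> stay positive
  in both triangles, and the sign of the remaining coordinate decides which triangle contains a
  given neighbour. No gap is left because the third vertices lie on opposite sides.\<close>

lemma interior_of_edge_pair:
  assumes K: "K \<in> \<T>" and L: "L \<in> \<T>" and ne: "K \<noteq> L" and t: "tri u v w K" and t': "tri u' v w L"
    and x: "x \<in> closed_segment v w" "x \<noteq> v" "x \<noteq> w"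
  shows "x \<in> interior (K \<union> L)"
proof -
  obtain s where s: "s \<in> {0..1}" "x = linepath v w s" using x(1) by (metis imageE linepath_image_01)
  then have "0 < s" "s < 1" using x by (auto simp: linepath_def less_le)
  let ?U = "{x. 0 < bary v w u x} \<inter> {x. 0 < bary w u v x} \<inter> {x. 0 < bary v w u' x} \<inter> {x. 0 < bary w u' v x}"
  have "open ?U" by (intro open_Int open_bary)
  moreover have "x \<in> ?U" using bary_linepath[OF t] bary_linepath[OF t'] s \<open>0 < s\<close> \<open>s < 1\<close> by auto
  moreover have "?U \<subseteq> K \<union> L"
  proof
    fix y assume y: "y \<in> ?U"
    have "0 \<le> bary u v w y \<or> 0 \<le> bary u' v w y"
      using opposite_sides[OF K L ne t t'] unfolding bary_def
      by (cases "cr (w - v) (y - v) \<ge> 0") (auto simp: zero_le_divide_iff mult_less_0_iff)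
    then show "y \<in> K \<union> L" using y tri_mem_iff[OF t] tri_mem_iff[OF t'] by auto
  qed
  ultimately show ?thesis by (rule_tac interiorI) auto
qed

text \<open>An induction over adjacency starting at unshared edges. If it failed, every edge of a
  bad triangle would be shared with another bad triangle; then the union \<open>A\<close> of the bad
  triangles, without their vertices, is open and closed in the plane minus finitely many points.
  That set is connected, so the bounded set \<open>A\<close> would fill the plane up to finitely
  many points.\<close>

lemma edge_chain_induct:
  assumes K: "K \<in> \<T>"
    and bdry: "\<And>K e. K \<in> \<T> \<Longrightarrow> e edge_of K \<Longrightarrow> (\<And>L. L \<in> \<T> \<Longrightarrow> e edge_of L \<Longrightarrow> L = K) \<Longrightarrow> P K"
    and step: "\<And>K L e. K \<in> \<T> \<Longrightarrow> L \<in> \<T> \<Longrightarrow> K \<noteq> L \<Longrightarrow> e edge_of K \<Longrightarrow> e edge_of L \<Longrightarrow> P K \<Longrightarrow> P L"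
  shows "P K"
proof (rule ccontr)
  assume "\<not> P K"
  define B where "B = {K \<in> \<T>. \<not> P K}"
  define V where "V = (\<Union>K\<in>B. {x. x extreme_point_of K})"
  define A where "A = \<Union>B"
  have BT: "B \<subseteq> \<T>" and finB: "finite B" using finT by (auto simp: B_def)
  have "finite {x. x extreme_point_of K}" if KB: "K \<in> B" for K
  proof -
    obtain u v w where "tri u v w K" using triT[of K] KB BT by blast
    then have "{x. x extreme_point_of K} = {u, v, w}" using tri_extreme by blast
    then show ?thesis by simp
  qed
  then have finV: "finite V" unfolding V_def using finB by blast
  \<comment> \<open>The step rule is used backwards: a good neighbour would pass the property to
    \<open>K\<close>.\<close>
  have partner: "\<exists>L\<in>B. L \<noteq> K \<and> e edge_of L" if KB: "K \<in> B" and eK: "e edge_of K" for K e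
  proof -
    have KT: "K \<in> \<T>" "\<not> P K" using KB by (auto simp: B_def)
    then obtain L where L: "L \<in> \<T>" "e edge_of L" "L \<noteq> K" using bdry[OF KT(1) eK] by blast
    then have "\<not> P L" using step[OF L(1) KT(1) L(3) L(2) eK] KT by blast
    then show ?thesis using L by (auto simp: B_def)
  qed
  have int: "x \<in> interior A" if x: "x \<in> A - V" for x
  proof -
    obtain K where K: "K \<in> B" "x \<in> K" using x by (auto simp: A_def)
    obtain u v w where t: "tri u v w K" using triT[of K] K BT by blast
    have edge: ?thesis if t: "tri u v w K" and 0: "bary u v w x = 0" for u v w
    proof -
      have xe: "x \<in> closed_segment v w" using on_edge_iff[OF t] K 0 by simp
      obtain L where L: "L \<in> B" "L \<noteq> K" "closed_segment v w edge_of L" using partner[OF K(1) tri_edge[OF t]] by blast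
      have "v \<noteq> w" using t by (simp add: tri_def)
      obtain p q r where "tri p q r L" using triT[of L] L BT by blast
      then obtain u' where t': "tri u' v w L" using edge_tri_endpoints[OF _ L(3) \<open>v \<noteq> w\<close>] by blast
      have "v \<in> V" "w \<in> V" unfolding V_def using tri_extreme[OF t] K by blast+
      then have "x \<noteq> v" "x \<noteq> w" using x by auto
      then have "x \<in> interior (K \<union> L)" using K L BT t t' xe by (intro interior_of_edge_pair[OF _ _ _ t t']) auto
      moreover have "K \<union> L \<subseteq> A" using K L by (auto simp: A_def)
      ultimately show ?thesis using interior_mono by blast
    qed
    show ?thesis
    proof (cases "0 < bary u v w x \<and> 0 < bary v w u x \<and> 0 < bary w u v x")
      case True
      then have "x \<in> interior K" using tri_interior[OF t] by blast
      then show ?thesis using K interior_mono[of K A] by (auto simp: A_def)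
    next
      case False
      then have "bary u v w x = 0 \<or> bary v w u x = 0 \<or> bary w u v x = 0" using tri_mem_iff[OF t] K by fastforce
      then show ?thesis using edge t tri_rotate[OF t] tri_rotate[OF tri_rotate[OF t]] by blast
    qed
  qed
  have "compact A" unfolding A_def using finB triT BT tri_convex_compact by (intro compact_Union) blast+
  have con: "connected (- V)"
    using path_connected_complement_countable[of V] finV by (intro path_connected_imp_connected) (auto simp: countable_finite)
  have "openin (top_of_set (- V)) (A - V)"
  proof -
    have "A - V = - V \<inter> interior A" using int interior_subset by blast
    then show ?thesis using openin_open_Int[of "interior A" "- V"] by simp
  qed
  moreover have "closedin (top_of_set (- V)) (A - V)"
  proof -
    have "A - V = - V \<inter> A" by blast
    then show ?thesis using closedin_closed_Int[OF compact_imp_closed[OF \<open>compact A\<close>], of "- V"] by simp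
  qed
  ultimately have "A - V = {} \<or> A - V = - V" using con connected_clopen by blast
  moreover have "A - V \<noteq> {}"
  proof
    assume "A - V = {}"
    then have "A \<subseteq> V" by blast
    then have "finite A" using finV finite_subset by blast
    moreover have "K \<subseteq> A" using \<open>\<not> P K\<close> K by (auto simp: A_def B_def)
    moreover obtain x where "x \<in> interior K" using triT[OF K] tri_interior_nonempty by blast
    ultimately have "finite (interior K)" "interior K \<noteq> {}" using finite_subset interior_subset by (metis, blast)
    then show False using finite_imp_not_open open_interior by blast
  qed
  ultimately have "- V \<subseteq> A" by blast
  then have "UNIV = A \<union> V" by blast
  moreover have "bounded (A \<union> V)" using \<open>compact A\<close> finV by (auto simp: compact_imp_bounded finite_imp_bounded)
  ultimately show False using not_bounded_UNIV[where 'a="real^2"] by simp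
qed

end

section \<open>Symmetric tensor fields\<close>

definition outer :: "real^2 \<Rightarrow> real^2 \<Rightarrow> real^2^2" where "outer a b = (\<chi> i j. a $ i * b $ j)"

lemma outer_nth [simp]: "outer a b $ i $ j = a $ i * b $ j"
  by (simp add: outer_def)

lemma outer_mult: "outer a b *v c = (b \<bullet> c) *\<^sub>R a"
  by (simp add: vec_eq_iff matrix_vector_mult_def inner_vec_def sum_distrib_left mult_ac)

lemma sym_mats_iff: "A \<in> sym_mats \<longleftrightarrow> A $ 1 $ 2 = A $ 2 $ 1"
  by (auto simp: sym_mats_def transpose_def vec_eq_iff forall_2)

lemma sym_outer: "outer a a \<in> sym_mats"
  by (simp add: sym_mats_iff)

lemma sym_add: "A \<in> sym_mats \<Longrightarrow> B \<in> sym_mats \<Longrightarrow> A + B \<in> sym_mats"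
  by (simp add: sym_mats_iff)

lemma sym_diff: "A \<in> sym_mats \<Longrightarrow> B \<in> sym_mats \<Longrightarrow> A - B \<in> sym_mats"
  by (simp add: sym_mats_iff)

lemma sym_scaleR: "A \<in> sym_mats \<Longrightarrow> r *\<^sub>R A \<in> sym_mats"
  by (simp add: sym_mats_iff)

lemma matrix_mult2: "(A::real^2^2) *v x = (\<chi> i. A $ i $ 1 * x $ 1 + A $ i $ 2 * x $ 2)"
  by (simp add: vec_eq_iff matrix_vector_mult_def sum_2)

lemma scaleR_matrix_vector: "(r *\<^sub>R (A::real^2^2)) *v x = r *\<^sub>R (A *v x)"
  by (simp add: matrix_mult2 vec_eq_iff algebra_simps)

lemma polys_matrix_iff:
  fixes f :: "real^2 \<Rightarrow> real^2^2"
  shows "f \<in> polys k D \<longleftrightarrow> (\<forall>i j. (\<lambda>x. f x $ i $ j) \<in> polys k D)"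
  by (simp add: polys_vec_iff)

lemma polys_matrix_nth: "(f :: real^2 \<Rightarrow> real^2^2) \<in> polys k D \<Longrightarrow> (\<lambda>x. f x $ i $ j) \<in> polys k D"
  by (simp add: polys_matrix_iff)

lemma polys_vec_nth: "(f :: real^2 \<Rightarrow> real^2) \<in> polys k D \<Longrightarrow> (\<lambda>x. f x $ i) \<in> polys k D"
  by (simp add: polys_vec_iff)

lemma polys_continuous_vector:
  fixes f :: "real^2 \<Rightarrow> 'x::real_normed_vector"
  assumes "f \<in> polys k UNIV" shows "continuous_on S f"
proof -
  obtain c where "f = (\<lambda>x. \<Sum>i\<le>k. \<Sum>j\<le>k - i. monom2 i j x *\<^sub>R c i j)" using assms by (auto simp: polys_UNIV_iff)
  then show ?thesis by (auto intro!: continuous_intros)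
qed

lemma polys_scaleR_const: "(f :: real^2 \<Rightarrow> real) \<in> polys k D \<Longrightarrow> (\<lambda>x. f x *\<^sub>R c) \<in> polys k D"
  using polys_scaleR_mult[of f k D "\<lambda>_. c" 0] polys_const[of c 0 D] by simp

lemma polys_bilinear_form:
  fixes f :: "real^2 \<Rightarrow> real^2^2"
  shows "f \<in> polys k D \<Longrightarrow> (\<lambda>x. a \<bullet> (f x *v b)) \<in> polys k D"
  by (rule polys_linear[of "\<lambda>A. a \<bullet> (A *v b)"])
     (auto intro!: linearI simp: matrix_mult2 inner_vec_def sum_2 algebra_simps)

lemma classical_div_add:
  assumes "\<And>i j. (\<lambda>y. \<tau> y $ i $ j) differentiable at x" "\<And>i j. (\<lambda>y. \<sigma> y $ i $ j) differentiable at x"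
  shows "classical_div (\<lambda>x. \<tau> x + \<sigma> x) x = classical_div \<tau> x + classical_div \<sigma> x"
  using assms by (simp add: classical_div_def vec_eq_iff sum_2 partial_add)

text \<open>A tensor built from the direction \<open>d\<close> twice sees only derivatives along
  \<open>d\<close>; its behaviour across \<open>d\<close> has no influence on its
  divergence.\<close>

lemma classical_div_outer:
  assumes "f differentiable at x"
  shows "classical_div (\<lambda>x. f x *\<^sub>R outer d d) x = dir_deriv d f x *\<^sub>R d"
proof -
  have "partial j (\<lambda>y. f y * c) x = c * partial j f x" for j c
    using partial_cmult[OF assms, of j c] by (simp add: mult.commute)
  then have "classical_div (\<lambda>x. f x *\<^sub>R outer d d) x $ i = d $ i * d $ 1 * partial 1 f x + d $ i * d $ 2 * partial 2 f x" for i
    by (simp add: classical_div_def sum_2)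
  then show ?thesis by (simp add: vec_eq_iff dir_deriv_partial[OF assms] algebra_simps)
qed

lemma polys_outer_differentiable: "(f::real^2 \<Rightarrow> real) \<in> polys k UNIV \<Longrightarrow> (\<lambda>y. (f y *\<^sub>R outer d d) $ i $ j) differentiable at x"
  by (intro polys_differentiable[of _ k] polys_matrix_nth polys_scaleR_const)

lemma polys_classical_div:
  assumes "\<tau> \<in> polys k UNIV" shows "classical_div \<tau> \<in> polys (k - 1) UNIV"
proof -
  have "(\<lambda>x. classical_div \<tau> x $ i) \<in> polys (k - 1) UNIV" for i
    unfolding classical_div_def vec_lambda_beta sum_2 using assms
    by (intro polys_add polys_partial polys_matrix_nth)
  then show ?thesis by (simp add: polys_vec_iff)
qed

section \<open>Weak divergence of piecewise polynomial tensor fields\<close>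

text \<open>By Green's formula the integral of this defect is the flux of row \<open>i\<close> of
  \<tau> through the boundary of \<open>K\<close>, weighted by \<phi>. Summed over the triangles it
  measures how far the piecewise divergence is from being the weak one.\<close>

definition wdiv_defect :: "(real^2) set \<Rightarrow> 2 \<Rightarrow> (real^2 \<Rightarrow> real) \<Rightarrow> (real^2 \<Rightarrow> real^2^2) \<Rightarrow> real^2 \<Rightarrow> real" where
  "wdiv_defect K i \<phi> \<tau> x = indicator (interior K) x * ((\<Sum>j\<in>UNIV. \<tau> x $ i $ j * partial j \<phi> x) + classical_div \<tau> x $ i * \<phi> x)"

lemma integrable_piece:
  fixes f :: "real^2 \<Rightarrow> real"
  assumes "continuous_on UNIV f" "\<phi> \<in> test_functions U"
  shows "integrable lebesgue (\<lambda>x. indicator (interior K) x * (f x * \<phi> x))"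
proof -
  obtain R where R: "R > 0" "\<forall>x. \<phi> x \<noteq> 0 \<longrightarrow> norm x \<le> R" using test_function_support[OF assms(2)] by blast
  have c: "continuous_on UNIV (\<lambda>x. f x * \<phi> x)"
    using assms test_function_continuous by (intro continuous_on_mult) auto
  have "integrable lborel (\<lambda>x. indicator (cball 0 R) x *\<^sub>R (f x * \<phi> x))"
    using c by (intro borel_integrable_compact) (auto intro: continuous_on_subset)
  moreover have "(\<lambda>x. indicator (cball 0 R) x *\<^sub>R (f x * \<phi> x)) = (\<lambda>x. f x * \<phi> x)"
    using R by (auto simp: indicator_def fun_eq_iff)
  ultimately have "integrable lborel (\<lambda>x. f x * \<phi> x)" by simp
  then have "integrable lborel (\<lambda>x. indicator (interior K) x *\<^sub>R (f x * \<phi> x))"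
    by (intro integrable_mult_indicator) auto
  then show ?thesis by (intro integrable_completion[THEN iffD2]) auto
qed

lemma wdiv_defect_integrable:
  assumes "\<tau> \<in> polys k UNIV" "\<phi> \<in> test_functions U"
  shows "integrable lebesgue (wdiv_defect K i \<phi> \<tau>)"
proof -
  have "integrable lebesgue (\<lambda>x. indicator (interior K) x * (\<tau> x $ i $ 1 * partial 1 \<phi> x)
     + indicator (interior K) x * (\<tau> x $ i $ 2 * partial 2 \<phi> x) + indicator (interior K) x * (classical_div \<tau> x $ i * \<phi> x))"
    using assms
    by (intro Bochner_Integration.integrable_add integrable_piece[where U = U] test_function_partial polys_continuous[of _ k] polys_continuous[of _ "k - 1"] polys_matrix_nth polys_vec_nth polys_classical_div)
  then show ?thesis unfolding wdiv_defect_def[abs_def] by (simp add: sum_2 algebra_simps)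
qed

lemma wdiv_defect_add:
  assumes "\<tau> \<in> polys k UNIV" "\<sigma> \<in> polys l UNIV"
  shows "wdiv_defect K i \<phi> (\<lambda>x. \<tau> x + \<sigma> x) x = wdiv_defect K i \<phi> \<tau> x + wdiv_defect K i \<phi> \<sigma> x"
proof -
  have "classical_div (\<lambda>x. \<tau> x + \<sigma> x) x = classical_div \<tau> x + classical_div \<sigma> x"
    using assms by (intro classical_div_add polys_differentiable[of _ k] polys_differentiable[of _ l] polys_matrix_nth)
  then show ?thesis by (simp add: wdiv_defect_def sum_2 algebra_simps)
qed

lemma cr_self [simp]: "cr a a = 0" by (simp add: cr_def)
lemma cr_scaleR: "cr a (c *\<^sub>R b) = c * cr a b" by (simp add: cr_def algebra_simps)

text \<open>The bubble vanishes where a line in the direction of the edge \<open>v w\<close> leaves the triangle, so its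
  extension by zero is Lipschitz in that direction.\<close>

lemma edge_bubble_integral:
  assumes t: "tri u v w K" and l: "l \<in> polys k UNIV" and \<phi>: "\<phi> \<in> test_functions U"
  defines "f \<equiv> \<lambda>x. bary v w u x * bary w u v x * l x"
  shows "integral\<^sup>L lebesgue (\<lambda>x. indicator (interior K) x * (f x * dir_deriv (w - v) \<phi> x + dir_deriv (w - v) f x * \<phi> x)) = 0"
proof -
  let ?A = "bary v w u" and ?B = "bary w u v" and ?C = "bary u v w"
  define d where "d = w - v"
  have t2: "tri v w u K" and t3: "tri w u v K" using t tri_rotate by blast+
  have K: "convex K" "compact K" using tri_convex_compact[OF t] by auto
  then have bK: "bounded K" using compact_imp_bounded by blast
  have f: "f \<in> polys (2 + k) UNIV" unfolding f_def
    by (intro polys_mult[where k = 2 and l = k] polys_mult[where k = 1 and l = 1] bary_polys l) auto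
  define F where "F x = indicator K x * (f x * \<phi> x)" for x
  obtain B\<phi> where B\<phi>: "B\<phi> > 0" "\<forall>x. \<bar>\<phi> x\<bar> \<le> B\<phi>" using test_function_bounded[OF \<phi>] by blast
  obtain M\<phi> where M\<phi>: "M\<phi> > 0" "\<forall>x y. \<bar>\<phi> x - \<phi> y\<bar> \<le> M\<phi> * norm (x - y)" using test_function_Lipschitz[OF \<phi>] by blast
  obtain Bf where Bf: "Bf > 0" "\<forall>x\<in>K. \<bar>f x\<bar> \<le> Bf" using polys_bounded[OF f bK] by blast
  obtain Mf where Mf: "Mf > 0" "\<forall>x\<in>K. \<forall>y\<in>K. \<bar>f x - f y\<bar> \<le> Mf * norm (x - y)" using polys_Lipschitz[OF f bK K(1)] by blast
  obtain Bl where Bl: "Bl > 0" "\<forall>x\<in>K. \<bar>l x\<bar> \<le> Bl" using polys_bounded[OF l bK] by blast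
  define a where "a = \<bar>cr (u - w) d / cr (u - w) (v - w)\<bar>"
  define b where "b = \<bar>cr (v - u) d / cr (v - u) (w - u)\<bar>"
  have ab0: "a \<ge> 0" "b \<ge> 0" by (auto simp: a_def b_def)
  \<comment> \<open>Moving along \<open>d\<close> changes the coordinates of \<open>v\<close> and
    \<open>w\<close> linearly and leaves that of \<open>u\<close> fixed.\<close>
  have shift: "?C (x + h *\<^sub>R d) = ?C x" "\<bar>?A (x + h *\<^sub>R d) - ?A x\<bar> = \<bar>h\<bar> * a" "\<bar>?B (x + h *\<^sub>R d) - ?B x\<bar> = \<bar>h\<bar> * b" for x h
    unfolding bary_shift a_def b_def by (simp_all add: cr_scaleR d_def abs_mult)
  define L where "L = (Bf * M\<phi> + Mf * B\<phi>) * norm d + (a + b) * Bl * B\<phi>"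
  have L1: "(Bf * M\<phi> + Mf * B\<phi>) * norm d \<ge> 0" "(a + b) * Bl * B\<phi> \<ge> 0" using Bf M\<phi> Mf B\<phi> Bl ab0 by simp_all
  \<comment> \<open>A chord in direction \<open>d\<close> leaves the triangle through one of the
    other two edges, where the coordinate of \<open>v\<close> or of \<open>w\<close> is zero. If
    this happens within \<open>h\<close>, that coordinate is already small at \<open>y\<close>, and
    the other one is at most 1.\<close>
  have exit: "\<bar>F y\<bar> \<le> (a + b) * Bl * B\<phi> * \<bar>h\<bar>" if y: "y \<in> K" "y + h *\<^sub>R d \<notin> K" for y h
  proof -
    have pos: "?A y \<ge> 0" "?B y \<ge> 0" "?C y \<ge> 0" "?A y \<le> 1" "?B y \<le> 1"
      using y(1) tri_mem_iff[OF t] bary_sum[OF t, of y] by auto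
    have "?A (y + h *\<^sub>R d) < 0 \<or> ?B (y + h *\<^sub>R d) < 0"
      using y(2) tri_mem_iff[OF t, of "y + h *\<^sub>R d"] shift(1)[of y h] pos by auto
    then have "?A y \<le> \<bar>h\<bar> * a \<or> ?B y \<le> \<bar>h\<bar> * b" using shift(2,3)[of y h] by linarith
    moreover have hab: "0 \<le> \<bar>h\<bar> * a" "0 \<le> \<bar>h\<bar> * b" using ab0 by simp_all
    ultimately have "?A y * ?B y \<le> \<bar>h\<bar> * a + \<bar>h\<bar> * b"
    proof (elim disjE)
      assume "?A y \<le> \<bar>h\<bar> * a"
      moreover have "?A y * ?B y \<le> ?A y" using pos by (simp add: mult_left_le)
      ultimately show ?thesis using hab by linarith
    next
      assume "?B y \<le> \<bar>h\<bar> * b"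
      moreover have "?A y * ?B y \<le> ?B y" using pos by (simp add: mult_left_le_one_le)
      ultimately show ?thesis using hab by linarith
    qed
    then have "\<bar>?A y * ?B y\<bar> \<le> \<bar>h\<bar> * (a + b)" using pos by (simp add: algebra_simps)
    moreover have "\<bar>F y\<bar> = \<bar>?A y * ?B y\<bar> * (\<bar>l y\<bar> * \<bar>\<phi> y\<bar>)" using y(1) by (simp add: F_def f_def abs_mult)
    moreover have "\<bar>l y\<bar> * \<bar>\<phi> y\<bar> \<le> Bl * B\<phi>" using Bl B\<phi> y(1) by (intro mult_mono) auto
    ultimately have "\<bar>F y\<bar> \<le> (\<bar>h\<bar> * (a + b)) * (Bl * B\<phi>)" using ab0 by (simp add: mult_mono)
    then show ?thesis by (simp add: mult_ac)
  qed
  have Lip: "\<bar>F (x + h *\<^sub>R d) - F x\<bar> \<le> L * h" if h: "0 < h" "h \<le> 1" for x h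
  proof -
    consider "x \<in> K" "x + h *\<^sub>R d \<in> K" | "x \<in> K" "x + h *\<^sub>R d \<notin> K" | "x \<notin> K" "x + h *\<^sub>R d \<in> K" | "x \<notin> K" "x + h *\<^sub>R d \<notin> K" by blast
    then show ?thesis
    proof cases
      case 1
      define y where "y = x + h *\<^sub>R d"
      have y: "y \<in> K" "norm (y - x) = norm d * h" using 1 h by (simp_all add: y_def)
      have "F y - F x = f y * (\<phi> y - \<phi> x) + (f y - f x) * \<phi> x" using 1 y(1) by (simp add: F_def algebra_simps)
      then have "\<bar>F y - F x\<bar> \<le> \<bar>f y\<bar> * \<bar>\<phi> y - \<phi> x\<bar> + \<bar>f y - f x\<bar> * \<bar>\<phi> x\<bar>"
        using abs_triangle_ineq[of "f y * (\<phi> y - \<phi> x)" "(f y - f x) * \<phi> x"] by (simp add: abs_mult)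
      also have "\<dots> \<le> Bf * (M\<phi> * norm (y - x)) + (Mf * norm (y - x)) * B\<phi>"
        using Bf Mf M\<phi> B\<phi> 1 y(1) by (intro add_mono mult_mono) auto
      also have "\<dots> = (Bf * M\<phi> + Mf * B\<phi>) * norm d * h" unfolding y(2) by (simp add: algebra_simps)
      also have "\<dots> \<le> L * h" using L1 h unfolding L_def by (intro mult_right_mono) auto
      finally show ?thesis by (simp only: y_def)
    next
      case 2
      then have "\<bar>F (x + h *\<^sub>R d) - F x\<bar> = \<bar>F x\<bar>" by (simp add: F_def)
      also have "\<dots> \<le> (a + b) * Bl * B\<phi> * h" using exit[OF 2] h by simp
      also have "\<dots> \<le> L * h" using L1 h unfolding L_def by (intro mult_right_mono) auto
      finally show ?thesis .
    next
      case 3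
      then have "\<bar>F (x + h *\<^sub>R d) - F x\<bar> = \<bar>F (x + h *\<^sub>R d)\<bar>" by (simp add: F_def)
      also have "\<dots> \<le> (a + b) * Bl * B\<phi> * h" using exit[OF 3(2), of "- h"] 3(1) h by simp
      also have "\<dots> \<le> L * h" using L1 h unfolding L_def by (intro mult_right_mono) auto
      finally show ?thesis .
    next
      case 4
      then show ?thesis using L1 h by (simp add: F_def L_def)
    qed
  qed
  define G where "G x = indicator (interior K) x * (f x * dir_deriv d \<phi> x + dir_deriv d f x * \<phi> x)" for x
  have dd: "dir_deriv d \<phi> x = d $ 1 * partial 1 \<phi> x + d $ 2 * partial 2 \<phi> x"
    "dir_deriv d f x = d $ 1 * partial 1 f x + d $ 2 * partial 2 f x" for x
    using dir_deriv_partial polys_differentiable[OF f] test_function_differentiable[OF \<phi>] by blast+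
  have cont: "continuous_on UNIV f" "continuous_on UNIV \<phi>" "continuous_on UNIV (partial i f)" "continuous_on UNIV (partial i \<phi>)" for i
    using polys_continuous[OF f] polys_continuous[OF polys_partial[OF f]] test_function_continuous[OF \<phi>] test_function_continuous[OF test_function_partial[OF \<phi>]] by blast+
  have G_meas: "G \<in> borel_measurable borel"
    unfolding G_def[abs_def] dd
    by (intro borel_measurable_times borel_measurable_indicator borel_measurable_continuous_onI continuous_intros cont) auto
  have Fint: "integrable lborel F"
  proof -
    have "integrable lborel (\<lambda>x. indicator K x *\<^sub>R (f x * \<phi> x))"
      using K(2) cont by (intro borel_integrable_compact continuous_on_mult) (auto intro: continuous_on_subset)
    then show ?thesis by (simp add: F_def[abs_def])
  qed
  obtain R where R: "R > 0" "\<forall>x. \<phi> x \<noteq> 0 \<longrightarrow> norm x \<le> R" using test_function_support[OF \<phi>] by blast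
  have "integral\<^sup>L lebesgue G = 0"
  proof (rule integral_difference_quotient_limit[OF Fint _ Lip, where R = R])
    show "G \<in> borel_measurable lebesgue" using G_meas by (intro measurable_completion) simp
    show "norm x \<le> R" if "F x \<noteq> 0" for x using that R by (auto simp: F_def)
    have "AE x in lebesgue. x \<notin> frontier K"
      using negligible_convex_frontier[OF K(1)] negligible_iff_null_sets by (intro AE_not_in) blast
    then show "AE x in lebesgue. ((\<lambda>h. F (x + h *\<^sub>R d)) has_real_derivative G x) (at 0)"
    proof eventually_elim
      fix x assume x: "x \<notin> frontier K"
      obtain g V where g: "open V" "x \<in> V" "\<And>y. y \<in> V \<Longrightarrow> F y = g y" "g differentiable at x" "dir_deriv d g x = G x"
      proof (cases "x \<in> interior K")
        case True
        show ?thesis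
        proof (rule that[of "interior K" "\<lambda>y. f y * \<phi> y"])
          show "F y = f y * \<phi> y" if "y \<in> interior K" for y using that interior_subset by (auto simp: F_def indicator_def)
          have "((\<lambda>y. f y * \<phi> y) has_derivative (\<lambda>h. f x * frechet_derivative \<phi> (at x) h + frechet_derivative f (at x) h * \<phi> x)) (at x)"
            by (intro has_derivative_mult frechet_D polys_differentiable[OF f] test_function_differentiable[OF \<phi>])
          then show "dir_deriv d (\<lambda>y. f y * \<phi> y) x = G x" "(\<lambda>y. f y * \<phi> y) differentiable at x"
            using True by (auto simp: dir_deriv_eqI G_def dir_deriv_def[of _ f] dir_deriv_def[of _ \<phi>] differentiable_def)
        qed (use True in auto)
      next
        case False
        then have "x \<notin> K" using x closure_subset[of K] by (auto simp: frontier_def)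
        show ?thesis
        proof (rule that[of "- K" "\<lambda>_. 0"])
          show "open (- K)" using K(2) compact_imp_closed by blast
          show "dir_deriv d (\<lambda>_. 0) x = G x" using False by (simp add: G_def dir_deriv_partial)
        qed (use \<open>x \<notin> K\<close> in \<open>auto simp: F_def\<close>)
      qed
      have Fd: "(F has_derivative frechet_derivative g (at x)) (at x)"
        using has_derivative_transform_within_open[OF frechet_D[OF g(4)] g(1,2)] g(3) by simp
      then have Fdiff: "F differentiable at (x + 0 *\<^sub>R d)" by (auto simp: differentiable_def)
      have "dir_deriv d F x = G x" unfolding dir_deriv_eqI[OF Fd] using g(5) by (simp add: dir_deriv_def)
      then show "((\<lambda>h. F (x + h *\<^sub>R d)) has_real_derivative G x) (at 0)"
        using has_derivative_line[OF Fdiff] by simp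
    qed
  qed
  then show ?thesis by (simp add: G_def[abs_def] d_def)
qed

lemma edge_bubble_wdiv:
  assumes t: "tri u v w K" and l: "l \<in> polys k UNIV" and \<phi>: "\<phi> \<in> test_functions U"
  shows "integral\<^sup>L lebesgue (wdiv_defect K i \<phi> (\<lambda>x. (bary v w u x * bary w u v x * l x) *\<^sub>R outer (w - v) (w - v))) = 0"
proof -
  let ?f = "\<lambda>x. bary v w u x * bary w u v x * l x" and ?d = "w - v"
  have f: "?f \<in> polys (2 + k) UNIV"
    by (intro polys_mult[where k = 2 and l = k] polys_mult[where k = 1 and l = 1] bary_polys l) auto
  have "wdiv_defect K i \<phi> (\<lambda>x. ?f x *\<^sub>R outer ?d ?d) = (\<lambda>x. ?d $ i * (indicator (interior K) x * (?f x * dir_deriv ?d \<phi> x + dir_deriv ?d ?f x * \<phi> x)))"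
    unfolding wdiv_defect_def[abs_def] classical_div_outer[OF polys_differentiable[OF f]] dir_deriv_partial[OF test_function_differentiable[OF \<phi>]]
    by (simp add: sum_2 algebra_simps)
  then show ?thesis using edge_bubble_integral[OF t l \<phi>] by (simp only: integral_mult_right_zero mult_zero_right)
qed

text \<open>Expanding \<open>s * (1 - s) * (\<alpha> + \<beta> * s)\<close> shows that \<alpha> has
  to be the coefficient of degree 1 and \<beta> minus that of degree 3; the middle coefficient then
  fits because the value at 1 is the sum of all coefficients.\<close>

lemma cubic_bubble_factor:
  fixes q :: "real poly"
  assumes "degree q \<le> 3" "poly q 0 = 0" "poly q 1 = 0"
  obtains \<alpha> \<beta> where "\<And>s. poly q s = s * (1 - s) * (\<alpha> + \<beta> * s)" "degree q \<le> 2 \<Longrightarrow> \<beta> = 0"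
proof (rule that[of "coeff q 1" "- coeff q 3"])
  fix s
  have c: "coeff q 0 = 0" "coeff q 1 + coeff q 2 + coeff q 3 = 0"
    using assms(2,3) by (auto simp: poly_upto[OF assms(1)] sum_le3)
  then have c2: "coeff q 2 = - coeff q 1 - coeff q 3" by linarith
  show "poly q s = s * (1 - s) * (coeff q 1 + - coeff q 3 * s)"
    unfolding poly_upto[OF assms(1)] sum_le3 c2 c(1) by (simp add: power2_eq_square power3_eq_cube algebra_simps)
qed (simp add: coeff_eq_0)

lemma inner_outer_correction: "d \<bullet> ((A - c *\<^sub>R outer d d) *v d) = d \<bullet> (A *v d) - c * ((d \<bullet> d) * (d \<bullet> d))"
  by (simp add: matrix_vector_mult_diff_rdistrib scaleR_matrix_vector outer_mult inner_diff_right)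

lemma edge_correction:
  assumes t: "tri u v w K" and \<rho>: "\<rho> \<in> polys 3 UNIV"
  obtains b where "b \<in> polys 1 UNIV"
    "\<And>s. (w - v) \<bullet> ((\<rho> (linepath v w s) - (bary v w u (linepath v w s) * bary w u v (linepath v w s) * b (linepath v w s)) *\<^sub>R outer (w - v) (w - v)) *v (w - v))
       = (1 - s) * ((w - v) \<bullet> (\<rho> v *v (w - v))) + s * ((w - v) \<bullet> (\<rho> w *v (w - v)))"
proof -
  let ?d = "w - v"
  have "(\<lambda>x. ?d \<bullet> (\<rho> x *v ?d)) \<in> polys 3 UNIV" using \<rho> by (rule polys_bilinear_form)
  then obtain q where q: "degree q \<le> 3" "\<And>s. ?d \<bullet> (\<rho> (v + s *\<^sub>R ?d) *v ?d) = poly q s"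
    by (rule polys_line[where a = v and d = "w - v"]) blast
  have qv: "?d \<bullet> (\<rho> v *v ?d) = poly q 0" and qw: "?d \<bullet> (\<rho> w *v ?d) = poly q 1" using q(2)[of 0] q(2)[of 1] by simp_all
  \<comment> \<open>The tangential-tangential component minus its linear interpolant vanishes at
    both endpoints, hence contains the edge bubble as a factor.\<close>
  define r where "r = q - [:poly q 0, poly q 1 - poly q 0:]"
  have "degree r \<le> 3" unfolding r_def using q(1) by (intro degree_diff_le) auto
  moreover have "poly r 0 = 0" "poly r 1 = 0" by (simp_all add: r_def)
  ultimately obtain \<alpha> \<beta> where ab: "\<And>s. poly r s = s * (1 - s) * (\<alpha> + \<beta> * s)" using cubic_bubble_factor by metis
  define N where "N = ?d \<bullet> ?d"
  have N: "N \<noteq> 0" using t by (auto simp: N_def tri_def)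
  \<comment> \<open>Contracting \<open>outer d d\<close> twice with \<open>d\<close> gives the
    square of \<open>N\<close>, which the factor in front compensates.\<close>
  define b where "b x = (1 / (N * N)) * (\<alpha> + \<beta> * bary w u v x)" for x
  have "b \<in> polys 1 UNIV" unfolding b_def[abs_def] by (intro polys_cmult polys_add polys_const bary_polys)
  moreover have "?d \<bullet> ((\<rho> (linepath v w s) - (bary v w u (linepath v w s) * bary w u v (linepath v w s) * b (linepath v w s)) *\<^sub>R outer ?d ?d) *v ?d)
       = (1 - s) * (?d \<bullet> (\<rho> v *v ?d)) + s * (?d \<bullet> (\<rho> w *v ?d))" for s
  proof -
    have "?d \<bullet> ((\<rho> (linepath v w s) - (bary v w u (linepath v w s) * bary w u v (linepath v w s) * b (linepath v w s)) *\<^sub>R outer ?d ?d) *v ?d)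
      = poly q s - ((1 - s) * s * (1 / (N * N) * (\<alpha> + \<beta> * s))) * (N * N)"
      unfolding inner_outer_correction b_def bary_linepath[OF t] N_def[symmetric]
      unfolding linepath_alt q(2) ..
    also have "\<dots> = poly q s - poly r s" using N by (simp add: ab mult_ac)
    also have "\<dots> = (1 - s) * poly q 0 + s * poly q 1" by (simp add: r_def algebra_simps)
    finally show ?thesis by (simp add: qv qw)
  qed
  ultimately show thesis using that by blast
qed

text \<open>In the orthogonal basis \<open>n\<close>, \<open>d\<close> a symmetric matrix has three
  entries; the value on \<open>n\<close> accounts for two of them and the quadratic form at
  \<open>d\<close> for the third.\<close>

lemma sym_zero_frame:
  assumes "A \<in> sym_mats" "A *v n = 0" "d \<bullet> (A *v d) = 0" "n \<noteq> 0" "d \<noteq> 0" "n \<bullet> d = 0"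
  shows "A = 0"
proof -
  define p q r where "p = A $ 1 $ 1" and "q = A $ 1 $ 2" and "r = A $ 2 $ 2"
  have q': "A $ 2 $ 1 = q" using assms(1) by (simp add: sym_mats_iff q_def)
  have e: "p * n $ 1 + q * n $ 2 = 0" "q * n $ 1 + r * n $ 2 = 0"
    using assms(2) by (auto simp: matrix_mult2 vec_eq_iff forall_2 p_def q_def r_def q'[unfolded q_def])
  have dd: "d $ 1 * (p * d $ 1 + q * d $ 2) + d $ 2 * (q * d $ 1 + r * d $ 2) = 0"
    using assms(3) q' by (simp add: matrix_mult2 inner_vec_def sum_2 p_def q_def r_def)
  have nd: "n $ 1 * d $ 1 + n $ 2 * d $ 2 = 0" using assms(6) by (simp add: inner_vec_def sum_2)
  define D where "D = d $ 1 * d $ 1 + d $ 2 * d $ 2"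
  define N where "N = n $ 1 * n $ 1 + n $ 2 * n $ 2"
  have "d \<bullet> d \<noteq> 0" "n \<bullet> n \<noteq> 0" using assms(4,5) by auto
  then have DN: "D \<noteq> 0" "N \<noteq> 0" by (auto simp: D_def N_def inner_vec_def sum_2)
  \<comment> \<open>Up to the factor \<open>k / D\<close> the vector \<open>n\<close> is
    \<open>d\<close> turned by a right angle, so the equations for \<open>n\<close> become equations
    for \<open>d\<close>.\<close>
  define k where "k = n $ 1 * d $ 2 - n $ 2 * d $ 1"
  have nk: "n $ 1 * D = k * d $ 2" "n $ 2 * D = - k * d $ 1" unfolding D_def k_def using nd by algebra+
  have "k \<noteq> 0"
  proof
    assume "k = 0"
    then have "n $ 1 = 0" "n $ 2 = 0" using nk DN by auto
    then show False using DN by (simp add: N_def)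
  qed
  have "k * (p * d $ 2 - q * d $ 1) = 0" "k * (q * d $ 2 - r * d $ 1) = 0" using e nk by algebra+
  then have f: "p * d $ 2 = q * d $ 1" "q * d $ 2 = r * d $ 1" using \<open>k \<noteq> 0\<close> by auto
  have "(p + r) * D = 0" using dd f unfolding D_def by algebra
  then have "r = - p" using DN by auto
  then have "p * D = 0" "q * D = 0" using f dd unfolding D_def by algebra+
  then have "p = 0" "q = 0" using DN by auto
  then show ?thesis using \<open>r = - p\<close> q' by (simp add: vec_eq_iff forall_2 p_def q_def r_def)
qed

lemma tri_permutations:
  assumes "tri u v w K" "tri u' v' w' K"
  shows "(u', v', w') \<in> {(u, v, w), (v, w, u), (w, u, v), (u, w, v), (v, u, w), (w, v, u)}"
proof -
  have "{u', v', w'} = {u, v, w}" using tri_extreme[OF assms(1)] tri_extreme[OF assms(2)] by blast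
  moreover have "distinct [u', v', w']" using assms(2) by (simp add: tri_def)
  moreover have "u' \<in> {u, v, w}" "v' \<in> {u, v, w}" "w' \<in> {u, v, w}" using calculation(1) by blast+
  ultimately show ?thesis by auto
qed

lemma linepath_swap: "linepath w v s = linepath v w (1 - s)"
  by (simp add: linepath_def)

text \<open>A tensor field is corrected by edge bubbles, which leave the normal components on all edges
  unchanged, so that its tangential-tangential component becomes affine on every edge.\<close>

lemma tensor_decomposition:
  assumes t: "tri u v w K" and \<rho>: "\<rho> \<in> polys 3 UNIV"
  shows "\<exists>C B. C \<in> polys 3 UNIV \<and> B \<in> polys 3 UNIV \<and> (\<forall>x. \<rho> x = C x + B x) \<and> range B \<subseteq> sym_mats \<and>
    (\<forall>\<phi> i U. \<phi> \<in> test_functions U \<longrightarrow> integral\<^sup>L lebesgue (wdiv_defect K i \<phi> B) = 0) \<and>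
    (\<forall>z. z extreme_point_of K \<longrightarrow> B z = 0) \<and>
    (\<forall>u' v' w' s m. tri u' v' w' K \<longrightarrow> (w' - v') \<bullet> m = 0 \<longrightarrow> C (linepath v' w' s) *v m = \<rho> (linepath v' w' s) *v m) \<and>
    (\<forall>u' v' w' s. tri u' v' w' K \<longrightarrow> (w' - v') \<bullet> (C (linepath v' w' s) *v (w' - v'))
       = (1 - s) * ((w' - v') \<bullet> (\<rho> v' *v (w' - v'))) + s * ((w' - v') \<bullet> (\<rho> w' *v (w' - v'))))"
proof -
  have t2: "tri v w u K" and t3: "tri w u v K" using t tri_rotate by blast+
  define Bf where "Bf u v w b x = (bary v w u x * bary w u v x * b x) *\<^sub>R outer (w - v) (w - v)" for u v w b x
  obtain b1 where b1: "b1 \<in> polys 1 UNIV" "\<And>s. (w - v) \<bullet> ((\<rho> (linepath v w s) - Bf u v w b1 (linepath v w s)) *v (w - v))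
       = (1 - s) * ((w - v) \<bullet> (\<rho> v *v (w - v))) + s * ((w - v) \<bullet> (\<rho> w *v (w - v)))"
    using edge_correction[OF t \<rho>] unfolding Bf_def by metis
  obtain b2 where b2: "b2 \<in> polys 1 UNIV" "\<And>s. (u - w) \<bullet> ((\<rho> (linepath w u s) - Bf v w u b2 (linepath w u s)) *v (u - w))
       = (1 - s) * ((u - w) \<bullet> (\<rho> w *v (u - w))) + s * ((u - w) \<bullet> (\<rho> u *v (u - w)))"
    using edge_correction[OF t2 \<rho>] unfolding Bf_def by metis
  obtain b3 where b3: "b3 \<in> polys 1 UNIV" "\<And>s. (v - u) \<bullet> ((\<rho> (linepath u v s) - Bf w u v b3 (linepath u v s)) *v (v - u))
       = (1 - s) * ((v - u) \<bullet> (\<rho> u *v (v - u))) + s * ((v - u) \<bullet> (\<rho> v *v (v - u)))"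
    using edge_correction[OF t3 \<rho>] unfolding Bf_def by metis
  have Bfp: "Bf u v w b \<in> polys 3 UNIV" if "b \<in> polys 1 UNIV" for u v w b
    unfolding Bf_def[abs_def]
    by (intro polys_scaleR_const polys_mult[where k = 2 and l = 1] polys_mult[where k = 1 and l = 1] bary_polys that) auto
  define B where "B x = Bf u v w b1 x + (Bf v w u b2 x + Bf w u v b3 x)" for x
  have Bp23: "(\<lambda>x. Bf v w u b2 x + Bf w u v b3 x) \<in> polys 3 UNIV"
    by (intro polys_add Bfp b2 b3)
  have Bp: "B \<in> polys 3 UNIV" unfolding B_def[abs_def] by (intro polys_add[OF Bfp[OF b1(1)]] Bp23)
  define C where "C x = \<rho> x - B x" for x
  have Cp: "C \<in> polys 3 UNIV" unfolding C_def[abs_def] by (intro polys_diff \<rho> Bp)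
  have bl: "bary u v w (linepath v w s) = 0" "bary v w u (linepath w u s) = 0" "bary w u v (linepath u v s) = 0" for s
    using bary_linepath t t2 t3 by blast+
  \<comment> \<open>Each of the three bubbles vanishes on the other two edges, so the corrections do
    not interfere.\<close>
  have B_on: "B (linepath v w s) = Bf u v w b1 (linepath v w s)" "B (linepath w u s) = Bf v w u b2 (linepath w u s)"
    "B (linepath u v s) = Bf w u v b3 (linepath u v s)" for s
    by (simp_all add: B_def Bf_def bl)
  define E where "E v w \<longleftrightarrow> (\<forall>s m. (w - v) \<bullet> m = 0 \<longrightarrow> C (linepath v w s) *v m = \<rho> (linepath v w s) *v m) \<and>
    (\<forall>s. (w - v) \<bullet> (C (linepath v w s) *v (w - v)) = (1 - s) * ((w - v) \<bullet> (\<rho> v *v (w - v))) + s * ((w - v) \<bullet> (\<rho> w *v (w - v))))" for v w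
  have Bm: "Bf u v w b x *v m = 0" if "(w - v) \<bullet> m = 0" for u v w b x m
    using that by (simp add: Bf_def scaleR_matrix_vector outer_mult)
  have Cm: "C x *v m = \<rho> x *v m - B x *v m" for x m
    by (simp add: C_def matrix_vector_mult_diff_rdistrib)
  have E1: "E v w" unfolding E_def using b1(2) Bm by (simp add: C_def B_on matrix_vector_mult_diff_rdistrib)
  have E2: "E w u" unfolding E_def using b2(2) Bm by (simp add: C_def B_on matrix_vector_mult_diff_rdistrib)
  have E3: "E u v" unfolding E_def using b3(2) Bm by (simp add: C_def B_on matrix_vector_mult_diff_rdistrib)
  \<comment> \<open>\<open>E\<close> does not depend on the orientation of the edge, which together
    with the three edges covers all six orderings of the vertices.\<close>
  have E_swap: "E w v" if "E v w" for v w
  proof -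
    have neg: "(v - w) \<bullet> (A *v (v - w)) = (w - v) \<bullet> (A *v (w - v))" for A :: "real^2^2"
      by (simp add: matrix_mult2 inner_vec_def sum_2 algebra_simps)
    have "(w - v) \<bullet> m = 0" if "(v - w) \<bullet> m = 0" for m using that by (simp add: inner_diff_left)
    then show ?thesis using that unfolding E_def neg linepath_swap[of w v] by simp
  qed
  have E: "E v' w'" if "tri u' v' w' K" for u' v' w'
    using tri_permutations[OF t that] E1 E2 E3 E_swap by auto
  show ?thesis
  proof (rule exI[of _ C], rule exI[of _ B], intro conjI allI impI)
    show "\<rho> x = C x + B x" for x by (simp add: C_def)
    show "range B \<subseteq> sym_mats"
      unfolding B_def[abs_def] Bf_def by (auto intro!: sym_add sym_scaleR sym_outer)
    show "integral\<^sup>L lebesgue (wdiv_defect K i \<phi> B) = 0" if \<phi>: "\<phi> \<in> test_functions U" for \<phi> i U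
    proof -
      have eq: "wdiv_defect K i \<phi> B = (\<lambda>x. wdiv_defect K i \<phi> (Bf u v w b1) x + (wdiv_defect K i \<phi> (Bf v w u b2) x + wdiv_defect K i \<phi> (Bf w u v b3) x))"
        unfolding B_def[abs_def] wdiv_defect_add[OF Bfp[OF b1(1)] Bp23, abs_def] wdiv_defect_add[OF Bfp[OF b2(1)] Bfp[OF b3(1)], abs_def] ..
      have "integral\<^sup>L lebesgue (wdiv_defect K i \<phi> B) = integral\<^sup>L lebesgue (wdiv_defect K i \<phi> (Bf u v w b1))
         + (integral\<^sup>L lebesgue (wdiv_defect K i \<phi> (Bf v w u b2)) + integral\<^sup>L lebesgue (wdiv_defect K i \<phi> (Bf w u v b3)))"
        unfolding eq
        using wdiv_defect_integrable[OF Bfp[OF b1(1)] \<phi>, of K i u v w] wdiv_defect_integrable[OF Bfp[OF b2(1)] \<phi>, of K i v w u]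
          wdiv_defect_integrable[OF Bfp[OF b3(1)] \<phi>, of K i w u v]
        by (simp only: Bochner_Integration.integral_add Bochner_Integration.integrable_add)
      also have "\<dots> = 0"
        using edge_bubble_wdiv[OF t b1(1) \<phi>, of i] edge_bubble_wdiv[OF t2 b2(1) \<phi>, of i] edge_bubble_wdiv[OF t3 b3(1) \<phi>, of i]
        by (simp add: Bf_def[abs_def])
      finally show ?thesis .
    qed
    show "B z = 0" if "z extreme_point_of K" for z
      using that tri_extreme[OF t] bary_self[OF t] bary_self[OF t2] bary_self[OF t3] by (auto simp: B_def Bf_def)
  next
    fix u' v' w' s m assume "tri u' v' w' K" "(w' - v') \<bullet> m = 0"
    then show "C (linepath v' w' s) *v m = \<rho> (linepath v' w' s) *v m" using E[of u' v' w'] unfolding E_def by blast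
  next
    fix u' v' w' s assume "tri u' v' w' K"
    then show "(w' - v') \<bullet> (C (linepath v' w' s) *v (w' - v'))
       = (1 - s) * ((w' - v') \<bullet> (\<rho> v' *v (w' - v'))) + s * ((w' - v') \<bullet> (\<rho> w' *v (w' - v')))"
      using E[of u' v' w'] unfolding E_def by blast
  qed (rule Cp Bp)+
qed

lemma frame_expand:
  assumes "norm n = 1" "norm t = 1" "n \<bullet> t = 0" shows "(x :: real^2) = (n \<bullet> x) *\<^sub>R n + (t \<bullet> x) *\<^sub>R t"
proof -
  have n: "n $ 1 * n $ 1 + n $ 2 * n $ 2 = 1" and t: "t $ 1 * t $ 1 + t $ 2 * t $ 2 = 1"
    using assms(1,2) by (simp_all add: norm_eq_1 inner_vec_def sum_2)
  have nt: "n $ 1 * t $ 1 + n $ 2 * t $ 2 = 0" using assms(3) by (simp add: inner_vec_def sum_2)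
  define k where "k = n $ 1 * t $ 2 - n $ 2 * t $ 1"
  have tk: "t $ 1 = - n $ 2 * k" "t $ 2 = n $ 1 * k" using n nt unfolding k_def by algebra+
  have "k * k = 1" using t n unfolding tk by algebra
  then have "x $ 1 = (n $ 1 * x $ 1 + n $ 2 * x $ 2) * n $ 1 + (t $ 1 * x $ 1 + t $ 2 * x $ 2) * t $ 1"
    "x $ 2 = (n $ 1 * x $ 1 + n $ 2 * x $ 2) * n $ 2 + (t $ 1 * x $ 1 + t $ 2 * x $ 2) * t $ 2"
    using n unfolding tk by algebra+
  then show ?thesis by (simp add: vec_eq_iff forall_2 inner_vec_def sum_2)
qed

section \<open>Weak divergence of matching families\<close>

locale framed_mesh = mesh \<Omega> \<T> + triangulated \<T>
  for \<Omega> :: "(real^2) set" and \<T> :: "(real^2) set set" +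
  fixes n t :: "(real^2) set \<Rightarrow> real^2"
  assumes frames: "edge_frames \<T> n t"
begin

lemma frame:
  assumes "K \<in> \<T>" "tri u v w K" "e = closed_segment v w"
  shows "norm (n e) = 1" "norm (t e) = 1" "n e \<bullet> t e = 0" "n e \<bullet> (w - v) = 0" "t e \<bullet> (w - v) \<noteq> 0"
    "w - v = (t e \<bullet> (w - v)) *\<^sub>R t e" "n e \<noteq> 0"
proof -
  have e: "e edge_of K" using tri_edge[OF assms(2)] assms(3) by simp
  show f: "norm (n e) = 1" "norm (t e) = 1" "n e \<bullet> t e = 0"
    using frames assms(1) e unfolding edge_frames_def by blast+
  have "v \<in> e" "w \<in> e" using assms(3) by auto
  then show nd: "n e \<bullet> (w - v) = 0" using frames assms(1) e unfolding edge_frames_def by blast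
  show d: "w - v = (t e \<bullet> (w - v)) *\<^sub>R t e" using frame_expand[OF f, of "w - v"] nd by simp
  have "w - v \<noteq> 0" using assms(2) by (auto simp: tri_def)
  then show "t e \<bullet> (w - v) \<noteq> 0" using d by auto
  show "n e \<noteq> 0" using f(1) by auto
qed

text \<open>Pointwise form of the single-valued degrees of freedom; for families of shape functions
  the two forms agree, see \<open>sigma_space_iff\<close>.\<close>

definition consistent :: "((real^2) set \<Rightarrow> real^2 \<Rightarrow> real^2^2) \<Rightarrow> bool" where
  "consistent \<rho> \<longleftrightarrow> (\<forall>K\<in>\<T>. \<forall>L\<in>\<T>. \<forall>z. z extreme_point_of K \<and> z extreme_point_of L \<longrightarrow> \<rho> K z = \<rho> L z) \<and>
    (\<forall>K\<in>\<T>. \<forall>L\<in>\<T>. \<forall>e. e edge_of K \<and> e edge_of L \<longrightarrow> (\<forall>x\<in>e. \<rho> K x *v n e = \<rho> L x *v n e))"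

lemma glue_test_integral:
  fixes q :: "(real^2) set \<Rightarrow> real^2 \<Rightarrow> real"
  assumes "\<And>K. K \<in> \<T> \<Longrightarrow> continuous_on UNIV (q K)" "\<psi> \<in> test_functions \<Omega>"
  shows "integral\<^sup>L (lebesgue_on \<Omega>) (\<lambda>x. glue \<T> q x * \<psi> x) = (\<Sum>K\<in>\<T>. integral\<^sup>L lebesgue (\<lambda>x. indicator (interior K) x * (q K x * \<psi> x)))"
proof -
  have "integral\<^sup>L (lebesgue_on \<Omega>) (\<lambda>x. glue \<T> q x * \<psi> x) = integral\<^sup>L lebesgue (\<lambda>x. indicator \<Omega> x *\<^sub>R (glue \<T> q x * \<psi> x))"
    by (simp add: integral_restrict_space)
  also have "(\<lambda>x. indicator \<Omega> x *\<^sub>R (glue \<T> q x * \<psi> x)) = (\<lambda>x. \<Sum>K\<in>\<T>. indicator (interior K) x * (q K x * \<psi> x))"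
    using test_function_outside[OF assms(2)] by (auto simp: glue_def indicator_def sum_distrib_left mult_ac fun_eq_iff intro!: sum.cong)
  also have "integral\<^sup>L lebesgue \<dots> = (\<Sum>K\<in>\<T>. integral\<^sup>L lebesgue (\<lambda>x. indicator (interior K) x * (q K x * \<psi> x)))"
    using assms by (intro Bochner_Integration.integral_sum integrable_piece)
  finally show ?thesis .
qed

text \<open>The right-hand side compares the two sides of the definition of the weak divergence, so
  a vanishing sum of defects is the weak divergence formula.\<close>

lemma sum_wdiv_defect:
  assumes \<tau>: "\<And>K. K \<in> \<T> \<Longrightarrow> \<tau> K \<in> polys k UNIV" and \<phi>: "\<phi> \<in> test_functions \<Omega>"
  shows "(\<Sum>K\<in>\<T>. integral\<^sup>L lebesgue (wdiv_defect K i \<phi> (\<tau> K)))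
    = (\<Sum>j\<in>UNIV. integral\<^sup>L (lebesgue_on \<Omega>) (\<lambda>x. glue \<T> (\<lambda>K x. \<tau> K x $ i $ j) x * partial j \<phi> x))
     + integral\<^sup>L (lebesgue_on \<Omega>) (\<lambda>x. glue \<T> (\<lambda>K x. classical_div (\<tau> K) x $ i) x * \<phi> x)"
proof -
  have c: "continuous_on UNIV (\<lambda>x. \<tau> K x $ i $ j)" "continuous_on UNIV (\<lambda>x. classical_div (\<tau> K) x $ i)" if "K \<in> \<T>" for K j
    using polys_continuous[OF polys_matrix_nth[OF \<tau>[OF that]]] polys_continuous[OF polys_vec_nth[OF polys_classical_div[OF \<tau>[OF that]]]] by blast+
  have "integral\<^sup>L lebesgue (wdiv_defect K i \<phi> (\<tau> K)) =
    (\<Sum>j\<in>UNIV. integral\<^sup>L lebesgue (\<lambda>x. indicator (interior K) x * (\<tau> K x $ i $ j * partial j \<phi> x)))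
     + integral\<^sup>L lebesgue (\<lambda>x. indicator (interior K) x * (classical_div (\<tau> K) x $ i * \<phi> x))" if K: "K \<in> \<T>" for K
  proof -
    have eq: "wdiv_defect K i \<phi> (\<tau> K) = (\<lambda>x. (\<Sum>j\<in>UNIV. indicator (interior K) x * (\<tau> K x $ i $ j * partial j \<phi> x)) + indicator (interior K) x * (classical_div (\<tau> K) x $ i * \<phi> x))"
      by (auto simp: wdiv_defect_def fun_eq_iff sum_distrib_left distrib_left)
    have i1: "integrable lebesgue (\<lambda>x. indicator (interior K) x * (\<tau> K x $ i $ j * partial j \<phi> x))" for j
      using c(1)[OF K] test_function_partial[OF \<phi>] by (rule integrable_piece)
    have i2: "integrable lebesgue (\<lambda>x. indicator (interior K) x * (classical_div (\<tau> K) x $ i * \<phi> x))"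
      using c(2)[OF K] \<phi> by (rule integrable_piece)
    show ?thesis unfolding eq
      by (subst Bochner_Integration.integral_add, intro Bochner_Integration.integrable_sum i1, rule i2, subst Bochner_Integration.integral_sum, rule i1, rule refl)
  qed
  then have "(\<Sum>K\<in>\<T>. integral\<^sup>L lebesgue (wdiv_defect K i \<phi> (\<tau> K))) =
    (\<Sum>j\<in>UNIV. \<Sum>K\<in>\<T>. integral\<^sup>L lebesgue (\<lambda>x. indicator (interior K) x * (\<tau> K x $ i $ j * partial j \<phi> x)))
     + (\<Sum>K\<in>\<T>. integral\<^sup>L lebesgue (\<lambda>x. indicator (interior K) x * (classical_div (\<tau> K) x $ i * \<phi> x)))"
    by (simp add: sum.distrib sum.swap[of _ UNIV \<T>])
  then show ?thesis using c \<phi> test_function_partial by (simp add: glue_test_integral)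
qed

lemma glue_nth: "glue \<T> \<rho> x $ i = glue \<T> (\<lambda>K x. \<rho> K x $ i) x"
  by (simp add: glue_def)

lemma integrable_glue_test:
  fixes q :: "(real^2) set \<Rightarrow> real^2 \<Rightarrow> real"
  assumes "\<And>K. K \<in> \<T> \<Longrightarrow> continuous_on UNIV (q K)" "\<psi> \<in> test_functions \<Omega>"
  shows "integrable (lebesgue_on \<Omega>) (\<lambda>x. glue \<T> q x * \<psi> x)"
  by (intro integrable_test_mult[OF L2_integrable[OF lmeasurable_\<Omega> glue_L2] assms(2)] assms(1))

lemma continuous_piecewise_wdiv:
  assumes C: "\<And>K. K \<in> \<T> \<Longrightarrow> C K \<in> polys k UNIV" and \<phi>: "\<phi> \<in> test_functions \<Omega>"
    and match: "\<And>K L x. K \<in> \<T> \<Longrightarrow> L \<in> \<T> \<Longrightarrow> x \<in> K \<inter> L \<Longrightarrow> C K x = C L x"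
  shows "(\<Sum>K\<in>\<T>. integral\<^sup>L lebesgue (wdiv_defect K i \<phi> (C K))) = 0"
proof -
  have Cij: "(\<lambda>x. C K x $ i $ j) \<in> polys k UNIV" if "K \<in> \<T>" for K j using C that by (intro polys_matrix_nth)
  have cont: "continuous_on UNIV (partial j (\<lambda>x. C K x $ i $ j))" if "K \<in> \<T>" for K j
    by (rule polys_continuous[OF polys_partial[OF Cij[OF that]]])
  have "(\<lambda>x. glue \<T> (\<lambda>K x. classical_div (C K) x $ i) x * \<phi> x)
     = (\<lambda>x. \<Sum>j\<in>UNIV. glue \<T> (\<lambda>K. partial j (\<lambda>x. C K x $ i $ j)) x * \<phi> x)"
    by (rule ext) (simp add: glue_def classical_div_def sum_2 sum.distrib algebra_simps)
  then have "integral\<^sup>L (lebesgue_on \<Omega>) (\<lambda>x. glue \<T> (\<lambda>K x. classical_div (C K) x $ i) x * \<phi> x)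
    = (\<Sum>j\<in>UNIV. integral\<^sup>L (lebesgue_on \<Omega>) (\<lambda>x. glue \<T> (\<lambda>K. partial j (\<lambda>x. C K x $ i $ j)) x * \<phi> x))"
    using integrable_glue_test[OF cont \<phi>] by (simp add: Bochner_Integration.integral_sum)
  moreover have "integral\<^sup>L (lebesgue_on \<Omega>) (\<lambda>x. glue \<T> (\<lambda>K x. C K x $ i $ j) x * partial j \<phi> x)
     = - integral\<^sup>L (lebesgue_on \<Omega>) (\<lambda>x. glue \<T> (\<lambda>K. partial j (\<lambda>x. C K x $ i $ j)) x * \<phi> x)" for j
  proof (rule continuous_piecewise_weak_partial[where p = "\<lambda>K x. C K x $ i $ j" and k = k, OF _ _ \<phi>])
    show "(\<lambda>x. C K x $ i $ j) \<in> polys k UNIV" if "K \<in> \<T>" for K using that by (rule Cij)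
    show "C K x $ i $ j = C L x $ i $ j" if "K \<in> \<T>" "L \<in> \<T>" "x \<in> K \<inter> L" for K L x
      by (simp only: match[OF that])
  qed
  ultimately show ?thesis using sum_wdiv_defect[where \<tau> = C and i = i, OF C \<phi>] by (simp add: sum_negf)
qed

text \<open>The correcting bubbles have zero defect on each triangle and vanish at the vertices.
  What remains is continuous: on a shared edge the normal component matches, the
  tangential-tangential one is affine with common endpoint values, and a symmetric matrix is
  determined by the two.\<close>

lemma consistent_weak_div:
  assumes \<rho>: "\<And>K. K \<in> \<T> \<Longrightarrow> \<rho> K \<in> polys 3 UNIV" and sym: "\<And>K. K \<in> \<T> \<Longrightarrow> range (\<rho> K) \<subseteq> sym_mats"
    and con: "consistent \<rho>" and \<phi>: "\<phi> \<in> test_functions \<Omega>"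
  shows "integral\<^sup>L (lebesgue_on \<Omega>) (\<lambda>x. \<Sum>j\<in>UNIV. glue \<T> \<rho> x $ i $ j * partial j \<phi> x)
    = - integral\<^sup>L (lebesgue_on \<Omega>) (\<lambda>x. glue \<T> (\<lambda>K. classical_div (\<rho> K)) x $ i * \<phi> x)"
proof -
  define D where "D K C B \<longleftrightarrow> C \<in> polys 3 UNIV \<and> B \<in> polys 3 UNIV \<and> (\<forall>x. \<rho> K x = C x + B x) \<and> range B \<subseteq> sym_mats \<and>
    (\<forall>\<phi> i U. \<phi> \<in> test_functions U \<longrightarrow> integral\<^sup>L lebesgue (wdiv_defect K i \<phi> B) = 0) \<and>
    (\<forall>z. z extreme_point_of K \<longrightarrow> B z = 0) \<and>
    (\<forall>u' v' w' s m. tri u' v' w' K \<longrightarrow> (w' - v') \<bullet> m = 0 \<longrightarrow> C (linepath v' w' s) *v m = \<rho> K (linepath v' w' s) *v m) \<and>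
    (\<forall>u' v' w' s. tri u' v' w' K \<longrightarrow> (w' - v') \<bullet> (C (linepath v' w' s) *v (w' - v'))
       = (1 - s) * ((w' - v') \<bullet> (\<rho> K v' *v (w' - v'))) + s * ((w' - v') \<bullet> (\<rho> K w' *v (w' - v'))))" for K C B
  have "\<forall>K\<in>\<T>. \<exists>C B. D K C B"
  proof
    fix K assume K: "K \<in> \<T>"
    obtain u v w where t: "tri u v w K" using triT[OF K] by blast
    show "\<exists>C B. D K C B" unfolding D_def by (rule tensor_decomposition[OF t \<rho>[OF K]])
  qed
  from bchoice[OF this] obtain C where "\<forall>K\<in>\<T>. \<exists>B. D K (C K) B" by blast
  from bchoice[OF this] obtain B where "\<forall>K\<in>\<T>. D K (C K) (B K)" by blast
  note CBall = this[unfolded D_def]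
  have
    C: "\<And>K. K \<in> \<T> \<Longrightarrow> C K \<in> polys 3 UNIV" and B: "\<And>K. K \<in> \<T> \<Longrightarrow> B K \<in> polys 3 UNIV"
    and CB: "\<And>K x. K \<in> \<T> \<Longrightarrow> \<rho> K x = C K x + B K x" and Bs: "\<And>K. K \<in> \<T> \<Longrightarrow> range (B K) \<subseteq> sym_mats"
    and Bz: "\<And>K z. K \<in> \<T> \<Longrightarrow> z extreme_point_of K \<Longrightarrow> B K z = 0"
    and Cn: "\<And>K u' v' w' s m. K \<in> \<T> \<Longrightarrow> tri u' v' w' K \<Longrightarrow> (w' - v') \<bullet> m = 0 \<Longrightarrow> C K (linepath v' w' s) *v m = \<rho> K (linepath v' w' s) *v m"
    and Ct: "\<And>K u' v' w' s. K \<in> \<T> \<Longrightarrow> tri u' v' w' K \<Longrightarrow> (w' - v') \<bullet> (C K (linepath v' w' s) *v (w' - v'))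
       = (1 - s) * ((w' - v') \<bullet> (\<rho> K v' *v (w' - v'))) + s * ((w' - v') \<bullet> (\<rho> K w' *v (w' - v')))"
    using CBall by (auto simp del: split_paired_All)
  have B0: "integral\<^sup>L lebesgue (wdiv_defect K i \<phi> (B K)) = 0" if "K \<in> \<T>" for K
    using bspec[OF CBall that] \<phi> by (elim conjE) blast
  have vert: "\<rho> K z = \<rho> L z" if "K \<in> \<T>" "L \<in> \<T>" "z extreme_point_of K" "z extreme_point_of L" for K L z
    using con that unfolding consistent_def by blast
  have Cs: "C K x \<in> sym_mats" if "K \<in> \<T>" for K x
  proof -
    have "C K x = \<rho> K x - B K x" using CB[OF that] by simp
    moreover have "\<rho> K x \<in> sym_mats" "B K x \<in> sym_mats" using sym[OF that] Bs[OF that] by blast+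
    ultimately show ?thesis using sym_diff by simp
  qed
  have match: "C K x = C L x" if K: "K \<in> \<T>" and L: "L \<in> \<T>" and x: "x \<in> K \<inter> L" for K L x
  proof (cases "K = L")
    case False
    show ?thesis
    proof (rule intersection_cases[OF K L False])
      show "K \<inter> L \<noteq> {}" using x by blast
    next
      fix z assume z: "K \<inter> L = {z}" "z extreme_point_of K" "z extreme_point_of L"
      then have "x = z" using x by blast
      then show ?thesis using CB[OF K, of z] CB[OF L, of z] Bz K L z(2,3) vert[OF K L z(2,3)] by simp
    next
      fix u v w u' assume t: "tri u v w K" "tri u' v w L" "K \<inter> L = closed_segment v w"
      define e where "e = closed_segment v w"
      obtain s where s: "s \<in> {0..1}" "x = linepath v w s" using x t(3) by (metis imageE linepath_image_01)
      have xe: "x \<in> e" using x t(3) by (simp add: e_def)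
      have ee: "e edge_of K" "e edge_of L" using tri_edge t e_def by blast+
      note f = frame[OF K t(1) e_def]
      have nd: "(w - v) \<bullet> n e = 0" using f(4) by (simp add: inner_commute)
      have "\<rho> K x *v n e = \<rho> L x *v n e" using con K L ee xe unfolding consistent_def by blast
      then have n0: "(C K x - C L x) *v n e = 0"
        unfolding matrix_vector_mult_diff_rdistrib s(2) Cn[OF K t(1) nd] Cn[OF L t(2) nd]
        unfolding s(2) by simp
      have "v extreme_point_of K" "v extreme_point_of L" "w extreme_point_of K" "w extreme_point_of L"
        using tri_extreme[OF t(1)] tri_extreme[OF t(2)] by auto
      then have "\<rho> K v = \<rho> L v" "\<rho> K w = \<rho> L w" using vert[OF K L] by blast+
      then have "(w - v) \<bullet> (C K x *v (w - v)) = (w - v) \<bullet> (C L x *v (w - v))"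
        unfolding s(2) Ct[OF K t(1)] Ct[OF L t(2)] by simp
      then have "(w - v) \<bullet> ((C K x - C L x) *v (w - v)) = 0"
        unfolding matrix_vector_mult_diff_rdistrib inner_diff_right[of "w - v" "C K x *v (w - v)" "C L x *v (w - v)"] by simp
      then have "C K x - C L x = 0"
        using n0 f(4,7) t(1) Cs K L by (intro sym_zero_frame[of _ "n e" "w - v"] sym_diff) (auto simp: tri_def)
      then show ?thesis by simp
    qed
  qed simp
  have "integral\<^sup>L lebesgue (wdiv_defect K i \<phi> (\<rho> K)) = integral\<^sup>L lebesgue (wdiv_defect K i \<phi> (C K))" if K: "K \<in> \<T>" for K
  proof -
    have "\<rho> K = (\<lambda>x. C K x + B K x)" using CB[OF K] by auto
    then have "wdiv_defect K i \<phi> (\<rho> K) = (\<lambda>x. wdiv_defect K i \<phi> (C K) x + wdiv_defect K i \<phi> (B K) x)"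
      using wdiv_defect_add[OF C[OF K] B[OF K]] by auto
    then show ?thesis
      using wdiv_defect_integrable[OF C[OF K] \<phi>] wdiv_defect_integrable[OF B[OF K] \<phi>] B0[OF K] by (simp add: Bochner_Integration.integral_add)
  qed
  then have "(\<Sum>K\<in>\<T>. integral\<^sup>L lebesgue (wdiv_defect K i \<phi> (\<rho> K))) = 0"
    using continuous_piecewise_wdiv[where C = C and i = i, OF C \<phi> match] by simp
  then have "(\<Sum>j\<in>UNIV. integral\<^sup>L (lebesgue_on \<Omega>) (\<lambda>x. glue \<T> (\<lambda>K x. \<rho> K x $ i $ j) x * partial j \<phi> x))
     = - integral\<^sup>L (lebesgue_on \<Omega>) (\<lambda>x. glue \<T> (\<lambda>K x. classical_div (\<rho> K) x $ i) x * \<phi> x)"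
    using sum_wdiv_defect[where \<tau> = \<rho> and i = i, OF \<rho> \<phi>] by simp
  moreover have "integrable (lebesgue_on \<Omega>) (\<lambda>x. glue \<T> (\<lambda>K x. \<rho> K x $ i $ j) x * partial j \<phi> x)" for j
    using polys_continuous[OF polys_matrix_nth[OF \<rho>]] test_function_partial[OF \<phi>] by (intro integrable_glue_test)
  ultimately show ?thesis by (simp add: glue_nth Bochner_Integration.integral_sum)
qed

end

section \<open>The divergence on one triangle\<close>

text \<open>Symmetric cubic fields that vanish at the vertices and have no normal component on the
  two edges at \<open>u\<close>. The triples are coefficients of affine functions in the coordinates
  \<open>x\<close> of \<open>v\<close> and \<open>y\<close> of \<open>w\<close>: \<open>p\<close>,
  \<open>q\<close>, \<open>r\<close> multiply the bubbles of the edges \<open>u v\<close>,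
  \<open>u w\<close>, \<open>v w\<close> in their own directions, while \<open>m\<close> and
  \<open>k\<close> produce flux through the edge \<open>v w\<close>.\<close>

definition tens :: "real^2 \<Rightarrow> real^2 \<Rightarrow> real^2 \<Rightarrow> real \<times> real \<times> real \<Rightarrow> real \<times> real \<times> real \<Rightarrow> real \<times> real \<times> real
    \<Rightarrow> real \<times> real \<times> real \<Rightarrow> real \<times> real \<times> real \<Rightarrow> real^2 \<Rightarrow> real^2^2" where
  "tens u v w p q r m k X = (let x = bary v w u X; y = bary w u v X; aff = (\<lambda>(c0, c1, c2). c0 + c1 * x + c2 * y) in
     (x * (1 - x - y) * aff p + x * y * aff m) *\<^sub>R outer (v - u) (v - u)
   + (y * (1 - x - y) * aff q + x * y * aff k) *\<^sub>R outer (w - u) (w - u)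
   + (x * y * aff r) *\<^sub>R outer (w - v) (w - v))"

text \<open>By \<open>bary_has_derivative\<close> these quotients are the derivatives of the
  coordinates of \<open>v\<close> and \<open>w\<close> in the three edge directions.\<close>

lemma dir_deriv_bary_tri:
  assumes "tri u v w K"
  shows "cr (u - w) (v - u) / cr (u - w) (v - w) = 1" "cr (u - w) (w - u) / cr (u - w) (v - w) = 0"
    "cr (u - w) (w - v) / cr (u - w) (v - w) = -1"
    "cr (v - u) (v - u) / cr (v - u) (w - u) = 0" "cr (v - u) (w - u) / cr (v - u) (w - u) = 1"
    "cr (v - u) (w - v) / cr (v - u) (w - u) = 1"
proof -
  have nz: "cr (u - w) (v - w) \<noteq> 0" "cr (v - u) (w - u) \<noteq> 0"
    using tri_cr[OF tri_rotate[OF assms]] tri_cr[OF tri_rotate[OF tri_rotate[OF assms]]] by auto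
  have "cr (u - w) (v - u) = cr (u - w) (v - w)" "cr (u - w) (w - u) = 0" "cr (u - w) (w - v) = - cr (u - w) (v - w)"
    "cr (v - u) (w - v) = cr (v - u) (w - u)" by (simp_all add: cr_def algebra_simps)
  with nz show "cr (u - w) (v - u) / cr (u - w) (v - w) = 1" "cr (u - w) (w - u) / cr (u - w) (v - w) = 0"
    "cr (u - w) (w - v) / cr (u - w) (v - w) = -1"
    "cr (v - u) (v - u) / cr (v - u) (w - u) = 0" "cr (v - u) (w - u) / cr (v - u) (w - u) = 1"
    "cr (v - u) (w - v) / cr (v - u) (w - u) = 1" by simp_all
qed

text \<open>The result is sorted by the basis \<open>v - u\<close>, \<open>w - u\<close> and by
  monomials in the two coordinates. A linear divergence means that the six quadratic coefficients
  vanish; \<open>local_div_surj\<close> and \<open>local_extension\<close> choose their coefficients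
  from this table.\<close>

lemma div_tens:
  assumes t: "tri u v w K"
  defines "x \<equiv> bary v w u" and "y \<equiv> bary w u v"
  shows "classical_div (tens u v w (p0, p1, p2) (q0, q1, q2) (r0, r1, r2) (m0, m1, m2) (k0, k1, k2)) X =
    (p0 + (2 * p1 - 2 * p0 - r0) * x X + (p2 - p0 + m0 + r0) * y X + (- 3 * p1 - r1) * (x X * x X)
       + (- 2 * p2 - 2 * p1 + 2 * m1 + 2 * (r1 - r2)) * (x X * y X) + (- p2 + m2 + r2) * (y X * y X)) *\<^sub>R (v - u)
  + (q0 + (q1 - q0 + k0 + r0) * x X + (2 * q2 - 2 * q0 - r0) * y X + (- q1 + k1 + r1) * (x X * x X)
       + (- 2 * q1 - 2 * q2 + 2 * k2 - 2 * (r1 - r2)) * (x X * y X) + (- 3 * q2 - r2) * (y X * y X)) *\<^sub>R (w - u)"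
proof -
  let ?a = "v - u" and ?b = "w - u" and ?d = "w - v"
  define dx dy where "dx h = cr (u - w) h / cr (u - w) (v - w)" and "dy h = cr (v - u) h / cr (v - u) (w - u)" for h
  have hx: "(x has_derivative dx) (at X)" and hy: "(y has_derivative dy) (at X)"
    unfolding x_def y_def dx_def[abs_def] dy_def[abs_def] by (rule bary_has_derivative)+
  have d: "dx ?a = 1" "dx ?b = 0" "dx ?d = -1" "dy ?a = 0" "dy ?b = 1" "dy ?d = 1"
    using dir_deriv_bary_tri[OF t] by (simp_all add: dx_def dy_def)
  define f where "f X = x X * (1 - x X - y X) * (p0 + p1 * x X + p2 * y X) + x X * y X * (m0 + m1 * x X + m2 * y X)" for X
  define g where "g X = y X * (1 - x X - y X) * (q0 + q1 * x X + q2 * y X) + x X * y X * (k0 + k1 * x X + k2 * y X)" for X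
  define h where "h X = x X * y X * (r0 + r1 * x X + r2 * y X)" for X
  have T: "tens u v w (p0, p1, p2) (q0, q1, q2) (r0, r1, r2) (m0, m1, m2) (k0, k1, k2) = (\<lambda>X. f X *\<^sub>R outer ?a ?a + g X *\<^sub>R outer ?b ?b + h X *\<^sub>R outer ?d ?d)"
    by (simp add: tens_def fun_eq_iff f_def g_def h_def x_def y_def Let_def)
  have pol: "x \<in> polys 1 UNIV" "y \<in> polys 1 UNIV" unfolding x_def y_def by (rule bary_polys)+
  have aff: "(\<lambda>X. c0 + c1 * x X + c2 * y X) \<in> polys 1 UNIV" for c0 c1 c2
    by (intro polys_add polys_cmult polys_const pol)
  have z: "(\<lambda>X. 1 - x X - y X) \<in> polys 1 UNIV" by (intro polys_diff polys_const pol)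
  have fp: "f \<in> polys 3 UNIV" unfolding f_def[abs_def]
    by (intro polys_add polys_mult[where k=2 and l=1] polys_mult[where k=1 and l=1] pol aff z) auto
  have gp: "g \<in> polys 3 UNIV" unfolding g_def[abs_def]
    by (intro polys_add polys_mult[where k=2 and l=1] polys_mult[where k=1 and l=1] pol aff z) auto
  have hp: "h \<in> polys 3 UNIV" unfolding h_def[abs_def]
    by (intro polys_mult[where k=2 and l=1] polys_mult[where k=1 and l=1] pol aff) auto
  have fd: "(f has_derivative (\<lambda>e. dx e * ((1 - 2 * x X - y X) * (p0 + p1 * x X + p2 * y X) + x X * (1 - x X - y X) * p1 + y X * (m0 + m1 * x X + m2 * y X) + x X * y X * m1)
      + dy e * (- x X * (p0 + p1 * x X + p2 * y X) + x X * (1 - x X - y X) * p2 + x X * (m0 + m1 * x X + m2 * y X) + x X * y X * m2))) (at X)"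
    unfolding f_def[abs_def] by (auto intro!: derivative_eq_intros hx hy simp: algebra_simps)
  have gd: "(g has_derivative (\<lambda>e. dx e * (- y X * (q0 + q1 * x X + q2 * y X) + y X * (1 - x X - y X) * q1 + y X * (k0 + k1 * x X + k2 * y X) + x X * y X * k1)
      + dy e * ((1 - x X - 2 * y X) * (q0 + q1 * x X + q2 * y X) + y X * (1 - x X - y X) * q2 + x X * (k0 + k1 * x X + k2 * y X) + x X * y X * k2))) (at X)"
    unfolding g_def[abs_def] by (auto intro!: derivative_eq_intros hx hy simp: algebra_simps)
  have hd: "(h has_derivative (\<lambda>e. dx e * (y X * (r0 + r1 * x X + r2 * y X) + x X * y X * r1) + dy e * (x X * (r0 + r1 * x X + r2 * y X) + x X * y X * r2))) (at X)"
    unfolding h_def[abs_def] by (auto intro!: derivative_eq_intros hx hy simp: algebra_simps)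
  have "classical_div (\<lambda>X. f X *\<^sub>R outer ?a ?a + g X *\<^sub>R outer ?b ?b + h X *\<^sub>R outer ?d ?d) X
     = dir_deriv ?a f X *\<^sub>R ?a + dir_deriv ?b g X *\<^sub>R ?b + dir_deriv ?d h X *\<^sub>R ?d"
  proof -
    have o: "(\<lambda>y. (f y *\<^sub>R outer d d) $ i $ j) differentiable at X" if "f \<in> polys 3 UNIV" for f d i j
      using that by (rule polys_outer_differentiable)
    have s: "(\<lambda>y. (f y *\<^sub>R outer ?a ?a + g y *\<^sub>R outer ?b ?b) $ i $ j) differentiable at X" for i j
      by (intro polys_differentiable[of _ 3] polys_matrix_nth polys_add polys_scaleR_const fp gp)
    show ?thesis
      by (simp only: classical_div_add[OF s o[OF hp]] classical_div_add[OF o[OF fp] o[OF gp]]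
          classical_div_outer[OF polys_differentiable[OF fp]] classical_div_outer[OF polys_differentiable[OF gp]]
          classical_div_outer[OF polys_differentiable[OF hp]])
  qed
  also have "\<dots> = (dir_deriv ?a f X - dir_deriv ?d h X) *\<^sub>R ?a + (dir_deriv ?b g X + dir_deriv ?d h X) *\<^sub>R ?b"
  proof -
    \<comment> \<open>The third edge direction is the difference of the other two, so its bubble
      contributes to both basis vectors with opposite signs.\<close>
    have "?d = ?b - ?a" by simp
    then have "c *\<^sub>R ?d = c *\<^sub>R ?b - c *\<^sub>R ?a" for c by (simp only: scaleR_diff_right)
    then show ?thesis by (simp only: scaleR_add_left scaleR_diff_left) (simp add: algebra_simps)
  qed
  also have "dir_deriv ?a f X - dir_deriv ?d h X = p0 + (2 * p1 - 2 * p0 - r0) * x X + (p2 - p0 + m0 + r0) * y X + (- 3 * p1 - r1) * (x X * x X)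
       + (- 2 * p2 - 2 * p1 + 2 * m1 + 2 * (r1 - r2)) * (x X * y X) + (- p2 + m2 + r2) * (y X * y X)"
    unfolding dir_deriv_eqI[OF fd] dir_deriv_eqI[OF hd] d by (simp add: algebra_simps)
  also have "dir_deriv ?b g X + dir_deriv ?d h X = q0 + (q1 - q0 + k0 + r0) * x X + (2 * q2 - 2 * q0 - r0) * y X + (- q1 + k1 + r1) * (x X * x X)
       + (- 2 * q1 - 2 * q2 + 2 * k2 - 2 * (r1 - r2)) * (x X * y X) + (- 3 * q2 - r2) * (y X * y X)"
    unfolding dir_deriv_eqI[OF gd] dir_deriv_eqI[OF hd] d by (simp add: algebra_simps)
  finally show ?thesis unfolding T .
qed

lemma polys_tens: "tens u v w p q r m k \<in> polys 3 UNIV"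
proof -
  have aff: "(\<lambda>X. case c of (c0, c1, c2) \<Rightarrow> c0 + c1 * bary v w u X + c2 * bary w u v X) \<in> polys 1 UNIV" for c :: "real \<times> real \<times> real"
    by (cases c, simp only: prod.case) (intro polys_add polys_cmult polys_const bary_polys)
  have z: "(\<lambda>X. 1 - bary v w u X - bary w u v X) \<in> polys 1 UNIV" by (intro polys_diff polys_const bary_polys)
  show ?thesis unfolding tens_def[abs_def] Let_def
    by (intro polys_add polys_scaleR_const polys_mult[where k=2 and l=1] polys_mult[where k=1 and l=1] bary_polys aff z) auto
qed

lemma sym_tens: "range (tens u v w p q r m k) \<subseteq> sym_mats"
  unfolding tens_def Let_def by (auto intro!: sym_add sym_scaleR sym_outer)

lemma tens_edge:
  assumes t: "tri u v w K"
  shows "(v - u) \<bullet> n = 0 \<Longrightarrow> tens u v w p q r m k (linepath u v s) *v n = 0"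
    "(u - w) \<bullet> n = 0 \<Longrightarrow> tens u v w p q r m k (linepath w u s) *v n = 0"
    "(w - v) \<bullet> n = 0 \<Longrightarrow> tens u v w p q r (m0, m1, m2) (k0, k1, k2) (linepath v w s) *v n
      = ((1 - s) * s * ((v - u) \<bullet> n)) *\<^sub>R ((m0 + m1 * (1 - s) + m2 * s) *\<^sub>R (v - u) + (k0 + k1 * (1 - s) + k2 * s) *\<^sub>R (w - u))"
proof -
  have t2: "tri v w u K" and t3: "tri w u v K" using t tri_rotate by blast+
  have e1: "bary v w u (linepath u v s) = s" "bary w u v (linepath u v s) = 0" using bary_linepath[OF t3] by auto
  have e2: "bary v w u (linepath w u s) = 0" "bary w u v (linepath w u s) = 1 - s" using bary_linepath[OF t2] by auto
  have e3: "bary v w u (linepath v w s) = 1 - s" "bary w u v (linepath v w s) = s" using bary_linepath[OF t] by auto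
  show "tens u v w p q r m k (linepath u v s) *v n = 0" if "(v - u) \<bullet> n = 0"
    using that by (simp add: tens_def Let_def e1 scaleR_matrix_vector outer_mult)
  show "tens u v w p q r m k (linepath w u s) *v n = 0" if "(u - w) \<bullet> n = 0"
  proof -
    have "(w - u) \<bullet> n = 0" using that by (simp add: inner_diff_left)
    then show ?thesis by (simp add: tens_def Let_def e2 scaleR_matrix_vector outer_mult)
  qed
  show "tens u v w p q r (m0, m1, m2) (k0, k1, k2) (linepath v w s) *v n
      = ((1 - s) * s * ((v - u) \<bullet> n)) *\<^sub>R ((m0 + m1 * (1 - s) + m2 * s) *\<^sub>R (v - u) + (k0 + k1 * (1 - s) + k2 * s) *\<^sub>R (w - u))"
    if "(w - v) \<bullet> n = 0"
  proof -
    have wu: "(w - u) \<bullet> n = (v - u) \<bullet> n" using that by (simp add: inner_diff_left)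
    show ?thesis
      unfolding tens_def Let_def e3 matrix_vector_mult_add_rdistrib scaleR_matrix_vector outer_mult that wu
      by (simp add: scaleR_add_right mult_ac)
  qed
qed

lemma tens_vertex: "tri u v w K \<Longrightarrow> z extreme_point_of K \<Longrightarrow> tens u v w p q r m k z = 0"
  using tri_extreme[of u v w K z] bary_self[of v w u K] bary_self[of w u v K] tri_rotate[of u v w K] tri_rotate[of v w u K]
  by (auto simp: tens_def Let_def)

lemma polys1_affine:
  assumes "f \<in> polys 1 UNIV" "a + b + c = 1"
  shows "f (a *\<^sub>R A + b *\<^sub>R B + c *\<^sub>R C) = a *\<^sub>R f A + b *\<^sub>R f B + c *\<^sub>R f C"
  using assms(1)
proof (induction rule: polys_induct)
  case (monom i j d)
  then consider "i = 0" "j = 0" | "i = 1" "j = 0" | "i = 0" "j = 1" by linarith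
  then show ?case
  proof cases
    case 1
    have "d = (a + b + c) *\<^sub>R d" using assms(2) by simp
    then show ?thesis using 1 by (simp add: scaleR_add_left)
  qed (simp_all add: scaleR_add_left)
qed (simp_all add: scaleR_add_right add_ac)

lemma polys1_bary:
  assumes t: "tri u v w K" and q: "(q :: real^2 \<Rightarrow> real^2) \<in> polys 1 UNIV"
  obtains c0 c1 c2 d0 d1 d2 where "\<And>X. q X = (c0 + c1 * bary v w u X + c2 * bary w u v X) *\<^sub>R (v - u) + (d0 + d1 * bary v w u X + d2 * bary w u v X) *\<^sub>R (w - u)"
proof -
  let ?a = "v - u" and ?b = "w - u"
  have D: "cr ?a ?b \<noteq> 0" using t by (simp add: tri_def)
  \<comment> \<open>Cramer's rule for the basis \<open>v - u\<close>, \<open>w - u\<close>.\<close>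
  define c d where "c V = cr V ?b / cr ?a ?b" and "d V = cr ?a V / cr ?a ?b" for V
  have cd: "V = c V *\<^sub>R ?a + d V *\<^sub>R ?b" for V
  proof -
    have "cr ?a ?b *\<^sub>R V = cr V ?b *\<^sub>R ?a + cr ?a V *\<^sub>R ?b"
      by (simp add: vec_eq_iff forall_2 cr_def algebra_simps)
    then have "(1 / cr ?a ?b) *\<^sub>R (cr ?a ?b *\<^sub>R V) = (1 / cr ?a ?b) *\<^sub>R (cr V ?b *\<^sub>R ?a + cr ?a V *\<^sub>R ?b)" by simp
    then show ?thesis using D by (simp add: c_def d_def scaleR_add_right)
  qed
  have "q X = (c (q u) + c (q v - q u) * bary v w u X + c (q w - q u) * bary w u v X) *\<^sub>R ?a + (d (q u) + d (q v - q u) * bary v w u X + d (q w - q u) * bary w u v X) *\<^sub>R ?b" for X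
  proof -
    have "q X = bary u v w X *\<^sub>R q u + bary v w u X *\<^sub>R q v + bary w u v X *\<^sub>R q w"
      using polys1_affine[OF q bary_sum[OF t, of X], of u v w] bary_expand[OF t, of X] by simp
    also have "bary u v w X = 1 - bary v w u X - bary w u v X" using bary_sum[OF t, of X] by simp
    also have "(1 - bary v w u X - bary w u v X) *\<^sub>R q u + bary v w u X *\<^sub>R q v + bary w u v X *\<^sub>R q w
      = q u + bary v w u X *\<^sub>R (q v - q u) + bary w u v X *\<^sub>R (q w - q u)" by (simp add: algebra_simps)
    also have "\<dots> = (c (q u) *\<^sub>R ?a + d (q u) *\<^sub>R ?b) + bary v w u X *\<^sub>R (c (q v - q u) *\<^sub>R ?a + d (q v - q u) *\<^sub>R ?b)
       + bary w u v X *\<^sub>R (c (q w - q u) *\<^sub>R ?a + d (q w - q u) *\<^sub>R ?b)"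
      using cd[of "q u"] cd[of "q v - q u"] cd[of "q w - q u"] by simp
    finally show ?thesis by (simp add: scaleR_add_right scaleR_add_left mult_ac add_ac)
  qed
  then show thesis using that by blast
qed

section \<open>Fields on one triangle with flux through a single edge\<close>

context framed_mesh
begin

text \<open>On the edge opposite \<open>u\<close> the tangential-normal component is a constant
  times \<open>(1 - s) * s\<close> times the affine function of the last premise; constancy of that
  function brings the degree down from 3 to 2. On the other two edges the normal components
  vanish.\<close>

lemma tens_sigma_shape:
  assumes K: "K \<in> \<T>" and t: "tri u v w K"
    and E1: "\<And>X. classical_div (tens u v w p q r (m0, m1, m2) (k0, k1, k2)) X
       = (c0 + c1 * bary v w u X + c2 * bary w u v X) *\<^sub>R (v - u) + (d0 + d1 * bary v w u X + d2 * bary w u v X) *\<^sub>R (w - u)"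
    and con: "\<And>s. (m0 + m1 * (1 - s) + m2 * s) * ((v - u) \<bullet> t (closed_segment v w)) + (k0 + k1 * (1 - s) + k2 * s) * ((w - u) \<bullet> t (closed_segment v w)) = c"
  shows "tens u v w p q r (m0, m1, m2) (k0, k1, k2) \<in> sigma_shape n t K"
proof -
  let ?\<tau> = "tens u v w p q r (m0, m1, m2) (k0, k1, k2)"
  have t2: "tri v w u K" and t3: "tri w u v K" using t tri_rotate by blast+
  have "(\<lambda>X. (c0 + c1 * bary v w u X + c2 * bary w u v X) *\<^sub>R (v - u) + (d0 + d1 * bary v w u X + d2 * bary w u v X) *\<^sub>R (w - u)) \<in> polys 1 K"
    by (rule polys_UNIV_D) (intro polys_add polys_scaleR_const polys_cmult polys_const bary_polys)
  moreover have "classical_div ?\<tau> = (\<lambda>X. (c0 + c1 * bary v w u X + c2 * bary w u v X) *\<^sub>R (v - u) + (d0 + d1 * bary v w u X + d2 * bary w u v X) *\<^sub>R (w - u))"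
    using E1 by (rule ext)
  ultimately have "classical_div ?\<tau> \<in> polys 1 K" by (simp only:)
  moreover have "(\<lambda>x. t e \<bullet> (?\<tau> x *v n e)) \<in> polys 2 e" if e: "e edge_of K" for e
  proof -
    obtain u' v' w' where t': "tri u' v' w' K" "e = closed_segment v' w'" using edge_tri[OF t e] .
    then consider "e = closed_segment v w" | "e = closed_segment w u" | "e = closed_segment u v"
      using tri_permutations[OF t t'(1)] by (auto simp: closed_segment_commute)
    then show ?thesis
    proof cases
      case 1
      have vw: "v \<noteq> w" using t by (simp add: tri_def)
      have no: "(w - v) \<bullet> n e = 0" using frame(4)[OF K t 1] by (simp add: inner_commute)
      define \<omega> where "\<omega> = (v - u) \<bullet> n e"
      show ?thesis unfolding 1
      proof (rule polys_segment_I[OF vw, where q = "[:0, \<omega> * c, - \<omega> * c:]"])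
        show "degree [:0, \<omega> * c, - \<omega> * c:] \<le> 2" by simp
        fix s :: real
        have "t e \<bullet> (?\<tau> (linepath v w s) *v n e) = ((1 - s) * s * \<omega>) * ((m0 + m1 * (1 - s) + m2 * s) * ((v - u) \<bullet> t e) + (k0 + k1 * (1 - s) + k2 * s) * ((w - u) \<bullet> t e))"
          unfolding tens_edge(3)[OF t no] \<omega>_def by (simp only: inner_scaleR_right inner_add_right inner_commute[of "t e"])
        also have "\<dots> = ((1 - s) * s * \<omega>) * c" using con[of s] 1 by simp
        finally show "t (closed_segment v w) \<bullet> (?\<tau> (linepath v w s) *v n (closed_segment v w)) = poly [:0, \<omega> * c, - \<omega> * c:] s"
          using 1 by (simp add: algebra_simps)
      qed
    next
      case 2
      have no: "(u - w) \<bullet> n e = 0" using frame(4)[OF K t2 2] by (simp add: inner_commute)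
      have "t e \<bullet> (?\<tau> x *v n e) = 0" if "x \<in> e" for x
      proof -
        obtain s where "x = linepath w u s" using \<open>x \<in> e\<close> 2 by (metis imageE linepath_image_01)
        then show ?thesis using tens_edge(2)[OF t no] by simp
      qed
      then show ?thesis by (rule polys_cong[OF polys_zero])
    next
      case 3
      have no: "(v - u) \<bullet> n e = 0" using frame(4)[OF K t3 3] by (simp add: inner_commute)
      have "t e \<bullet> (?\<tau> x *v n e) = 0" if "x \<in> e" for x
      proof -
        obtain s where "x = linepath u v s" using \<open>x \<in> e\<close> 3 by (metis imageE linepath_image_01)
        then show ?thesis using tens_edge(1)[OF t no] by simp
      qed
      then show ?thesis by (rule polys_cong[OF polys_zero])
    qed
  qed
  ultimately show ?thesis unfolding sigma_shape_def using polys_tens sym_tens by blast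
qed

lemma tens_zero_edges:
  assumes K: "K \<in> \<T>" and t: "tri u v w K" and e: "e edge_of K" "e \<noteq> closed_segment v w" "x \<in> e"
  shows "tens u v w p q r m k x *v n e = 0"
proof -
  have t2: "tri v w u K" and t3: "tri w u v K" using t tri_rotate by blast+
  obtain u' v' w' where t': "tri u' v' w' K" "e = closed_segment v' w'" using edge_tri[OF t e(1)] .
  then consider "e = closed_segment w u" | "e = closed_segment u v"
    using tri_permutations[OF t t'(1)] e(2) by (auto simp: closed_segment_commute)
  then show ?thesis
  proof cases
    case 1
    then have no: "(u - w) \<bullet> n e = 0" using frame(4)[OF K t2 1] by (simp add: inner_commute)
    obtain s where "x = linepath w u s" using e(3) 1 by (metis imageE linepath_image_01)
    then show ?thesis using tens_edge(2)[OF t no] by simp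
  next
    case 2
    then have no: "(v - u) \<bullet> n e = 0" using frame(4)[OF K t3 2] by (simp add: inner_commute)
    obtain s where "x = linepath u v s" using e(3) 2 by (metis imageE linepath_image_01)
    then show ?thesis using tens_edge(1)[OF t no] by simp
  qed
qed

text \<open>Extended by zero, such a field meets all matching conditions except possibly the one
  across \<open>e\<close>.\<close>

definition edge_supported :: "(real^2) set \<Rightarrow> (real^2) set \<Rightarrow> (real^2 \<Rightarrow> real^2^2) \<Rightarrow> bool" where
  "edge_supported K e \<tau> \<longleftrightarrow> (\<forall>z. z extreme_point_of K \<longrightarrow> \<tau> z = 0) \<and> (\<forall>e' x. e' edge_of K \<longrightarrow> e' \<noteq> e \<longrightarrow> x \<in> e' \<longrightarrow> \<tau> x *v n e' = 0)"

text \<open>Bubbles alone only reach the divergences orthogonal to the rigid motions; the three fluxes through a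
  single edge supply the missing dimensions. The coefficients solve the linear system read off \<open>div_tens\<close>.\<close>

lemma local_div_surj:
  assumes K: "K \<in> \<T>" and e: "e edge_of K" and q: "q \<in> polys 1 UNIV"
  obtains \<tau> where "\<tau> \<in> sigma_shape n t K" "classical_div \<tau> = q" "edge_supported K e \<tau>"
proof -
  obtain u0 v0 w0 where "tri u0 v0 w0 K" using triT[OF K] by blast
  then obtain u v w where t: "tri u v w K" and ee: "e = closed_segment v w" using edge_tri[OF _ e] by metis
  obtain c0 c1 c2 d0 d1 d2 where q: "\<And>X. q X = (c0 + c1 * bary v w u X + c2 * bary w u v X) *\<^sub>R (v - u) + (d0 + d1 * bary v w u X + d2 * bary w u v X) *\<^sub>R (w - u)"
    by (rule polys1_bary[OF t q]) (rule that, assumption)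
  \<comment> \<open>Tangential parts of the two edges at \<open>u\<close>. Taking
    \<open>a2 * g\<close> and \<open>- a1 * g\<close> as linear flux coefficients below makes their
    contributions to the tangential-normal component cancel, as \<open>tens_sigma_shape\<close>
    requires.\<close>
  define a1 a2 where "a1 = (v - u) \<bullet> t e" and "a2 = (w - u) \<bullet> t e"
  have "a2 - a1 = t e \<bullet> (w - v)" by (simp add: a1_def a2_def inner_diff_left inner_diff_right inner_commute)
  then have a12: "a2 - a1 \<noteq> 0" using frame(5)[OF K t ee] by simp
  \<comment> \<open>Two of the linear equations determine \<open>r0\<close>, and they agree only if
    \<open>2 * (p1 - q2)\<close> equals \<open>c1 + 2 * c0 - d2 - 2 * d0\<close>. The quadratic
    equations give \<open>p1 - q2 = g * (a2 - a1) / 5\<close>, whence this value.\<close>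
  define g where "g = 5 * (c1 + 2 * c0 - d2 - 2 * d0) / (2 * (a2 - a1))"
  have g: "g * (a2 - a1) = 5 / 2 * (c1 + 2 * c0 - d2 - 2 * d0)"
  proof -
    have "5 * c / (2 * D) * D = 5 / 2 * c" if "D \<noteq> 0" for c D :: real using that by simp
    from this[OF a12] show ?thesis unfolding g_def by blast
  qed
  \<comment> \<open>After eliminating the \<open>p\<close> and \<open>q\<close> coefficients, the
    mixed quadratic terms leave \<open>r1 = a1 * g + 2/3 * r2\<close> and
    \<open>r2 = a2 * g + 2/3 * r1\<close>; this is the solution.\<close>
  define r1 r2 where "r1 = g * (6 * a2 + 9 * a1) / 5" and "r2 = g * (9 * a2 + 6 * a1) / 5"
  define p1 q2 p2 q1 where "p1 = - r1 / 3" and "q2 = - r2 / 3" and "p2 = - a2 * g + r2" and "q1 = - a1 * g + r1"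
  define r0 where "r0 = 2 * p1 - c1 - 2 * c0"
  \<comment> \<open>The constant fluxes are still free and absorb the two remaining linear
    equations.\<close>
  define m0 k0 where "m0 = c2 + c0 - p2 - r0" and "k0 = d1 + d0 - q1 - r0"
  let ?\<tau> = "tens u v w (c0, p1, p2) (d0, q1, q2) (r0, r1, r2) (m0, a2 * g, - a2 * g) (k0, - a1 * g, a1 * g)"
  have pq: "p1 - q2 = g * (a2 - a1) / 5" by (simp add: p1_def q2_def r1_def r2_def algebra_simps add_divide_distrib diff_divide_distrib)
  have l1: "2 * p1 - 2 * c0 - r0 = c1" "p2 - c0 + m0 + r0 = c2" "q1 - d0 + k0 + r0 = d1" by (simp_all add: r0_def m0_def k0_def)
  have l2: "2 * q2 - 2 * d0 - r0 = d2" using pq g by (simp add: r0_def)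
  have qu: "- 3 * p1 - r1 = 0" "- p2 + - a2 * g + r2 = 0" "- q1 + - a1 * g + r1 = 0" "- 3 * q2 - r2 = 0"
    by (simp_all add: p1_def q2_def p2_def q1_def)
  have qu2: "- 2 * p2 - 2 * p1 + 2 * (a2 * g) + 2 * (r1 - r2) = 0" "- 2 * q1 - 2 * q2 + 2 * (a1 * g) - 2 * (r1 - r2) = 0"
    by (simp_all add: p1_def q2_def p2_def q1_def r1_def r2_def field_simps)
  have dv: "classical_div ?\<tau> X = q X" for X
    unfolding div_tens[OF t] l1 l2 qu qu2 q by simp
  have s: "?\<tau> \<in> sigma_shape n t K"
  proof (rule tens_sigma_shape[OF K t])
    show "classical_div ?\<tau> X = (c0 + c1 * bary v w u X + c2 * bary w u v X) *\<^sub>R (v - u) + (d0 + d1 * bary v w u X + d2 * bary w u v X) *\<^sub>R (w - u)" for X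
      using dv q by simp
    show "(m0 + a2 * g * (1 - s) + - a2 * g * s) * ((v - u) \<bullet> t (closed_segment v w)) + (k0 + - a1 * g * (1 - s) + a1 * g * s) * ((w - u) \<bullet> t (closed_segment v w))
       = m0 * a1 + k0 * a2" for s
      unfolding ee[symmetric] a1_def[symmetric] a2_def[symmetric] by (simp add: algebra_simps)
  qed
  show thesis
    by (rule that[OF s]) (use dv tens_vertex[OF t] tens_zero_edges[OF K t] ee in \<open>auto simp: edge_supported_def\<close>)
qed

text \<open>Continues the flux of a neighbour's field into \<open>K\<close>. That field vanishes at
  the endpoints, so its components on the edge are bubbles, and fluxes with affine factors suffice
  to reproduce them; the other coefficients keep the divergence linear. Which linear divergence
  results is left open and is repaired in \<open>div_single_surj\<close>.\<close>

lemma local_extension: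
  assumes K: "K \<in> \<T>" and e: "e edge_of K" and \<tau>': "\<tau>' \<in> polys 3 UNIV" "(\<lambda>x. t e \<bullet> (\<tau>' x *v n e)) \<in> polys 2 e"
    and z: "\<And>z. z extreme_point_of K \<Longrightarrow> z \<in> e \<Longrightarrow> \<tau>' z = 0"
  obtains \<tau> where "\<tau> \<in> sigma_shape n t K" "edge_supported K e \<tau>" "\<And>x. x \<in> e \<Longrightarrow> \<tau> x *v n e = \<tau>' x *v n e"
proof -
  obtain u0 v0 w0 where "tri u0 v0 w0 K" using triT[OF K] by blast
  then obtain u v w where t: "tri u v w K" and ee: "e = closed_segment v w" using edge_tri[OF _ e] by metis
  note f = frame[OF K t ee]
  have v0: "\<tau>' v = 0" "\<tau>' w = 0" using z tri_extreme[OF t] ee by auto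
  define a1 a2 where "a1 = (v - u) \<bullet> t e" and "a2 = (w - u) \<bullet> t e"
  have "a2 - a1 = t e \<bullet> (w - v)" by (simp add: a1_def a2_def inner_diff_left inner_diff_right inner_commute)
  then have a12: "a2 - a1 \<noteq> 0" using f(5) by simp
  \<comment> \<open>As \<open>w - v\<close> is tangential, both edges at \<open>u\<close> have the
    same normal part, and it is nonzero because the triangle is not degenerate.\<close>
  define \<omega> where "\<omega> = (v - u) \<bullet> n e"
  have no: "(w - v) \<bullet> n e = 0" using f(4) by (simp add: inner_commute)
  then have \<omega>w: "(w - u) \<bullet> n e = \<omega>" by (simp add: \<omega>_def inner_diff_left)
  have \<omega>0: "\<omega> \<noteq> 0"
  proof
    assume "\<omega> = 0"
    then have v: "v - u = (t e \<bullet> (v - u)) *\<^sub>R t e"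
      using frame_expand[OF f(1-3), of "v - u"] by (simp add: \<omega>_def inner_commute)
    have "w - u = (t e \<bullet> (w - u)) *\<^sub>R t e"
      using frame_expand[OF f(1-3), of "w - u"] \<omega>w \<open>\<omega> = 0\<close> by (simp add: inner_commute)
    then have "cr (v - u) (w - u) = cr ((t e \<bullet> (v - u)) *\<^sub>R t e) ((t e \<bullet> (w - u)) *\<^sub>R t e)" using v by simp
    also have "\<dots> = 0" by (simp add: cr_def)
    finally show False using t by (simp add: tri_def)
  qed
  have M1: "(\<lambda>x. n e \<bullet> (\<tau>' x *v n e)) \<in> polys 3 (closed_segment v w)"
    using polys_bilinear_form[OF polys_UNIV_D[OF \<tau>'(1)]] .
  have M2: "(\<lambda>x. t e \<bullet> (\<tau>' x *v n e)) \<in> polys 2 (closed_segment v w)"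
    using \<tau>'(2) by (simp only: ee)
  obtain Q1 where Q1: "degree Q1 \<le> 3" "\<And>s. s \<in> {0..1} \<Longrightarrow> n e \<bullet> (\<tau>' (linepath v w s) *v n e) = poly Q1 s"
    using polys_segment_E[OF M1] by metis
  obtain Q2 where Q2: "degree Q2 \<le> 2" "\<And>s. s \<in> {0..1} \<Longrightarrow> t e \<bullet> (\<tau>' (linepath v w s) *v n e) = poly Q2 s"
    using polys_segment_E[OF M2] by metis
  have "poly Q1 0 = 0" "poly Q1 1 = 0" "poly Q2 0 = 0" "poly Q2 1 = 0"
    using Q1(2)[of 0] Q1(2)[of 1] Q2(2)[of 0] Q2(2)[of 1] v0 by (simp_all add: linepath_def)
  then obtain \<alpha> \<beta> \<alpha>' where ab: "\<And>s. poly Q1 s = s * (1 - s) * (\<alpha> + \<beta> * s)" "\<And>s. poly Q2 s = s * (1 - s) * \<alpha>'"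
  proof -
    assume Z: "poly Q1 0 = 0" "poly Q1 1 = 0" "poly Q2 0 = 0" "poly Q2 1 = 0"
      and th: "\<And>\<alpha> \<beta> \<alpha>'. (\<And>s. poly Q1 s = s * (1 - s) * (\<alpha> + \<beta> * s)) \<Longrightarrow> (\<And>s. poly Q2 s = s * (1 - s) * \<alpha>') \<Longrightarrow> thesis"
    obtain \<alpha> \<beta> where 1: "\<And>s. poly Q1 s = s * (1 - s) * (\<alpha> + \<beta> * s)" using cubic_bubble_factor[OF Q1(1) Z(1,2)] by metis
    have "degree Q2 \<le> 3" using Q2(1) by simp
    then obtain \<alpha>' \<beta>' where 2: "\<And>s. poly Q2 s = s * (1 - s) * (\<alpha>' + \<beta>' * s)" "\<beta>' = 0" using cubic_bubble_factor[OF _ Z(3,4)] Q2(1) by metis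
    show thesis using th[OF 1, of \<alpha>'] 2 by simp
  qed
  \<comment> \<open>Targets for the fluxes: the normal component prescribes the sum of the two
    affine factors, the tangential one their combination with weights \<open>a1\<close> and
    \<open>a2\<close>. This is a two by two system with determinant \<open>a2 - a1\<close>.\<close>
  define S0 S1 T where "S0 = \<alpha> / (\<omega> * \<omega>)" and "S1 = \<beta> / (\<omega> * \<omega>)" and "T = \<alpha>' / \<omega>"
  define D where "D = a2 - a1"
  have D: "D \<noteq> 0" using a12 by (simp add: D_def)
  define m0 m2 k0 k2 where "m0 = (a2 * S0 - T) / D" and "m2 = a2 * S1 / D" and "k0 = (T - a1 * S0) / D" and "k2 = - a1 * S1 / D"
  \<comment> \<open>Here the mixed quadratic terms leave \<open>r1 = k2 / 2 + 2/3 * r2\<close> and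
    \<open>r2 = 2/3 * r1 - m2 / 2\<close>.\<close>
  define r1 r2 where "r1 = - (6 * m2 - 9 * k2) / 10" and "r2 = - (9 * m2 - 6 * k2) / 10"
  define p1 q2 p2 where "p1 = - r1 / 3" and "q2 = - r2 / 3" and "p2 = m2 + r2"
  let ?\<tau> = "tens u v w (0, p1, p2) (0, r1, q2) (0, r1, r2) (m0, 0, m2) (k0, 0, k2)"
  have qu: "- 3 * p1 - r1 = 0" "- p2 + m2 + r2 = 0" "- r1 + 0 + r1 = 0" "- 3 * q2 - r2 = 0"
    by (simp_all add: p1_def q2_def p2_def)
  have qu2: "- 2 * p2 - 2 * p1 + 2 * 0 + 2 * (r1 - r2) = 0" "- 2 * r1 - 2 * q2 + 2 * k2 - 2 * (r1 - r2) = 0"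
    by (simp_all add: p1_def q2_def p2_def r1_def r2_def algebra_simps add_divide_distrib diff_divide_distrib)
  have mk: "m0 * a1 + k0 * a2 = T" "m2 * a1 + k2 * a2 = 0" "m0 + k0 = S0" "m2 + k2 = S1"
  proof -
    have "m0 * D = a2 * S0 - T" "k0 * D = T - a1 * S0" "m2 * D = a2 * S1" "k2 * D = - a1 * S1"
      using D by (simp_all add: m0_def k0_def m2_def k2_def)
    then have "(m0 * a1 + k0 * a2) * D = T * D" "(m2 * a1 + k2 * a2) * D = 0" "(m0 + k0) * D = S0 * D" "(m2 + k2) * D = S1 * D"
      unfolding D_def by algebra+
    then show "m0 * a1 + k0 * a2 = T" "m2 * a1 + k2 * a2 = 0" "m0 + k0 = S0" "m2 + k2 = S1" using D by auto
  qed
  have s: "?\<tau> \<in> sigma_shape n t K"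
  proof (rule tens_sigma_shape[OF K t])
    show "classical_div ?\<tau> X = (0 + (2 * p1) * bary v w u X + (p2 + m0) * bary w u v X) *\<^sub>R (v - u) + (0 + (r1 + k0) * bary v w u X + (2 * q2) * bary w u v X) *\<^sub>R (w - u)" for X
      unfolding div_tens[OF t] qu qu2 by simp
    show "(m0 + 0 * (1 - s) + m2 * s) * ((v - u) \<bullet> t (closed_segment v w)) + (k0 + 0 * (1 - s) + k2 * s) * ((w - u) \<bullet> t (closed_segment v w)) = T" for s
    proof -
      have "(m0 + m2 * s) * a1 + (k0 + k2 * s) * a2 = (m0 * a1 + k0 * a2) + (m2 * a1 + k2 * a2) * s" by (simp add: algebra_simps)
      then show ?thesis unfolding ee[symmetric] a1_def[symmetric] a2_def[symmetric] mk by simp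
    qed
  qed
  have agree: "?\<tau> x *v n e = \<tau>' x *v n e" if "x \<in> e" for x
  proof -
    obtain s where s: "s \<in> {0..1}" "x = linepath v w s" using \<open>x \<in> e\<close> ee by (metis imageE linepath_image_01)
    have T: "?\<tau> x *v n e = ((1 - s) * s * \<omega>) *\<^sub>R ((m0 + m2 * s) *\<^sub>R (v - u) + (k0 + k2 * s) *\<^sub>R (w - u))"
      unfolding s(2) tens_edge(3)[OF t no] \<omega>_def by simp
    have "n e \<bullet> (?\<tau> x *v n e) = ((1 - s) * s * \<omega>) * ((m0 + m2 * s) * \<omega> + (k0 + k2 * s) * \<omega>)"
      unfolding T by (simp only: inner_scaleR_right inner_add_right inner_commute[of "n e"] \<omega>_def[symmetric] \<omega>w)
    also have "\<dots> = ((1 - s) * s * \<omega>) * (((m0 + k0) + (m2 + k2) * s) * \<omega>)" by (simp add: algebra_simps)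
    also have "\<dots> = (1 - s) * s * (\<alpha> + \<beta> * s)"
      unfolding mk S0_def S1_def using \<omega>0 by (simp add: field_simps)
    also have "\<dots> = n e \<bullet> (\<tau>' x *v n e)" unfolding s(2) Q1(2)[OF s(1)] ab by simp
    finally have 1: "n e \<bullet> (?\<tau> x *v n e) = n e \<bullet> (\<tau>' x *v n e)" .
    have "t e \<bullet> (?\<tau> x *v n e) = ((1 - s) * s * \<omega>) * ((m0 + m2 * s) * a1 + (k0 + k2 * s) * a2)"
      unfolding T by (simp only: inner_scaleR_right inner_add_right inner_commute[of "t e"] a1_def[symmetric] a2_def[symmetric])
    also have "\<dots> = ((1 - s) * s * \<omega>) * ((m0 * a1 + k0 * a2) + (m2 * a1 + k2 * a2) * s)" by (simp add: algebra_simps)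
    also have "\<dots> = (1 - s) * s * \<alpha>'" unfolding mk T_def using \<omega>0 by simp
    also have "\<dots> = t e \<bullet> (\<tau>' x *v n e)" unfolding s(2) Q2(2)[OF s(1)] ab by simp
    finally have 2: "t e \<bullet> (?\<tau> x *v n e) = t e \<bullet> (\<tau>' x *v n e)" .
    show ?thesis using frame_expand[OF f(1-3), of "?\<tau> x *v n e"] frame_expand[OF f(1-3), of "\<tau>' x *v n e"] 1 2 by simp
  qed
  show thesis
    by (rule that[OF s _ agree]) (use tens_vertex[OF t] tens_zero_edges[OF K t] ee in \<open>auto simp: edge_supported_def\<close>)
qed

end

section \<open>The discrete spaces\<close>

lemma sigma_shape_add:
  assumes "\<sigma> \<in> sigma_shape n t K" "\<tau> \<in> sigma_shape n t K" shows "(\<lambda>x. \<sigma> x + \<tau> x) \<in> sigma_shape n t K"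
proof -
  have p: "\<sigma> \<in> polys 3 UNIV" "\<tau> \<in> polys 3 UNIV" using assms by (auto simp: sigma_shape_def)
  have "classical_div (\<lambda>x. \<sigma> x + \<tau> x) = (\<lambda>x. classical_div \<sigma> x + classical_div \<tau> x)"
    using p by (intro ext classical_div_add polys_differentiable[of _ 3] polys_matrix_nth)
  moreover have "\<dots> \<in> polys 1 K" using assms by (intro polys_add) (auto simp: sigma_shape_def)
  moreover have "(\<lambda>x. t e \<bullet> ((\<sigma> x + \<tau> x) *v n e)) \<in> polys 2 e" if "e edge_of K" for e
    using polys_add[of "\<lambda>x. t e \<bullet> (\<sigma> x *v n e)" 2 e "\<lambda>x. t e \<bullet> (\<tau> x *v n e)"] assms that
    by (simp add: sigma_shape_def matrix_vector_mult_add_rdistrib inner_add_right)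
  ultimately show ?thesis
    using assms p unfolding sigma_shape_def by (auto intro!: polys_add sym_add)
qed

lemma classical_div_scaleR:
  assumes "\<tau> \<in> polys k UNIV" shows "classical_div (\<lambda>x. c *\<^sub>R \<tau> x) x = c *\<^sub>R classical_div \<tau> x"
proof -
  have d: "(\<lambda>y. \<tau> y $ i $ j) differentiable at x" for i j by (intro polys_differentiable[of _ k] polys_matrix_nth assms)
  show ?thesis by (simp add: classical_div_def vec_eq_iff sum_2 partial_cmult[OF d] algebra_simps)
qed

lemma sigma_shape_scaleR:
  assumes "\<tau> \<in> sigma_shape n t K" shows "(\<lambda>x. c *\<^sub>R \<tau> x) \<in> sigma_shape n t K"
proof -
  have p: "\<tau> \<in> polys 3 UNIV" using assms by (auto simp: sigma_shape_def)
  have "classical_div (\<lambda>x. c *\<^sub>R \<tau> x) = (\<lambda>x. c *\<^sub>R classical_div \<tau> x)"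
    using p by (intro ext classical_div_scaleR)
  moreover have "\<dots> \<in> polys 1 K" using assms by (intro polys_scaleR) (auto simp: sigma_shape_def)
  moreover have "(\<lambda>x. t e \<bullet> ((c *\<^sub>R \<tau> x) *v n e)) \<in> polys 2 e" if "e edge_of K" for e
    using polys_cmult[of "\<lambda>x. t e \<bullet> (\<tau> x *v n e)" 2 e c] assms that
    by (simp add: sigma_shape_def scaleR_matrix_vector)
  ultimately show ?thesis
    using assms p unfolding sigma_shape_def by (auto intro!: polys_scaleR sym_scaleR)
qed

lemma classical_div_zero: "classical_div (\<lambda>x. 0) = (\<lambda>x. 0)"
  by (rule ext) (simp add: classical_div_def vec_eq_iff)

lemma sigma_shape_zero: "(\<lambda>x. 0) \<in> sigma_shape n t K"
  unfolding sigma_shape_def by (auto simp: classical_div_zero sym_mats_iff intro: polys_zero)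

lemma polys_vector_zero_on_open:
  fixes f :: "real^2 \<Rightarrow> real^2"
  assumes "f \<in> polys k UNIV" "open U" "x0 \<in> U" "\<And>x. x \<in> U \<Longrightarrow> f x = 0" shows "f = (\<lambda>x. 0)"
proof (rule ext)
  fix x
  have "f x $ i = 0" for i
    by (rule polys_zero_on_open[OF polys_vec_nth[OF assms(1)] assms(2,3)]) (simp add: assms(4))
  then show "f x = 0" by (simp add: vec_eq_iff)
qed

text \<open>The points of \<open>U\<close> where the polynomial is nonzero form an open null set,
  hence none; a polynomial vanishing on a nonempty open set is zero.\<close>

lemma polys_AE_zero:
  fixes f :: "real^2 \<Rightarrow> real"
  assumes f: "f \<in> polys k UNIV" and ae: "AE x in lebesgue. x \<in> U \<longrightarrow> f x = 0" and U: "open U" "x0 \<in> U"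
  shows "f = (\<lambda>x. 0)"
proof -
  let ?N = "U \<inter> {x. f x \<noteq> 0}"
  have "open {x. f x \<noteq> 0}" using polys_continuous[OF f] by (intro open_Collect_neq) auto
  then have o: "open ?N" using U(1) by blast
  have "AE x in lebesgue. x \<notin> ?N" using ae by eventually_elim auto
  then have "?N \<in> null_sets lebesgue" using o by (subst (asm) AE_iff_null_sets[symmetric]) auto
  then have "negligible ?N" by (simp add: negligible_iff_null_sets)
  then have "?N = {}" using o open_not_negligible by blast
  then show ?thesis using polys_zero_on_open[OF f U] by auto
qed

section \<open>Families of shape functions and surjectivity of the divergence\<close>

context framed_mesh
begin

text \<open>The working form of the global tensor space: one polynomial field per triangle, with
  pointwise matching.\<close>

definition sig :: "((real^2) set \<Rightarrow> real^2 \<Rightarrow> real^2^2) \<Rightarrow> bool" where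
  "sig \<rho> \<longleftrightarrow> (\<forall>K\<in>\<T>. \<rho> K \<in> sigma_shape n t K) \<and> consistent \<rho>"

lemma sig_polys: "sig \<rho> \<Longrightarrow> K \<in> \<T> \<Longrightarrow> \<rho> K \<in> polys 3 UNIV"
  and sig_sym: "sig \<rho> \<Longrightarrow> K \<in> \<T> \<Longrightarrow> range (\<rho> K) \<subseteq> sym_mats"
  by (auto simp: sig_def sigma_shape_def)

lemma consistent_vertex: "consistent \<rho> \<Longrightarrow> K \<in> \<T> \<Longrightarrow> L \<in> \<T> \<Longrightarrow> z extreme_point_of K \<Longrightarrow> z extreme_point_of L \<Longrightarrow> \<rho> K z = \<rho> L z"
  unfolding consistent_def by blast

lemma consistent_edge: "consistent \<rho> \<Longrightarrow> K \<in> \<T> \<Longrightarrow> L \<in> \<T> \<Longrightarrow> e edge_of K \<Longrightarrow> e edge_of L \<Longrightarrow> x \<in> e \<Longrightarrow> \<rho> K x *v n e = \<rho> L x *v n e"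
  unfolding consistent_def by blast

lemma consistentI:
  assumes "\<And>K L z. K \<in> \<T> \<Longrightarrow> L \<in> \<T> \<Longrightarrow> z extreme_point_of K \<Longrightarrow> z extreme_point_of L \<Longrightarrow> \<rho> K z = \<rho> L z"
    "\<And>K L e x. K \<in> \<T> \<Longrightarrow> L \<in> \<T> \<Longrightarrow> e edge_of K \<Longrightarrow> e edge_of L \<Longrightarrow> x \<in> e \<Longrightarrow> \<rho> K x *v n e = \<rho> L x *v n e"
  shows "consistent \<rho>"
  using assms unfolding consistent_def by blast

lemma sig_zero: "sig (\<lambda>K x. 0)"
  by (auto simp: sig_def consistent_def sigma_shape_zero)

lemma sig_add_scaleR:
  assumes \<rho>: "sig \<rho>" and \<sigma>: "sig \<sigma>" shows "sig (\<lambda>K x. \<rho> K x + c *\<^sub>R \<sigma> K x)"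
proof -
  have c: "consistent \<rho>" "consistent \<sigma>" using \<rho> \<sigma> by (simp_all add: sig_def)
  have "consistent (\<lambda>K x. \<rho> K x + c *\<^sub>R \<sigma> K x)"
  proof (rule consistentI)
    fix K L z assume "K \<in> \<T>" "L \<in> \<T>" "z extreme_point_of K" "z extreme_point_of L"
    then have "\<rho> K z = \<rho> L z" "\<sigma> K z = \<sigma> L z" using consistent_vertex[OF c(1)] consistent_vertex[OF c(2)] by blast+
    then show "\<rho> K z + c *\<^sub>R \<sigma> K z = \<rho> L z + c *\<^sub>R \<sigma> L z" by simp
  next
    fix K L e x assume "K \<in> \<T>" "L \<in> \<T>" "e edge_of K" "e edge_of L" "x \<in> e"
    then have "\<rho> K x *v n e = \<rho> L x *v n e" "\<sigma> K x *v n e = \<sigma> L x *v n e"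
      using consistent_edge[OF c(1)] consistent_edge[OF c(2)] by blast+
    then show "(\<rho> K x + c *\<^sub>R \<sigma> K x) *v n e = (\<rho> L x + c *\<^sub>R \<sigma> L x) *v n e"
      by (simp add: matrix_vector_mult_add_rdistrib scaleR_matrix_vector)
  qed
  moreover have "\<rho> K \<in> sigma_shape n t K" "\<sigma> K \<in> sigma_shape n t K" if "K \<in> \<T>" for K
    using \<rho> \<sigma> that by (simp_all add: sig_def)
  ultimately show ?thesis unfolding sig_def by (intro conjI ballI sigma_shape_add sigma_shape_scaleR)
qed

lemma sig_div_add_scaleR:
  "sig \<rho> \<Longrightarrow> sig \<sigma> \<Longrightarrow> K \<in> \<T> \<Longrightarrow> classical_div (\<lambda>x. \<rho> K x + c *\<^sub>R \<sigma> K x) = (\<lambda>x. classical_div (\<rho> K) x + c *\<^sub>R classical_div (\<sigma> K) x)"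
proof (rule ext)
  fix x assume "sig \<rho>" "sig \<sigma>" "K \<in> \<T>"
  then have p: "\<rho> K \<in> polys 3 UNIV" "\<sigma> K \<in> polys 3 UNIV" by (auto intro: sig_polys)
  have "classical_div (\<lambda>x. \<rho> K x + c *\<^sub>R \<sigma> K x) x = classical_div (\<rho> K) x + classical_div (\<lambda>x. c *\<^sub>R \<sigma> K x) x"
    by (intro classical_div_add polys_differentiable[of _ 3] polys_matrix_nth p polys_scaleR)
  then show "classical_div (\<lambda>x. \<rho> K x + c *\<^sub>R \<sigma> K x) x = classical_div (\<rho> K) x + c *\<^sub>R classical_div (\<sigma> K) x"
    using classical_div_scaleR[OF p(2)] by simp
qed

lemma interior_point: "K \<in> \<T> \<Longrightarrow> \<exists>x. x \<in> interior K"
  using triT tri_interior_nonempty by metis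

text \<open>The shape condition speaks about \<open>K\<close> only; polynomials that agree on an
  open set coincide, so the degree bound holds on the plane.\<close>

lemma sigma_div_polys1:
  assumes K: "K \<in> \<T>" and \<tau>: "\<tau> \<in> sigma_shape n t K" shows "classical_div \<tau> \<in> polys 1 UNIV"
proof -
  have "classical_div \<tau> \<in> polys 1 K" using \<tau> by (simp add: sigma_shape_def)
  then obtain p where p: "p \<in> polys 1 UNIV" "\<And>x. x \<in> K \<Longrightarrow> classical_div \<tau> x = p x" by (rule polysE) blast
  have "classical_div \<tau> \<in> polys (3 - 1) UNIV" using \<tau> by (intro polys_classical_div) (simp add: sigma_shape_def)
  then have d: "(\<lambda>x. classical_div \<tau> x - p x) \<in> polys 2 UNIV"
    using p(1) polys_mono[of 1 2 p UNIV] by (intro polys_diff) auto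
  obtain x0 where x0: "x0 \<in> interior K" using interior_point[OF K] by blast
  have "(\<lambda>x. classical_div \<tau> x - p x) = (\<lambda>x. 0)"
    by (rule polys_vector_zero_on_open[OF d open_interior x0]) (use p(2) interior_subset in auto)
  then have "classical_div \<tau> = p" by (auto simp: fun_eq_iff)
  then show ?thesis using p(1) by simp
qed

text \<open>Localises the divergence at one triangle. Through an unshared edge a field may carry
  flux without a partner. Otherwise the flux through \<open>e\<close> is continued into the
  neighbour, where it creates an unwanted divergence, and a field from the induction hypothesis
  removes it.\<close>

lemma div_single_surj:
  assumes "K \<in> \<T>"
  shows "\<forall>q\<in>polys 1 UNIV. \<exists>\<rho>. sig \<rho> \<and> classical_div (\<rho> K) = q \<and> (\<forall>L\<in>\<T>. L \<noteq> K \<longrightarrow> classical_div (\<rho> L) = (\<lambda>x. 0))"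
proof -
  define P where "P K \<longleftrightarrow> (\<forall>q\<in>polys 1 UNIV. \<exists>\<rho>. sig \<rho> \<and> classical_div (\<rho> K) = q \<and> (\<forall>L\<in>\<T>. L \<noteq> K \<longrightarrow> classical_div (\<rho> L) = (\<lambda>x. 0)))" for K
  have "P K"
  proof (rule edge_chain_induct[OF assms])
    fix K e assume 1: "K \<in> \<T>" "e edge_of K" "\<And>L. L \<in> \<T> \<Longrightarrow> e edge_of L \<Longrightarrow> L = K"
    show "P K"
      unfolding P_def
    proof
      fix q :: "real^2 \<Rightarrow> real^2" assume q: "q \<in> polys 1 UNIV"
      obtain \<tau> where \<tau>: "\<tau> \<in> sigma_shape n t K" "classical_div \<tau> = q" "edge_supported K e \<tau>"
        using local_div_surj[OF 1(1,2) q] .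
      define \<rho> where "\<rho> L = (if L = K then \<tau> else (\<lambda>x. 0))" for L
      have "consistent \<rho>"
      proof (rule consistentI)
        fix L M z assume "L \<in> \<T>" "M \<in> \<T>" "z extreme_point_of L" "z extreme_point_of M"
        then show "\<rho> L z = \<rho> M z" using \<tau>(3) by (auto simp: \<rho>_def edge_supported_def)
      next
        fix L M e' x assume LM: "L \<in> \<T>" "M \<in> \<T>" "e' edge_of L" "e' edge_of M" "x \<in> e'"
        show "\<rho> L x *v n e' = \<rho> M x *v n e'"
        proof (cases "L = M")
          case False
          then have "L = K \<or> M = K \<Longrightarrow> e' \<noteq> e" using 1(3) LM by blast
          then show ?thesis using \<tau>(3) LM by (auto simp: \<rho>_def edge_supported_def)
        qed simp
      qed
      then have "sig \<rho>" using \<tau>(1) sigma_shape_zero by (auto simp: sig_def \<rho>_def)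
      then show "\<exists>\<rho>. sig \<rho> \<and> classical_div (\<rho> K) = q \<and> (\<forall>L\<in>\<T>. L \<noteq> K \<longrightarrow> classical_div (\<rho> L) = (\<lambda>x. 0))"
        using \<tau>(2) by (intro exI[of _ \<rho>]) (simp add: \<rho>_def classical_div_zero)
    qed
  next
    fix K L e assume 2: "K \<in> \<T>" "L \<in> \<T>" "K \<noteq> L" "e edge_of K" "e edge_of L" "P K"
    show "P L"
      unfolding P_def
    proof
      fix q :: "real^2 \<Rightarrow> real^2" assume q: "q \<in> polys 1 UNIV"
      obtain \<tau> where \<tau>: "\<tau> \<in> sigma_shape n t L" "classical_div \<tau> = q" "edge_supported L e \<tau>"
        using local_div_surj[OF 2(2,5) q] .
      have \<tau>p: "\<tau> \<in> polys 3 UNIV" "(\<lambda>x. t e \<bullet> (\<tau> x *v n e)) \<in> polys 2 e" using \<tau>(1) 2(5) by (auto simp: sigma_shape_def)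
      have ext: "z extreme_point_of K \<longleftrightarrow> z extreme_point_of L" if "z \<in> e" for z
      proof -
        have "e face_of K" "e face_of L" using 2(4,5) by (auto simp: edge_of_def)
        then show ?thesis using extreme_point_of_face that by metis
      qed
      obtain \<sigma> where \<sigma>: "\<sigma> \<in> sigma_shape n t K" "edge_supported K e \<sigma>" "\<And>x. x \<in> e \<Longrightarrow> \<sigma> x *v n e = \<tau> x *v n e"
        using local_extension[OF 2(1,4) \<tau>p] ext \<tau>(3) unfolding edge_supported_def by metis
      define \<rho>1 where "\<rho>1 M = (if M = L then \<tau> else if M = K then \<sigma> else (\<lambda>x. 0))" for M
      have edges: "\<rho>1 M x *v n e' = 0" if "M \<in> \<T>" "e' edge_of M" "e' \<noteq> e" "x \<in> e'" for M e' x
        using that \<tau>(3) \<sigma>(2) by (auto simp: \<rho>1_def edge_supported_def)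
      have "consistent \<rho>1"
      proof (rule consistentI)
        fix M N z assume "M \<in> \<T>" "N \<in> \<T>" "z extreme_point_of M" "z extreme_point_of N"
        then show "\<rho>1 M z = \<rho>1 N z" using \<tau>(3) \<sigma>(2) by (auto simp: \<rho>1_def edge_supported_def)
      next
        fix M N e' x assume MN: "M \<in> \<T>" "N \<in> \<T>" "e' edge_of M" "e' edge_of N" "x \<in> e'"
        show "\<rho>1 M x *v n e' = \<rho>1 N x *v n e'"
        proof (cases "e' = e")
          case True
          then have "M = K \<or> M = L" "N = K \<or> N = L"
            using at_most_two[OF 2(1,2) MN(1) 2(4,5)] at_most_two[OF 2(1,2) MN(2) 2(4,5)] 2(3) MN(3,4) by blast+
          then show ?thesis using \<sigma>(3) MN(5) True 2(3) by (auto simp: \<rho>1_def)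
        next
          case False
          then show ?thesis using edges[of M e' x] edges[of N e' x] MN by simp
        qed
      qed
      then have s1: "sig \<rho>1" using \<tau>(1) \<sigma>(1) sigma_shape_zero by (auto simp: sig_def \<rho>1_def)
      have "classical_div \<sigma> \<in> polys 1 UNIV" using sigma_div_polys1[OF 2(1) \<sigma>(1)] .
      then obtain \<rho>2 where \<rho>2: "sig \<rho>2" "classical_div (\<rho>2 K) = classical_div \<sigma>" "\<forall>M\<in>\<T>. M \<noteq> K \<longrightarrow> classical_div (\<rho>2 M) = (\<lambda>x. 0)"
        using 2(6) unfolding P_def by blast
      \<comment> \<open>\<open>\<rho>2\<close> has the same divergence as \<sigma> on
        \<open>K\<close> and none elsewhere, so only the divergence on \<open>L\<close>
        survives.\<close>
      define \<rho> where "\<rho> M x = \<rho>1 M x + (-1) *\<^sub>R \<rho>2 M x" for M x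
      have "sig \<rho>" unfolding \<rho>_def[abs_def] using s1 \<rho>2(1) by (rule sig_add_scaleR)
      moreover have dv: "classical_div (\<rho> M) = (\<lambda>x. classical_div (\<rho>1 M) x + (-1) *\<^sub>R classical_div (\<rho>2 M) x)" if "M \<in> \<T>" for M
        unfolding \<rho>_def[abs_def] using sig_div_add_scaleR[OF s1 \<rho>2(1) that] by blast
      have "classical_div (\<rho> L) = q" using dv[OF 2(2)] \<rho>2(3) 2(2,3) \<tau>(2) by (auto simp: \<rho>1_def)
      moreover have "classical_div (\<rho> M) = (\<lambda>x. 0)" if "M \<in> \<T>" "M \<noteq> L" for M
        using dv[OF that(1)] \<rho>2(2,3) that by (cases "M = K") (auto simp: \<rho>1_def classical_div_zero)
      ultimately show "\<exists>\<rho>. sig \<rho> \<and> classical_div (\<rho> L) = q \<and> (\<forall>M\<in>\<T>. M \<noteq> L \<longrightarrow> classical_div (\<rho> M) = (\<lambda>x. 0))" by blast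
    qed
  qed
  then show ?thesis unfolding P_def .
qed

lemma div_family_surj:
  assumes q: "\<And>K. K \<in> \<T> \<Longrightarrow> q K \<in> polys 1 UNIV"
  obtains \<rho> where "sig \<rho>" "\<And>K. K \<in> \<T> \<Longrightarrow> classical_div (\<rho> K) = q K"
proof -
  have "\<exists>\<rho>. sig \<rho> \<and> (\<forall>K\<in>\<T>. classical_div (\<rho> K) = (if K \<in> F then q K else (\<lambda>x. 0)))" if "F \<subseteq> \<T>" for F
    using finite_subset[OF that fin] that
  proof (induction F rule: finite_induct)
    case empty
    show ?case using sig_zero classical_div_zero by auto
  next
    case (insert K F)
    then obtain \<rho> where \<rho>: "sig \<rho>" "\<forall>L\<in>\<T>. classical_div (\<rho> L) = (if L \<in> F then q L else (\<lambda>x. 0))" by auto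
    have K: "K \<in> \<T>" using insert by simp
    obtain \<sigma> where \<sigma>: "sig \<sigma>" "classical_div (\<sigma> K) = q K" "\<forall>L\<in>\<T>. L \<noteq> K \<longrightarrow> classical_div (\<sigma> L) = (\<lambda>x. 0)"
      using div_single_surj[OF K] q[OF K] by blast
    have "classical_div (\<lambda>x. \<rho> L x + 1 *\<^sub>R \<sigma> L x) = (if L \<in> insert K F then q L else (\<lambda>x. 0))" if L: "L \<in> \<T>" for L
      unfolding sig_div_add_scaleR[OF \<rho>(1) \<sigma>(1) L] using \<rho>(2) \<sigma>(2,3) L insert(2) by (cases "L = K") auto
    then show ?case using sig_add_scaleR[OF \<rho>(1) \<sigma>(1), of 1] by (intro exI[of _ "\<lambda>L x. \<rho> L x + 1 *\<^sub>R \<sigma> L x"]) blast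
  qed
  from this[of \<T>] show thesis using that by auto
qed

section \<open>From integral degrees of freedom to pointwise matching\<close>

lemma seg_inner_diff:
  assumes "f \<in> polys k UNIV" "g \<in> polys k UNIV" "q \<in> polys l UNIV"
  shows "seg_inner a b (\<lambda>x. f x - g x) q = seg_inner a b f q - seg_inner a b g q"
proof -
  have i: "(\<lambda>s. h (linepath a b s) * q (linepath a b s)) integrable_on {0..1}" if "h \<in> polys k UNIV" for h
  proof -
    have c: "continuous_on UNIV h" "continuous_on UNIV q" using polys_continuous that assms(3) by blast+
    have "continuous_on {0..1} (\<lambda>s. h (linepath a b s))" "continuous_on {0..1} (\<lambda>s. q (linepath a b s))"
      by (rule continuous_on_compose2[OF c(1) continuous_on_linepath], simp, rule continuous_on_compose2[OF c(2) continuous_on_linepath], simp)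
    then have "continuous_on {0..1} (\<lambda>s. h (linepath a b s) * q (linepath a b s))"
      by (rule continuous_on_mult)
    then show ?thesis by (rule integrable_continuous_interval)
  qed
  show ?thesis
    unfolding seg_inner_def left_diff_distrib integral_diff[OF i[OF assms(1)] i[OF assms(2)]] right_diff_distrib ..
qed

text \<open>The counts are exact: a quadratic with two endpoint values and one moment, a cubic with
  two endpoint values and two moments. The first alternative is used for the tangential-normal
  component, the second for the normal-normal one.\<close>

lemma dofs_imp_zero:
  assumes vw: "v \<noteq> w" and f: "f \<in> polys 3 UNIV" "f v = 0" "f w = 0" and x: "x \<in> closed_segment v w"
    and dof: "f \<in> polys 2 (closed_segment v w) \<and> (\<forall>q\<in>polys 0 UNIV. seg_inner v w f q = 0) \<or> (\<forall>q\<in>polys 1 UNIV. seg_inner v w f q = 0)"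
  shows "f x = 0"
proof -
  obtain s where s: "s \<in> {0..1}" "x = linepath v w s" using x by (metis imageE linepath_image_01)
  have one: "(\<lambda>_. 1) \<in> polys 0 UNIV" by (rule polys_const)
  have d0: "dist v w \<noteq> 0" using vw by simp
  from dof show ?thesis
  proof
    assume a: "f \<in> polys 2 (closed_segment v w) \<and> (\<forall>q\<in>polys 0 UNIV. seg_inner v w f q = 0)"
    then obtain Q where Q: "degree Q \<le> 2" "\<And>s. s \<in> {0..1} \<Longrightarrow> f (linepath v w s) = poly Q s"
      using polys_segment_E by metis
    have "poly Q 0 = 0" "poly Q 1 = 0" using Q(2)[of 0] Q(2)[of 1] f by (simp_all add: linepath_def)
    moreover have "integral {0..1} (\<lambda>s. poly Q s) = 0"
    proof -
      have "seg_inner v w f (\<lambda>_. 1) = 0" using a one by blast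
      then have "integral {0..1} (\<lambda>s. f (linepath v w s)) = 0" using d0 by (simp add: seg_inner_def)
      moreover have "integral {0..1} (\<lambda>s. f (linepath v w s)) = integral {0..1} (\<lambda>s. poly Q s)"
        using Q(2) by (rule integral_cong)
      ultimately show ?thesis by simp
    qed
    ultimately have "Q = 0" using moments2_unique[OF Q(1)] by blast
    then show ?thesis using Q(2)[OF s(1)] s(2) by simp
  next
    assume a: "\<forall>q\<in>polys 1 UNIV. seg_inner v w f q = 0"
    obtain Q where Q: "degree Q \<le> 3" "\<And>s. f (v + s *\<^sub>R (w - v)) = poly Q s" using polys_line[OF f(1)] by metis
    then have Q': "f (linepath v w s) = poly Q s" for s by (simp add: linepath_alt)
    have "poly Q 0 = 0" "poly Q 1 = 0" using Q(2)[of 0] Q(2)[of 1] f by simp_all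
    moreover have "integral {0..1} (\<lambda>s. poly Q s) = 0"
    proof -
      have "seg_inner v w f (\<lambda>_. 1) = 0" using a one polys_mono[of 0 1] by blast
      then show ?thesis using d0 by (simp add: seg_inner_def Q')
    qed
    moreover have "integral {0..1} (\<lambda>s. poly Q s * s) = 0"
    proof -
      define N where "N = (w - v) \<bullet> (w - v)"
      have N: "N \<noteq> 0" using vw by (simp add: N_def)
      \<comment> \<open>The edge parameter as a linear polynomial on the plane, admissible as a test
        function for the first moment.\<close>
      define r where "r x = (1 / N) * (x \<bullet> (w - v) - v \<bullet> (w - v))" for x
      have "r \<in> polys 1 UNIV" unfolding r_def[abs_def] by (intro polys_cmult polys_diff polys_cvec polys_const) simp
      then have "seg_inner v w f r = 0" using a by blast
      moreover have "r (linepath v w s) = s" for s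
      proof -
        have "(v + s *\<^sub>R (w - v)) \<bullet> (w - v) - v \<bullet> (w - v) = s * N" by (simp add: inner_add_left N_def)
        then show ?thesis using N by (simp add: r_def linepath_alt)
      qed
      ultimately show ?thesis using d0 by (simp add: seg_inner_def Q')
    qed
    ultimately have "Q = 0" using moments3_unique[OF Q(1)] by blast
    then show ?thesis using Q' s(2) by simp
  qed
qed

lemma dofs_imp_normal_continuous:
  assumes K: "K \<in> \<T>" and L: "L \<in> \<T>" and e: "e edge_of K" "e edge_of L" and x: "x \<in> e"
    and \<rho>: "\<rho> \<in> sigma_shape n t K" "\<sigma> \<in> sigma_shape n t L"
    and vert: "\<And>z. z extreme_point_of K \<Longrightarrow> z extreme_point_of L \<Longrightarrow> \<rho> z = \<sigma> z"
    and dof_n: "\<And>a b q. e = closed_segment a b \<Longrightarrow> q \<in> polys 1 e \<Longrightarrow> seg_inner a b (\<lambda>x. n e \<bullet> (\<rho> x *v n e)) q = seg_inner a b (\<lambda>x. n e \<bullet> (\<sigma> x *v n e)) q"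
    and dof_t: "\<And>a b q. e = closed_segment a b \<Longrightarrow> q \<in> polys 0 e \<Longrightarrow> seg_inner a b (\<lambda>x. t e \<bullet> (\<rho> x *v n e)) q = seg_inner a b (\<lambda>x. t e \<bullet> (\<sigma> x *v n e)) q"
  shows "\<rho> x *v n e = \<sigma> x *v n e"
proof -
  obtain u0 v0 w0 where "tri u0 v0 w0 K" using triT[OF K] by blast
  then obtain u v w where t: "tri u v w K" and ee: "e = closed_segment v w" using edge_tri[OF _ e(1)] by metis
  have vw: "v \<noteq> w" using t by (simp add: tri_def)
  obtain p q r where "tri p q r L" using triT[OF L] by blast
  then obtain u' where t': "tri u' v w L" using edge_tri_endpoints[OF _ _ vw] e(2) ee by metis
  have pp: "\<rho> \<in> polys 3 UNIV" "\<sigma> \<in> polys 3 UNIV" using \<rho> by (auto simp: sigma_shape_def)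
  have eqv: "\<rho> v = \<sigma> v" "\<rho> w = \<sigma> w" using vert tri_extreme[OF t] tri_extreme[OF t'] by auto
  have bp: "(\<lambda>x. c \<bullet> (\<rho> x *v n e)) \<in> polys 3 UNIV" "(\<lambda>x. c \<bullet> (\<sigma> x *v n e)) \<in> polys 3 UNIV" for c
    using pp by (auto intro: polys_bilinear_form)
  have xe: "x \<in> closed_segment v w" using x ee by simp
  have "n e \<bullet> (\<rho> x *v n e) - n e \<bullet> (\<sigma> x *v n e) = 0"
  proof (rule dofs_imp_zero[OF vw _ _ _ xe, where f = "\<lambda>x. n e \<bullet> (\<rho> x *v n e) - n e \<bullet> (\<sigma> x *v n e)"])
    show "(\<lambda>x. n e \<bullet> (\<rho> x *v n e) - n e \<bullet> (\<sigma> x *v n e)) \<in> polys 3 UNIV" using bp by (intro polys_diff)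
    have "seg_inner v w (\<lambda>x. n e \<bullet> (\<rho> x *v n e) - n e \<bullet> (\<sigma> x *v n e)) q = 0" if "q \<in> polys 1 UNIV" for q
      using seg_inner_diff[OF bp that] dof_n[OF ee polys_UNIV_D[OF that]] by simp
    then show "(\<lambda>x. n e \<bullet> (\<rho> x *v n e) - n e \<bullet> (\<sigma> x *v n e)) \<in> polys 2 (closed_segment v w) \<and>
      (\<forall>q\<in>polys 0 UNIV. seg_inner v w (\<lambda>x. n e \<bullet> (\<rho> x *v n e) - n e \<bullet> (\<sigma> x *v n e)) q = 0) \<or>
      (\<forall>q\<in>polys 1 UNIV. seg_inner v w (\<lambda>x. n e \<bullet> (\<rho> x *v n e) - n e \<bullet> (\<sigma> x *v n e)) q = 0)" by blast
  qed (use eqv in simp_all)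
  moreover have "t e \<bullet> (\<rho> x *v n e) - t e \<bullet> (\<sigma> x *v n e) = 0"
  proof (rule dofs_imp_zero[OF vw _ _ _ xe, where f = "\<lambda>x. t e \<bullet> (\<rho> x *v n e) - t e \<bullet> (\<sigma> x *v n e)"])
    show "(\<lambda>x. t e \<bullet> (\<rho> x *v n e) - t e \<bullet> (\<sigma> x *v n e)) \<in> polys 3 UNIV" using bp by (intro polys_diff)
    have "seg_inner v w (\<lambda>x. t e \<bullet> (\<rho> x *v n e) - t e \<bullet> (\<sigma> x *v n e)) q = 0" if "q \<in> polys 0 UNIV" for q
      using seg_inner_diff[OF bp that] dof_t[OF ee polys_UNIV_D[OF that]] by simp
    moreover have "(\<lambda>x. t e \<bullet> (\<rho> x *v n e) - t e \<bullet> (\<sigma> x *v n e)) \<in> polys 2 e"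
      using \<rho> e by (intro polys_diff) (auto simp: sigma_shape_def)
    ultimately show "(\<lambda>x. t e \<bullet> (\<rho> x *v n e) - t e \<bullet> (\<sigma> x *v n e)) \<in> polys 2 (closed_segment v w) \<and>
      (\<forall>q\<in>polys 0 UNIV. seg_inner v w (\<lambda>x. t e \<bullet> (\<rho> x *v n e) - t e \<bullet> (\<sigma> x *v n e)) q = 0) \<or>
      (\<forall>q\<in>polys 1 UNIV. seg_inner v w (\<lambda>x. t e \<bullet> (\<rho> x *v n e) - t e \<bullet> (\<sigma> x *v n e)) q = 0)" using ee by blast
  qed (use eqv in simp_all)
  ultimately show ?thesis
    using frame_expand[OF frame(1-3)[OF K t ee], of "\<rho> x *v n e"] frame_expand[OF frame(1-3)[OF K t ee], of "\<sigma> x *v n e"] by simp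
qed

lemma seg_inner_cong:
  assumes "e = closed_segment a b" "\<And>x. x \<in> e \<Longrightarrow> f x = g x" shows "seg_inner a b f q = seg_inner a b g q"
proof -
  have "integral {0..1} (\<lambda>s. f (linepath a b s) * q (linepath a b s)) = integral {0..1} (\<lambda>s. g (linepath a b s) * q (linepath a b s))"
    by (rule integral_cong) (use assms linepath_in_path in auto)
  then show ?thesis by (simp add: seg_inner_def)
qed

text \<open>Moments along an edge are equivalent to pointwise equality of the normal components,
  given equal vertex values and the degree bounds of the shape functions. Later arguments about the
  tensor space go through this form.\<close>

lemma sigma_space_iff:
  "\<tau> \<in> sigma_space \<Omega> \<T> n t \<longleftrightarrow> (\<exists>\<rho>. sig \<rho> \<and> (\<forall>K\<in>\<T>. AE x in lebesgue_on K. \<tau> x = \<rho> K x))"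
proof
  assume "\<tau> \<in> sigma_space \<Omega> \<T> n t"
  then obtain \<rho> where \<rho>: "\<forall>K\<in>\<T>. \<rho> K \<in> sigma_shape n t K \<and> (AE x in lebesgue_on K. \<tau> x = \<rho> K x)"
    and vert: "\<forall>K\<in>\<T>. \<forall>K'\<in>\<T>. \<forall>z. z extreme_point_of K \<and> z extreme_point_of K' \<longrightarrow> \<rho> K z = \<rho> K' z"
    and dofs: "\<forall>K\<in>\<T>. \<forall>K'\<in>\<T>. \<forall>e a b. e edge_of K \<and> e edge_of K' \<and> e = closed_segment a b \<longrightarrow>
        (\<forall>q\<in>polys 1 e. seg_inner a b (\<lambda>x. n e \<bullet> (\<rho> K x *v n e)) q = seg_inner a b (\<lambda>x. n e \<bullet> (\<rho> K' x *v n e)) q) \<and>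
        (\<forall>q\<in>polys 0 e. seg_inner a b (\<lambda>x. t e \<bullet> (\<rho> K x *v n e)) q = seg_inner a b (\<lambda>x. t e \<bullet> (\<rho> K' x *v n e)) q)"
    unfolding sigma_space_def mem_Collect_eq by (elim conjE exE) (rule that; assumption)
  have "\<rho> K x *v n e = \<rho> L x *v n e" if KL: "K \<in> \<T>" "L \<in> \<T>" "e edge_of K" "e edge_of L" "x \<in> e" for K L e x
  proof (rule dofs_imp_normal_continuous[OF KL])
    show "\<rho> K \<in> sigma_shape n t K" "\<rho> L \<in> sigma_shape n t L" using \<rho> KL by blast+
    show "\<rho> K z = \<rho> L z" if "z extreme_point_of K" "z extreme_point_of L" for z using vert KL that by blast
    fix a b q assume ab: "e = closed_segment a b"
    note D = mp[OF spec[of _ b, OF spec[of _ a, OF spec[of _ e, OF bspec[OF bspec[OF dofs KL(1)] KL(2)]]]] conjI[OF KL(3) conjI[OF KL(4) ab]]]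
    show "seg_inner a b (\<lambda>x. n e \<bullet> (\<rho> K x *v n e)) q = seg_inner a b (\<lambda>x. n e \<bullet> (\<rho> L x *v n e)) q" if "q \<in> polys 1 e"
      by (rule bspec[OF conjunct1[OF D] that])
    show "seg_inner a b (\<lambda>x. t e \<bullet> (\<rho> K x *v n e)) q = seg_inner a b (\<lambda>x. t e \<bullet> (\<rho> L x *v n e)) q" if "q \<in> polys 0 e"
      by (rule bspec[OF conjunct2[OF D] that])
  qed
  then have "consistent \<rho>" using vert by (intro consistentI) blast+
  then show "\<exists>\<rho>. sig \<rho> \<and> (\<forall>K\<in>\<T>. AE x in lebesgue_on K. \<tau> x = \<rho> K x)"
    using \<rho> unfolding sig_def by blast
next
  assume "\<exists>\<rho>. sig \<rho> \<and> (\<forall>K\<in>\<T>. AE x in lebesgue_on K. \<tau> x = \<rho> K x)"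
  then obtain \<rho> where \<rho>: "sig \<rho>" "\<And>K. K \<in> \<T> \<Longrightarrow> AE x in lebesgue_on K. \<tau> x = \<rho> K x" by blast
  have "\<tau> \<in> L2 \<Omega>" by (rule L2_piecewise[OF polys_continuous_vector[OF sig_polys[OF \<rho>(1)]] \<rho>(2)])
  moreover have "AE x in lebesgue_on \<Omega>. \<tau> x \<in> sym_mats"
    unfolding AE_pieces_iff
  proof
    fix K assume K: "K \<in> \<T>"
    show "AE x in lebesgue_on K. \<tau> x \<in> sym_mats" using \<rho>(2)[OF K] by eventually_elim (use sig_sym[OF \<rho>(1) K] in auto)
  qed
  moreover have si: "seg_inner a b (\<lambda>x. c \<bullet> (\<rho> K x *v n e)) q = seg_inner a b (\<lambda>x. c \<bullet> (\<rho> L x *v n e)) q"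
    if KL: "K \<in> \<T>" "L \<in> \<T>" "e edge_of K" "e edge_of L" "e = closed_segment a b" for K L e a b c q
  proof (rule seg_inner_cong[OF KL(5)])
    fix x assume "x \<in> e"
    then have "\<rho> K x *v n e = \<rho> L x *v n e" using \<rho>(1) KL by (intro consistent_edge) (simp_all add: sig_def)
    then show "c \<bullet> (\<rho> K x *v n e) = c \<bullet> (\<rho> L x *v n e)" by simp
  qed
  moreover have "\<rho> K z = \<rho> L z" if "K \<in> \<T>" "L \<in> \<T>" "z extreme_point_of K \<and> z extreme_point_of L" for K L z
    using consistent_vertex[of \<rho> K L z] \<rho>(1) that by (simp add: sig_def)
  moreover have "\<rho> K \<in> sigma_shape n t K" if "K \<in> \<T>" for K using \<rho>(1) that by (simp add: sig_def)
  ultimately show "\<tau> \<in> sigma_space \<Omega> \<T> n t"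
    unfolding sigma_space_def
    by (intro CollectI conjI exI[of _ \<rho>] ballI allI impI) (assumption | rule \<rho>(2) si | elim conjE)+
qed

section \<open>The weak divergence on the discrete space\<close>

lemma integral_test_cong:
  fixes f g :: "real^2 \<Rightarrow> real"
  assumes "f \<in> L2 \<Omega>" "g \<in> L2 \<Omega>" "AE x in lebesgue_on \<Omega>. f x = g x" "\<phi> \<in> test_functions U"
  shows "integral\<^sup>L (lebesgue_on \<Omega>) (\<lambda>x. f x * \<phi> x) = integral\<^sup>L (lebesgue_on \<Omega>) (\<lambda>x. g x * \<phi> x)"
proof (rule integral_cong_AE)
  have i: "integrable (lebesgue_on \<Omega>) (\<lambda>x. f x * \<phi> x)" "integrable (lebesgue_on \<Omega>) (\<lambda>x. g x * \<phi> x)"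
    using integrable_test_mult[OF L2_integrable[OF lmeasurable_\<Omega>]] assms by blast+
  then show "(\<lambda>x. f x * \<phi> x) \<in> borel_measurable (lebesgue_on \<Omega>)" "(\<lambda>x. g x * \<phi> x) \<in> borel_measurable (lebesgue_on \<Omega>)" by auto
  show "AE x in lebesgue_on \<Omega>. f x * \<phi> x = g x * \<phi> x" using assms(3) by eventually_elim simp
qed

lemma weak_unique:
  fixes f g :: "real^2 \<Rightarrow> real"
  assumes f: "f \<in> L2 \<Omega>" and g: "g \<in> L2 \<Omega>"
    and eq: "\<And>\<phi>. \<phi> \<in> test_functions \<Omega> \<Longrightarrow> integral\<^sup>L (lebesgue_on \<Omega>) (\<lambda>x. f x * \<phi> x) = integral\<^sup>L (lebesgue_on \<Omega>) (\<lambda>x. g x * \<phi> x)"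
  shows "AE x in lebesgue_on \<Omega>. f x = g x"
proof -
  have i: "integrable (lebesgue_on \<Omega>) f" "integrable (lebesgue_on \<Omega>) g" using L2_integrable[OF lmeasurable_\<Omega>] f g by blast+
  have "AE x in lebesgue. x \<in> \<Omega> \<longrightarrow> f x - g x = 0"
  proof (rule du_Bois_Reymond[OF open_\<Omega> order_refl sets_\<Omega>])
    show "integrable (lebesgue_on \<Omega>) (\<lambda>x. f x - g x)" using i by simp
    fix \<phi> assume \<phi>: "\<phi> \<in> test_functions \<Omega>"
    show "integral\<^sup>L (lebesgue_on \<Omega>) (\<lambda>x. (f x - g x) * \<phi> x) = 0"
      using eq[OF \<phi>] integrable_test_mult[OF i(1) \<phi>] integrable_test_mult[OF i(2) \<phi>] by (simp add: left_diff_distrib)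
  qed
  then show ?thesis by (simp add: AE_lebesgue_on_iff)
qed

lemma L2_nth: "(f :: real^2 \<Rightarrow> real^2) \<in> L2 \<Omega> \<Longrightarrow> (\<lambda>x. f x $ i) \<in> L2 \<Omega>"
  by (rule L2_linear_image[where h = "\<lambda>v. v $ i"]) (auto intro: linearI)

lemma L2_nth2: "(f :: real^2 \<Rightarrow> real^2^2) \<in> L2 \<Omega> \<Longrightarrow> (\<lambda>x. f x $ i $ j) \<in> L2 \<Omega>"
  by (rule L2_linear_image[where h = "\<lambda>v. v $ i $ j"]) (auto intro: linearI)

lemma sig_weak_div:
  assumes \<rho>: "sig \<rho>" and \<tau>: "\<And>K. K \<in> \<T> \<Longrightarrow> AE x in lebesgue_on K. \<tau> x = \<rho> K x" and \<phi>: "\<phi> \<in> test_functions \<Omega>"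
  shows "integral\<^sup>L (lebesgue_on \<Omega>) (\<lambda>x. \<Sum>j\<in>UNIV. \<tau> x $ i $ j * partial j \<phi> x)
     = - integral\<^sup>L (lebesgue_on \<Omega>) (\<lambda>x. glue \<T> (\<lambda>K. classical_div (\<rho> K)) x $ i * \<phi> x)"
proof -
  have c: "continuous_on UNIV (\<rho> K)" if "K \<in> \<T>" for K using polys_continuous_vector[OF sig_polys[OF \<rho> that]] .
  have L2: "\<tau> \<in> L2 \<Omega>" "glue \<T> \<rho> \<in> L2 \<Omega>" by (rule L2_piecewise[OF c \<tau>], assumption+, rule glue_L2[OF c])
  have ae: "AE x in lebesgue_on \<Omega>. \<tau> x = glue \<T> \<rho> x" by (rule AE_glue_eq[OF \<tau>])
  have eq: "integral\<^sup>L (lebesgue_on \<Omega>) (\<lambda>x. \<tau> x $ i $ j * partial j \<phi> x) = integral\<^sup>L (lebesgue_on \<Omega>) (\<lambda>x. glue \<T> \<rho> x $ i $ j * partial j \<phi> x)" for j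
    by (rule integral_test_cong[OF L2_nth2[OF L2(1)] L2_nth2[OF L2(2)] _ test_function_partial[OF \<phi>]])
       (use ae in \<open>eventually_elim, simp\<close>)
  have int: "integrable (lebesgue_on \<Omega>) (\<lambda>x. f x $ i $ j * partial j \<phi> x)" if "f \<in> L2 \<Omega>" for f :: "real^2 \<Rightarrow> real^2^2" and j
    by (rule integrable_test_mult[OF L2_integrable[OF lmeasurable_\<Omega> L2_nth2[OF that]] test_function_partial[OF \<phi>]])
  have "integral\<^sup>L (lebesgue_on \<Omega>) (\<lambda>x. \<Sum>j\<in>UNIV. \<tau> x $ i $ j * partial j \<phi> x) = integral\<^sup>L (lebesgue_on \<Omega>) (\<lambda>x. \<Sum>j\<in>UNIV. glue \<T> \<rho> x $ i $ j * partial j \<phi> x)"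
    using int[OF L2(1)] int[OF L2(2)] eq by (simp add: Bochner_Integration.integral_sum)
  also have "\<dots> = - integral\<^sup>L (lebesgue_on \<Omega>) (\<lambda>x. glue \<T> (\<lambda>K. classical_div (\<rho> K)) x $ i * \<phi> x)"
    using \<rho> by (intro consistent_weak_div[OF sig_polys[OF \<rho>] sig_sym[OF \<rho>] _ \<phi>]) (auto simp: sig_def)
  finally show ?thesis .
qed

text \<open>The piecewise divergence is a weak divergence by \<open>sig_weak_div\<close>, and weak
  divergences are unique; so the relation can be decided triangle by triangle.\<close>

lemma div_rel_sig_iff:
  assumes \<rho>: "sig \<rho>" and \<tau>: "\<And>K. K \<in> \<T> \<Longrightarrow> AE x in lebesgue_on K. \<tau> x = \<rho> K x"
  shows "(\<tau>, q) \<in> div_rel \<Omega> \<longleftrightarrow> (\<forall>K\<in>\<T>. AE x in lebesgue_on K. q x = classical_div (\<rho> K) x)"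
proof -
  have c: "continuous_on UNIV (\<rho> K)" "continuous_on UNIV (classical_div (\<rho> K))" if "K \<in> \<T>" for K
    using polys_continuous_vector[OF sig_polys[OF \<rho> that]] polys_continuous_vector[OF polys_classical_div[OF sig_polys[OF \<rho> that]]] .
  let ?d = "glue \<T> (\<lambda>K. classical_div (\<rho> K))"
  have L2: "\<tau> \<in> L2 \<Omega>" "?d \<in> L2 \<Omega>" by (rule L2_piecewise[OF c(1) \<tau>], assumption+, rule glue_L2[OF c(2)])
  show ?thesis
  proof
    assume "(\<tau>, q) \<in> div_rel \<Omega>"
    then have q: "q \<in> L2 \<Omega>" and w: "\<And>i \<phi>. \<phi> \<in> test_functions \<Omega> \<Longrightarrow>
        integral\<^sup>L (lebesgue_on \<Omega>) (\<lambda>x. \<Sum>j\<in>UNIV. \<tau> x $ i $ j * partial j \<phi> x) = - integral\<^sup>L (lebesgue_on \<Omega>) (\<lambda>x. q x $ i * \<phi> x)"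
      by (auto simp: div_rel_def)
    have "AE x in lebesgue_on \<Omega>. q x $ i = ?d x $ i" for i
      by (rule weak_unique[OF L2_nth[OF q] L2_nth[OF L2(2)]]) (use w sig_weak_div[OF \<rho> \<tau>] in auto)
    then have "AE x in lebesgue_on \<Omega>. q x $ 1 = ?d x $ 1" "AE x in lebesgue_on \<Omega>. q x $ 2 = ?d x $ 2" by blast+
    then have "AE x in lebesgue_on \<Omega>. q x = ?d x" by eventually_elim (simp add: vec_eq_iff forall_2)
    then have *: "\<forall>K\<in>\<T>. AE x in lebesgue_on K. q x = ?d x" by (simp add: AE_pieces_iff)
    show "\<forall>K\<in>\<T>. AE x in lebesgue_on K. q x = classical_div (\<rho> K) x"
    proof
      fix K assume K: "K \<in> \<T>"
      show "AE x in lebesgue_on K. q x = classical_div (\<rho> K) x"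
        using bspec[OF * K] AE_glue[OF K, of "\<lambda>K. classical_div (\<rho> K)"] by eventually_elim simp
    qed
  next
    assume ae: "\<forall>K\<in>\<T>. AE x in lebesgue_on K. q x = classical_div (\<rho> K) x"
    have q: "q \<in> L2 \<Omega>" by (rule L2_piecewise[OF c(2) bspec[OF ae]])
    have qd: "AE x in lebesgue_on \<Omega>. q x = ?d x" by (rule AE_glue_eq) (rule bspec[OF ae])
    have "integral\<^sup>L (lebesgue_on \<Omega>) (\<lambda>x. q x $ i * \<phi> x) = integral\<^sup>L (lebesgue_on \<Omega>) (\<lambda>x. ?d x $ i * \<phi> x)" if "\<phi> \<in> test_functions \<Omega>" for i \<phi>
      by (rule integral_test_cong[OF L2_nth[OF q] L2_nth[OF L2(2)] _ that]) (use qd in \<open>eventually_elim, simp\<close>)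
    then show "(\<tau>, q) \<in> div_rel \<Omega>"
      unfolding div_rel_def using L2 q sig_weak_div[OF \<rho> \<tau>] by auto
  qed
qed

lemma sigma_subset_domain_div: "sigma_space \<Omega> \<T> n t \<subseteq> Domain (div_rel \<Omega>)"
proof
  fix \<tau> assume "\<tau> \<in> sigma_space \<Omega> \<T> n t"
  then obtain \<rho> where \<rho>: "sig \<rho>" "\<And>K. K \<in> \<T> \<Longrightarrow> AE x in lebesgue_on K. \<tau> x = \<rho> K x" using sigma_space_iff by blast
  have "(\<tau>, glue \<T> (\<lambda>K. classical_div (\<rho> K))) \<in> div_rel \<Omega>"
    using div_rel_sig_iff[OF \<rho>] AE_glue[of _ "\<lambda>K. classical_div (\<rho> K)"] by blast
  then show "\<tau> \<in> Domain (div_rel \<Omega>)" by blast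
qed

lemma div_image: "div_rel \<Omega> `` sigma_space \<Omega> \<T> n t = V_space \<Omega> \<T>"
proof
  show "div_rel \<Omega> `` sigma_space \<Omega> \<T> n t \<subseteq> V_space \<Omega> \<T>"
  proof
    fix q assume "q \<in> div_rel \<Omega> `` sigma_space \<Omega> \<T> n t"
    then obtain \<tau> where \<tau>: "\<tau> \<in> sigma_space \<Omega> \<T> n t" "(\<tau>, q) \<in> div_rel \<Omega>" by blast
    obtain \<rho> where \<rho>: "sig \<rho>" "\<And>K. K \<in> \<T> \<Longrightarrow> AE x in lebesgue_on K. \<tau> x = \<rho> K x" using sigma_space_iff \<tau>(1) by blast
    have ae: "\<forall>K\<in>\<T>. AE x in lebesgue_on K. q x = classical_div (\<rho> K) x" using div_rel_sig_iff[OF \<rho>] \<tau>(2) by blast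
    have "classical_div (\<rho> K) \<in> polys 1 K" if "K \<in> \<T>" for K using \<rho>(1) that by (auto simp: sig_def sigma_shape_def)
    then have "\<forall>K\<in>\<T>. q \<in> ae_polys 1 K" using ae unfolding ae_polys_def by blast
    then show "q \<in> V_space \<Omega> \<T>" using \<tau>(2) by (auto simp: V_space_def div_rel_def)
  qed
  show "V_space \<Omega> \<T> \<subseteq> div_rel \<Omega> `` sigma_space \<Omega> \<T> n t"
  proof
    fix q assume q: "q \<in> V_space \<Omega> \<T>"
    have "\<exists>p. p \<in> polys 1 UNIV \<and> (AE x in lebesgue_on K. q x = p x)" if K: "K \<in> \<T>" for K
    proof -
      obtain p where p: "p \<in> polys 1 K" "AE x in lebesgue_on K. q x = p x" using q K by (auto simp: V_space_def ae_polys_def)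
      obtain p' where p': "p' \<in> polys 1 UNIV" "\<And>x. x \<in> K \<Longrightarrow> p x = p' x" using polysE[OF p(1)] by metis
      have "AE x in lebesgue_on K. q x = p' x"
        using p(2) K unfolding AE_lebesgue_on_iff[OF sets_K[OF K]] by eventually_elim (use p'(2) in auto)
      then show ?thesis using p'(1) by blast
    qed
    then obtain p where p: "\<And>K. K \<in> \<T> \<Longrightarrow> p K \<in> polys 1 UNIV \<and> (AE x in lebesgue_on K. q x = p K x)" by metis
    obtain \<rho> where \<rho>: "sig \<rho>" "\<And>K. K \<in> \<T> \<Longrightarrow> classical_div (\<rho> K) = p K" using div_family_surj[of p] p by blast
    have g: "\<And>K. K \<in> \<T> \<Longrightarrow> AE x in lebesgue_on K. glue \<T> \<rho> x = \<rho> K x" by (rule AE_glue)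
    have "(glue \<T> \<rho>, q) \<in> div_rel \<Omega>" using div_rel_sig_iff[OF \<rho>(1) g] \<rho>(2) p by simp
    moreover have "glue \<T> \<rho> \<in> sigma_space \<Omega> \<T> n t" using sigma_space_iff \<rho>(1) g by blast
    ultimately show "q \<in> div_rel \<Omega> `` sigma_space \<Omega> \<T> n t" by blast
  qed
qed

end

section \<open>The Airy operator on polynomials\<close>

definition airy :: "(real^2 \<Rightarrow> real) \<Rightarrow> real^2 \<Rightarrow> real^2^2" where
  "airy p x = (\<chi> i j. if i = 1 then (if j = 1 then partial 2 (partial 2 p) x else - partial 1 (partial 2 p) x)
                     else (if j = 1 then - partial 1 (partial 2 p) x else partial 1 (partial 1 p) x))"

lemma airy_nth [simp]:
  "airy p x $ 1 $ 1 = partial 2 (partial 2 p) x" "airy p x $ 1 $ 2 = - partial 1 (partial 2 p) x"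
  "airy p x $ 2 $ 1 = - partial 1 (partial 2 p) x" "airy p x $ 2 $ 2 = partial 1 (partial 1 p) x"
  by (simp_all add: airy_def)

lemma polys_pp: "p \<in> polys (Suc (Suc k)) UNIV \<Longrightarrow> partial i (partial j p) \<in> polys k UNIV"
  using polys_partial[of "partial j p" "Suc k" i] polys_partial[of p "Suc (Suc k)" j] by simp

lemma polys5_pp: "p \<in> polys 5 UNIV \<Longrightarrow> partial i (partial j p) \<in> polys 3 UNIV"
  using polys_pp[of p 3] by (simp add: eval_nat_numeral)

lemma polys_dir_deriv: "p \<in> polys k UNIV \<Longrightarrow> dir_deriv d p = (\<lambda>x. d $ 1 * partial 1 p x + d $ 2 * partial 2 p x)"
  by (rule ext) (rule dir_deriv_partial[OF polys_differentiable])

lemma polys_dir_deriv_mem: "p \<in> polys k UNIV \<Longrightarrow> dir_deriv d p \<in> polys (k - 1) UNIV"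
  unfolding polys_dir_deriv by (intro polys_add polys_cmult polys_partial)

lemma partial_polys_sub:
  "p \<in> polys k UNIV \<Longrightarrow> q \<in> polys l UNIV \<Longrightarrow> partial i (\<lambda>x. p x - q x) = (\<lambda>x. partial i p x - partial i q x)"
  by (intro ext partial_diff polys_differentiable)

lemma partial_dir_deriv:
  assumes "p \<in> polys k UNIV" shows "partial i (dir_deriv d p) = (\<lambda>x. d $ 1 * partial i (partial 1 p) x + d $ 2 * partial i (partial 2 p) x)"
proof (rule ext)
  fix x
  have d: "partial j p differentiable at x" for j by (rule polys_differentiable[OF polys_partial[OF assms]])
  have "partial i (\<lambda>x. d $ 1 * partial 1 p x + d $ 2 * partial 2 p x) x = partial i (\<lambda>x. d $ 1 * partial 1 p x) x + partial i (\<lambda>x. d $ 2 * partial 2 p x) x"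
    by (intro partial_add differentiable_mult differentiable_const d)
  then show "partial i (dir_deriv d p) x = d $ 1 * partial i (partial 1 p) x + d $ 2 * partial i (partial 2 p) x"
    unfolding polys_dir_deriv[OF assms] by (simp add: partial_cmult[OF d])
qed

lemma dir_deriv_dir_deriv:
  assumes "p \<in> polys k UNIV"
  shows "dir_deriv a (dir_deriv b p) x = a $ 1 * b $ 1 * partial 1 (partial 1 p) x + (a $ 1 * b $ 2 + a $ 2 * b $ 1) * partial 1 (partial 2 p) x
     + a $ 2 * b $ 2 * partial 2 (partial 2 p) x"
  unfolding dir_deriv_partial[OF polys_differentiable[OF polys_dir_deriv_mem[OF assms]]] partial_dir_deriv[OF assms]
    polys_partial_commute[OF assms, of 2 1] by (simp add: algebra_simps)

text \<open>\<open>k\<close> is the sign relating the given tangent to the rotated normal.\<close>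

lemma orthonormal_rotation:
  assumes "norm n = 1" "norm t = 1" "n \<bullet> t = (0::real)"
  obtains k where "k * k = 1" "(t :: real^2) $ 1 = - k * n $ 2" "t $ 2 = k * n $ 1"
proof (rule that[of "n $ 1 * t $ 2 - n $ 2 * t $ 1"])
  have n: "n $ 1 * n $ 1 + n $ 2 * n $ 2 = 1" and t: "t $ 1 * t $ 1 + t $ 2 * t $ 2 = 1"
    and nt: "n $ 1 * t $ 1 + n $ 2 * t $ 2 = 0"
    using assms by (simp_all add: norm_eq_1 inner_vec_def sum_2)
  then show "t $ 1 = - (n $ 1 * t $ 2 - n $ 2 * t $ 1) * n $ 2" "t $ 2 = (n $ 1 * t $ 2 - n $ 2 * t $ 1) * n $ 1"
    by algebra+
  show "(n $ 1 * t $ 2 - n $ 2 * t $ 1) * (n $ 1 * t $ 2 - n $ 2 * t $ 1) = 1" using n t nt by algebra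
qed

text \<open>Links the two shape conditions: the tangential derivative lowers the degree on an edge
  by one, so degree 3 for the normal derivative of \<open>p\<close> corresponds to degree 2 for this
  component.\<close>

lemma airy_tangential_normal:
  assumes "p \<in> polys k UNIV" "norm n = 1" "norm t = 1" "n \<bullet> t = 0"
  shows "t \<bullet> (airy p x *v n) = - dir_deriv t (dir_deriv n p) x"
proof -
  obtain k where k: "k * k = 1" "t $ 1 = - k * n $ 2" "t $ 2 = k * n $ 1" using orthonormal_rotation[OF assms(2-4)] .
  show ?thesis
    unfolding dir_deriv_dir_deriv[OF assms(1)] matrix_mult2 inner_vec_def sum_2 k(2,3) by (simp add: algebra_simps)
qed

text \<open>The Airy tensor is the Hessian conjugated by a quarter turn. Its value on the normal is
  therefore the turned tangential derivative of the gradient, up to the sign of the frame, which the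
  factor \<open>t $ 2 * n $ 1 - t $ 1 * n $ 2\<close> records.\<close>

lemma airy_normal:
  assumes "p \<in> polys k UNIV" "norm n = 1" "norm t = 1" "n \<bullet> t = 0"
  shows "airy p x *v n = (\<chi> i. if i = 1 then dir_deriv t (partial 2 p) x * (t $ 2 * n $ 1 - t $ 1 * n $ 2)
     else - dir_deriv t (partial 1 p) x * (t $ 2 * n $ 1 - t $ 1 * n $ 2))"
proof -
  obtain k where k: "k * k = 1" "t $ 1 = - k * n $ 2" "t $ 2 = k * n $ 1" using orthonormal_rotation[OF assms(2-4)] .
  have n: "n $ 1 * n $ 1 + n $ 2 * n $ 2 = 1" using assms(2) by (simp add: norm_eq_1 inner_vec_def sum_2)
  have s: "t $ 2 * n $ 1 - t $ 1 * n $ 2 = k" using n unfolding k(2,3) by algebra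
  have d: "dir_deriv t (partial j p) x = t $ 1 * partial 1 (partial j p) x + t $ 2 * partial 2 (partial j p) x" for j
    by (rule dir_deriv_partial[OF polys_differentiable[OF polys_partial[OF assms(1)]]])
  have e: "k * (k * c) = c" for c using k(1) by (simp add: mult.assoc[symmetric])
  show ?thesis
    unfolding s unfolding d k(2,3) polys_partial_commute[OF assms(1), of 2 1]
    by (simp add: matrix_mult2 vec_eq_iff forall_2 algebra_simps e)
qed

text \<open>Applied along an edge to the difference of two polynomials: their Airy tensors have the
  same normal components there exactly when the gradients differ by a constant.\<close>

lemma airy_normal_zero:
  assumes "p \<in> polys k UNIV" "norm n = 1" "norm t = 1" "n \<bullet> t = 0"
  shows "airy p x *v n = 0 \<longleftrightarrow> (\<forall>j. dir_deriv t (partial j p) x = 0)"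
proof -
  obtain k where k: "k * k = 1" "t $ 1 = - k * n $ 2" "t $ 2 = k * n $ 1" using orthonormal_rotation[OF assms(2-4)] .
  have n: "n $ 1 * n $ 1 + n $ 2 * n $ 2 = 1" using assms(2) by (simp add: norm_eq_1 inner_vec_def sum_2)
  have s: "t $ 2 * n $ 1 - t $ 1 * n $ 2 = k" using n unfolding k(2,3) by algebra
  have "k \<noteq> 0" using k(1) by auto
  then show ?thesis unfolding airy_normal[OF assms] s by (auto simp: vec_eq_iff forall_2)
qed

lemma classical_div_airy:
  assumes "p \<in> polys k UNIV" shows "classical_div (airy p) = (\<lambda>x. 0)"
proof (rule ext)
  fix x
  have pp: "partial j p \<in> polys (k - 1) UNIV" for j using assms by (rule polys_partial)
  have d: "partial i (partial j p) differentiable at x" for i j by (rule polys_differentiable[OF polys_partial[OF pp]])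
  have m: "partial l (\<lambda>y. - partial i (partial j p) y) x = - partial l (partial i (partial j p)) x" for l i j
    by (rule partial_minus[OF d])
  have "partial 1 (partial 2 (partial 2 p)) = partial 2 (partial 1 (partial 2 p))" by (rule polys_partial_commute[OF pp])
  moreover have "partial 1 (partial 1 (partial 2 p)) = partial 2 (partial 1 (partial 1 p))"
    unfolding polys_partial_commute[OF assms, of 1 2] by (rule polys_partial_commute[OF pp])
  ultimately show "classical_div (airy p) x = 0"
    by (simp add: classical_div_def vec_eq_iff forall_2 sum_2 m)
qed

lemma polys_airy: "p \<in> polys 5 UNIV \<Longrightarrow> airy p \<in> polys 3 UNIV"
  unfolding polys_matrix_iff forall_2 airy_nth by (intro conjI polys_uminus polys5_pp)

lemma sym_airy: "range (airy p) \<subseteq> sym_mats"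
  by (auto simp: sym_mats_iff)

lemma airy_diff:
  assumes "p \<in> polys k UNIV" "q \<in> polys k UNIV" shows "airy (\<lambda>x. p x - q x) x = airy p x - airy q x"
proof -
  have "partial i (partial j (\<lambda>x. p x - q x)) = (\<lambda>x. partial i (partial j p) x - partial i (partial j q) x)" for i j
    unfolding partial_polys_sub[OF assms] by (rule partial_polys_sub[OF polys_partial[OF assms(1)] polys_partial[OF assms(2)]])
  then show ?thesis by (simp add: vec_eq_iff forall_2)
qed

text \<open>A symmetric field with vanishing divergence is the Airy image of a polynomial: the Poincare lemma is
  applied to the rows of the would-be Hessian, and once more to the gradient.\<close>

lemma airy_potential:
  assumes \<rho>: "\<rho> \<in> polys 3 UNIV" "range \<rho> \<subseteq> sym_mats" and div: "classical_div \<rho> = (\<lambda>x. 0)"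
  obtains p where "p \<in> polys 5 UNIV" "airy p = \<rho>"
proof -
  have r: "(\<lambda>x. \<rho> x $ i $ j) \<in> polys 3 UNIV" for i j by (rule polys_matrix_nth[OF \<rho>(1)])
  have s: "\<rho> x $ 2 $ 1 = \<rho> x $ 1 $ 2" for x using \<rho>(2) by (auto simp: sym_mats_iff image_subset_iff)
  have d: "partial 1 (\<lambda>x. \<rho> x $ i $ 1) x + partial 2 (\<lambda>x. \<rho> x $ i $ 2) x = 0" for i x
  proof -
    have "classical_div \<rho> x $ i = 0" using div by simp
    then show ?thesis by (simp add: classical_div_def sum_2)
  qed
  have m: "partial i (\<lambda>x. - \<rho> x $ 1 $ 2) x = - partial i (\<lambda>x. \<rho> x $ 1 $ 2) x" for i x
    by (rule partial_minus[OF polys_differentiable[OF r]])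
  have mp: "(\<lambda>x. - \<rho> x $ 1 $ 2) \<in> polys 3 UNIV" by (intro polys_uminus r)
  \<comment> \<open>\<open>f\<close> and \<open>g\<close> become the first partial derivatives of
    the potential: entries 22 and 12 of \<rho> form the gradient of \<open>f\<close>, entries 12 and
    11 that of \<open>g\<close>, the mixed entry with a minus sign. Each pair is integrable because
    a row of \<rho> is divergence free, and symmetry of \<rho> makes \<open>f\<close>,
    \<open>g\<close> itself integrable.\<close>
  have "partial 2 (\<lambda>x. \<rho> x $ 2 $ 2) x = partial 1 (\<lambda>x. - \<rho> x $ 1 $ 2) x" for x
    using d[of 2 x] unfolding s m by linarith
  then have "partial 2 (\<lambda>x. \<rho> x $ 2 $ 2) = partial 1 (\<lambda>x. - \<rho> x $ 1 $ 2)" ..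
  then obtain f where f: "f \<in> polys (Suc 3) UNIV" "partial 1 f = (\<lambda>x. \<rho> x $ 2 $ 2)" "partial 2 f = (\<lambda>x. - \<rho> x $ 1 $ 2)"
    using polys_Poincare[OF r mp] by metis
  have "partial 2 (\<lambda>x. - \<rho> x $ 1 $ 2) x = partial 1 (\<lambda>x. \<rho> x $ 1 $ 1) x" for x
    using d[of 1 x] unfolding m by linarith
  then have "partial 2 (\<lambda>x. - \<rho> x $ 1 $ 2) = partial 1 (\<lambda>x. \<rho> x $ 1 $ 1)" ..
  then obtain g where g: "g \<in> polys (Suc 3) UNIV" "partial 1 g = (\<lambda>x. - \<rho> x $ 1 $ 2)" "partial 2 g = (\<lambda>x. \<rho> x $ 1 $ 1)"
    using polys_Poincare[OF mp r] by metis
  have "partial 2 f = partial 1 g" using f g by simp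
  then obtain p where p: "p \<in> polys (Suc (Suc 3)) UNIV" "partial 1 p = f" "partial 2 p = g"
    using polys_Poincare[OF f(1) g(1)] by metis
  have "airy p = \<rho>"
    using s by (intro ext) (simp add: vec_eq_iff forall_2 p f g)
  then show thesis using that[of p] p(1) by (simp add: eval_nat_numeral)
qed

lemma poly_eq_on_unit:
  fixes P Q :: "real poly"
  assumes "\<And>s. s \<in> {0..1} \<Longrightarrow> poly P s = poly Q s" shows "P = Q"
proof -
  have "{0<..<1} \<subseteq> {s. poly (P - Q) s = 0}" using assms by auto
  then have "infinite {s. poly (P - Q) s = 0}" by (metis finite_subset infinite_Ioo zero_less_one)
  then have "P - Q = 0" using poly_roots_finite by blast
  then show ?thesis by simp
qed

lemma polys_line_deriv:
  assumes "f \<in> polys k UNIV" "\<And>s. f (a + s *\<^sub>R d) = poly q s"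
  shows "dir_deriv d f (a + s *\<^sub>R d) = poly (pderiv q) s"
  by (rule poly_line_deriv[OF polys_differentiable[OF assms(1)] assms(2)])

lemma polys_line_const:
  assumes f: "f \<in> polys k UNIV" and 0: "\<And>x. x \<in> closed_segment v w \<Longrightarrow> dir_deriv (w - v) f x = 0"
    and x: "x \<in> closed_segment v w" "y \<in> closed_segment v w"
  shows "f x = f y"
proof -
  obtain q where q: "\<And>s. f (v + s *\<^sub>R (w - v)) = poly q s" using polys_line[OF f] by metis
  have "poly (pderiv q) s = poly 0 s" if "s \<in> {0..1}" for s
    using polys_line_deriv[OF f q, of s] 0[of "linepath v w s"] linepath_in_path[OF that, of v w] by (simp add: linepath_alt)
  then have "pderiv q = 0" by (rule poly_eq_on_unit)
  then obtain c where c: "q = [:c:]" using pderiv_iszero by blast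
  have "f z = c" if z: "z \<in> closed_segment v w" for z
  proof -
    obtain s where "z = linepath v w s" using z by (metis imageE linepath_image_01)
    then show ?thesis using q c by (simp add: linepath_alt)
  qed
  then show ?thesis using x by simp
qed

lemma dir_deriv_scaleR: "f differentiable at x \<Longrightarrow> dir_deriv (c *\<^sub>R d) f x = c * dir_deriv d f x"
  by (simp add: dir_deriv_partial algebra_simps)

lemma polys_second_zero:
  assumes p: "p \<in> polys k UNIV" and 0: "\<And>i j. partial i (partial j p) = (\<lambda>x. 0)"
  shows "p y = p x + ((y - x) $ 1 * partial 1 p x + (y - x) $ 2 * partial 2 p x)" "partial i p y = partial i p x"
proof -
  have c: "partial i p y = partial i p x" for i y
  proof (rule polys_line_const[OF polys_partial[OF p], of x y])
    show "dir_deriv (y - x) (partial i p) z = 0" for z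
      by (simp add: dir_deriv_partial[OF polys_differentiable[OF polys_partial[OF p]]] 0)
  qed auto
  then show "partial i p y = partial i p x" .
  let ?g1 = "partial 1 p x" and ?g2 = "partial 2 p x"
  define r where "r z = p z - ((z $ 1) * ?g1 + (z $ 2) * ?g2)" for z
  have l: "(\<lambda>z. (z $ 1) * ?g1 + (z $ 2) * ?g2) \<in> polys 1 UNIV"
    by (intro polys_add polys_mult[where k = 1 and l = 0] polys_coord polys_const) auto
  then have rp: "r \<in> polys (max k 1) UNIV" unfolding r_def[abs_def] using p polys_mono[of k "max k 1"] polys_mono[of 1 "max k 1"] by (intro polys_diff) auto
  have ld: "((\<lambda>z. (z $ 1) * ?g1 + (z $ 2) * ?g2) has_derivative (\<lambda>h. h $ 1 * ?g1 + h $ 2 * ?g2)) (at z)" for z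
    by (auto intro!: derivative_eq_intros bounded_linear.has_derivative[OF bounded_linear_vec_nth])
  have "dir_deriv d r z = 0" for d z
  proof -
    have "(r has_derivative (\<lambda>h. (h $ 1 * partial 1 p z + h $ 2 * partial 2 p z) - (h $ 1 * ?g1 + h $ 2 * ?g2))) (at z)"
      unfolding r_def[abs_def] by (intro has_derivative_diff has_derivative_partial polys_differentiable[OF p] ld)
    then show ?thesis using c[of 1 z] c[of 2 z] by (simp add: dir_deriv_eqI)
  qed
  then have "r y = r x" by (intro polys_line_const[OF rp, of x y]) auto
  then show "p y = p x + ((y - x) $ 1 * ?g1 + (y - x) $ 2 * ?g2)" by (simp add: r_def algebra_simps)
qed

section \<open>Bell functions and the Airy map on the mesh\<close>

context framed_mesh
begin

text \<open>If \<open>Q\<close> is the normal derivative of \<open>p\<close> in the edge parameter,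
  then the tangential-normal component of the Airy tensor is \<open>pderiv Q\<close> times
  \<open>- 1 / c\<close>, where \<open>c\<close> converts the edge vector into the unit tangent. So
  \<open>Q\<close> has degree at most 3 exactly when that component has degree at most 2. The
  divergence condition holds since Airy tensors are divergence free.\<close>

lemma airy_in_sigma_iff:
  assumes K: "K \<in> \<T>" and p: "p \<in> polys 5 UNIV"
  shows "airy p \<in> sigma_shape n t K \<longleftrightarrow> p \<in> bell_shape n K"
proof -
  have edge: "(\<lambda>x. t e \<bullet> (airy p x *v n e)) \<in> polys 2 e \<longleftrightarrow> dir_deriv (n e) p \<in> polys 3 e" if e: "e edge_of K" for e
  proof -
    obtain u0 v0 w0 where "tri u0 v0 w0 K" using triT[OF K] by blast
    then obtain u v w where tr: "tri u v w K" and ee: "e = closed_segment v w" using edge_tri[OF _ e] by metis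
    note f = frame[OF K tr ee]
    have vw: "v \<noteq> w" using tr by (simp add: tri_def)
    define c where "c = t e \<bullet> (w - v)"
    have c: "w - v = c *\<^sub>R t e" "c \<noteq> 0" using f(5,6) by (auto simp: c_def)
    have g: "dir_deriv (n e) p \<in> polys 4 UNIV" using polys_dir_deriv_mem[OF p, of "n e"] by simp
    obtain Q where Q: "\<And>s. dir_deriv (n e) p (v + s *\<^sub>R (w - v)) = poly Q s" using polys_line[OF g] by metis
    have A: "t e \<bullet> (airy p (linepath v w s) *v n e) = poly (smult (- 1 / c) (pderiv Q)) s" for s
    proof -
      have "poly (pderiv Q) s = dir_deriv (c *\<^sub>R t e) (dir_deriv (n e) p) (linepath v w s)"
        using polys_line_deriv[OF g Q, of s] by (simp add: linepath_alt c(1)[symmetric])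
      also have "\<dots> = c * dir_deriv (t e) (dir_deriv (n e) p) (linepath v w s)"
        by (rule dir_deriv_scaleR[OF polys_differentiable[OF g]])
      also have "\<dots> = - c * (t e \<bullet> (airy p (linepath v w s) *v n e))"
        using airy_tangential_normal[OF p f(1-3)] by simp
      finally show ?thesis using c(2) by simp
    qed
    show ?thesis
    proof
      assume "dir_deriv (n e) p \<in> polys 3 e"
      then have "dir_deriv (n e) p \<in> polys 3 (closed_segment v w)" by (simp only: ee)
      then obtain Q3 where Q3: "degree Q3 \<le> 3" "\<And>s. s \<in> {0..1} \<Longrightarrow> dir_deriv (n e) p (linepath v w s) = poly Q3 s"
        using polys_segment_E by metis
      have "Q = Q3" by (rule poly_eq_on_unit) (use Q Q3(2) in \<open>auto simp: linepath_alt\<close>)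
      then have "degree (smult (- 1 / c) (pderiv Q)) \<le> 2" using Q3(1) by (auto simp: degree_pderiv)
      then have "(\<lambda>x. t e \<bullet> (airy p x *v n e)) \<in> polys 2 (closed_segment v w)"
        by (rule polys_segment_I[OF vw]) (rule A)
      then show "(\<lambda>x. t e \<bullet> (airy p x *v n e)) \<in> polys 2 e" by (simp only: ee)
    next
      assume "(\<lambda>x. t e \<bullet> (airy p x *v n e)) \<in> polys 2 e"
      then have "(\<lambda>x. t e \<bullet> (airy p x *v n e)) \<in> polys 2 (closed_segment v w)" by (simp only: ee)
      then obtain Q2 where Q2: "degree Q2 \<le> 2" "\<And>s. s \<in> {0..1} \<Longrightarrow> t e \<bullet> (airy p (linepath v w s) *v n e) = poly Q2 s"
        using polys_segment_E by metis
      have "smult (- 1 / c) (pderiv Q) = Q2" by (rule poly_eq_on_unit) (use A Q2(2) in auto)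
      then have "degree (pderiv Q) \<le> 2" using Q2(1) c(2) by auto
      then have "degree Q \<le> 3" by (simp add: degree_pderiv)
      then have "dir_deriv (n e) p \<in> polys 3 (closed_segment v w)"
        by (rule polys_segment_I[OF vw]) (simp add: linepath_alt Q)
      then show "dir_deriv (n e) p \<in> polys 3 e" by (simp only: ee)
    qed
  qed
  have "classical_div (airy p) \<in> polys 1 K" unfolding classical_div_airy[OF p] by (rule polys_zero)
  then show ?thesis
    using edge polys_airy[OF p] sym_airy p unfolding sigma_shape_def bell_shape_def by blast
qed

definition C1_match :: "((real^2) set \<Rightarrow> real^2 \<Rightarrow> real) \<Rightarrow> bool" where
  "C1_match p \<longleftrightarrow> (\<forall>K\<in>\<T>. \<forall>L\<in>\<T>. \<forall>x\<in>K \<inter> L. p K x = p L x \<and> (\<forall>i. partial i (p K) x = partial i (p L) x))"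

lemma C1_matchD:
  assumes "C1_match p" "K \<in> \<T>" "L \<in> \<T>" "x \<in> K \<inter> L"
  shows "p K x = p L x" "partial i (p K) x = partial i (p L) x"
  using assms unfolding C1_match_def by blast+

lemma L2_glue_polys: "(\<And>K. K \<in> \<T> \<Longrightarrow> (q K :: real^2 \<Rightarrow> real) \<in> polys k UNIV) \<Longrightarrow> glue \<T> q \<in> L2 \<Omega>"
  by (rule glue_L2[OF polys_continuous])

lemma has_weak_deriv_cong:
  assumes "has_weak_deriv \<Omega> is v w" "v \<in> L2 \<Omega>" "v' \<in> L2 \<Omega>" "w \<in> L2 \<Omega>" "w' \<in> L2 \<Omega>"
    "AE x in lebesgue_on \<Omega>. v x = v' x" "AE x in lebesgue_on \<Omega>. w x = w' x"
  shows "has_weak_deriv \<Omega> is v' w'"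
  unfolding has_weak_deriv_def
proof
  fix \<phi> assume \<phi>: "\<phi> \<in> test_functions \<Omega>"
  have "partials is \<phi> \<in> test_functions \<Omega>"
    by (induction "is") (use \<phi> test_function_partial in \<open>auto simp: partials_def\<close>)
  then have "integral\<^sup>L (lebesgue_on \<Omega>) (\<lambda>x. v x * partials is \<phi> x) = integral\<^sup>L (lebesgue_on \<Omega>) (\<lambda>x. v' x * partials is \<phi> x)"
    by (rule integral_test_cong[OF assms(2,3,6)])
  moreover have "integral\<^sup>L (lebesgue_on \<Omega>) (\<lambda>x. w x * \<phi> x) = integral\<^sup>L (lebesgue_on \<Omega>) (\<lambda>x. w' x * \<phi> x)"
    by (rule integral_test_cong[OF assms(4,5,7) \<phi>])
  ultimately show "integral\<^sup>L (lebesgue_on \<Omega>) (\<lambda>x. v' x * partials is \<phi> x) = (- 1) ^ length is * integral\<^sup>L (lebesgue_on \<Omega>) (\<lambda>x. w' x * \<phi> x)"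
    using assms(1) \<phi> unfolding has_weak_deriv_def by simp
qed

lemma has_weak_deriv_unique:
  assumes "has_weak_deriv \<Omega> is v w" "has_weak_deriv \<Omega> is v w'" "w \<in> L2 \<Omega>" "w' \<in> L2 \<Omega>"
  shows "AE x in lebesgue_on \<Omega>. w x = w' x"
  by (rule weak_unique[OF assms(3,4)]) (use assms(1,2) in \<open>simp add: has_weak_deriv_def\<close>)

lemma C1_weak_derivs:
  assumes p: "\<And>K. K \<in> \<T> \<Longrightarrow> p K \<in> polys 5 UNIV" and m: "C1_match p"
  shows "has_weak_deriv \<Omega> [] (glue \<T> p) (glue \<T> p)"
    "has_weak_deriv \<Omega> [i] (glue \<T> p) (glue \<T> (\<lambda>K. partial i (p K)))"
    "has_weak_deriv \<Omega> [i, j] (glue \<T> p) (glue \<T> (\<lambda>K. partial i (partial j (p K))))"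
proof -
  have m0: "p K x = p L x" and m1: "partial i (p K) x = partial i (p L) x" if "K \<in> \<T>" "L \<in> \<T>" "x \<in> K \<inter> L" for K L x i
    using m that unfolding C1_match_def by blast+
  show "has_weak_deriv \<Omega> [] (glue \<T> p) (glue \<T> p)" by (simp add: has_weak_deriv_def partials_def)
  have w: "integral\<^sup>L (lebesgue_on \<Omega>) (\<lambda>x. glue \<T> p x * partial i \<phi> x) = - integral\<^sup>L (lebesgue_on \<Omega>) (\<lambda>x. glue \<T> (\<lambda>K. partial i (p K)) x * \<phi> x)"
    if "\<phi> \<in> test_functions \<Omega>" for i \<phi>
    by (rule continuous_piecewise_weak_partial[OF p m0 that])
  have w2: "integral\<^sup>L (lebesgue_on \<Omega>) (\<lambda>x. glue \<T> (\<lambda>K. partial j (p K)) x * partial i \<phi> x)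
      = - integral\<^sup>L (lebesgue_on \<Omega>) (\<lambda>x. glue \<T> (\<lambda>K. partial i (partial j (p K))) x * \<phi> x)"
    if "\<phi> \<in> test_functions \<Omega>" for i j \<phi>
    by (rule continuous_piecewise_weak_partial[where p = "\<lambda>K. partial j (p K)", OF polys_partial[OF p] m1 that])
  show "has_weak_deriv \<Omega> [i] (glue \<T> p) (glue \<T> (\<lambda>K. partial i (p K)))"
    using w by (simp add: has_weak_deriv_def partials_def)
  \<comment> \<open>Integrating by parts first against \<open>partial i\<close> and then against
    \<open>partial j\<close> puts the derivatives on \<open>p\<close> in the opposite order.\<close>
  have "glue \<T> (\<lambda>K. partial i (partial j (p K))) = glue \<T> (\<lambda>K. partial j (partial i (p K)))"
    unfolding glue_def[abs_def] by (intro ext sum.cong refl) (simp add: polys_partial_commute[OF p, of _ i j])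
  then show "has_weak_deriv \<Omega> [i, j] (glue \<T> p) (glue \<T> (\<lambda>K. partial i (partial j (p K))))"
    using w[OF test_function_partial] w2 by (simp add: has_weak_deriv_def partials_def)
qed

lemma glue_airy_nth:
  "glue \<T> (\<lambda>K. airy (p K)) x $ 1 $ 1 = glue \<T> (\<lambda>K. partial 2 (partial 2 (p K))) x"
  "- (glue \<T> (\<lambda>K. airy (p K)) x $ 1 $ 2) = glue \<T> (\<lambda>K. partial 1 (partial 2 (p K))) x"
  "- (glue \<T> (\<lambda>K. airy (p K)) x $ 2 $ 1) = glue \<T> (\<lambda>K. partial 1 (partial 2 (p K))) x"
  "glue \<T> (\<lambda>K. airy (p K)) x $ 2 $ 2 = glue \<T> (\<lambda>K. partial 1 (partial 1 (p K))) x"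
  by (simp_all add: glue_def sum_negf)

text \<open>The weak second derivatives of a \<open>C1_match\<close> family are the piecewise ones,
  and weak derivatives are unique; so the relation can be decided triangle by triangle.\<close>

lemma airy_rel_iff:
  assumes p: "\<And>K. K \<in> \<T> \<Longrightarrow> p K \<in> polys 5 UNIV" and m: "C1_match p"
    and v: "\<And>K. K \<in> \<T> \<Longrightarrow> AE x in lebesgue_on K. v x = p K x"
  shows "(v, \<tau>) \<in> airy_rel \<Omega> \<longleftrightarrow> (\<forall>K\<in>\<T>. AE x in lebesgue_on K. \<tau> x = airy (p K) x)"
proof -
  have cv: "continuous_on UNIV (p K)" "continuous_on UNIV (airy (p K))" if "K \<in> \<T>" for K
    using polys_continuous[OF p[OF that]] polys_continuous_vector[OF polys_airy[OF p[OF that]]] .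
  let ?A = "glue \<T> (\<lambda>K. airy (p K))"
  have vL: "v \<in> L2 \<Omega>" by (rule L2_piecewise[OF cv(1) v])
  have gL: "glue \<T> p \<in> L2 \<Omega>" by (rule glue_L2[OF cv(1)])
  have AL: "?A \<in> L2 \<Omega>" by (rule glue_L2[OF cv(2)])
  have ppL: "glue \<T> (\<lambda>K. partial i (partial j (p K))) \<in> L2 \<Omega>" for i j
    by (rule L2_glue_polys[OF polys5_pp[OF p]])
  have vg: "AE x in lebesgue_on \<Omega>. v x = glue \<T> p x" by (rule AE_glue_eq[OF v])
  then have gv: "AE x in lebesgue_on \<Omega>. glue \<T> p x = v x" by eventually_elim simp
  have W: "has_weak_deriv \<Omega> [i, j] v (glue \<T> (\<lambda>K. partial i (partial j (p K))))" for i j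
    by (rule has_weak_deriv_cong[OF C1_weak_derivs(3)[OF p m] gL vL ppL ppL gv]) auto
  have neg: "(\<lambda>x. - f x) \<in> L2 \<Omega>" if "f \<in> L2 \<Omega>" for f :: "real^2 \<Rightarrow> real"
    by (rule L2_linear_image[OF that, where h = uminus]) (auto intro: linearI)
  show ?thesis
  proof
    assume "(v, \<tau>) \<in> airy_rel \<Omega>"
    then have \<tau>: "\<tau> \<in> L2 \<Omega>" and h: "has_weak_deriv \<Omega> [2, 2] v (\<lambda>x. \<tau> x $ 1 $ 1)" "has_weak_deriv \<Omega> [1, 2] v (\<lambda>x. - (\<tau> x $ 1 $ 2))"
      "has_weak_deriv \<Omega> [1, 2] v (\<lambda>x. - (\<tau> x $ 2 $ 1))" "has_weak_deriv \<Omega> [1, 1] v (\<lambda>x. \<tau> x $ 2 $ 2)"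
      by (auto simp: airy_rel_def)
    have "AE x in lebesgue_on \<Omega>. \<tau> x $ 1 $ 1 = ?A x $ 1 $ 1"
      unfolding glue_airy_nth by (rule has_weak_deriv_unique[OF h(1) W L2_nth2[OF \<tau>] ppL])
    moreover have "AE x in lebesgue_on \<Omega>. - (\<tau> x $ 1 $ 2) = - (?A x $ 1 $ 2)"
      unfolding glue_airy_nth by (rule has_weak_deriv_unique[OF h(2) W neg[OF L2_nth2[OF \<tau>]] ppL])
    moreover have "AE x in lebesgue_on \<Omega>. - (\<tau> x $ 2 $ 1) = - (?A x $ 2 $ 1)"
      unfolding glue_airy_nth by (rule has_weak_deriv_unique[OF h(3) W neg[OF L2_nth2[OF \<tau>]] ppL])
    moreover have "AE x in lebesgue_on \<Omega>. \<tau> x $ 2 $ 2 = ?A x $ 2 $ 2"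
      unfolding glue_airy_nth by (rule has_weak_deriv_unique[OF h(4) W L2_nth2[OF \<tau>] ppL])
    ultimately have "AE x in lebesgue_on \<Omega>. \<tau> x = ?A x"
      by eventually_elim (simp add: vec_eq_iff forall_2)
    then have *: "\<forall>K\<in>\<T>. AE x in lebesgue_on K. \<tau> x = ?A x" by (simp add: AE_pieces_iff)
    show "\<forall>K\<in>\<T>. AE x in lebesgue_on K. \<tau> x = airy (p K) x"
    proof
      fix K assume K: "K \<in> \<T>"
      show "AE x in lebesgue_on K. \<tau> x = airy (p K) x"
        using bspec[OF * K] AE_glue[OF K, of "\<lambda>K. airy (p K)"] by eventually_elim simp
    qed
  next
    assume ae: "\<forall>K\<in>\<T>. AE x in lebesgue_on K. \<tau> x = airy (p K) x"
    have \<tau>: "\<tau> \<in> L2 \<Omega>" by (rule L2_piecewise[OF cv(2) bspec[OF ae]])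
    have "AE x in lebesgue_on \<Omega>. \<tau> x = ?A x" by (rule AE_glue_eq) (rule bspec[OF ae])
    then have A\<tau>: "AE x in lebesgue_on \<Omega>. ?A x = \<tau> x" by eventually_elim simp
    have vv: "AE x in lebesgue_on \<Omega>. v x = v x" by simp
    have W': "has_weak_deriv \<Omega> [i, j] v g" if "g \<in> L2 \<Omega>" "AE x in lebesgue_on \<Omega>. glue \<T> (\<lambda>K. partial i (partial j (p K))) x = g x" for i j g
      by (rule has_weak_deriv_cong[OF W vL vL ppL that(1) vv that(2)])
    show "(v, \<tau>) \<in> airy_rel \<Omega>"
      unfolding airy_rel_def
    proof (clarify, intro conjI vL \<tau>)
      show "has_weak_deriv \<Omega> [2, 2] v (\<lambda>x. \<tau> x $ 1 $ 1)"
        by (rule W'[OF L2_nth2[OF \<tau>]], unfold glue_airy_nth[symmetric]) (use A\<tau> in \<open>eventually_elim, simp\<close>)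
      show "has_weak_deriv \<Omega> [1, 2] v (\<lambda>x. - (\<tau> x $ 1 $ 2))"
        by (rule W'[OF neg[OF L2_nth2[OF \<tau>]]], unfold glue_airy_nth(2)[symmetric]) (use A\<tau> in \<open>eventually_elim, simp\<close>)
      show "has_weak_deriv \<Omega> [1, 2] v (\<lambda>x. - (\<tau> x $ 2 $ 1))"
        by (rule W'[OF neg[OF L2_nth2[OF \<tau>]]], unfold glue_airy_nth(3)[symmetric]) (use A\<tau> in \<open>eventually_elim, simp\<close>)
      show "has_weak_deriv \<Omega> [1, 1] v (\<lambda>x. \<tau> x $ 2 $ 2)"
        by (rule W'[OF L2_nth2[OF \<tau>]], unfold glue_airy_nth[symmetric]) (use A\<tau> in \<open>eventually_elim, simp\<close>)
    qed
  qed
qed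

lemma C1_sobolev:
  assumes p: "\<And>K. K \<in> \<T> \<Longrightarrow> p K \<in> polys 5 UNIV" and m: "C1_match p"
    and v: "\<And>K. K \<in> \<T> \<Longrightarrow> AE x in lebesgue_on K. v x = p K x"
  shows "v \<in> sobolev_H 2 \<Omega>"
proof -
  have cv: "continuous_on UNIV (p K)" if "K \<in> \<T>" for K using polys_continuous[OF p[OF that]] .
  have vL: "v \<in> L2 \<Omega>" by (rule L2_piecewise[OF cv v])
  have gL: "glue \<T> p \<in> L2 \<Omega>" by (rule glue_L2[OF cv])
  have "AE x in lebesgue_on \<Omega>. v x = glue \<T> p x" by (rule AE_glue_eq[OF v])
  then have gv: "AE x in lebesgue_on \<Omega>. glue \<T> p x = v x" by eventually_elim simp
  have lift: "\<exists>w\<in>L2 \<Omega>. has_weak_deriv \<Omega> is v w" if "has_weak_deriv \<Omega> is (glue \<T> p) w" "w \<in> L2 \<Omega>" for "is" w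
  proof
    show "has_weak_deriv \<Omega> is v w" by (rule has_weak_deriv_cong[OF that(1) gL vL that(2) that(2) gv]) simp
  qed (rule that)
  have "\<exists>w\<in>L2 \<Omega>. has_weak_deriv \<Omega> is v w" if l: "length is \<le> 2" for "is"
  proof -
    consider "is = []" | i where "is = [i]" | i j where "is = [i, j]"
      using l by (cases "is"; cases "tl is"; cases "tl (tl is)") auto
    then show ?thesis
    proof cases
      case 1 then show ?thesis using lift[OF C1_weak_derivs(1)[OF p m] gL] by simp
    next
      case (2 i) then show ?thesis using lift[OF C1_weak_derivs(2)[OF p m] L2_glue_polys[OF polys_partial[OF p]]] by simp
    next
      case (3 i j) then show ?thesis using lift[OF C1_weak_derivs(3)[OF p m] L2_glue_polys[OF polys5_pp[OF p]]] by simp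
    qed
  qed
  then show ?thesis using vL by (simp add: sobolev_H_def)
qed

lemma partials_simps: "partials [] f = f" "partials [i] f = partial i f" "partials [i, j] f = partial i (partial j f)"
  by (simp_all add: partials_def)

text \<open>Degree 5 on an edge is determined by the 2-jets at its endpoints, and the normal derivative, being of
  degree 3, by its 1-jets.\<close>

lemma bell_C1:
  assumes b: "\<And>K. K \<in> \<T> \<Longrightarrow> p K \<in> bell_shape n K"
    and vert: "\<And>K L z is. K \<in> \<T> \<Longrightarrow> L \<in> \<T> \<Longrightarrow> z extreme_point_of K \<Longrightarrow> z extreme_point_of L \<Longrightarrow> length is \<le> 2 \<Longrightarrow> partials is (p K) z = partials is (p L) z"
  shows "C1_match p"
  unfolding C1_match_def
proof (intro ballI)
  fix K L x assume K: "K \<in> \<T>" and L: "L \<in> \<T>" and x: "x \<in> K \<inter> L"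
  have pp: "p K \<in> polys 5 UNIV" "p L \<in> polys 5 UNIV" using b K L by (auto simp: bell_shape_def)
  have V: "p K z = p L z" "partial i (p K) z = partial i (p L) z" "partial i (partial j (p K)) z = partial i (partial j (p L)) z"
    if "z extreme_point_of K" "z extreme_point_of L" for z i j
    using vert[OF K L that, of "[]"] vert[OF K L that, of "[i]"] vert[OF K L that, of "[i, j]"] by (simp_all add: partials_simps)
  show "p K x = p L x \<and> (\<forall>i. partial i (p K) x = partial i (p L) x)"
  proof (cases "K = L")
    case False
    show ?thesis
    proof (rule intersection_cases[OF K L False])
      show "K \<inter> L \<noteq> {}" using x by blast
    next
      fix z assume z: "K \<inter> L = {z}" "z extreme_point_of K" "z extreme_point_of L"
      then have "x = z" using x by blast
      then show ?thesis using V z by blast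
    next
      fix u v w u' assume tr: "tri u v w K" "tri u' v w L" "K \<inter> L = closed_segment v w"
      define e where "e = closed_segment v w"
      note f = frame[OF K tr(1) e_def]
      obtain s where s: "s \<in> {0..1}" "x = linepath v w s" using x tr(3) by (metis imageE linepath_image_01)
      define r where "r z = p K z - p L z" for z
      let ?d = "w - v"
      have r: "r \<in> polys 5 UNIV" unfolding r_def[abs_def] by (rule polys_diff[OF pp])
      have r1: "partial i r = (\<lambda>z. partial i (p K) z - partial i (p L) z)" for i
        unfolding r_def[abs_def] by (rule partial_polys_sub[OF pp])
      have r2: "partial i (partial j r) = (\<lambda>z. partial i (partial j (p K)) z - partial i (partial j (p L)) z)" for i j
        unfolding r1 by (rule partial_polys_sub[OF polys_partial[OF pp(1)] polys_partial[OF pp(2)]])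
      have ext: "v extreme_point_of K" "v extreme_point_of L" "w extreme_point_of K" "w extreme_point_of L"
        using tri_extreme[OF tr(1)] tri_extreme[OF tr(2)] by auto
      have z: "r z = 0" "partial i r z = 0" "partial i (partial j r) z = 0" if "z = v \<or> z = w" for z i j
      proof -
        show "r z = 0" using V ext that by (auto simp: r_def)
        show "partial i r z = 0" unfolding r1 using V ext that by auto
        show "partial i (partial j r) z = 0" unfolding r2 using V ext that by auto
      qed
      have g: "dir_deriv c r \<in> polys 4 UNIV" for c using polys_dir_deriv_mem[OF r, of c] by simp
      have d1: "dir_deriv c r y = 0" "dir_deriv a (dir_deriv c r) y = 0" if "y = v \<or> y = w" for a c y
        unfolding dir_deriv_dir_deriv[OF r] using z[OF that] by (simp_all add: polys_dir_deriv[OF r])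
      obtain Q where Q: "degree Q \<le> 5" "\<And>s. r (v + s *\<^sub>R ?d) = poly Q s" using polys_line[OF r] by metis
      have Qd: "dir_deriv ?d r (v + s *\<^sub>R ?d) = poly (pderiv Q) s" for s by (rule polys_line_deriv[OF r Q(2)])
      have Qdd: "dir_deriv ?d (dir_deriv ?d r) (v + s *\<^sub>R ?d) = poly (pderiv (pderiv Q)) s" for s by (rule polys_line_deriv[OF g Qd])
      have "Q = 0"
      proof (rule Hermite5_unique[OF Q(1)])
        show "poly Q 0 = 0" "poly Q 1 = 0" using Q(2)[of 0] Q(2)[of 1] z(1) by auto
        show "poly (pderiv Q) 0 = 0" "poly (pderiv Q) 1 = 0" using Qd[of 0] Qd[of 1] d1(1) by auto
        show "poly (pderiv (pderiv Q)) 0 = 0" "poly (pderiv (pderiv Q)) 1 = 0" using Qdd[of 0] Qdd[of 1] d1(2) by auto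
      qed
      then have x0: "r x = 0" and xd: "dir_deriv ?d r x = 0"
        using Q(2)[of s] Qd[of s] s(2) by (simp_all add: linepath_alt)
      \<comment> \<open>A priori the normal derivative of \<open>r\<close> has degree 4 on the edge.
        The Bell condition lowers it to 3, where the four endpoint data, all furnished by the
        second-order jets at the vertices, determine it.\<close>
      obtain P where P: "\<And>s. dir_deriv (n e) r (v + s *\<^sub>R ?d) = poly P s" using polys_line[OF g] by metis
      have "dir_deriv (n e) r = (\<lambda>z. dir_deriv (n e) (p K) z - dir_deriv (n e) (p L) z)"
        unfolding polys_dir_deriv[OF r] polys_dir_deriv[OF pp(1)] polys_dir_deriv[OF pp(2)] r1 by (auto simp: algebra_simps)
      moreover have "e edge_of K" "e edge_of L" using tri_edge tr e_def by blast+
      then have "dir_deriv (n e) (p K) \<in> polys 3 e" "dir_deriv (n e) (p L) \<in> polys 3 e" using b K L by (auto simp: bell_shape_def)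
      ultimately have "dir_deriv (n e) r \<in> polys 3 e" by (simp add: polys_diff)
      then have "dir_deriv (n e) r \<in> polys 3 (closed_segment v w)" by (simp only: e_def)
      then obtain P3 where P3: "degree P3 \<le> 3" "\<And>s. s \<in> {0..1} \<Longrightarrow> dir_deriv (n e) r (linepath v w s) = poly P3 s"
        using polys_segment_E by metis
      have "P = P3" by (rule poly_eq_on_unit) (use P P3(2) in \<open>auto simp: linepath_alt\<close>)
      then have dP: "degree P \<le> 3" using P3(1) by simp
      have Pd: "dir_deriv ?d (dir_deriv (n e) r) (v + s *\<^sub>R ?d) = poly (pderiv P) s" for s by (rule polys_line_deriv[OF g P])
      have "P = 0"
      proof (rule Hermite3_unique[OF dP])
        show "poly P 0 = 0" "poly P 1 = 0" using P[of 0] P[of 1] d1(1) by auto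
        show "poly (pderiv P) 0 = 0" "poly (pderiv P) 1 = 0" using Pd[of 0] Pd[of 1] d1(2) by auto
      qed
      then have xn: "dir_deriv (n e) r x = 0" using P[of s] s(2) by (simp add: linepath_alt)
      have "t e \<bullet> ?d \<noteq> 0" "?d = (t e \<bullet> ?d) *\<^sub>R t e" using f(5,6) by auto
      then have xt: "dir_deriv (t e) r x = 0"
        using xd dir_deriv_scaleR[OF polys_differentiable[OF r], of "t e \<bullet> ?d" "t e" x] by simp
      have "partial i r x = 0" for i
      proof -
        define \<alpha> \<beta> where "\<alpha> = n e \<bullet> axis i 1" and "\<beta> = t e \<bullet> axis i 1"
        have "axis i 1 = \<alpha> *\<^sub>R n e + \<beta> *\<^sub>R t e" unfolding \<alpha>_def \<beta>_def by (rule frame_expand[OF f(1-3)])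
        then have "dir_deriv (axis i 1) r x = \<alpha> * dir_deriv (n e) r x + \<beta> * dir_deriv (t e) r x"
          by (simp only: polys_dir_deriv[OF r] vector_add_component vector_scaleR_component real_scaleR_def) (simp add: algebra_simps)
        then show ?thesis using xn xt by (simp add: partial_def dir_deriv_def)
      qed
      then show ?thesis using x0 by (simp add: r1 r_def)
    qed
  qed simp
qed

text \<open>Matching gradients on a shared edge have matching tangential derivatives, and these are
  the normal components of the Airy tensors. Vertex values need the second derivatives, hence the
  last premise.\<close>

lemma C1_airy_sig:
  assumes b: "\<And>K. K \<in> \<T> \<Longrightarrow> p K \<in> bell_shape n K" and m: "C1_match p"
    and vert: "\<And>K L z i j. K \<in> \<T> \<Longrightarrow> L \<in> \<T> \<Longrightarrow> z extreme_point_of K \<Longrightarrow> z extreme_point_of L \<Longrightarrow> partial i (partial j (p K)) z = partial i (partial j (p L)) z"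
  shows "sig (\<lambda>K. airy (p K))"
proof -
  have p: "p K \<in> polys 5 UNIV" if "K \<in> \<T>" for K using b[OF that] by (simp add: bell_shape_def)
  have "consistent (\<lambda>K. airy (p K))"
  proof (rule consistentI)
    fix K L z assume "K \<in> \<T>" "L \<in> \<T>" "z extreme_point_of K" "z extreme_point_of L"
    from vert[OF this] show "airy (p K) z = airy (p L) z" by (simp add: vec_eq_iff forall_2)
  next
    fix K L e x assume K: "K \<in> \<T>" and L: "L \<in> \<T>" and e: "e edge_of K" "e edge_of L" and x: "x \<in> e"
    obtain u0 v0 w0 where "tri u0 v0 w0 K" using triT[OF K] by blast
    then obtain u v w where tr: "tri u v w K" and ee: "e = closed_segment v w" using edge_tri[OF _ e(1)] by metis
    note f = frame[OF K tr ee]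
    have sub: "closed_segment v w \<subseteq> K \<inter> L" using e ee edge_of_imp_subset by blast
    define r where "r z = p K z - p L z" for z
    have r: "r \<in> polys 5 UNIV" unfolding r_def[abs_def] by (rule polys_diff[OF p[OF K] p[OF L]])
    have r1: "partial i r = (\<lambda>z. partial i (p K) z - partial i (p L) z)" for i
      unfolding r_def[abs_def] by (rule partial_polys_sub[OF p[OF K] p[OF L]])
    have "dir_deriv (t e) (partial j r) x = 0" for j
    proof -
      have pj: "partial j r \<in> polys (5 - 1) UNIV" by (rule polys_partial[OF r])
      obtain Q where Q: "\<And>s. partial j r (v + s *\<^sub>R (w - v)) = poly Q s" using polys_line[OF pj] by metis
      have "poly Q s = poly 0 s" if "s \<in> {0..1}" for s
      proof -
        have "linepath v w s \<in> K \<inter> L" using sub linepath_in_path[OF that, of v w] by blast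
        then have "partial j r (linepath v w s) = 0" unfolding r1 using C1_matchD(2)[OF m K L, of "linepath v w s" j] by simp
        then show ?thesis using Q[of s] by (simp add: linepath_alt)
      qed
      then have "Q = 0" by (rule poly_eq_on_unit)
      obtain s where s: "x = linepath v w s" using x ee by (metis imageE linepath_image_01)
      have "dir_deriv (w - v) (partial j r) x = 0"
        using polys_line_deriv[OF pj Q, of s] \<open>Q = 0\<close> s by (simp add: linepath_alt)
      then have "dir_deriv ((t e \<bullet> (w - v)) *\<^sub>R t e) (partial j r) x = 0" using f(6) by simp
      then show ?thesis using f(5) by (simp add: dir_deriv_scaleR[OF polys_differentiable[OF pj]])
    qed
    then have "airy r x *v n e = 0" using airy_normal_zero[OF r f(1-3)] by blast
    moreover have "airy r x = airy (p K) x - airy (p L) x" unfolding r_def[abs_def] by (rule airy_diff[OF p[OF K] p[OF L]])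
    ultimately show "airy (p K) x *v n e = airy (p L) x *v n e" by (simp add: matrix_vector_mult_diff_rdistrib)
  qed
  then show ?thesis using airy_in_sigma_iff[OF _ p] b by (simp add: sig_def)
qed

text \<open>Local potentials are unique up to affine functions, represented by their 1-jets \<open>(c, g)\<close>, so the
  mismatches on overlaps form a cocycle on the closed cover by triangles.\<close>

lemma airy_global_potential:
  assumes con: "contractible (\<Union>\<T>)" and \<rho>: "sig \<rho>" and div: "\<And>K. K \<in> \<T> \<Longrightarrow> classical_div (\<rho> K) = (\<lambda>x. 0)"
  obtains p where "\<And>K. K \<in> \<T> \<Longrightarrow> p K \<in> bell_shape n K" "\<And>K. K \<in> \<T> \<Longrightarrow> airy (p K) = \<rho> K" "C1_match p"
proof -
  have "\<exists>p. p \<in> polys 5 UNIV \<and> airy p = \<rho> K" if "K \<in> \<T>" for K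
    using airy_potential[OF sig_polys[OF \<rho> that] sig_sym[OF \<rho> that] div[OF that]] by metis
  then obtain p0 where p0: "\<And>K. K \<in> \<T> \<Longrightarrow> p0 K \<in> polys 5 UNIV" and a0: "\<And>K. K \<in> \<T> \<Longrightarrow> airy (p0 K) = \<rho> K" by metis
  define grad where "grad f x = (\<chi> i. partial i f x)" for f and x :: "real^2"
  \<comment> \<open>For an affine function this is the same at every point: the value at the origin
    and the gradient. Jets taken at different points thus become comparable.\<close>
  define jet where "jet f x = (f x - x \<bullet> grad f x, grad f x)" for f and x :: "real^2"
  have grad_sub: "grad (\<lambda>z. f z - g z) x = grad f x - grad g x" if "f \<in> polys 5 UNIV" "g \<in> polys 5 UNIV" for f g x
    by (simp add: grad_def vec_eq_iff partial_polys_sub[OF that])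
  have jet_sub: "jet (\<lambda>z. f z - g z) x = jet f x - jet g x" if "f \<in> polys 5 UNIV" "g \<in> polys 5 UNIV" for f g x
    by (simp add: jet_def grad_sub[OF that] inner_diff_right)
  have jet_const: "jet (p0 K) x - jet (p0 L) x = jet (p0 K) y - jet (p0 L) y"
    if K: "K \<in> \<T>" and L: "L \<in> \<T>" and x: "x \<in> K \<inter> L" and y: "y \<in> K \<inter> L" for K L x y
  proof (cases "K = L")
    case False
    show ?thesis
    proof (rule intersection_cases[OF K L False])
      show "K \<inter> L \<noteq> {}" using x by blast
    next
      fix z assume "K \<inter> L = {z}"
      then have "x = y" using x y by auto
      then show ?thesis by simp
    next
      fix u v w u' assume tr: "tri u v w K" "tri u' v w L" "K \<inter> L = closed_segment v w"
      define e where "e = closed_segment v w"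
      note f = frame[OF K tr(1) e_def]
      define r where "r z = p0 K z - p0 L z" for z
      have r: "r \<in> polys 5 UNIV" unfolding r_def[abs_def] by (rule polys_diff[OF p0[OF K] p0[OF L]])
      have ee: "e edge_of K" "e edge_of L" using tri_edge tr e_def by blast+
      have pc: "partial j r z = partial j r z'" if z: "z \<in> closed_segment v w" "z' \<in> closed_segment v w" for j z z'
      proof (rule polys_line_const[OF polys_partial[OF r] _ z])
        fix y assume "y \<in> closed_segment v w"
        then have "\<rho> K y *v n e = \<rho> L y *v n e" using \<rho> K L ee by (intro consistent_edge) (auto simp: sig_def e_def)
        moreover have "airy r y = \<rho> K y - \<rho> L y"
          unfolding r_def[abs_def] airy_diff[OF p0[OF K] p0[OF L]] a0[OF K] a0[OF L] ..
        ultimately have "airy r y *v n e = 0" by (simp add: matrix_vector_mult_diff_rdistrib)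
        then have "dir_deriv (t e) (partial j r) y = 0" using airy_normal_zero[OF r f(1-3)] by blast
        then have "dir_deriv ((t e \<bullet> (w - v)) *\<^sub>R t e) (partial j r) y = 0"
          by (simp add: dir_deriv_scaleR[OF polys_differentiable[OF polys_partial[OF r]]])
        then show "dir_deriv (w - v) (partial j r) y = 0" using f(6) by simp
      qed
      have xy: "x \<in> closed_segment v w" "y \<in> closed_segment v w" using x y tr(3) by auto
      \<comment> \<open>Along the shared edge the gradient of the mismatch is constant, so
        subtracting the linear function with this gradient leaves a constant there: on the edge the
        mismatch agrees to first order with one affine function.\<close>
      define g where "g = grad r x"
      define r' where "r' z = r z - z \<bullet> g" for z
      have l: "(\<lambda>z. z \<bullet> g) \<in> polys 1 UNIV" by (rule polys_cvec) simp
      then have l5: "(\<lambda>z. z \<bullet> g) \<in> polys 5 UNIV" using polys_mono[of 1 5] by simp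
      have r': "r' \<in> polys 5 UNIV" unfolding r'_def[abs_def] by (rule polys_diff[OF r l5])
      have "r' x = r' y"
      proof (rule polys_line_const[OF r' _ xy])
        fix z assume z: "z \<in> closed_segment v w"
        have "((\<lambda>z. z \<bullet> g) has_derivative (\<lambda>h. h \<bullet> g)) (at z)" by (auto intro!: derivative_eq_intros)
        then have "(r' has_derivative (\<lambda>h. (h $ 1 * partial 1 r z + h $ 2 * partial 2 r z) - h \<bullet> g)) (at z)"
          unfolding r'_def[abs_def] by (intro has_derivative_diff has_derivative_partial polys_differentiable[OF r])
        then show "dir_deriv (w - v) r' z = 0"
          using pc[OF z xy(1)] by (simp add: dir_deriv_eqI g_def grad_def inner_vec_def sum_2)
      qed
      moreover have "grad r y = g" using pc[OF xy(2,1)] by (simp add: g_def grad_def vec_eq_iff)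
      ultimately have "jet r x = jet r y" by (simp add: jet_def g_def r'_def)
      then show ?thesis unfolding r_def[abs_def] jet_sub[OF p0[OF K] p0[OF L]] .
    qed
  qed simp
  \<comment> \<open>Any common point serves, by \<open>jet_const\<close>.\<close>
  define \<gamma> where "\<gamma> K L = (let x = (SOME x. x \<in> K \<inter> L) in jet (p0 K) x - jet (p0 L) x)" for K L
  have \<gamma>: "\<gamma> K L = jet (p0 K) x - jet (p0 L) x" if "K \<in> \<T>" "L \<in> \<T>" "x \<in> K \<inter> L" for K L x
    unfolding \<gamma>_def Let_def using that by (intro jet_const someI[of "\<lambda>x. x \<in> K \<inter> L"])
  have compT: "compact K" and connT: "connected K" if "K \<in> \<T>" for K using comp conv convex_connected that by blast+
  have coc: "\<gamma> K L + \<gamma> L M = \<gamma> K M" if KLM: "K \<in> \<T>" "L \<in> \<T>" "M \<in> \<T>" "K \<inter> L \<inter> M \<noteq> {}" for K L M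
  proof -
    obtain x where "x \<in> K \<inter> L \<inter> M" using KLM(4) by blast
    then show ?thesis using \<gamma>[of K L x] \<gamma>[of L M x] \<gamma>[of K M x] KLM by simp
  qed
  obtain s where s: "\<And>K L. K \<in> \<T> \<Longrightarrow> L \<in> \<T> \<Longrightarrow> K \<inter> L \<noteq> {} \<Longrightarrow> \<gamma> K L = s K - s L"
    by (rule Cech_cocycle_trivial[OF fin compT connT con coc]) (assumption | rule that)+
  \<comment> \<open>The affine function with jet \<open>s K\<close>; subtracting it removes the
    mismatches and leaves the Airy tensors unchanged.\<close>
  define l where "l K z = fst (s K) + z \<bullet> snd (s K)" for K and z :: "real^2"
  have l1: "l K \<in> polys 1 UNIV" for K unfolding l_def[abs_def] by (intro polys_add polys_const polys_cvec) simp
  have l5: "l K \<in> polys 5 UNIV" for K by (rule polys_mono[OF _ l1]) simp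
  have ld: "(l K has_derivative (\<lambda>h. h \<bullet> snd (s K))) (at x)" for K x
    unfolding l_def[abs_def] by (auto intro!: derivative_eq_intros)
  have lp: "partial i (l K) = (\<lambda>_. snd (s K) $ i)" for i K
    by (rule ext) (simp add: partial_eqI[OF ld] inner_axis')
  define p where "p K z = p0 K z - l K z" for K z
  have p5: "p K \<in> polys 5 UNIV" if "K \<in> \<T>" for K unfolding p_def[abs_def] by (rule polys_diff[OF p0[OF that] l5])
  have ap: "airy (p K) = \<rho> K" if K: "K \<in> \<T>" for K
  proof (rule ext)
    fix x
    have "airy (l K) x = 0" by (simp add: vec_eq_iff forall_2 lp)
    then show "airy (p K) x = \<rho> K x" unfolding p_def[abs_def] airy_diff[OF p0[OF K] l5] a0[OF K] by simp
  qed
  have gl: "grad (l K) x = snd (s K)" for K x by (simp add: grad_def lp vec_eq_iff)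
  have jl: "jet (l K) x = s K" for K x by (simp add: jet_def gl l_def prod_eq_iff)
  have "C1_match p"
    unfolding C1_match_def
  proof (intro ballI)
    fix K L x assume K: "K \<in> \<T>" and L: "L \<in> \<T>" and x: "x \<in> K \<inter> L"
    have "jet (p K) x - jet (p L) x = (jet (p0 K) x - jet (p0 L) x) - (s K - s L)"
      unfolding p_def[abs_def] jet_sub[OF p0[OF K] l5] jet_sub[OF p0[OF L] l5] jl by simp
    also have "\<dots> = 0" using \<gamma>[OF K L x] s[OF K L] x by auto
    finally have j: "jet (p K) x = jet (p L) x" by simp
    then have g: "grad (p K) x = grad (p L) x" by (simp add: jet_def)
    then have "p K x = p L x" using j by (simp add: jet_def)
    moreover have "partial i (p K) x = partial i (p L) x" for i using g by (simp add: grad_def vec_eq_iff)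
    ultimately show "p K x = p L x \<and> (\<forall>i. partial i (p K) x = partial i (p L) x)" by blast
  qed
  moreover have "p K \<in> bell_shape n K" if K: "K \<in> \<T>" for K
    using airy_in_sigma_iff[OF K p5[OF K]] ap[OF K] \<rho> K by (simp add: sig_def)
  ultimately show thesis using that ap by blast
qed

text \<open>From left to right this is Hermite interpolation on the edges. From right to left the
  second derivatives at a vertex are read off from the Airy tensors, whose vertex values are
  single-valued.\<close>

lemma bell_space_iff:
  "v \<in> bell_space \<Omega> \<T> n \<longleftrightarrow> (\<exists>p. (\<forall>K\<in>\<T>. p K \<in> bell_shape n K \<and> (AE x in lebesgue_on K. v x = p K x)) \<and> C1_match p \<and> sig (\<lambda>K. airy (p K)))"
proof
  assume "v \<in> bell_space \<Omega> \<T> n"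
  then obtain p where p: "\<forall>K\<in>\<T>. p K \<in> bell_shape n K \<and> (AE x in lebesgue_on K. v x = p K x)"
    and vert: "\<forall>K\<in>\<T>. \<forall>L\<in>\<T>. \<forall>z. z extreme_point_of K \<and> z extreme_point_of L \<longrightarrow> (\<forall>is. length is \<le> 2 \<longrightarrow> partials is (p K) z = partials is (p L) z)"
    unfolding bell_space_def mem_Collect_eq by (elim conjE exE) (rule that; assumption)
  have b: "p K \<in> bell_shape n K" if "K \<in> \<T>" for K using p that by blast
  have V: "partials is (p K) z = partials is (p L) z"
    if "K \<in> \<T>" "L \<in> \<T>" "z extreme_point_of K" "z extreme_point_of L" "length is \<le> 2" for K L z "is"
    using vert that by blast
  have m: "C1_match p" by (rule bell_C1[OF b V])
  moreover have "sig (\<lambda>K. airy (p K))"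
  proof (rule C1_airy_sig[OF b m])
    fix K L z i j assume "K \<in> \<T>" "L \<in> \<T>" "z extreme_point_of K" "z extreme_point_of L"
    then show "partial i (partial j (p K)) z = partial i (partial j (p L)) z" using V[of K L z "[i, j]"] by (simp add: partials_simps)
  qed
  ultimately show "\<exists>p. (\<forall>K\<in>\<T>. p K \<in> bell_shape n K \<and> (AE x in lebesgue_on K. v x = p K x)) \<and> C1_match p \<and> sig (\<lambda>K. airy (p K))" using p by blast
next
  assume "\<exists>p. (\<forall>K\<in>\<T>. p K \<in> bell_shape n K \<and> (AE x in lebesgue_on K. v x = p K x)) \<and> C1_match p \<and> sig (\<lambda>K. airy (p K))"
  then obtain p where p: "\<And>K. K \<in> \<T> \<Longrightarrow> p K \<in> bell_shape n K" and v: "\<And>K. K \<in> \<T> \<Longrightarrow> AE x in lebesgue_on K. v x = p K x"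
    and m: "C1_match p" and s: "sig (\<lambda>K. airy (p K))" by blast
  have p5: "p K \<in> polys 5 UNIV" if "K \<in> \<T>" for K using p[OF that] by (simp add: bell_shape_def)
  have sob: "v \<in> sobolev_H 2 \<Omega>" by (rule C1_sobolev[OF p5 m v])
  have vert: "partials is (p K) z = partials is (p L) z"
    if KL: "K \<in> \<T>" "L \<in> \<T>" "z extreme_point_of K" "z extreme_point_of L" and l: "length is \<le> 2" for K L z "is"
  proof -
    have zz: "z \<in> K \<inter> L" using KL extreme_point_of_def by blast
    have A: "airy (p K) z = airy (p L) z" using s KL by (intro consistent_vertex[where \<rho> = "\<lambda>K. airy (p K)"]) (auto simp: sig_def)
    have pp: "partial 1 (partial 1 (p K)) z = partial 1 (partial 1 (p L)) z" "partial 1 (partial 2 (p K)) z = partial 1 (partial 2 (p L)) z"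
      "partial 2 (partial 2 (p K)) z = partial 2 (partial 2 (p L)) z"
      using arg_cong[OF A, of "\<lambda>M. M $ 2 $ 2"] arg_cong[OF A, of "\<lambda>M. M $ 1 $ 2"] arg_cong[OF A, of "\<lambda>M. M $ 1 $ 1"] by simp_all
    then have "partial 2 (partial 1 (p K)) z = partial 2 (partial 1 (p L)) z"
      using polys_partial_commute[OF p5[OF KL(1)], of 2 1] polys_partial_commute[OF p5[OF KL(2)], of 2 1] by simp
    with pp have P: "partial i (partial j (p K)) z = partial i (partial j (p L)) z" for i j
      using exhaust_2[of i] exhaust_2[of j] by auto
    have M: "p K z = p L z" "partial i (p K) z = partial i (p L) z" for i by (rule C1_matchD[OF m KL(1,2) zz])+
    consider "is = []" | i where "is = [i]" | i j where "is = [i, j]"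
      using l by (cases "is"; cases "tl is"; cases "tl (tl is)") auto
    then show ?thesis by cases (simp_all add: partials_simps P M)
  qed
  show "v \<in> bell_space \<Omega> \<T> n"
    unfolding bell_space_def
    by (intro CollectI conjI exI[of _ p] ballI allI impI sob p v) (assumption | elim conjE, rule vert; assumption)+
qed

lemma bell_airyD:
  assumes "\<forall>K\<in>\<T>. p K \<in> bell_shape n K \<and> (AE x in lebesgue_on K. v x = p K x)" "C1_match p"
  shows "(v, \<tau>) \<in> airy_rel \<Omega> \<longleftrightarrow> (\<forall>K\<in>\<T>. AE x in lebesgue_on K. \<tau> x = airy (p K) x)"
  by (rule airy_rel_iff[OF _ assms(2)]) (use assms(1) in \<open>auto simp: bell_shape_def\<close>)

lemma bell_subset_domain_airy: "bell_space \<Omega> \<T> n \<subseteq> Domain (airy_rel \<Omega>)"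
proof
  fix v assume "v \<in> bell_space \<Omega> \<T> n"
  then obtain p where p: "\<forall>K\<in>\<T>. p K \<in> bell_shape n K \<and> (AE x in lebesgue_on K. v x = p K x)" "C1_match p"
    unfolding bell_space_iff by blast
  have "(v, glue \<T> (\<lambda>K. airy (p K))) \<in> airy_rel \<Omega>"
    unfolding bell_airyD[OF p] by (intro ballI AE_glue)
  then show "v \<in> Domain (airy_rel \<Omega>)" by blast
qed

lemma sig_cong:
  assumes "sig \<rho>" "\<And>K. K \<in> \<T> \<Longrightarrow> \<rho>' K = \<rho> K" shows "sig \<rho>'"
proof -
  have c: "consistent \<rho>" using assms(1) by (simp add: sig_def)
  have "consistent \<rho>'"
  proof (rule consistentI)
    fix K L z assume a: "K \<in> \<T>" "L \<in> \<T>" "z extreme_point_of K" "z extreme_point_of L"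
    show "\<rho>' K z = \<rho>' L z" unfolding assms(2)[OF a(1)] assms(2)[OF a(2)] by (rule consistent_vertex[OF c a])
  next
    fix K L e x assume a: "K \<in> \<T>" "L \<in> \<T>" "e edge_of K" "e edge_of L" "x \<in> e"
    show "\<rho>' K x *v n e = \<rho>' L x *v n e" unfolding assms(2)[OF a(1)] assms(2)[OF a(2)] by (rule consistent_edge[OF c a])
  qed
  then show ?thesis using assms by (simp add: sig_def)
qed

lemma airy_image:
  assumes con: "contractible (\<Union>\<T>)"
  shows "airy_rel \<Omega> `` bell_space \<Omega> \<T> n = {\<tau> \<in> sigma_space \<Omega> \<T> n t. (\<tau>, \<lambda>x. 0) \<in> div_rel \<Omega>}"
proof (intro subset_antisym subsetI)
  fix \<tau> assume "\<tau> \<in> airy_rel \<Omega> `` bell_space \<Omega> \<T> n"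
  then obtain v where v: "v \<in> bell_space \<Omega> \<T> n" "(v, \<tau>) \<in> airy_rel \<Omega>" by blast
  obtain p where p: "\<forall>K\<in>\<T>. p K \<in> bell_shape n K \<and> (AE x in lebesgue_on K. v x = p K x)" "C1_match p" and s: "sig (\<lambda>K. airy (p K))"
    using v(1) unfolding bell_space_iff by blast
  have ae: "\<And>K. K \<in> \<T> \<Longrightarrow> AE x in lebesgue_on K. \<tau> x = airy (p K) x" using v(2) unfolding bell_airyD[OF p] by blast
  have "\<tau> \<in> sigma_space \<Omega> \<T> n t" unfolding sigma_space_iff by (rule exI[of _ "\<lambda>K. airy (p K)"]) (use s ae in blast)
  moreover have "classical_div (airy (p K)) = (\<lambda>x. 0)" if "K \<in> \<T>" for K
    by (rule classical_div_airy[of _ 5]) (use p(1) that in \<open>simp add: bell_shape_def\<close>)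
  then have "\<forall>K\<in>\<T>. AE x in lebesgue_on K. 0 = classical_div (airy (p K)) x" by simp
  then have "(\<tau>, \<lambda>x. 0) \<in> div_rel \<Omega>" by (rule div_rel_sig_iff[OF s ae, THEN iffD2, rotated])
  ultimately show "\<tau> \<in> {\<tau> \<in> sigma_space \<Omega> \<T> n t. (\<tau>, \<lambda>x. 0) \<in> div_rel \<Omega>}" by blast
next
  fix \<tau> assume "\<tau> \<in> {\<tau> \<in> sigma_space \<Omega> \<T> n t. (\<tau>, \<lambda>x. 0) \<in> div_rel \<Omega>}"
  then have \<tau>: "\<tau> \<in> sigma_space \<Omega> \<T> n t" "(\<tau>, \<lambda>x. 0) \<in> div_rel \<Omega>" by auto
  obtain \<rho> where \<rho>: "sig \<rho>" and ae: "\<And>K. K \<in> \<T> \<Longrightarrow> AE x in lebesgue_on K. \<tau> x = \<rho> K x" using \<tau>(1) sigma_space_iff by blast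
  \<comment> \<open>The weak equation yields zero only almost everywhere on \<open>K\<close>; for
    polynomials this is identically zero.\<close>
  have dv: "classical_div (\<rho> K) = (\<lambda>x. 0)" if K: "K \<in> \<T>" for K
  proof -
    have z: "AE x in lebesgue_on K. 0 = classical_div (\<rho> K) x"
      by (rule div_rel_sig_iff[OF \<rho> ae, THEN iffD1, OF _ \<tau>(2), THEN bspec, OF _ K])
    obtain x0 where x0: "x0 \<in> interior K" using interior_point[OF K] by blast
    have "(\<lambda>x. classical_div (\<rho> K) x $ i) = (\<lambda>x. 0)" for i
    proof (rule polys_AE_zero[OF polys_vec_nth[OF polys_classical_div[OF sig_polys[OF \<rho> K]]] _ open_interior x0])
      show "AE x in lebesgue. x \<in> interior K \<longrightarrow> classical_div (\<rho> K) x $ i = 0"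
        using z unfolding AE_lebesgue_on_iff[OF sets_K[OF K]] by eventually_elim (use interior_subset in \<open>auto simp: eq_commute[of 0]\<close>)
    qed
    then show ?thesis by (simp add: vec_eq_iff fun_eq_iff)
  qed
  obtain p where p: "\<And>K. K \<in> \<T> \<Longrightarrow> p K \<in> bell_shape n K" and ap: "\<And>K. K \<in> \<T> \<Longrightarrow> airy (p K) = \<rho> K" and m: "C1_match p"
    using airy_global_potential[OF con \<rho> dv] by blast
  have v: "\<forall>K\<in>\<T>. p K \<in> bell_shape n K \<and> (AE x in lebesgue_on K. glue \<T> p x = p K x)" using p AE_glue[of _ p] by blast
  have s: "sig (\<lambda>K. airy (p K))" using sig_cong[OF \<rho>, of "\<lambda>K. airy (p K)"] ap by blast
  have "glue \<T> p \<in> bell_space \<Omega> \<T> n" unfolding bell_space_iff using v m s by blast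
  moreover have "(glue \<T> p, \<tau>) \<in> airy_rel \<Omega>" unfolding bell_airyD[OF v m] using ae ap by simp
  ultimately show "\<tau> \<in> airy_rel \<Omega> `` bell_space \<Omega> \<T> n" by blast
qed

text \<open>A vanishing Hessian makes every piece affine, and equal values and gradients at one
  common point make the affine functions of touching triangles equal; connectedness spreads this
  over the mesh.\<close>

lemma airy_kernel:
  assumes con: "connected (\<Union>\<T>)" and ne: "\<T> \<noteq> {}"
  shows "{v \<in> bell_space \<Omega> \<T> n. (v, \<lambda>x. 0) \<in> airy_rel \<Omega>} = ae_polys 1 \<Omega>"
proof (intro subset_antisym subsetI)
  fix v assume "v \<in> {v \<in> bell_space \<Omega> \<T> n. (v, \<lambda>x. 0) \<in> airy_rel \<Omega>}"
  then have v: "v \<in> bell_space \<Omega> \<T> n" "(v, \<lambda>x. 0) \<in> airy_rel \<Omega>" by auto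
  obtain p where p: "\<forall>K\<in>\<T>. p K \<in> bell_shape n K \<and> (AE x in lebesgue_on K. v x = p K x)" and m: "C1_match p"
    using v(1) unfolding bell_space_iff by blast
  have p5: "p K \<in> polys 5 UNIV" if "K \<in> \<T>" for K using p that by (simp add: bell_shape_def)
  have 0: "partial i (partial j (p K)) = (\<lambda>x. 0)" if K: "K \<in> \<T>" for K i j
  proof -
    have z: "AE x in lebesgue_on K. 0 = airy (p K) x" using v(2) K unfolding bell_airyD[OF p m] by blast
    obtain x0 where x0: "x0 \<in> interior K" using interior_point[OF K] by blast
    have A: "(\<lambda>x. airy (p K) x $ i $ j) = (\<lambda>x. 0)" for i j
    proof (rule polys_AE_zero[OF polys_matrix_nth[OF polys_airy[OF p5[OF K]]] _ open_interior x0])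
      show "AE x in lebesgue. x \<in> interior K \<longrightarrow> airy (p K) x $ i $ j = 0"
        using z unfolding AE_lebesgue_on_iff[OF sets_K[OF K]]
      proof eventually_elim
        fix x assume "x \<in> K \<longrightarrow> 0 = airy (p K) x"
        then have "airy (p K) x = 0" if "x \<in> interior K" using that interior_subset[of K] by auto
        then show "x \<in> interior K \<longrightarrow> airy (p K) x $ i $ j = 0" by (metis zero_index)
      qed
    qed
    have "partial 2 (partial 2 (p K)) = (\<lambda>x. 0)" "partial 1 (partial 2 (p K)) = (\<lambda>x. 0)" "partial 1 (partial 1 (p K)) = (\<lambda>x. 0)"
      using A[of 1 1] A[of 1 2] A[of 2 2] by (simp_all add: fun_eq_iff)
    moreover from this have "partial 2 (partial 1 (p K)) = (\<lambda>x. 0)" using polys_partial_commute[OF p5[OF K], of 2 1] by simp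
    ultimately show ?thesis using exhaust_2[of i] exhaust_2[of j] by auto
  qed
  have same: "p K = p L" if KL: "K \<in> \<T>" "L \<in> \<T>" "K \<inter> L \<noteq> {}" for K L
  proof
    fix y
    obtain x where x: "x \<in> K \<inter> L" using KL(3) by blast
    have "p K x = p L x" "partial i (p K) x = partial i (p L) x" for i by (rule C1_matchD[OF m KL(1,2) x])+
    then show "p K y = p L y"
      using polys_second_zero(1)[OF p5[OF KL(1)] 0[OF KL(1)], of y x] polys_second_zero(1)[OF p5[OF KL(2)] 0[OF KL(2)], of y x] by simp
  qed
  obtain K0 where K0: "K0 \<in> \<T>" using ne by blast
  \<comment> \<open>Triangles carrying the function of \<open>K0\<close> and all others form two
    closed sets, disjoint because triangles with a common point carry the same function.\<close>
  define A where "A = \<Union>{K \<in> \<T>. p K = p K0}"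
  define B where "B = \<Union>{K \<in> \<T>. p K \<noteq> p K0}"
  have cl: "closed A" "closed B" unfolding A_def B_def using fin comp compact_imp_closed by (auto intro!: closed_Union)
  have "A \<inter> B = {}" unfolding A_def B_def using same by fastforce
  moreover have "\<Union>\<T> \<subseteq> A \<union> B" unfolding A_def B_def by auto
  moreover have "A \<inter> \<Union>\<T> \<noteq> {}" unfolding A_def using K0 interior_point[OF K0] interior_subset by blast
  ultimately have BT: "B \<inter> \<Union>\<T> = {}" using connected_closedD[OF con _ _ cl] by blast
  have all: "p K = p K0" if K: "K \<in> \<T>" for K
  proof (rule ccontr)
    assume "p K \<noteq> p K0"
    obtain x where "x \<in> interior K" using interior_point[OF K] by blast
    then have "x \<in> B \<inter> \<Union>\<T>" unfolding B_def using K \<open>p K \<noteq> p K0\<close> interior_subset by blast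
    then show False using BT by blast
  qed
  have "AE x in lebesgue_on \<Omega>. v x = p K0 x"
    unfolding AE_pieces_iff
  proof
    fix K assume K: "K \<in> \<T>"
    have "AE x in lebesgue_on K. v x = p K x" using p K by blast
    then show "AE x in lebesgue_on K. v x = p K0 x" using all[OF K] by simp
  qed
  moreover have "p K0 \<in> polys 1 UNIV"
  proof -
    have "p K0 = (\<lambda>y. p K0 0 + ((y $ 1) * partial 1 (p K0) 0 + (y $ 2) * partial 2 (p K0) 0))"
    proof
      fix y show "p K0 y = p K0 0 + ((y $ 1) * partial 1 (p K0) 0 + (y $ 2) * partial 2 (p K0) 0)"
        using polys_second_zero(1)[OF p5[OF K0] 0[OF K0], of y 0] by simp
    qed
    moreover have "\<dots> \<in> polys 1 UNIV"
      by (intro polys_add polys_const polys_mult[where k = 1 and l = 0] polys_coord) auto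
    ultimately show ?thesis by simp
  qed
  then have "p K0 \<in> polys 1 \<Omega>" by (rule polys_UNIV_D)
  ultimately show "v \<in> ae_polys 1 \<Omega>" unfolding ae_polys_def by blast
next
  fix v :: "real^2 \<Rightarrow> real" assume "v \<in> ae_polys 1 \<Omega>"
  then obtain q where q: "q \<in> polys 1 \<Omega>" "AE x in lebesgue_on \<Omega>. v x = q x" by (auto simp: ae_polys_def)
  obtain r where r: "r \<in> polys 1 UNIV" "\<And>x. x \<in> \<Omega> \<Longrightarrow> q x = r x" using polysE[OF q(1)] by metis
  have "AE x in lebesgue_on \<Omega>. v x = r x"
    using q(2) unfolding AE_lebesgue_on_iff[OF sets_\<Omega>] by eventually_elim (use r(2) in auto)
  then have v: "\<forall>K\<in>\<T>. AE x in lebesgue_on K. v x = r x" unfolding AE_pieces_iff .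
  have r5: "r \<in> polys 5 UNIV" using r(1) polys_mono[of 1 5] by simp
  have pc: "partial i g = (\<lambda>x. 0)" if g: "g \<in> polys 0 UNIV" for g i
  proof -
    obtain c where "g = (\<lambda>x. c)" using g by (auto simp: polys_UNIV_iff)
    then show ?thesis by auto
  qed
  have "partial i r \<in> polys 0 UNIV" for i using polys_partial[OF r(1)] by simp
  then have 0: "partial i (partial j r) = (\<lambda>x. 0)" for i j by (rule pc)
  have "airy r = (\<lambda>x. 0)" by (intro ext) (simp add: vec_eq_iff forall_2 0)
  have "dir_deriv c r \<in> polys 3 e" for c e
    by (rule polys_UNIV_D, rule polys_mono[OF _ polys_dir_deriv_mem[OF r(1)]]) simp
  then have b: "r \<in> bell_shape n K" for K using r5 by (simp add: bell_shape_def)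
  have p: "\<forall>K\<in>\<T>. r \<in> bell_shape n K \<and> (AE x in lebesgue_on K. v x = r x)" using b v by blast
  have m: "C1_match (\<lambda>K. r)" by (simp add: C1_match_def)
  have s: "sig (\<lambda>K. airy r)" unfolding \<open>airy r = (\<lambda>x. 0)\<close> by (rule sig_zero)
  have "v \<in> bell_space \<Omega> \<T> n" unfolding bell_space_iff by (rule exI[of _ "\<lambda>K. r"]) (use p m s in blast)
  moreover have "(v, \<lambda>x. 0) \<in> airy_rel \<Omega>"
    unfolding bell_airyD[where p = "\<lambda>K. r", OF p m] \<open>airy r = (\<lambda>x. 0)\<close> by simp
  ultimately show "v \<in> {v \<in> bell_space \<Omega> \<T> n. (v, \<lambda>x. 0) \<in> airy_rel \<Omega>}" by blast
qed

end

text \<open>The weak operators are relations, whose images silently skip elements without a partner.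
  The two \<open>Domain\<close> inclusions say that both operators are defined on the whole spaces,
  so that the equalities of images carry their usual meaning.\<close>

theorem lemma2p5:
  fixes \<Omega> :: "(real^2) set" and \<T> :: "(real^2) set set"
    and n t :: "(real^2) set \<Rightarrow> real^2"
  assumes "polygon \<Omega>"
    and "conforming_triangulation \<Omega> \<T>"
    and "edge_frames \<T> n t"
  shows "bell_space \<Omega> \<T> n \<subseteq> Domain (airy_rel \<Omega>)
    \<and> sigma_space \<Omega> \<T> n t \<subseteq> Domain (div_rel \<Omega>)
    \<and> {v \<in> bell_space \<Omega> \<T> n. (v, \<lambda>x. 0) \<in> airy_rel \<Omega>} = ae_polys 1 \<Omega>
    \<and> airy_rel \<Omega> `` bell_space \<Omega> \<T> n = {\<tau> \<in> sigma_space \<Omega> \<T> n t. (\<tau>, \<lambda>x. 0) \<in> div_rel \<Omega>}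
    \<and> div_rel \<Omega> `` sigma_space \<Omega> \<T> n t = V_space \<Omega> \<T>"
proof -
  have T: "finite \<T>" "\<And>K L. K \<in> \<T> \<Longrightarrow> L \<in> \<T> \<Longrightarrow> K \<inter> L face_of K" "\<And>K. K \<in> \<T> \<Longrightarrow> 2 simplex K" "\<Union>\<T> = closure \<Omega>"
    using assms(2) by (auto simp: conforming_triangulation_def triangulation_def)
  have tri: "\<exists>u v w. tri u v w K" if "K \<in> \<T>" for K using simplex_tri[OF T(3)[OF that]] by metis
  \<comment> \<open>Interpreted first, because the disjoint interiors required of a mesh are derived
    from the face condition.\<close>
  interpret tr: triangulated \<T> by standard (use T tri in auto)
  have cc: "convex K" "compact K" if "K \<in> \<T>" for K using tri[OF that] tri_convex_compact by blast+
  interpret framed_mesh \<Omega> \<T> n t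
    by standard (use polygon_facts[OF assms(1)] polygon_frontier_null[OF assms(1)] cc T tr.interiors_disjoint assms(3) in auto)
  have con: "contractible (\<Union>\<T>)"
    using polygon_closure_contractible[OF assms(1) T(1) cc T(4)] T(4) by simp
  have conn: "connected (\<Union>\<T>)" using polygon_facts(3)[OF assms(1)] T(4) by (simp add: connected_imp_connected_closure)
  have ne: "\<T> \<noteq> {}" using polygon_facts(4)[OF assms(1)] closure_subset[of \<Omega>] T(4) by auto
  show ?thesis
    using bell_subset_domain_airy sigma_subset_domain_div airy_kernel[OF conn ne] airy_image[OF con] div_image by blast
qed

end
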